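(* Let $\mathscr{R}=\mathscr{O}_K$ be the ring of integers of a finite extension $K$ of $\mathbb{Q}_p$ with residue field $\kappa$, and assume there is a finite flat ring map $\mathscr{R}\to\mathscr{R}'$, where $\mathscr{R}'$ is also a regular local ring. Then any $(\mathscr{R}'\otimes_{\mathbb{Z}_p}W(\kappa))[\![u]\!]$-module $\mathfrak{M}$ which is finite free (i.e., finitely generated and free) over $(\mathscr{R}\otimes_{\mathbb{Z}_p}W(\kappa))[\![u]\!]$ is also a finite free $(\mathscr{R}'\otimes_{\mathbb{Z}_p}W(\kappa))[\![u]\!]$-module.
   Context: $p$ is a fixed prime number, $\kappa=\mathscr{O}_K/\pi\mathscr{O}_K$ is the residue field of $K$ (with $\pi$ a uniformizer of $\mathscr{O}_K$), and $W(\kappa)$ is the ring of Witt vectors of $\kappa$. For a ring $A$, $A[\![u]\!]$ is the power series ring over $A$. A $(\mathscr{R}'\otimes_{\mathbb{Z}_p}W(\kappa))[\![u]\!]$-module is regarded as a $(\mathscr{R}\otimes_{\mathbb{Z}_p}W(\kappa))[\![u]\!]$-module by restriction of scalars along the map induced by $\mathscr{R}\to\mathscr{R}'$. *)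

theory Defs
  imports
    "HOL-Library.Poly_Mapping"
    "HOL-Library.Extended_Nat"
    "HOL-Algebra.Algebra"
begin

section \<open>The $p$-adic integers and the $p$-adic numbers\<close>

text \<open>The inverse limit of the rings of integers modulo \<open>p^n\<close>; the \<open>n\<close>-th component is
  represented by its residue in \<open>{0..<p^n}\<close>.\<close>

definition padic_int :: "nat \<Rightarrow> (nat \<Rightarrow> int) ring" where
  "padic_int p =
    \<lparr>carrier = {a. \<forall>n. 0 \<le> a n \<and> a n < int p ^ n \<and> a (Suc n) mod int p ^ n = a n},
     monoid.mult = (\<lambda>a b n. (a n * b n) mod int p ^ n),
     one = (\<lambda>n. 1 mod int p ^ n),
     ring.zero = (\<lambda>n. 0),
     add = (\<lambda>a b n. (a n + b n) mod int p ^ n)\<rparr>"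

definition fraction_rel :: "('a, 'm) ring_scheme \<Rightarrow> (('a \<times> 'a) \<times> ('a \<times> 'a)) set" where
  "fraction_rel R = {((a, b), (c, d)).
     a \<in> carrier R \<and> b \<in> carrier R - {\<zero>\<^bsub>R\<^esub>} \<and> c \<in> carrier R \<and> d \<in> carrier R - {\<zero>\<^bsub>R\<^esub>} \<and>
     a \<otimes>\<^bsub>R\<^esub> d = c \<otimes>\<^bsub>R\<^esub> b}"

definition fraction :: "('a, 'm) ring_scheme \<Rightarrow> 'a \<Rightarrow> 'a \<Rightarrow> ('a \<times> 'a) set" where
  "fraction R a b = fraction_rel R `` {(a, b)}"

text \<open>Meaningful for a domain \<open>R\<close>.\<close>

definition fraction_field :: "('a, 'm) ring_scheme \<Rightarrow> ('a \<times> 'a) set ring" where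
  "fraction_field R =
    \<lparr>carrier = (carrier R \<times> (carrier R - {\<zero>\<^bsub>R\<^esub>})) // fraction_rel R,
     monoid.mult = (\<lambda>U V. \<Union>(a, b)\<in>U. \<Union>(c, d)\<in>V. fraction R (a \<otimes>\<^bsub>R\<^esub> c) (b \<otimes>\<^bsub>R\<^esub> d)),
     one = fraction R \<one>\<^bsub>R\<^esub> \<one>\<^bsub>R\<^esub>,
     ring.zero = fraction R \<zero>\<^bsub>R\<^esub> \<one>\<^bsub>R\<^esub>,
     add = (\<lambda>U V. \<Union>(a, b)\<in>U. \<Union>(c, d)\<in>V.
       fraction R (a \<otimes>\<^bsub>R\<^esub> d \<oplus>\<^bsub>R\<^esub> c \<otimes>\<^bsub>R\<^esub> b) (b \<otimes>\<^bsub>R\<^esub> d))\<rparr>"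

definition padic_field :: "nat \<Rightarrow> ((nat \<Rightarrow> int) \<times> (nat \<Rightarrow> int)) set ring" where
  "padic_field p = fraction_field (padic_int p)"

definition padic_of_int :: "nat \<Rightarrow> (nat \<Rightarrow> int) \<Rightarrow> ((nat \<Rightarrow> int) \<times> (nat \<Rightarrow> int)) set" where
  "padic_of_int p a = fraction (padic_int p) a \<one>\<^bsub>padic_int p\<^esub>"


section \<open>Finite extensions of the $p$-adic numbers and their rings of integers\<close>

definition finite_padic_extension ::
    "nat \<Rightarrow> ('k, 'm) ring_scheme \<Rightarrow> (((nat \<Rightarrow> int) \<times> (nat \<Rightarrow> int)) set \<Rightarrow> 'k) \<Rightarrow> bool" where
  "finite_padic_extension p K \<iota> \<longleftrightarrow>
     field K \<and> \<iota> \<in> ring_hom (padic_field p) K \<and>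
     ring.finite_dimension K (\<iota> ` carrier (padic_field p)) (carrier K)"

definition integral_over :: "('k, 'm) ring_scheme \<Rightarrow> 'k set \<Rightarrow> 'k \<Rightarrow> bool" where
  "integral_over K A x \<longleftrightarrow>
     (\<exists>q \<in> carrier (univ_poly K A). q \<noteq> [] \<and> lead_coeff q = \<one>\<^bsub>K\<^esub> \<and> ring.eval K q x = \<zero>\<^bsub>K\<^esub>)"

definition ring_of_integers ::
    "nat \<Rightarrow> ('k, 'm) ring_scheme \<Rightarrow> (((nat \<Rightarrow> int) \<times> (nat \<Rightarrow> int)) set \<Rightarrow> 'k)
      \<Rightarrow> ('k, 'm) ring_scheme" where
  "ring_of_integers p K \<iota> =
     K\<lparr>carrier := {x \<in> carrier K. integral_over K (\<iota> ` padic_of_int p ` carrier (padic_int p)) x}\<rparr>"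

text \<open>For a discrete valuation ring.\<close>

definition uniformizer :: "('a, 'm) ring_scheme \<Rightarrow> 'a \<Rightarrow> bool" where
  "uniformizer R \<pi> \<longleftrightarrow> \<pi> \<in> carrier R \<and> maximalideal (PIdl\<^bsub>R\<^esub> \<pi>) R"


section \<open>Regular local rings\<close>

definition krull_dim :: "('a, 'm) ring_scheme \<Rightarrow> enat" where
  "krull_dim R = Sup {enat n | n.
     \<exists>P. (\<forall>i\<le>n. primeideal (P i) R) \<and> (\<forall>i<n. P i \<subset> P (Suc i))}"

definition regular_local_ring :: "('a, 'm) ring_scheme \<Rightarrow> bool" where
  "regular_local_ring R \<longleftrightarrow>
     cring R \<and> noetherian_ring R \<and> (\<exists>!\<mm>. maximalideal \<mm> R) \<and>
     (\<exists>S \<subseteq> carrier R. finite S \<and> enat (card S) = krull_dim R \<and> maximalideal (Idl\<^bsub>R\<^esub> S) R)"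


section \<open>Modules\<close>

definition finitely_generated_module ::
    "('a, 'm) ring_scheme \<Rightarrow> ('a, 'c, 'n) module_scheme \<Rightarrow> bool" where
  "finitely_generated_module R M \<longleftrightarrow> module R M \<and>
     (\<exists>B \<subseteq> carrier M. finite B \<and>
        (\<forall>x \<in> carrier M. \<exists>c \<in> B \<rightarrow> carrier R. x = (\<Oplus>\<^bsub>M\<^esub>b\<in>B. c b \<odot>\<^bsub>M\<^esub> b)))"

definition finite_free_module ::
    "('a, 'm) ring_scheme \<Rightarrow> ('a, 'c, 'n) module_scheme \<Rightarrow> bool" where
  "finite_free_module R M \<longleftrightarrow> module R M \<and>
     (\<exists>B \<subseteq> carrier M. finite B \<and>
        (\<forall>x \<in> carrier M. \<exists>!c. c \<in> B \<rightarrow>\<^sub>E carrier R \<and> x = (\<Oplus>\<^bsub>M\<^esub>b\<in>B. c b \<odot>\<^bsub>M\<^esub> b)))"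

definition linear_maps ::
    "('a, 'm) ring_scheme \<Rightarrow> ('a, 'c, 'n) module_scheme \<Rightarrow> ('a, 'd, 'o) module_scheme
      \<Rightarrow> ('c \<Rightarrow> 'd) set" where
  "linear_maps R M N = {f \<in> hom (add_monoid M) (add_monoid N).
     \<forall>a \<in> carrier R. \<forall>x \<in> carrier M. f (a \<odot>\<^bsub>M\<^esub> x) = a \<odot>\<^bsub>N\<^esub> f x}"

definition restrict_scalars ::
    "('a \<Rightarrow> 'b) \<Rightarrow> ('b, 'c, 'n) module_scheme \<Rightarrow> ('a, 'c) module" where
  "restrict_scalars f M =
    \<lparr>carrier = carrier M, monoid.mult = monoid.mult M, one = one M, ring.zero = ring.zero M, add = add M,
     smult = (\<lambda>a x. f a \<odot>\<^bsub>M\<^esub> x)\<rparr>"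

text \<open>The target \<open>B\<close> of a ring map \<open>f: A \<rightarrow> B\<close>, viewed as an \<open>A\<close>-module.\<close>

definition algebra_module :: "('a \<Rightarrow> 'b) \<Rightarrow> ('b, 'm) ring_scheme \<Rightarrow> ('a, 'b) module" where
  "algebra_module f B =
    \<lparr>carrier = carrier B, monoid.mult = monoid.mult B, one = one B, ring.zero = ring.zero B, add = add B,
     smult = (\<lambda>a x. f a \<otimes>\<^bsub>B\<^esub> x)\<rparr>"


section \<open>Tensor products\<close>

text \<open>The tensor product of \<open>M\<close> and \<open>N\<close> over \<open>S\<close> is the quotient of the free abelian group on
  \<open>carrier M \<times> carrier N\<close> by the subgroup generated by the bilinearity relations.\<close>

abbreviation tensor_free ::
    "('c, 'm) ring_scheme \<Rightarrow> ('d, 'n) ring_scheme \<Rightarrow> ('c \<times> 'd \<Rightarrow>\<^sub>0 int) monoid" where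
  "tensor_free M N \<equiv> free_Abelian_group (carrier M \<times> carrier N)"

definition tensor_relations ::
    "('s, 'm) ring_scheme \<Rightarrow> ('s, 'c, 'n) module_scheme \<Rightarrow> ('s, 'd, 'o) module_scheme
      \<Rightarrow> ('c \<times> 'd \<Rightarrow>\<^sub>0 int) set" where
  "tensor_relations S M N = generate (tensor_free M N)
     ({frag_of (x \<oplus>\<^bsub>M\<^esub> x', y) - frag_of (x, y) - frag_of (x', y) | x x' y.
         x \<in> carrier M \<and> x' \<in> carrier M \<and> y \<in> carrier N} \<union>
      {frag_of (x, y \<oplus>\<^bsub>N\<^esub> y') - frag_of (x, y) - frag_of (x, y') | x y y'.
         x \<in> carrier M \<and> y \<in> carrier N \<and> y' \<in> carrier N} \<union>
      {frag_of (s \<odot>\<^bsub>M\<^esub> x, y) - frag_of (x, s \<odot>\<^bsub>N\<^esub> y) | s x y.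
         s \<in> carrier S \<and> x \<in> carrier M \<and> y \<in> carrier N})"

definition tensor_product ::
    "('s, 'm) ring_scheme \<Rightarrow> ('s, 'c, 'n) module_scheme \<Rightarrow> ('s, 'd, 'o) module_scheme
      \<Rightarrow> ('c \<times> 'd \<Rightarrow>\<^sub>0 int) set monoid" where
  "tensor_product S M N = tensor_free M N Mod tensor_relations S M N"

text \<open>The map induced by \<open>f\<close> and \<open>g\<close> into the tensor product of \<open>M\<close> and \<open>N\<close>; when \<open>f\<close> and \<open>g\<close>
  are linear, the image below is a singleton for every coset \<open>U\<close>.\<close>

definition tensor_map ::
    "('s, 'm) ring_scheme \<Rightarrow> ('s, 'c, 'n) module_scheme \<Rightarrow> ('s, 'd, 'o) module_scheme
      \<Rightarrow> ('a \<Rightarrow> 'c) \<Rightarrow> ('b \<Rightarrow> 'd) \<Rightarrow> ('a \<times> 'b \<Rightarrow>\<^sub>0 int) set \<Rightarrow> ('c \<times> 'd \<Rightarrow>\<^sub>0 int) set" where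
  "tensor_map S M N f g U = the_elem
     ((\<lambda>t. r_coset (tensor_free M N) (tensor_relations S M N)
             (frag_extend (\<lambda>(x, y). frag_of (f x, g y)) t)) ` U)"

text \<open>Tensoring with \<open>M\<close> preserves injectivity. The modules \<open>N\<close> and \<open>N'\<close> range over all modules
  whose elements have the type of the elements of \<open>R\<close>. This is no restriction: the ideals of \<open>R\<close>
  are among them, and injectivity for the inclusions of ideals into \<open>R\<close> already implies
  flatness.\<close>

definition flat_module ::
    "('a, 'm) ring_scheme \<Rightarrow> ('a, 'c, 'n) module_scheme \<Rightarrow> bool" where
  "flat_module R M \<longleftrightarrow> module R M \<and>
     (\<forall>(N :: ('a, 'a) module) (N' :: ('a, 'a) module) f.
        module R N \<and> module R N' \<and> f \<in> linear_maps R N N' \<and> inj_on f (carrier N) \<longrightarrow>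
        inj_on (tensor_map R N' M f (\<lambda>x. x)) (carrier (tensor_product R N M)))"

text \<open>The free abelian group on \<open>carrier A \<times> carrier B\<close> with the multiplication that extends the
  componentwise product of basis elements biadditively.\<close>

definition pair_ring ::
    "('a, 'm) ring_scheme \<Rightarrow> ('b, 'n) ring_scheme \<Rightarrow> ('a \<times> 'b \<Rightarrow>\<^sub>0 int) ring" where
  "pair_ring A B =
    \<lparr>carrier = {t. Poly_Mapping.keys t \<subseteq> carrier A \<times> carrier B},
     monoid.mult = (\<lambda>t u. frag_extend (\<lambda>(a, b). frag_extend (\<lambda>(a', b').
       frag_of (a \<otimes>\<^bsub>A\<^esub> a', b \<otimes>\<^bsub>B\<^esub> b')) u) t),
     one = frag_of (\<one>\<^bsub>A\<^esub>, \<one>\<^bsub>B\<^esub>),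
     ring.zero = 0,
     add = (+)\<rparr>"

text \<open>The tensor product of the \<open>S\<close>-algebras \<open>f: S \<rightarrow> A\<close> and \<open>g: S \<rightarrow> B\<close>. The relation subgroup
  is an ideal of the pair ring, so the additive group of this ring is the tensor product of the
  underlying \<open>S\<close>-modules.\<close>

definition tensor_ring ::
    "('s, 'k) ring_scheme \<Rightarrow> ('s \<Rightarrow> 'a) \<Rightarrow> ('a, 'm) ring_scheme
      \<Rightarrow> ('s \<Rightarrow> 'b) \<Rightarrow> ('b, 'n) ring_scheme \<Rightarrow> ('a \<times> 'b \<Rightarrow>\<^sub>0 int) set ring" where
  "tensor_ring S f A g B =
     pair_ring A B Quot tensor_relations S (algebra_module f A) (algebra_module g B)"


section \<open>Power series\<close>

definition power_series_ring :: "('a, 'm) ring_scheme \<Rightarrow> (nat \<Rightarrow> 'a) ring" where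
  "power_series_ring A =
    \<lparr>carrier = UNIV \<rightarrow> carrier A,
     monoid.mult = (\<lambda>F G n. \<Oplus>\<^bsub>A\<^esub>i\<in>{..n}. F i \<otimes>\<^bsub>A\<^esub> G (n - i)),
     one = (\<lambda>n. if n = 0 then \<one>\<^bsub>A\<^esub> else \<zero>\<^bsub>A\<^esub>),
     ring.zero = (\<lambda>n. \<zero>\<^bsub>A\<^esub>),
     add = (\<lambda>F G n. F n \<oplus>\<^bsub>A\<^esub> G n)\<rparr>"

definition power_series_map :: "('a \<Rightarrow> 'b) \<Rightarrow> (nat \<Rightarrow> 'a) \<Rightarrow> (nat \<Rightarrow> 'b)" where
  "power_series_map h F = (\<lambda>n. h (F n))"


section \<open>Witt vectors\<close>

text \<open>Integer polynomials in the variables \<open>X\<^sub>i\<close> (index \<open>Inl i\<close>) and \<open>Y\<^sub>i\<close> (index \<open>Inr i\<close>).\<close>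

type_synonym witt_mpoly = "(nat + nat \<Rightarrow>\<^sub>0 nat) \<Rightarrow>\<^sub>0 int"

definition witt_var :: "nat + nat \<Rightarrow> witt_mpoly" where
  "witt_var v = Poly_Mapping.single (Poly_Mapping.single v 1) 1"

definition ghost_component :: "nat \<Rightarrow> nat \<Rightarrow> (nat \<Rightarrow> 'r::comm_ring_1) \<Rightarrow> 'r" where
  "ghost_component p n a = (\<Sum>i\<le>n. of_nat p ^ i * a i ^ (p ^ (n - i)))"

text \<open>By Witt's theorem there are unique sequences of polynomials over the integers with these
  properties when \<open>p\<close> is prime.\<close>

definition witt_sum_poly :: "nat \<Rightarrow> nat \<Rightarrow> witt_mpoly" where
  "witt_sum_poly p = (THE S. \<forall>n. ghost_component p n S =
     ghost_component p n (\<lambda>i. witt_var (Inl i)) + ghost_component p n (\<lambda>i. witt_var (Inr i)))"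

definition witt_prod_poly :: "nat \<Rightarrow> nat \<Rightarrow> witt_mpoly" where
  "witt_prod_poly p = (THE P. \<forall>n. ghost_component p n P =
     ghost_component p n (\<lambda>i. witt_var (Inl i)) * ghost_component p n (\<lambda>i. witt_var (Inr i)))"

definition mpoly_eval ::
    "('a, 'm) ring_scheme \<Rightarrow> ('v \<Rightarrow> 'a) \<Rightarrow> (('v \<Rightarrow>\<^sub>0 nat) \<Rightarrow>\<^sub>0 int) \<Rightarrow> 'a" where
  "mpoly_eval R \<nu> q = (\<Oplus>\<^bsub>R\<^esub>m\<in>Poly_Mapping.keys q.
     [Poly_Mapping.lookup q m] \<cdot>\<^bsub>R\<^esub>
       (\<Otimes>\<^bsub>R\<^esub>v\<in>Poly_Mapping.keys m. \<nu> v [^]\<^bsub>R\<^esub> Poly_Mapping.lookup m v))"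

text \<open>The \<open>p\<close>-typical Witt vectors. For a perfect field \<open>\<kappa>\<close> of characteristic \<open>p\<close> they are
  \<open>p\<close>-adically complete and separated, so there is exactly one ring homomorphism from the
  \<open>p\<close>-adic integers to them (up to its values outside the carrier); an arbitrary such
  homomorphism therefore describes their algebra structure over the \<open>p\<close>-adic integers.\<close>

definition witt_ring :: "nat \<Rightarrow> ('a, 'm) ring_scheme \<Rightarrow> (nat \<Rightarrow> 'a) ring" where
  "witt_ring p \<kappa> =
    \<lparr>carrier = UNIV \<rightarrow> carrier \<kappa>,
     monoid.mult = (\<lambda>a b n. mpoly_eval \<kappa> (case_sum a b) (witt_prod_poly p n)),
     one = (\<lambda>n. if n = 0 then \<one>\<^bsub>\<kappa>\<^esub> else \<zero>\<^bsub>\<kappa>\<^esub>),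
     ring.zero = (\<lambda>n. \<zero>\<^bsub>\<kappa>\<^esub>),
     add = (\<lambda>a b n. mpoly_eval \<kappa> (case_sum a b) (witt_sum_poly p n))\<rparr>"

end

theory Submission
  imports Defs
begin

text \<open>Let \<open>m + 1\<close> be the number of elements of \<open>\<kappa>\<close>. Both \<open>R\<close> and \<open>W(\<kappa>)\<close> contain a primitive \<open>m\<close>-th
  root of unity, and \<open>W(\<kappa>)\<close> is generated over the \<open>p\<close>-adic integers \<open>Z\<close> by its one. As \<open>m\<close> is
  invertible, the eigenvalues of this root cut \<open>R \<otimes> W(\<kappa>)\<close> into orthogonal idempotents \<open>\<epsilon>\<^sub>i\<close>, and
  the summand at \<open>\<epsilon>\<^sub>i\<close> is zero or a copy of \<open>R\<close>; likewise for \<open>R'\<close>. A regular local ring that is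
  finite free over \<open>Z\<close> has dimension at most one, so \<open>R'\<close> has a principal maximal ideal. Therefore the
  part of \<open>M / u M\<close> at \<open>\<epsilon>\<^sub>i\<close>, being torsion-free and finitely generated over \<open>R'\<close>, is free over \<open>R'\<close>,
  and its rank is the rank of \<open>M\<close> times \<open>[R : Z] / [R' : Z]\<close>, independently of \<open>i\<close>. Hence \<open>M / u M\<close> is free
  over \<open>R' \<otimes> W(\<kappa>)\<close>, and a basis lifts to \<open>M\<close> because \<open>M\<close> is complete and separated for \<open>u\<close> and has no
  \<open>u\<close>-torsion.\<close>

section \<open>Linear combinations modulo a submodule\<close>

text \<open>Freeness can fail only through varying ranks: \<open>R' \<otimes> W(\<kappa>)\<close>
  splits into several factors, and a module can be free over each factor without being free.
  Freeness over the smaller ring excludes this, but it speaks of ranks over \<open>R\<close>, while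
  ranks over \<open>R'\<close> are wanted. Both are therefore counted over the p-adic integers, and
  dividing by the rank of \<open>R'\<close> is possible because that rank is positive. The
  idempotents are built over \<open>R\<close> and carried to \<open>R'\<close>, so that both rings
  cut \<open>M\<close> into the same parts; the eigenvalues lie in \<open>R\<close> because
  \<open>\<kappa>\<close> is the residue field of \<open>R\<close> itself. Of the \<open>m\<close>
  candidates only those belonging to conjugates of the root in \<open>W(\<kappa>)\<close> are
  nonzero; which ones these are is never determined, the vanishing ones are discarded. No quotient
  \<open>M / u M\<close> is formed: spans and independence are taken modulo a submodule, so that one
  carrier serves as a module over all the rings involved. The same lifting argument is used twice,
  for \<open>p\<close> over the p-adic integers and for \<open>u\<close> over the power
  series.\<close>

definition lincomb :: "('a, 'm) ring_scheme \<Rightarrow> ('a, 'c, 'n) module_scheme \<Rightarrow> 'i set \<Rightarrow> ('i \<Rightarrow> 'a) \<Rightarrow> ('i \<Rightarrow> 'c) \<Rightarrow> 'c" where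
  "lincomb R M I c e = (\<Oplus>\<^bsub>M\<^esub>i\<in>I. c i \<odot>\<^bsub>M\<^esub> e i)"

text \<open>Equality in the quotient \<open>M / L\<close>, expressed inside \<open>M\<close>.
  Membership in the carrier is part of the relation, so transitivity and compatibility with the
  operations need no side conditions. For the zero submodule the relation is equality, see
  \<open>mcong_trivial\<close>.\<close>

definition mcong :: "('a, 'c, 'n) module_scheme \<Rightarrow> 'c set \<Rightarrow> 'c \<Rightarrow> 'c \<Rightarrow> bool" where
  "mcong M L x y \<longleftrightarrow> x \<in> carrier M \<and> y \<in> carrier M \<and> x \<ominus>\<^bsub>M\<^esub> y \<in> L"

text \<open>The images of the \<open>e i\<close> generate the image of \<open>D\<close> in
  \<open>M / L\<close>. Families are used instead of sets because those that occur, products along a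
  tower of rings and powers of a root of unity, may repeat values.\<close>

definition spans_mod :: "('a, 'm) ring_scheme \<Rightarrow> ('a, 'c, 'n) module_scheme \<Rightarrow> 'c set \<Rightarrow> 'c set
    \<Rightarrow> 'i set \<Rightarrow> ('i \<Rightarrow> 'c) \<Rightarrow> bool" where
  "spans_mod R M L D I e \<longleftrightarrow> finite I \<and> e \<in> I \<rightarrow> D \<and>
     (\<forall>d\<in>D. \<exists>c\<in>I \<rightarrow> carrier R. mcong M L d (lincomb R M I c e))"

definition indep_mod :: "('a, 'm) ring_scheme \<Rightarrow> ('a, 'c, 'n) module_scheme \<Rightarrow> 'c set
    \<Rightarrow> 'i set \<Rightarrow> ('i \<Rightarrow> 'c) \<Rightarrow> bool" where
  "indep_mod R M L I e \<longleftrightarrow> finite I \<and> e \<in> I \<rightarrow> carrier M \<and>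
     (\<forall>c\<in>I \<rightarrow> carrier R. lincomb R M I c e \<in> L \<longrightarrow> (\<forall>i\<in>I. c i = \<zero>\<^bsub>R\<^esub>))"

context module
begin

lemma submodule_carrier: "submodule L R M \<Longrightarrow> x \<in> L \<Longrightarrow> x \<in> carrier M"
  using submoduleE(1) by blast

lemma submodule_zero: "submodule L R M \<Longrightarrow> \<zero>\<^bsub>M\<^esub> \<in> L"
  using submoduleE(2,4) submodule_carrier
  by (metis R.zero_closed all_not_in_conv smult_l_null)

lemma submodule_minus: "submodule L R M \<Longrightarrow> x \<in> L \<Longrightarrow> y \<in> L \<Longrightarrow> x \<ominus>\<^bsub>M\<^esub> y \<in> L"
  using submoduleE(3,5) by (simp add: M.minus_eq)

lemma submodule_finsum:
  assumes "submodule L R M" "f \<in> I \<rightarrow> L"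
  shows "(\<Oplus>\<^bsub>M\<^esub>i\<in>I. f i) \<in> L"
proof (cases "finite I")
  case True
  then show ?thesis using assms(2)
  proof (induction I)
    case empty then show ?case using assms(1) by (simp add: submodule_zero)
  next
    case (insert i I)
    then have "f \<in> I \<rightarrow> carrier M" "f i \<in> carrier M" using submodule_carrier[OF assms(1)] by auto
    then show ?case using insert submoduleE(5)[OF assms(1)] by (auto simp: M.finsum_insert)
  qed
qed (use assms(1) in \<open>simp add: M.finsum_infinite submodule_zero\<close>)

lemma zero_submodule: "submodule {\<zero>\<^bsub>M\<^esub>} R M"
  by (intro submoduleI) auto

lemma lincomb_closed [simp]:
  assumes "c \<in> I \<rightarrow> carrier R" "e \<in> I \<rightarrow> carrier M"
  shows "lincomb R M I c e \<in> carrier M"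
  unfolding lincomb_def using assms by (auto intro!: M.finsum_closed)

lemma lincomb_in:
  assumes "submodule L R M" "c \<in> I \<rightarrow> carrier R" "e \<in> I \<rightarrow> L"
  shows "lincomb R M I c e \<in> L"
  unfolding lincomb_def using assms submoduleE(4)[OF assms(1)] by (auto intro!: submodule_finsum)

lemma lincomb_cong:
  assumes "\<And>i. i \<in> I \<Longrightarrow> c i = c' i" "\<And>i. i \<in> I \<Longrightarrow> e i = e' i" "c' \<in> I \<rightarrow> carrier R" "e' \<in> I \<rightarrow> carrier M"
  shows "lincomb R M I c e = lincomb R M I c' e'"
  unfolding lincomb_def using assms by (intro M.finsum_cong') auto

lemma lincomb_empty [simp]: "lincomb R M {} c e = \<zero>\<^bsub>M\<^esub>"
  by (simp add: lincomb_def)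

lemma lincomb_insert:
  assumes "finite I" "i \<notin> I" "c \<in> insert i I \<rightarrow> carrier R" "e \<in> insert i I \<rightarrow> carrier M"
  shows "lincomb R M (insert i I) c e = c i \<odot>\<^bsub>M\<^esub> e i \<oplus>\<^bsub>M\<^esub> lincomb R M I c e"
  unfolding lincomb_def using assms by (subst M.finsum_insert) auto

lemma lincomb_add:
  assumes "c \<in> I \<rightarrow> carrier R" "d \<in> I \<rightarrow> carrier R" "e \<in> I \<rightarrow> carrier M"
  shows "lincomb R M I (\<lambda>i. c i \<oplus> d i) e = lincomb R M I c e \<oplus>\<^bsub>M\<^esub> lincomb R M I d e"
proof -
  have "lincomb R M I (\<lambda>i. c i \<oplus> d i) e = (\<Oplus>\<^bsub>M\<^esub>i\<in>I. c i \<odot>\<^bsub>M\<^esub> e i \<oplus>\<^bsub>M\<^esub> d i \<odot>\<^bsub>M\<^esub> e i)"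
    unfolding lincomb_def using assms by (intro M.finsum_cong') (auto simp: Pi_iff smult_l_distr)
  then show ?thesis unfolding lincomb_def using assms by (simp add: M.finsum_addf Pi_iff)
qed

lemma lincomb_smult:
  assumes "a \<in> carrier R" "c \<in> I \<rightarrow> carrier R" "e \<in> I \<rightarrow> carrier M"
  shows "lincomb R M I (\<lambda>i. a \<otimes> c i) e = a \<odot>\<^bsub>M\<^esub> lincomb R M I c e"
proof (cases "finite I")
  case True
  have "lincomb R M I (\<lambda>i. a \<otimes> c i) e = (\<Oplus>\<^bsub>M\<^esub>i\<in>I. a \<odot>\<^bsub>M\<^esub> (c i \<odot>\<^bsub>M\<^esub> e i))"
    unfolding lincomb_def using assms by (intro M.finsum_cong') (auto simp: Pi_iff smult_assoc1)
  then show ?thesis unfolding lincomb_def using assms True by (simp add: finsum_smult_ldistr Pi_iff)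
qed (use assms in \<open>simp add: lincomb_def M.finsum_infinite\<close>)

lemma lincomb_uminus:
  assumes "c \<in> I \<rightarrow> carrier R" "e \<in> I \<rightarrow> carrier M"
  shows "lincomb R M I (\<lambda>i. \<ominus> c i) e = \<ominus>\<^bsub>M\<^esub> lincomb R M I c e"
proof -
  have "lincomb R M I (\<lambda>i. \<ominus> c i) e = lincomb R M I (\<lambda>i. (\<ominus> \<one>) \<otimes> c i) e"
    using assms by (intro lincomb_cong) (auto simp: Pi_iff R.l_minus)
  also have "\<dots> = (\<ominus> \<one>) \<odot>\<^bsub>M\<^esub> lincomb R M I c e" using assms by (intro lincomb_smult) auto
  finally show ?thesis using assms by (simp add: smult_l_minus)
qed

lemma lincomb_diff:
  assumes "c \<in> I \<rightarrow> carrier R" "d \<in> I \<rightarrow> carrier R" "e \<in> I \<rightarrow> carrier M"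
  shows "lincomb R M I (\<lambda>i. c i \<ominus> d i) e = lincomb R M I c e \<ominus>\<^bsub>M\<^esub> lincomb R M I d e"
  using lincomb_add[of c I "\<lambda>i. \<ominus> d i" e] assms
  by (simp add: R.minus_eq M.minus_eq lincomb_uminus Pi_iff)

lemma lincomb_zero:
  assumes "\<And>i. i \<in> I \<Longrightarrow> c i = \<zero>" "e \<in> I \<rightarrow> carrier M"
  shows "lincomb R M I c e = \<zero>\<^bsub>M\<^esub>"
proof -
  have "lincomb R M I c e = (\<Oplus>\<^bsub>M\<^esub>i\<in>I. \<zero>\<^bsub>M\<^esub>)"
    unfolding lincomb_def using assms by (intro M.finsum_cong') (auto simp: Pi_iff)
  then show ?thesis by simp
qed

lemma lincomb_single:
  assumes "finite I" "i \<in> I" "a \<in> carrier R" "e \<in> I \<rightarrow> carrier M"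
  shows "lincomb R M I (\<lambda>j. if j = i then a else \<zero>) e = a \<odot>\<^bsub>M\<^esub> e i"
proof -
  obtain J where J: "I = insert i J" "i \<notin> J" using assms(2) by (metis mk_disjoint_insert)
  have "lincomb R M I (\<lambda>j. if j = i then a else \<zero>) e
      = a \<odot>\<^bsub>M\<^esub> e i \<oplus>\<^bsub>M\<^esub> lincomb R M J (\<lambda>j. if j = i then a else \<zero>) e"
    unfolding J(1) using assms J by (subst lincomb_insert) auto
  moreover have "lincomb R M J (\<lambda>j. if j = i then a else \<zero>) e = \<zero>\<^bsub>M\<^esub>"
    using J assms by (intro lincomb_zero) auto
  ultimately show ?thesis using assms J by (auto simp: Pi_iff)
qed

lemma lincomb_mono_neutral:
  assumes "finite I" "J \<subseteq> I" "c \<in> I \<rightarrow> carrier R" "e \<in> I \<rightarrow> carrier M" "\<And>i. i \<in> I - J \<Longrightarrow> c i = \<zero>"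
  shows "lincomb R M I c e = lincomb R M J c e"
  unfolding lincomb_def
  using assms by (intro M.add.finprod_mono_neutral_cong_right) (auto simp: Pi_iff)

lemma lincomb_lincomb:
  assumes "finite I" "finite J" "c \<in> I \<rightarrow> carrier R" "e \<in> J \<rightarrow> carrier M"
    and "\<And>i. i \<in> I \<Longrightarrow> b i \<in> J \<rightarrow> carrier R"
  shows "lincomb R M I c (\<lambda>i. lincomb R M J (b i) e) = lincomb R M J (\<lambda>j. \<Oplus>i\<in>I. c i \<otimes> b i j) e"
  using assms(1,3,5)
proof (induction I)
  case empty
  then show ?case using assms by (simp add: lincomb_zero)
next
  case (insert i I)
  have 1: "lincomb R M J (\<lambda>j. \<Oplus>i\<in>insert i I. c i \<otimes> b i j) e
      = lincomb R M J (\<lambda>j. c i \<otimes> b i j \<oplus> (\<Oplus>i\<in>I. c i \<otimes> b i j)) e"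
    using insert assms by (intro lincomb_cong) (auto simp: Pi_iff R.finsum_insert intro!: R.finsum_closed)
  also have "\<dots> = lincomb R M J (\<lambda>j. c i \<otimes> b i j) e \<oplus>\<^bsub>M\<^esub> lincomb R M J (\<lambda>j. \<Oplus>i\<in>I. c i \<otimes> b i j) e"
    using insert assms by (intro lincomb_add) (auto simp: Pi_iff intro!: R.finsum_closed)
  also have "lincomb R M J (\<lambda>j. c i \<otimes> b i j) e = c i \<odot>\<^bsub>M\<^esub> lincomb R M J (b i) e"
    using insert assms by (intro lincomb_smult) (auto simp: Pi_iff)
  also have "lincomb R M J (\<lambda>j. \<Oplus>i\<in>I. c i \<otimes> b i j) e = lincomb R M I c (\<lambda>i. lincomb R M J (b i) e)"
    using insert by auto
  finally show ?case using insert assms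
    by (subst lincomb_insert) auto
qed

lemma mcong_refl: "submodule L R M \<Longrightarrow> x \<in> carrier M \<Longrightarrow> mcong M L x x"
  by (simp add: mcong_def submodule_zero M.r_neg M.minus_eq)

lemma mcong_sym: "submodule L R M \<Longrightarrow> mcong M L x y \<Longrightarrow> mcong M L y x"
  using submoduleE(3)[of L "x \<ominus>\<^bsub>M\<^esub> y"] by (simp add: mcong_def M.minus_eq M.minus_add M.a_comm)

lemma mcong_trans:
  assumes "submodule L R M" "mcong M L x y" "mcong M L y z"
  shows "mcong M L x z"
proof -
  have "(x \<ominus>\<^bsub>M\<^esub> y) \<oplus>\<^bsub>M\<^esub> (y \<ominus>\<^bsub>M\<^esub> z) = x \<ominus>\<^bsub>M\<^esub> z"
    using assms by (simp add: mcong_def M.minus_eq M.a_ac M.r_neg1 M.r_neg2)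
  then show ?thesis using assms submoduleE(5)[OF assms(1)] by (metis mcong_def)
qed

lemma mcong_add:
  assumes "submodule L R M" "mcong M L x y" "mcong M L x' y'"
  shows "mcong M L (x \<oplus>\<^bsub>M\<^esub> x') (y \<oplus>\<^bsub>M\<^esub> y')"
proof -
  have "(x \<ominus>\<^bsub>M\<^esub> y) \<oplus>\<^bsub>M\<^esub> (x' \<ominus>\<^bsub>M\<^esub> y') = (x \<oplus>\<^bsub>M\<^esub> x') \<ominus>\<^bsub>M\<^esub> (y \<oplus>\<^bsub>M\<^esub> y')"
    using assms by (simp add: mcong_def M.minus_eq M.a_ac M.minus_add)
  then show ?thesis using assms submoduleE(5)[OF assms(1)] by (metis mcong_def M.a_closed)
qed

lemma mcong_smult:
  assumes "submodule L R M" "mcong M L x y" "a \<in> carrier R"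
  shows "mcong M L (a \<odot>\<^bsub>M\<^esub> x) (a \<odot>\<^bsub>M\<^esub> y)"
proof -
  have "a \<odot>\<^bsub>M\<^esub> (x \<ominus>\<^bsub>M\<^esub> y) = a \<odot>\<^bsub>M\<^esub> x \<ominus>\<^bsub>M\<^esub> a \<odot>\<^bsub>M\<^esub> y"
    using assms by (simp add: mcong_def M.minus_eq smult_r_distr smult_r_minus)
  then show ?thesis using assms submoduleE(4)[OF assms(1)] by (metis mcong_def smult_closed)
qed

lemma mcong_diff:
  assumes "submodule L R M" "mcong M L x y" "mcong M L x' y'"
  shows "mcong M L (x \<ominus>\<^bsub>M\<^esub> x') (y \<ominus>\<^bsub>M\<^esub> y')"
proof -
  have "mcong M L (x \<oplus>\<^bsub>M\<^esub> (\<ominus> \<one>) \<odot>\<^bsub>M\<^esub> x') (y \<oplus>\<^bsub>M\<^esub> (\<ominus> \<one>) \<odot>\<^bsub>M\<^esub> y')"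
    using assms by (intro mcong_add mcong_smult) auto
  then show ?thesis using assms by (simp add: mcong_def smult_l_minus M.minus_eq)
qed

lemma mcong_zero_iff: "x \<in> carrier M \<Longrightarrow> mcong M L x \<zero>\<^bsub>M\<^esub> \<longleftrightarrow> x \<in> L"
  by (metis M.a_inv_closed M.l_neg M.minus_eq M.r_zero M.zero_closed mcong_def M.l_zero)

lemma mcong_trivial: "mcong M {\<zero>\<^bsub>M\<^esub>} x y \<longleftrightarrow> x \<in> carrier M \<and> x = y"
  by (auto simp: mcong_def M.r_neg M.minus_eq dest: M.minus_equality)

lemma mcong_in: "submodule L R M \<Longrightarrow> mcong M L x y \<Longrightarrow> x \<in> L \<longleftrightarrow> y \<in> L"
  by (metis mcong_def mcong_sym mcong_trans mcong_zero_iff)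

lemma mcong_finsum:
  assumes "submodule L R M" "\<And>i. i \<in> I \<Longrightarrow> mcong M L (f i) (g i)"
  shows "mcong M L (\<Oplus>\<^bsub>M\<^esub>i\<in>I. f i) (\<Oplus>\<^bsub>M\<^esub>i\<in>I. g i)"
proof (cases "finite I")
  case True
  then show ?thesis using assms(2)
  proof (induction I)
    case empty then show ?case using assms(1) by (simp add: mcong_refl)
  next
    case (insert i I)
    then have "f \<in> I \<rightarrow> carrier M" "f i \<in> carrier M" "g \<in> I \<rightarrow> carrier M" "g i \<in> carrier M"
      by (auto simp: mcong_def)
    then show ?case using insert by (simp add: M.finsum_insert mcong_add[OF assms(1)])
  qed
qed (use assms(1) in \<open>simp add: M.finsum_infinite mcong_refl\<close>)

end

section \<open>Separated and complete rings: division of relations and lifting from a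
  quotient\<close>

definition adic_separated :: "('a, 'm) ring_scheme \<Rightarrow> 'a \<Rightarrow> bool" where
  "adic_separated R x \<longleftrightarrow>
     (\<forall>a\<in>carrier R. (\<forall>n::nat. \<exists>b\<in>carrier R. a = x [^]\<^bsub>R\<^esub> n \<otimes>\<^bsub>R\<^esub> b) \<longrightarrow> a = \<zero>\<^bsub>R\<^esub>)"

text \<open>Completeness in the form of power series in \<open>x\<close>: every coefficient sequence
  \<open>s\<close> has a sum \<open>l\<close>, and after \<open>n\<close> terms the remainder is an
  explicit multiple of \<open>x^n\<close>. No topology is involved; uniqueness of the sum is the
  separate notion \<open>adic_separated\<close>.\<close>

definition adic_complete :: "('a, 'm) ring_scheme \<Rightarrow> 'a \<Rightarrow> bool" where
  "adic_complete R x \<longleftrightarrow>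
     (\<forall>s\<in>UNIV \<rightarrow> carrier R. \<exists>l\<in>carrier R. \<forall>n::nat. \<exists>t\<in>carrier R.
        l = (\<Oplus>\<^bsub>R\<^esub>k\<in>{..<n}. x [^]\<^bsub>R\<^esub> k \<otimes>\<^bsub>R\<^esub> s k) \<oplus>\<^bsub>R\<^esub> x [^]\<^bsub>R\<^esub> n \<otimes>\<^bsub>R\<^esub> t)"

lemma adic_separatedD:
  assumes "adic_separated R x" "a \<in> carrier R" "\<And>n::nat. \<exists>b\<in>carrier R. a = x [^]\<^bsub>R\<^esub> n \<otimes>\<^bsub>R\<^esub> b"
  shows "a = \<zero>\<^bsub>R\<^esub>"
  using assms unfolding adic_separated_def by blast

context module
begin

lemma spans_modD:
  assumes "spans_mod R M L D I e" "d \<in> D"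
  obtains c where "c \<in> I \<rightarrow> carrier R" "mcong M L d (lincomb R M I c e)"
  using assms unfolding spans_mod_def by blast

lemma add_diff_cancel_left:
  assumes "x \<in> carrier M" "y \<in> carrier M" "z \<in> carrier M"
  shows "(x \<oplus>\<^bsub>M\<^esub> y) \<oplus>\<^bsub>M\<^esub> \<ominus>\<^bsub>M\<^esub> (x \<oplus>\<^bsub>M\<^esub> z) = y \<oplus>\<^bsub>M\<^esub> \<ominus>\<^bsub>M\<^esub> z"
proof -
  have "(x \<oplus>\<^bsub>M\<^esub> y) \<oplus>\<^bsub>M\<^esub> \<ominus>\<^bsub>M\<^esub> (x \<oplus>\<^bsub>M\<^esub> z) = x \<oplus>\<^bsub>M\<^esub> (y \<oplus>\<^bsub>M\<^esub> (\<ominus>\<^bsub>M\<^esub> x \<oplus>\<^bsub>M\<^esub> \<ominus>\<^bsub>M\<^esub> z))"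
    using assms by (simp add: M.minus_add M.a_assoc)
  also have "\<dots> = x \<oplus>\<^bsub>M\<^esub> (\<ominus>\<^bsub>M\<^esub> x \<oplus>\<^bsub>M\<^esub> (y \<oplus>\<^bsub>M\<^esub> \<ominus>\<^bsub>M\<^esub> z))"
    using assms by (simp add: M.a_lcomm)
  finally show ?thesis using assms by (simp add: M.r_neg2)
qed

lemma spans_mod_remove:
  assumes L: "submodule L R M" and D: "D \<subseteq> carrier M"
    and sp: "spans_mod R M L D (insert i I) e" and i: "i \<notin> I"
    and c: "c \<in> I \<rightarrow> carrier R" "mcong M L (e i) (lincomb R M I c e)"
  shows "spans_mod R M L D I e"
  unfolding spans_mod_def
proof (intro conjI ballI)
  have fin: "finite I" and e: "e \<in> I \<rightarrow> D" "e i \<in> D" using sp by (auto simp: spans_mod_def)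
  then show "finite I" "e \<in> I \<rightarrow> D" by auto
  have eM: "e \<in> I \<rightarrow> carrier M" "e i \<in> carrier M" using e D by auto
  fix d assume "d \<in> D"
  then obtain b where b: "b \<in> insert i I \<rightarrow> carrier R" "mcong M L d (lincomb R M (insert i I) b e)"
    using spans_modD[OF sp] by blast
  have "lincomb R M (insert i I) b e = b i \<odot>\<^bsub>M\<^esub> e i \<oplus>\<^bsub>M\<^esub> lincomb R M I b e"
    using fin i b eM by (intro lincomb_insert) auto
  moreover have "mcong M L (b i \<odot>\<^bsub>M\<^esub> e i \<oplus>\<^bsub>M\<^esub> lincomb R M I b e)
      (b i \<odot>\<^bsub>M\<^esub> lincomb R M I c e \<oplus>\<^bsub>M\<^esub> lincomb R M I b e)"
    using b c eM L by (intro mcong_add mcong_smult mcong_refl) auto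
  moreover have "b i \<odot>\<^bsub>M\<^esub> lincomb R M I c e \<oplus>\<^bsub>M\<^esub> lincomb R M I b e
      = lincomb R M I (\<lambda>j. b i \<otimes> c j \<oplus> b j) e"
    using b c eM by (subst lincomb_add) (auto simp: lincomb_smult Pi_iff)
  ultimately have "mcong M L d (lincomb R M I (\<lambda>j. b i \<otimes> c j \<oplus> b j) e)"
    using b(2) mcong_trans[OF L] by metis
  then show "\<exists>c\<in>I \<rightarrow> carrier R. mcong M L d (lincomb R M I c e)"
    using b c by (intro bexI[of _ "\<lambda>j. b i \<otimes> c j \<oplus> b j"]) (auto simp: Pi_iff)
qed

lemma lincomb_remove:
  assumes "finite I" "i \<in> I" "c \<in> I \<rightarrow> carrier R" "e \<in> I \<rightarrow> carrier M"
  shows "lincomb R M I c e = c i \<odot>\<^bsub>M\<^esub> e i \<oplus>\<^bsub>M\<^esub> lincomb R M (I - {i}) c e"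
  using lincomb_insert[of "I - {i}" i c e] assms by (simp add: insert_absorb)

text \<open>Dividing the relation by its unit coefficient solves it for \<open>e i\<close>. This
  detects redundant generators, and it also shows that a maximal family spans.\<close>

lemma unit_coeff_solve:
  assumes L: "submodule L R M" and fin: "finite I" "i \<in> I" and c: "c \<in> I \<rightarrow> carrier R"
    and e: "e \<in> I \<rightarrow> carrier M" and rel: "lincomb R M I c e \<in> L" and u: "c i \<in> Units R"
  shows "\<exists>b\<in>I - {i} \<rightarrow> carrier R. mcong M L (e i) (lincomb R M (I - {i}) b e)"
proof -
  let ?v = "inv c i" let ?b = "\<lambda>j. \<ominus> (?v \<otimes> c j)"
  have v: "?v \<in> carrier R" "?v \<otimes> c i = \<one>" using u by auto
  have b: "?b \<in> I - {i} \<rightarrow> carrier R" using v c by (auto simp: Pi_iff)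
  have e': "e \<in> I - {i} \<rightarrow> carrier M" "e i \<in> carrier M" and c': "c \<in> I - {i} \<rightarrow> carrier R" "c i \<in> carrier R"
    using e c fin by auto
  have "?v \<odot>\<^bsub>M\<^esub> lincomb R M I c e = e i \<oplus>\<^bsub>M\<^esub> ?v \<odot>\<^bsub>M\<^esub> lincomb R M (I - {i}) c e"
    using lincomb_remove[OF fin c e] v c' e' by (simp add: smult_r_distr flip: smult_assoc1)
  also have "?v \<odot>\<^bsub>M\<^esub> lincomb R M (I - {i}) c e = \<ominus>\<^bsub>M\<^esub> lincomb R M (I - {i}) ?b e"
    using v c' e' b by (subst lincomb_uminus) (auto simp: lincomb_smult Pi_iff)
  finally have "e i \<ominus>\<^bsub>M\<^esub> lincomb R M (I - {i}) ?b e \<in> L"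
    using rel v submoduleE(4)[OF L] by (metis M.minus_eq)
  then show ?thesis using b e' by (intro bexI[of _ ?b]) (auto simp: mcong_def)
qed

text \<open>A generating set of least cardinality is a basis: modulo the nonunits \<open>x R\<close> this is Nakayama's
  lemma, and a relation all of whose coefficients are divisible by \<open>x\<close> can be divided by \<open>x\<close>.\<close>

theorem torsion_free_basis:
  assumes L: "submodule L R M" and D: "submodule D R M"
    and x: "x \<in> carrier R" and local: "\<And>a. a \<in> carrier R \<Longrightarrow> a \<in> Units R \<or> (\<exists>b\<in>carrier R. a = x \<otimes> b)"
    and sep: "adic_separated R x"
    and tf: "\<And>d. d \<in> D \<Longrightarrow> x \<odot>\<^bsub>M\<^esub> d \<in> L \<Longrightarrow> d \<in> L"
    and sp: "spans_mod R M L D I e"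
  shows "\<exists>J\<subseteq>I. spans_mod R M L D J e \<and> indep_mod R M L J e"
proof -
  have finI: "finite I" and DM: "D \<subseteq> carrier M" using sp submoduleE(1)[OF D] by (auto simp: spans_mod_def)
  define J where "J = arg_min card (\<lambda>J. J \<subseteq> I \<and> spans_mod R M L D J e)"
  have J: "J \<subseteq> I" "spans_mod R M L D J e"
    and Jmin: "\<And>J'. J' \<subseteq> I \<Longrightarrow> spans_mod R M L D J' e \<Longrightarrow> card J \<le> card J'"
    using arg_min_natI[of "\<lambda>J. J \<subseteq> I \<and> spans_mod R M L D J e" I card]
      arg_min_nat_le[of "\<lambda>J. J \<subseteq> I \<and> spans_mod R M L D J e" _ card] sp
    unfolding J_def by auto
  have finJ: "finite J" and eD: "e \<in> J \<rightarrow> D" and eJ: "e \<in> J \<rightarrow> carrier M"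
    using J(2) DM by (auto simp: spans_mod_def)
  have div: "\<exists>b\<in>J \<rightarrow> carrier R. (\<forall>i\<in>J. c i = x \<otimes> b i) \<and> lincomb R M J b e \<in> L"
    if c: "c \<in> J \<rightarrow> carrier R" "lincomb R M J c e \<in> L" for c
  proof -
    have "\<exists>b\<in>carrier R. c i = x \<otimes> b" if i: "i \<in> J" for i
    proof (rule ccontr)
      assume "\<not> (\<exists>b\<in>carrier R. c i = x \<otimes> b)"
      then have "c i \<in> Units R" using local c i by auto
      then obtain b where b: "b \<in> J - {i} \<rightarrow> carrier R" "mcong M L (e i) (lincomb R M (J - {i}) b e)"
        using unit_coeff_solve[OF L finJ i c(1) eJ c(2)] by blast
      have "insert i (J - {i}) = J" using i by auto
      then have "spans_mod R M L D (J - {i}) e"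
        using spans_mod_remove[OF L DM _ _ b] J(2) by simp
      then have "card J \<le> card (J - {i})" using J(1) by (intro Jmin) auto
      then show False using i finJ by (meson card_Diff1_less leD)
    qed
    then obtain b where b: "\<And>i. i \<in> J \<Longrightarrow> b i \<in> carrier R \<and> c i = x \<otimes> b i" by metis
    have "lincomb R M J c e = lincomb R M J (\<lambda>i. x \<otimes> b i) e"
      using b x eJ by (intro lincomb_cong) auto
    also have "\<dots> = x \<odot>\<^bsub>M\<^esub> lincomb R M J b e" using b x eJ by (intro lincomb_smult) auto
    finally have "x \<odot>\<^bsub>M\<^esub> lincomb R M J b e \<in> L" using c by simp
    moreover have "lincomb R M J b e \<in> D" using b eD by (intro lincomb_in[OF D]) auto
    ultimately show ?thesis using b tf by (intro bexI[of _ b]) auto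
  qed
  \<comment> \<open>A relation divided by \<open>x\<close> is again a relation, so the division can
    be repeated without end; separatedness then makes every coefficient zero.\<close>
  have "\<exists>b\<in>J \<rightarrow> carrier R. (\<forall>i\<in>J. c i = x [^] n \<otimes> b i) \<and> lincomb R M J b e \<in> L"
    if c: "c \<in> J \<rightarrow> carrier R" "lincomb R M J c e \<in> L" for c and n :: nat
  proof (induction n)
    case 0
    then show ?case using c by (intro bexI[of _ c]) (auto simp: Pi_iff)
  next
    case (Suc n)
    then obtain b where b: "b \<in> J \<rightarrow> carrier R" "\<forall>i\<in>J. c i = x [^] n \<otimes> b i" "lincomb R M J b e \<in> L"
      by blast
    obtain b' where b': "b' \<in> J \<rightarrow> carrier R" "\<forall>i\<in>J. b i = x \<otimes> b' i" "lincomb R M J b' e \<in> L"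
      using div[OF b(1,3)] by blast
    have "\<forall>i\<in>J. c i = x [^] Suc n \<otimes> b' i" using b b' x by (auto simp: R.m_assoc Pi_iff)
    then show ?case using b' by blast
  qed
  then have "c i = \<zero>" if "c \<in> J \<rightarrow> carrier R" "lincomb R M J c e \<in> L" "i \<in> J" for c i
    using that by (intro adic_separatedD[OF sep]) (auto simp: Pi_iff, metis funcset_mem)
  then have "indep_mod R M L J e" using finJ eJ by (auto simp: indep_mod_def)
  then show ?thesis using J by blast
qed

text \<open>Independence modulo \<open>x D\<close> implies independence: all coefficients of a
  relation are divisible by \<open>x\<close>, the factor \<open>x\<close> can be cancelled because
  \<open>D\<close> has no \<open>x\<close>-torsion, and the quotient is a relation of the same kind.
  Repeating this gives coefficients divisible by every power of \<open>x\<close>.\<close>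

lemma indep_lift:
  assumes fin: "finite I" and e: "e \<in> I \<rightarrow> D" and D: "submodule D R M" and x: "x \<in> carrier R"
    and sep: "adic_separated R x"
    and tf: "\<And>d. d \<in> D \<Longrightarrow> x \<odot>\<^bsub>M\<^esub> d = \<zero>\<^bsub>M\<^esub> \<Longrightarrow> d = \<zero>\<^bsub>M\<^esub>"
    and ind: "\<And>c i. c \<in> I \<rightarrow> carrier R \<Longrightarrow> lincomb R M I c e \<in> (\<lambda>d. x \<odot>\<^bsub>M\<^esub> d) ` D \<Longrightarrow> i \<in> I
      \<Longrightarrow> \<exists>b\<in>carrier R. c i = x \<otimes> b"
  shows "indep_mod R M {\<zero>\<^bsub>M\<^esub>} I e"
proof -
  have eM: "e \<in> I \<rightarrow> carrier M" using e submoduleE(1)[OF D] by auto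
  have div: "\<exists>b\<in>I \<rightarrow> carrier R. (\<forall>i\<in>I. c i = x \<otimes> b i) \<and> lincomb R M I b e = \<zero>\<^bsub>M\<^esub>"
    if c: "c \<in> I \<rightarrow> carrier R" "lincomb R M I c e = \<zero>\<^bsub>M\<^esub>" for c
  proof -
    have "lincomb R M I c e \<in> (\<lambda>d. x \<odot>\<^bsub>M\<^esub> d) ` D"
      using c x submodule_zero[OF D] by (auto intro!: image_eqI[of _ _ "\<zero>\<^bsub>M\<^esub>"])
    then obtain b where b: "\<And>i. i \<in> I \<Longrightarrow> b i \<in> carrier R \<and> c i = x \<otimes> b i" using ind[OF c(1)] by metis
    have "lincomb R M I c e = lincomb R M I (\<lambda>i. x \<otimes> b i) e"
      using b x eM by (intro lincomb_cong) auto
    also have "\<dots> = x \<odot>\<^bsub>M\<^esub> lincomb R M I b e" using b x eM by (intro lincomb_smult) auto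
    finally have "x \<odot>\<^bsub>M\<^esub> lincomb R M I b e = \<zero>\<^bsub>M\<^esub>" using c by simp
    moreover have "lincomb R M I b e \<in> D" using b e by (intro lincomb_in[OF D]) auto
    ultimately show ?thesis using b tf by (intro bexI[of _ b]) auto
  qed
  have "\<exists>b\<in>I \<rightarrow> carrier R. (\<forall>i\<in>I. c i = x [^] n \<otimes> b i) \<and> lincomb R M I b e = \<zero>\<^bsub>M\<^esub>"
    if c: "c \<in> I \<rightarrow> carrier R" "lincomb R M I c e = \<zero>\<^bsub>M\<^esub>" for c and n :: nat
  proof (induction n)
    case 0
    then show ?case using c by (intro bexI[of _ c]) (auto simp: Pi_iff)
  next
    case (Suc n)
    then obtain b where b: "b \<in> I \<rightarrow> carrier R" "\<forall>i\<in>I. c i = x [^] n \<otimes> b i" "lincomb R M I b e = \<zero>\<^bsub>M\<^esub>"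
      by blast
    obtain b' where b': "b' \<in> I \<rightarrow> carrier R" "\<forall>i\<in>I. b i = x \<otimes> b' i" "lincomb R M I b' e = \<zero>\<^bsub>M\<^esub>"
      using div[OF b(1,3)] by blast
    have "\<forall>i\<in>I. c i = x [^] Suc n \<otimes> b' i" using b b' x by (auto simp: R.m_assoc Pi_iff)
    then show ?case using b' by blast
  qed
  then have "c i = \<zero>" if "c \<in> I \<rightarrow> carrier R" "lincomb R M I c e = \<zero>\<^bsub>M\<^esub>" "i \<in> I" for c i
    using that by (intro adic_separatedD[OF sep]) (auto simp: Pi_iff, metis funcset_mem)
  then show ?thesis using fin eM by (auto simp: indep_mod_def)
qed

text \<open>Successive approximation: the remainder of \<open>d\<close> after one approximation is
  \<open>x\<close> times an element of \<open>D\<close>, which is approximated in turn. The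
  coefficients add up to power series in \<open>x\<close>, which converge in \<open>R\<close>;
  separatedness of \<open>D\<close> identifies the resulting combination with
  \<open>d\<close>.\<close>

theorem span_lift:
  assumes x: "x \<in> carrier R" and compl: "adic_complete R x" and D: "submodule D R M"
    and sep: "\<And>d. d \<in> D \<Longrightarrow> (\<And>n::nat. \<exists>d'\<in>D. d = (x [^] n) \<odot>\<^bsub>M\<^esub> d') \<Longrightarrow> d = \<zero>\<^bsub>M\<^esub>"
    and fin: "finite I" and e: "e \<in> I \<rightarrow> D"
    and gen: "\<And>d. d \<in> D \<Longrightarrow> \<exists>c\<in>I \<rightarrow> carrier R. \<exists>d'\<in>D. d = lincomb R M I c e \<oplus>\<^bsub>M\<^esub> x \<odot>\<^bsub>M\<^esub> d'"
  shows "spans_mod R M {\<zero>\<^bsub>M\<^esub>} D I e"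
  unfolding spans_mod_def
proof (intro conjI ballI fin e)
  fix d assume d: "d \<in> D"
  have DM: "D \<subseteq> carrier M" and eM: "e \<in> I \<rightarrow> carrier M" using submoduleE(1)[OF D] e by auto
  obtain C r where Cr: "\<And>d. d \<in> D \<Longrightarrow> C d \<in> I \<rightarrow> carrier R \<and> r d \<in> D
      \<and> d = lincomb R M I (C d) e \<oplus>\<^bsub>M\<^esub> x \<odot>\<^bsub>M\<^esub> r d"
    using gen by metis
  \<comment> \<open>The successive remainders of \<open>d\<close>; the coefficients found for
    \<open>q k\<close> enter the limit with weight \<open>x^k\<close>.\<close>
  define q where "q n = (r ^^ n) d" for n
  have q: "q n \<in> D" for n unfolding q_def using d Cr by (induction n) auto
  have qS: "q (Suc n) = r (q n)" for n by (simp add: q_def)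
  define S where "S n i = (\<Oplus>k\<in>{..<n}. x [^] k \<otimes> C (q k) i)" for n :: nat and i
  have "\<exists>l\<in>carrier R. \<forall>n. \<exists>t\<in>carrier R. l = S n i \<oplus> x [^] n \<otimes> t" if "i \<in> I" for i
    unfolding S_def
    using compl[unfolded adic_complete_def, rule_format, of "\<lambda>k. C (q k) i"] Cr[OF q] that by (auto simp: Pi_iff)
  then obtain l t where l: "\<And>i. i \<in> I \<Longrightarrow> l i \<in> carrier R"
      and t: "\<And>i n. i \<in> I \<Longrightarrow> t i n \<in> carrier R"
      and lt: "\<And>i n. i \<in> I \<Longrightarrow> l i = S n i \<oplus> x [^] n \<otimes> t i n"
    by metis
  have Cc: "C (q k) i \<in> carrier R" if "i \<in> I" for i k using Cr[OF q] that by (auto simp: Pi_iff)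
  have P: "S n i \<in> carrier R" if "i \<in> I" for i and n :: nat
    unfolding S_def using Cc that x by (intro R.finsum_closed) auto
  have qM: "q n \<in> carrier M" for n using q DM by blast
  have step: "d = lincomb R M I (S n) e \<oplus>\<^bsub>M\<^esub> (x [^] n) \<odot>\<^bsub>M\<^esub> q n" for n :: nat
  proof (induction n)
    case 0
    have "lincomb R M I (S 0) e = \<zero>\<^bsub>M\<^esub>"
      using eM by (intro lincomb_zero) (auto simp: S_def)
    then show ?case using d DM by (auto simp: q_def)
  next
    case (Suc n)
    have "lincomb R M I (S (Suc n)) e
        = lincomb R M I (\<lambda>i. S n i \<oplus> x [^] n \<otimes> C (q n) i) e"
      using eM Cc x P
      by (intro lincomb_cong) (auto simp: S_def lessThan_Suc R.finsum_insert Pi_iff R.a_comm)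
    also have "\<dots> = lincomb R M I (S n) e \<oplus>\<^bsub>M\<^esub> (x [^] n) \<odot>\<^bsub>M\<^esub> lincomb R M I (C (q n)) e"
      using eM Cc x P by (subst lincomb_add) (auto simp: lincomb_smult Pi_iff)
    finally have 1: "lincomb R M I (S (Suc n)) e = \<dots>" .
    have "q n = lincomb R M I (C (q n)) e \<oplus>\<^bsub>M\<^esub> x \<odot>\<^bsub>M\<^esub> q (Suc n)" using Cr[OF q, of n] qS by metis
    then have "(x [^] n) \<odot>\<^bsub>M\<^esub> q n = (x [^] n) \<odot>\<^bsub>M\<^esub> (lincomb R M I (C (q n)) e \<oplus>\<^bsub>M\<^esub> x \<odot>\<^bsub>M\<^esub> q (Suc n))"
      by metis
    also have "\<dots> = (x [^] n) \<odot>\<^bsub>M\<^esub> lincomb R M I (C (q n)) e \<oplus>\<^bsub>M\<^esub> (x [^] Suc n) \<odot>\<^bsub>M\<^esub> q (Suc n)"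
      using Cr[OF q, of n] x eM qM by (simp add: smult_r_distr smult_assoc1)
    finally show ?case using Suc eM Cc x P qM 1 by (simp add: M.a_assoc Pi_iff)
  qed
  \<comment> \<open>Both \<open>d\<close> and the limit combination differ from the
    \<open>n\<close>-th partial combination by \<open>x^n\<close> times an element of
    \<open>D\<close>, for every \<open>n\<close>.\<close>
  have "d \<ominus>\<^bsub>M\<^esub> lincomb R M I l e = \<zero>\<^bsub>M\<^esub>"
  proof (rule sep)
    show "d \<ominus>\<^bsub>M\<^esub> lincomb R M I l e \<in> D"
      using d l e by (intro submodule_minus[OF D] lincomb_in[OF D]) auto
    fix n :: nat
    let ?P = "lincomb R M I (S n) e"
    let ?t = "lincomb R M I (\<lambda>i. t i n) e"
    have "lincomb R M I l e = lincomb R M I (\<lambda>i. S n i \<oplus> x [^] n \<otimes> t i n) e"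
      using lt[of _ n] t P x eM by (intro lincomb_cong) auto
    also have "\<dots> = ?P \<oplus>\<^bsub>M\<^esub> (x [^] n) \<odot>\<^bsub>M\<^esub> ?t"
      using t P x eM by (subst lincomb_add) (auto simp: lincomb_smult Pi_iff)
    finally have 2: "lincomb R M I l e = ?P \<oplus>\<^bsub>M\<^esub> (x [^] n) \<odot>\<^bsub>M\<^esub> ?t" .
    have PM: "?P \<in> carrier M" "?t \<in> carrier M" using P t eM by auto
    have "d \<ominus>\<^bsub>M\<^esub> lincomb R M I l e = (x [^] n) \<odot>\<^bsub>M\<^esub> (q n \<ominus>\<^bsub>M\<^esub> ?t)"
      unfolding 2 using PM qM[of n] x
      by (subst step[of n]) (simp add: add_diff_cancel_left smult_r_distr smult_r_minus M.minus_eq)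
    moreover have "q n \<ominus>\<^bsub>M\<^esub> ?t \<in> D"
      using q t e by (intro submodule_minus[OF D] lincomb_in[OF D]) auto
    ultimately show "\<exists>d'\<in>D. d \<ominus>\<^bsub>M\<^esub> lincomb R M I l e = (x [^] n) \<odot>\<^bsub>M\<^esub> d'" by blast
  qed
  then have "mcong M {\<zero>\<^bsub>M\<^esub>} d (lincomb R M I l e)"
    using d DM l eM by (auto simp: mcong_def)
  then show "\<exists>c\<in>I \<rightarrow> carrier R. mcong M {\<zero>\<^bsub>M\<^esub>} d (lincomb R M I c e)"
    using l by (intro bexI[of _ l]) auto
qed

text \<open>Fraction-free Gaussian elimination, by induction on the generators. The scalars
  \<open>s\<close> are denominators: each \<open>f j\<close> has to lie in the span only after
  multiplication by a nonzero element, so the bound also applies to spans over the field of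
  fractions.\<close>

theorem indep_card_le:
  assumes dom: "domain R" and L: "submodule L R M"
    and "finite I" and "e \<in> I \<rightarrow> carrier M"
    and "\<And>j. j \<in> J \<Longrightarrow> \<exists>s\<in>carrier R - {\<zero>}. \<exists>c\<in>I \<rightarrow> carrier R. mcong M L (s \<odot>\<^bsub>M\<^esub> f j) (lincomb R M I c e)"
    and "indep_mod R M L J f"
  shows "card J \<le> card I"
  using assms(3-)
proof (induction I arbitrary: J f)
  case empty
  have "J = {}"
  proof (rule ccontr)
    assume "J \<noteq> {}"
    then obtain j where j: "j \<in> J" by blast
    have J: "finite J" "f \<in> J \<rightarrow> carrier M" using empty.prems(3) by (auto simp: indep_mod_def)
    obtain s where s: "s \<in> carrier R - {\<zero>}" "mcong M L (s \<odot>\<^bsub>M\<^esub> f j) \<zero>\<^bsub>M\<^esub>"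
      using empty.prems(2)[OF j] by auto
    then have "s \<odot>\<^bsub>M\<^esub> f j \<in> L" using mcong_zero_iff[of "s \<odot>\<^bsub>M\<^esub> f j" L] by (auto simp: mcong_def)
    then have "lincomb R M J (\<lambda>k. if k = j then s else \<zero>) f \<in> L"
      using s j J by (subst lincomb_single) auto
    then have "s = \<zero>" using empty.prems(3) j s
      unfolding indep_mod_def by (auto dest!: bspec[where x = "\<lambda>k. if k = j then s else \<zero>"])
    then show False using s by simp
  qed
  then show ?case by simp
next
  case (insert i0 I)
  have J: "finite J" "f \<in> J \<rightarrow> carrier M" using insert.prems(3) by (auto simp: indep_mod_def)
  obtain s c where s: "\<And>j. j \<in> J \<Longrightarrow> s j \<in> carrier R - {\<zero>}"
      and c: "\<And>j. j \<in> J \<Longrightarrow> c j \<in> insert i0 I \<rightarrow> carrier R"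
      and sc: "\<And>j. j \<in> J \<Longrightarrow> mcong M L (s j \<odot>\<^bsub>M\<^esub> f j) (lincomb R M (insert i0 I) (c j) e)"
    using insert.prems(2) by metis
  have e: "e \<in> I \<rightarrow> carrier M" "e \<in> insert i0 I \<rightarrow> carrier M" using insert.prems by auto
  show ?case
  proof (cases "\<forall>j\<in>J. c j i0 = \<zero>")
    case True
    have "card J \<le> card I"
    proof (rule insert.IH[OF e(1) _ insert.prems(3)])
      fix j assume j: "j \<in> J"
      have "lincomb R M (insert i0 I) (c j) e = lincomb R M I (c j) e"
        using True j c[OF j] e insert.hyps by (intro lincomb_mono_neutral) auto
      then show "\<exists>s\<in>carrier R - {\<zero>}. \<exists>c\<in>I \<rightarrow> carrier R. mcong M L (s \<odot>\<^bsub>M\<^esub> f j) (lincomb R M I c e)"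
        using s[OF j] c[OF j] sc[OF j] by (intro bexI[of _ "s j"] bexI[of _ "c j"]) auto
    qed
    then show ?thesis using insert.hyps by simp
  next
    case False
    then obtain j0 where j0: "j0 \<in> J" "c j0 i0 \<noteq> \<zero>" by blast
    \<comment> \<open>The pivot. One member \<open>j0\<close> of the independent family is spent to
      eliminate the generator \<open>i0\<close> from all the others.\<close>
    define a where "a = c j0 i0"
    define J' where "J' = J - {j0}"
    \<comment> \<open>Coordinates of the eliminated vector \<open>a s\<^sub>j f\<^sub>j - c\<^sub>j
      s\<^sub>j\<^sub>0 f\<^sub>j\<^sub>0\<close> in terms of \<open>f\<close>, with
      \<open>c\<^sub>j\<close> the coefficient of \<open>f\<^sub>j\<close> at \<open>i0\<close>.
      Writing it as a combination lets relations among the new vectors be turned into relations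
      among the old ones.\<close>
    define b where "b j = (\<lambda>k. (if k = j then a \<otimes> s j else \<zero>) \<ominus> (if k = j0 then c j i0 \<otimes> s j0 else \<zero>))" for j
    have a: "a \<in> carrier R" "a \<noteq> \<zero>" using j0 c by (auto simp: a_def)
    have sR: "s j \<in> carrier R" "c j i0 \<in> carrier R" if "j \<in> J" for j using s[OF that] c[OF that] by auto
    have bR: "b j \<in> J \<rightarrow> carrier R" if "j \<in> J" for j
      using sR[OF that] sR[OF j0(1)] a by (auto simp: b_def R.minus_eq)
    define f' where "f' j = lincomb R M J (b j) f" for j
    have f'M: "f' j \<in> carrier M" if "j \<in> J" for j using bR[OF that] J by (simp add: f'_def)
    have f': "f' j = a \<odot>\<^bsub>M\<^esub> (s j \<odot>\<^bsub>M\<^esub> f j) \<ominus>\<^bsub>M\<^esub> c j i0 \<odot>\<^bsub>M\<^esub> (s j0 \<odot>\<^bsub>M\<^esub> f j0)" if j: "j \<in> J" for j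
    proof -
      have "f' j = lincomb R M J (\<lambda>k. if k = j then a \<otimes> s j else \<zero>) f
          \<ominus>\<^bsub>M\<^esub> lincomb R M J (\<lambda>k. if k = j0 then c j i0 \<otimes> s j0 else \<zero>) f"
        unfolding f'_def b_def using sR[OF j] sR[OF j0(1)] a J by (intro lincomb_diff) auto
      also have "lincomb R M J (\<lambda>k. if k = j then a \<otimes> s j else \<zero>) f = (a \<otimes> s j) \<odot>\<^bsub>M\<^esub> f j"
        using sR[OF j] a J j by (intro lincomb_single) auto
      also have "lincomb R M J (\<lambda>k. if k = j0 then c j i0 \<otimes> s j0 else \<zero>) f = (c j i0 \<otimes> s j0) \<odot>\<^bsub>M\<^esub> f j0"
        using sR[OF j] sR[OF j0(1)] J j0 by (intro lincomb_single) auto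
      finally show ?thesis using sR[OF j] sR[OF j0(1)] a funcset_mem[OF J(2) j] funcset_mem[OF J(2) j0(1)]
        by (simp add: smult_assoc1)
    qed
    have "card J' \<le> card I"
    proof (rule insert.IH[OF e(1), of J' f'])
      fix j assume "j \<in> J'"
      then have j: "j \<in> J" by (auto simp: J'_def)
      let ?c = "\<lambda>i. a \<otimes> c j i \<ominus> c j i0 \<otimes> c j0 i"
      have cc: "?c \<in> insert i0 I \<rightarrow> carrier R"
        using c[OF j] c[OF j0(1)] a by (auto simp: Pi_iff R.minus_eq)
      have "mcong M L (f' j) (a \<odot>\<^bsub>M\<^esub> lincomb R M (insert i0 I) (c j) e \<ominus>\<^bsub>M\<^esub> c j i0 \<odot>\<^bsub>M\<^esub> lincomb R M (insert i0 I) (c j0) e)"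
        unfolding f'[OF j] using L sc[OF j] sc[OF j0(1)] a sR[OF j] by (intro mcong_diff mcong_smult) auto
      also have "a \<odot>\<^bsub>M\<^esub> lincomb R M (insert i0 I) (c j) e \<ominus>\<^bsub>M\<^esub> c j i0 \<odot>\<^bsub>M\<^esub> lincomb R M (insert i0 I) (c j0) e
          = lincomb R M (insert i0 I) ?c e"
        using c[OF j] c[OF j0(1)] a e by (subst lincomb_diff) (auto simp: lincomb_smult Pi_iff)
      also have "\<dots> = lincomb R M I ?c e"
        using cc insert.hyps e a sR[OF j]
        by (intro lincomb_mono_neutral) (auto simp: a_def[symmetric] R.m_comm R.minus_eq R.r_neg)
      finally show "\<exists>s\<in>carrier R - {\<zero>}. \<exists>c\<in>I \<rightarrow> carrier R. mcong M L (s \<odot>\<^bsub>M\<^esub> f' j) (lincomb R M I c e)"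
        using cc f'M[OF j] domain.one_not_zero[OF dom] by (intro bexI[of _ \<one>] bexI[of _ ?c]) auto
    next
      show "indep_mod R M L J' f'"
        unfolding indep_mod_def
      proof (intro conjI ballI impI)
        show "finite J'" "f' \<in> J' \<rightarrow> carrier M" using J f'M by (auto simp: J'_def)
        fix d k assume d: "d \<in> J' \<rightarrow> carrier R" "lincomb R M J' d f' \<in> L" and k: "k \<in> J'"
        let ?d = "\<lambda>k. \<Oplus>j\<in>J'. d j \<otimes> b j k"
        have bJ: "j \<in> J' \<Longrightarrow> i \<in> J \<Longrightarrow> b j i \<in> carrier R" for j i using bR[of j] by (auto simp: J'_def)
        \<comment> \<open>For \<open>k\<close> different from \<open>j0\<close>, only the vector
          with index \<open>k\<close> contributes to the coefficient of \<open>f k\<close>. That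
          coefficient is \<open>d k\<close> times the nonzero factor \<open>a s k\<close>.\<close>
        have "lincomb R M J' d f' = lincomb R M J ?d f"
          unfolding f'_def using J d bJ by (intro lincomb_lincomb) (auto simp: J'_def)
        then have "?d k = \<zero>" using d k insert.prems(3) bJ
          unfolding indep_mod_def J'_def
          by (auto dest!: bspec[where x = ?d] intro!: R.finsum_closed simp: J'_def Pi_iff)
        moreover have "?d k = (\<Oplus>j\<in>J'. if k = j then d j \<otimes> (a \<otimes> s j) else \<zero>)"
          using k d a sR by (intro R.finsum_cong') (auto simp: b_def J'_def R.minus_eq Pi_iff)
        moreover have "\<dots> = d k \<otimes> (a \<otimes> s k)"
          using k d a sR J by (intro R.finsum_singleton) (auto simp: J'_def Pi_iff)
        ultimately have "d k \<otimes> (a \<otimes> s k) = \<zero>" by simp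
        moreover have "a \<otimes> s k \<noteq> \<zero>"
          using a s[of k] k domain.integral[OF dom, of a "s k"] by (auto simp: J'_def)
        ultimately show "d k = \<zero>"
          using a sR[of k] d k domain.integral[OF dom, of "d k" "a \<otimes> s k"] by (auto simp: J'_def)
      qed
    qed
    then show ?thesis using J j0 insert.hyps by (simp add: J'_def)
  qed
qed

end

section \<open>Change of scalars and the tower law\<close>

lemma restrict_scalars_simps [simp]:
  "carrier (restrict_scalars h M) = carrier M"
  "ring.zero (restrict_scalars h M) = ring.zero M"
  "add (restrict_scalars h M) = add M"
  "smult (restrict_scalars h M) = (\<lambda>a x. h a \<odot>\<^bsub>M\<^esub> x)"
  by (simp_all add: restrict_scalars_def)

lemma restrict_scalars_finsum [simp]: "finsum (restrict_scalars h M) f I = finsum M f I"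
  by (simp add: finsum_def finprod_def)

lemma restrict_scalars_minus [simp]: "a_minus (restrict_scalars h M) x y = a_minus M x y"
  by (simp add: a_minus_def a_inv_def m_inv_def)

lemma algebra_module_simps [simp]:
  "carrier (algebra_module h B) = carrier B"
  "ring.zero (algebra_module h B) = ring.zero B"
  "add (algebra_module h B) = add B"
  "smult (algebra_module h B) = (\<lambda>a x. h a \<otimes>\<^bsub>B\<^esub> x)"
  by (simp_all add: algebra_module_def)

lemma algebra_module_finsum [simp]: "finsum (algebra_module h B) f I = finsum B f I"
  by (simp add: finsum_def finprod_def)

lemma algebra_module_minus [simp]: "a_minus (algebra_module h B) x y = a_minus B x y"
  by (simp add: a_minus_def a_inv_def m_inv_def)

lemma abelian_group_cong:
  assumes "abelian_group M" "carrier N = carrier M" "add N = add M" "ring.zero N = ring.zero M"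
  shows "abelian_group N"
proof -
  interpret M: abelian_group M by fact
  show ?thesis
    by (rule abelian_groupI) (use M.l_neg in \<open>auto simp: assms(2-4) M.a_ac intro!: bexI[of _ "\<ominus>\<^bsub>M\<^esub> x" for x]\<close>)
qed

lemma module_restrict_scalars:
  assumes "cring S" "h \<in> ring_hom S R" "module R M"
  shows "module S (restrict_scalars h M)"
proof -
  interpret M: module R M by fact
  show ?thesis
    using assms ring_hom_closed[OF assms(2)]
    by (intro moduleI abelian_group_cong[OF M.abelian_group_axioms])
       (simp_all add: ring_hom_add[OF assms(2)] ring_hom_mult[OF assms(2)] ring_hom_one[OF assms(2)]
          M.smult_l_distr M.smult_r_distr M.smult_assoc1)
qed

lemma module_algebra_module:
  assumes "cring S" "h \<in> ring_hom S B" "cring B"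
  shows "module S (algebra_module h B)"
proof -
  interpret B: cring B by fact
  show ?thesis
    using assms ring_hom_closed[OF assms(2)]
    by (intro moduleI abelian_group_cong[OF B.abelian_group_axioms])
       (simp_all add: ring_hom_add[OF assms(2)] ring_hom_mult[OF assms(2)] ring_hom_one[OF assms(2)]
          B.l_distr B.r_distr B.m_assoc)
qed

lemma (in abelian_monoid) finsum_Times:
  assumes "finite I" "finite K" "\<And>i k. i \<in> I \<Longrightarrow> k \<in> K \<Longrightarrow> f (i, k) \<in> carrier G"
  shows "(\<Oplus>z\<in>I \<times> K. f z) = (\<Oplus>i\<in>I. \<Oplus>k\<in>K. f (i, k))"
  using assms(1,3)
proof (induction I)
  case empty
  then show ?case by simp
next
  case (insert i I)
  have "(\<Oplus>z\<in>insert i I \<times> K. f z) = (\<Oplus>z\<in>Pair i ` K \<union> I \<times> K. f z)"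
    by (rule arg_cong2[where f = "finsum G"]) auto
  also have "\<dots> = (\<Oplus>z\<in>Pair i ` K. f z) \<oplus> (\<Oplus>z\<in>I \<times> K. f z)"
    using insert assms(2) by (intro finsum_Un_disjoint) auto
  also have "(\<Oplus>z\<in>Pair i ` K. f z) = (\<Oplus>k\<in>K. f (i, k))"
    using insert by (intro finsum_reindex) (auto intro: inj_onI)
  also have "(\<Oplus>z\<in>I \<times> K. f z) = (\<Oplus>i\<in>I. \<Oplus>k\<in>K. f (i, k))" using insert by auto
  finally show ?case using insert by (auto intro!: finsum_closed)
qed

context module
begin

lemma finsum_smult_rdistr:
  assumes "a \<in> I \<rightarrow> carrier R" "x \<in> carrier M"
  shows "(\<Oplus>i\<in>I. a i) \<odot>\<^bsub>M\<^esub> x = (\<Oplus>\<^bsub>M\<^esub>i\<in>I. a i \<odot>\<^bsub>M\<^esub> x)"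
proof (cases "finite I")
  case True
  then show ?thesis using assms
    by (induction I) (auto simp: smult_l_distr R.finsum_insert M.finsum_insert Pi_iff)
qed (use assms in \<open>simp add: R.finsum_infinite M.finsum_infinite\<close>)

lemma submodule_image:
  assumes "submodule D R M" "x \<in> carrier R"
  shows "submodule ((\<lambda>d. x \<odot>\<^bsub>M\<^esub> d) ` D) R M"
proof -
  note D = submoduleE[OF assms(1)]
  have DM: "\<And>d. d \<in> D \<Longrightarrow> d \<in> carrier M" using D(1) by auto
  show ?thesis
  proof (intro submoduleI)
    show "\<zero>\<^bsub>M\<^esub> \<in> (\<lambda>d. x \<odot>\<^bsub>M\<^esub> d) ` D"
      using submodule_zero[OF assms(1)] assms(2) by (auto intro!: image_eqI[of _ _ "\<zero>\<^bsub>M\<^esub>"])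
  next
    fix a assume "a \<in> (\<lambda>d. x \<odot>\<^bsub>M\<^esub> d) ` D"
    then obtain d where d: "d \<in> D" "a = x \<odot>\<^bsub>M\<^esub> d" by auto
    then have "\<ominus>\<^bsub>M\<^esub> a = x \<odot>\<^bsub>M\<^esub> (\<ominus>\<^bsub>M\<^esub> d)" using assms(2) DM by (simp add: smult_r_minus)
    then show "\<ominus>\<^bsub>M\<^esub> a \<in> (\<lambda>d. x \<odot>\<^bsub>M\<^esub> d) ` D" using D(3) d by blast
  next
    fix a b assume "a \<in> (\<lambda>d. x \<odot>\<^bsub>M\<^esub> d) ` D" "b \<in> (\<lambda>d. x \<odot>\<^bsub>M\<^esub> d) ` D"
    then obtain d d' where d: "d \<in> D" "a = x \<odot>\<^bsub>M\<^esub> d" "d' \<in> D" "b = x \<odot>\<^bsub>M\<^esub> d'" by auto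
    then have "a \<oplus>\<^bsub>M\<^esub> b = x \<odot>\<^bsub>M\<^esub> (d \<oplus>\<^bsub>M\<^esub> d')" using assms(2) DM by (simp add: smult_r_distr)
    then show "a \<oplus>\<^bsub>M\<^esub> b \<in> (\<lambda>d. x \<odot>\<^bsub>M\<^esub> d) ` D" using D(5) d by blast
  next
    fix a y assume a: "a \<in> carrier R" "y \<in> (\<lambda>d. x \<odot>\<^bsub>M\<^esub> d) ` D"
    then obtain d where d: "d \<in> D" "y = x \<odot>\<^bsub>M\<^esub> d" by auto
    then have "a \<odot>\<^bsub>M\<^esub> y = x \<odot>\<^bsub>M\<^esub> (a \<odot>\<^bsub>M\<^esub> d)"
      using assms(2) DM a by (simp add: R.m_comm flip: smult_assoc1)
    then show "a \<odot>\<^bsub>M\<^esub> y \<in> (\<lambda>d. x \<odot>\<^bsub>M\<^esub> d) ` D" using D(4) d a by blast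
  qed (use DM assms(2) in auto)
qed

text \<open>A maximal family that is independent modulo \<open>x\<close> spans modulo \<open>x\<close>.\<close>

theorem spans_of_bounded_rank:
  assumes x: "x \<in> carrier R" and local: "\<And>a. a \<in> carrier R \<Longrightarrow> a \<in> Units R \<or> (\<exists>b\<in>carrier R. a = x \<otimes> b)"
    and sep: "adic_separated R x" and compl: "adic_complete R x" and D: "submodule D R M"
    and tf: "\<And>d. d \<in> D \<Longrightarrow> x \<odot>\<^bsub>M\<^esub> d = \<zero>\<^bsub>M\<^esub> \<Longrightarrow> d = \<zero>\<^bsub>M\<^esub>"
    and Dsep: "\<And>d. d \<in> D \<Longrightarrow> (\<And>n::nat. \<exists>d'\<in>D. d = (x [^] n) \<odot>\<^bsub>M\<^esub> d') \<Longrightarrow> d = \<zero>\<^bsub>M\<^esub>"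
    and bound: "\<And>m f. f \<in> {..<m::nat} \<rightarrow> D \<Longrightarrow> indep_mod R M {\<zero>\<^bsub>M\<^esub>} {..<m} f \<Longrightarrow> m \<le> N"
  shows "\<exists>m f. spans_mod R M {\<zero>\<^bsub>M\<^esub>} D {..<m::nat} f"
proof -
  let ?L = "(\<lambda>d. x \<odot>\<^bsub>M\<^esub> d) ` D"
  have L: "submodule ?L R M" by (rule submodule_image[OF D x])
  \<comment> \<open>\<open>Q m f\<close> is independence modulo \<open>x D\<close>: the coefficients
    of a relation modulo \<open>x D\<close> are divisible by \<open>x\<close>. Such a family is
    independent by \<open>indep_lift\<close>, so its length is bounded by \<open>N\<close> and a
    longest one exists.\<close>
  define Q where "Q m f \<longleftrightarrow> f \<in> {..<m} \<rightarrow> D \<and> (\<forall>c\<in>{..<m} \<rightarrow> carrier R. lincomb R M {..<m} c f \<in> ?L \<longrightarrow>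
    (\<forall>i<m. \<exists>b\<in>carrier R. c i = x \<otimes> b))" for m :: nat and f
  have Qb: "m \<le> N" if "Q m f" for m f
  proof (rule bound)
    show f: "f \<in> {..<m} \<rightarrow> D" using that by (auto simp: Q_def)
    show "indep_mod R M {\<zero>\<^bsub>M\<^esub>} {..<m} f"
      using that by (intro indep_lift[OF _ f D x sep tf]) (auto simp: Q_def)
  qed
  have "Q 0 (\<lambda>_. \<zero>\<^bsub>M\<^esub>)" by (simp add: Q_def)
  then have ex: "\<exists>f. Q 0 f" by blast
  define m where "m = (GREATEST m. \<exists>f. Q m f)"
  have "\<exists>f. Q m f" unfolding m_def using ex Qb by (intro GreatestI_nat[of "\<lambda>m. \<exists>f. Q m f" 0 N]) auto
  then obtain f where f: "Q m f" by blast
  have max: "\<not> Q (Suc m) g" for g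
    using Greatest_le_nat[of "\<lambda>m. \<exists>f. Q m f" "Suc m" N] Qb unfolding m_def[symmetric] by auto
  have DM: "D \<subseteq> carrier M" using submoduleE(1)[OF D] .
  have fD: "f \<in> {..<m} \<rightarrow> D" using f by (simp add: Q_def)
  then have fM: "f \<in> {..<m} \<rightarrow> carrier M" using DM by auto
  have "spans_mod R M {\<zero>\<^bsub>M\<^esub>} D {..<m} f"
  proof (rule span_lift[OF x compl D Dsep _ fD])
    fix d assume d: "d \<in> D"
    define g where "g = f(m := d)"
    have gm: "g m = d" by (simp add: g_def)
    have gD: "g \<in> {..<Suc m} \<rightarrow> D" using fD d by (auto simp: g_def Pi_iff less_Suc_eq)
    then have gM: "g \<in> {..<Suc m} \<rightarrow> carrier M" using DM by auto
    obtain c i where c: "c \<in> {..<Suc m} \<rightarrow> carrier R" "lincomb R M {..<Suc m} c g \<in> ?L"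
        and i: "i < Suc m" "\<not> (\<exists>b\<in>carrier R. c i = x \<otimes> b)"
      using max[of g] gD unfolding Q_def by blast
    have Im: "{..<Suc m} - {m} = {..<m}" by auto
    have c': "c \<in> {..<m} \<rightarrow> carrier R" using c(1) by auto
    have cm: "c m \<in> carrier R" using c by auto
    \<comment> \<open>Otherwise \<open>c m\<close> is divisible by \<open>x\<close>, the term with
      \<open>d\<close> lies in \<open>x D\<close>, and what remains is a relation among the
      \<open>f\<close> alone. Then all coefficients are divisible by \<open>x\<close>, contrary to
      the choice of \<open>i\<close>.\<close>
    have "c m \<in> Units R"
    proof (rule ccontr)
      assume "c m \<notin> Units R"
      then obtain b where b: "b \<in> carrier R" "c m = x \<otimes> b" using local[OF cm] by blast
      have "lincomb R M {..<Suc m} c g = c m \<odot>\<^bsub>M\<^esub> g m \<oplus>\<^bsub>M\<^esub> lincomb R M {..<m} c g"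
        using lincomb_remove[of "{..<Suc m}" m c g] c gM Im by simp
      also have "lincomb R M {..<m} c g = lincomb R M {..<m} c f"
        using c fM by (intro lincomb_cong) (auto simp: g_def)
      finally have "lincomb R M {..<Suc m} c g = x \<odot>\<^bsub>M\<^esub> (b \<odot>\<^bsub>M\<^esub> d) \<oplus>\<^bsub>M\<^esub> lincomb R M {..<m} c f"
        using b x d DM gm by (simp add: smult_assoc1 subset_iff)
      moreover have lc: "lincomb R M {..<m} c f \<in> carrier M" using c(1) fM by (intro lincomb_closed) auto
      moreover have bd: "x \<odot>\<^bsub>M\<^esub> (b \<odot>\<^bsub>M\<^esub> d) \<in> ?L" using b d submoduleE(4)[OF D] by blast
      ultimately have "lincomb R M {..<m} c f = lincomb R M {..<Suc m} c g \<ominus>\<^bsub>M\<^esub> x \<odot>\<^bsub>M\<^esub> (b \<odot>\<^bsub>M\<^esub> d)"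
        using submodule_carrier[OF L bd]
        by (simp add: M.minus_eq M.a_assoc) (metis M.a_comm M.a_inv_closed M.r_neg2)
      then have "lincomb R M {..<m} c f \<in> ?L" using submodule_minus[OF L c(2) bd] by simp
      then have "\<forall>i<m. \<exists>b\<in>carrier R. c i = x \<otimes> b" using f c' unfolding Q_def by blast
      then show False using i b by (auto simp: less_Suc_eq)
    qed
    then obtain b where b: "b \<in> {..<m} \<rightarrow> carrier R" "mcong M ?L (g m) (lincomb R M {..<m} b g)"
      using unit_coeff_solve[OF L _ _ c(1) gM c(2), of m] Im by auto
    moreover have "lincomb R M {..<m} b g = lincomb R M {..<m} b f"
      using b fM by (intro lincomb_cong) (auto simp: g_def)
    ultimately obtain d' where d': "d' \<in> D" "d \<ominus>\<^bsub>M\<^esub> lincomb R M {..<m} b f = x \<odot>\<^bsub>M\<^esub> d'"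
      by (auto simp: mcong_def g_def)
    have dM: "d \<in> carrier M" and lM: "lincomb R M {..<m} b f \<in> carrier M" using d DM b fM by auto
    have "d = lincomb R M {..<m} b f \<oplus>\<^bsub>M\<^esub> (d \<ominus>\<^bsub>M\<^esub> lincomb R M {..<m} b f)"
      using dM lM by (simp add: M.minus_eq M.a_lcomm M.r_neg)
    then show "\<exists>c\<in>{..<m} \<rightarrow> carrier R. \<exists>d'\<in>D. d = lincomb R M {..<m} c f \<oplus>\<^bsub>M\<^esub> x \<odot>\<^bsub>M\<^esub> d'"
      using b d' by metis
  qed auto
  then show ?thesis by blast
qed

text \<open>The identity behind the tower law: a combination over \<open>S\<close> of the products
  of generators of \<open>R\<close> over \<open>S\<close> with vectors of \<open>M\<close> is a
  combination over \<open>R\<close> of those vectors. Spans and independence of the product family,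
  and hence multiplicativity of ranks, are read off from it.\<close>

lemma lincomb_Times:
  assumes S: "cring S" and h: "h \<in> ring_hom S R"
    and fin: "finite I" "finite K" and e: "e \<in> I \<rightarrow> carrier M" and g: "g \<in> K \<rightarrow> carrier R"
    and c: "c \<in> I \<times> K \<rightarrow> carrier S"
  shows "lincomb S (restrict_scalars h M) (I \<times> K) c (\<lambda>(i, k). g k \<odot>\<^bsub>M\<^esub> e i)
    = lincomb R M I (\<lambda>i. lincomb S (algebra_module h R) K (\<lambda>k. c (i, k)) g) e"
proof -
  have hc: "h (c (i, k)) \<in> carrier R" if "i \<in> I" "k \<in> K" for i k
    using c that ring_hom_closed[OF h] by auto
  have "lincomb S (restrict_scalars h M) (I \<times> K) c (\<lambda>(i, k). g k \<odot>\<^bsub>M\<^esub> e i)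
      = (\<Oplus>\<^bsub>M\<^esub>i\<in>I. \<Oplus>\<^bsub>M\<^esub>k\<in>K. h (c (i, k)) \<odot>\<^bsub>M\<^esub> (g k \<odot>\<^bsub>M\<^esub> e i))"
    unfolding lincomb_def using hc fin e g by (simp add: M.finsum_Times Pi_iff)
  also have "\<dots> = (\<Oplus>\<^bsub>M\<^esub>i\<in>I. (\<Oplus>k\<in>K. h (c (i, k)) \<otimes> g k) \<odot>\<^bsub>M\<^esub> e i)"
  proof (intro M.finsum_cong' refl)
    fix i assume i: "i \<in> I"
    have "(\<Oplus>k\<in>K. h (c (i, k)) \<otimes> g k) \<odot>\<^bsub>M\<^esub> e i = (\<Oplus>\<^bsub>M\<^esub>k\<in>K. (h (c (i, k)) \<otimes> g k) \<odot>\<^bsub>M\<^esub> e i)"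
      using i hc e g by (intro finsum_smult_rdistr) auto
    also have "\<dots> = (\<Oplus>\<^bsub>M\<^esub>k\<in>K. h (c (i, k)) \<odot>\<^bsub>M\<^esub> (g k \<odot>\<^bsub>M\<^esub> e i))"
      using i hc e g by (intro M.finsum_cong') (auto simp: smult_assoc1 Pi_iff)
    finally show "(\<Oplus>\<^bsub>M\<^esub>k\<in>K. h (c (i, k)) \<odot>\<^bsub>M\<^esub> (g k \<odot>\<^bsub>M\<^esub> e i)) = (\<Oplus>k\<in>K. h (c (i, k)) \<otimes> g k) \<odot>\<^bsub>M\<^esub> e i" by simp
  qed (use hc e g in \<open>auto simp: Pi_iff intro!: smult_closed R.finsum_closed\<close>)
  finally show ?thesis by (simp add: lincomb_def)
qed

lemma mcong_restrict_scalars [simp]: "mcong (restrict_scalars h M) L x y = mcong M L x y"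
  by (simp add: mcong_def)

lemma spans_mod_Times:
  assumes S: "cring S" and h: "h \<in> ring_hom S R" and D: "submodule D R M"
    and e: "spans_mod R M L D I e"
    and g: "spans_mod S (algebra_module h R) {\<zero>} (carrier R) K g"
  shows "spans_mod S (restrict_scalars h M) L D (I \<times> K) (\<lambda>(i, k). g k \<odot>\<^bsub>M\<^esub> e i)"
proof -
  interpret A: module S "algebra_module h R" by (rule module_algebra_module[OF S h R.is_cring])
  have DM: "D \<subseteq> carrier M" using submoduleE(1)[OF D] .
  have fin: "finite I" "finite K" and eD: "e \<in> I \<rightarrow> D" and gR: "g \<in> K \<rightarrow> carrier R"
    using e g by (auto simp: spans_mod_def)
  have eM: "e \<in> I \<rightarrow> carrier M" using eD DM by auto
  show ?thesis unfolding spans_mod_def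
  proof (intro conjI ballI)
    show "finite (I \<times> K)" using fin by simp
    show "(\<lambda>(i, k). g k \<odot>\<^bsub>M\<^esub> e i) \<in> I \<times> K \<rightarrow> D" using eD gR submoduleE(4)[OF D] by auto
    fix d assume "d \<in> D"
    then obtain c where c: "c \<in> I \<rightarrow> carrier R" "mcong M L d (lincomb R M I c e)"
      using spans_modD[OF e] by blast
    have "\<exists>b. b \<in> K \<rightarrow> carrier S \<and> c i = lincomb S (algebra_module h R) K b g" if "i \<in> I" for i
      using A.spans_modD[OF g, of "c i"] c(1) that A.mcong_trivial by (metis PiE algebra_module_simps(2))
    then obtain b where b: "\<And>i. i \<in> I \<Longrightarrow> b i \<in> K \<rightarrow> carrier S \<and> c i = lincomb S (algebra_module h R) K (b i) g"
      by metis
    let ?b = "\<lambda>(i, k). b i k"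
    have bb: "?b \<in> I \<times> K \<rightarrow> carrier S" using b by auto
    have "lincomb S (restrict_scalars h M) (I \<times> K) ?b (\<lambda>(i, k). g k \<odot>\<^bsub>M\<^esub> e i)
      = lincomb R M I (\<lambda>i. lincomb S (algebra_module h R) K (b i) g) e"
      using lincomb_Times[OF S h fin eM gR bb] by simp
    also have "\<dots> = lincomb R M I c e" using b c eM by (intro lincomb_cong) auto
    finally show "\<exists>c\<in>I \<times> K \<rightarrow> carrier S. mcong (restrict_scalars h M) L d
        (lincomb S (restrict_scalars h M) (I \<times> K) c (\<lambda>(i, k). g k \<odot>\<^bsub>M\<^esub> e i))"
      using c bb by (intro bexI[of _ ?b]) auto
  qed
qed

lemma indep_mod_Times:
  assumes S: "cring S" and h: "h \<in> ring_hom S R"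
    and e: "indep_mod R M L I e"
    and g: "indep_mod S (algebra_module h R) {\<zero>} K g"
  shows "indep_mod S (restrict_scalars h M) L (I \<times> K) (\<lambda>(i, k). g k \<odot>\<^bsub>M\<^esub> e i)"
proof -
  interpret A: module S "algebra_module h R" by (rule module_algebra_module[OF S h R.is_cring])
  have fin: "finite I" "finite K" and eM: "e \<in> I \<rightarrow> carrier M" and gR: "g \<in> K \<rightarrow> carrier R"
    using e g by (auto simp: indep_mod_def)
  show ?thesis unfolding indep_mod_def
  proof (intro conjI ballI impI)
    show "finite (I \<times> K)" using fin by simp
    show "(\<lambda>(i, k). g k \<odot>\<^bsub>M\<^esub> e i) \<in> I \<times> K \<rightarrow> carrier (restrict_scalars h M)" using eM gR by auto
    fix c z assume c: "c \<in> I \<times> K \<rightarrow> carrier S"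
      and 0: "lincomb S (restrict_scalars h M) (I \<times> K) c (\<lambda>(i, k). g k \<odot>\<^bsub>M\<^esub> e i) \<in> L"
      and z: "z \<in> I \<times> K"
    let ?a = "\<lambda>i. lincomb S (algebra_module h R) K (\<lambda>k. c (i, k)) g"
    have cz: "(\<lambda>k. c (i, k)) \<in> K \<rightarrow> carrier S" if "i \<in> I" for i using c that by auto
    have "?a \<in> I \<rightarrow> carrier R" using A.lincomb_closed[of _ K g] cz gR by auto
    moreover have "lincomb R M I ?a e \<in> L" using 0 lincomb_Times[OF S h fin eM gR c] by simp
    ultimately have "?a i = \<zero>" if "i \<in> I" for i using e that unfolding indep_mod_def by blast
    then show "c z = \<zero>\<^bsub>S\<^esub>" using g cz z unfolding indep_mod_def by fastforce
  qed
qed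

lemma spans_mod_extend_scalars:
  assumes h: "h \<in> ring_hom S R" and e: "spans_mod S (restrict_scalars h M) L D I e"
  shows "spans_mod R M L D I e"
  unfolding spans_mod_def
proof (intro conjI ballI)
  show "finite I" "e \<in> I \<rightarrow> D" using e by (auto simp: spans_mod_def)
  fix d assume "d \<in> D"
  then obtain c where c: "c \<in> I \<rightarrow> carrier S" "mcong M L d (lincomb S (restrict_scalars h M) I c e)"
    using e by (auto simp: spans_mod_def)
  then show "\<exists>c\<in>I \<rightarrow> carrier R. mcong M L d (lincomb R M I c e)"
    using ring_hom_closed[OF h] by (intro bexI[of _ "\<lambda>i. h (c i)"]) (auto simp: lincomb_def)
qed

end

section \<open>The $p$-adic integers\<close>

lemma (in abelian_group) eq_add_diff:
  assumes "x \<in> carrier G" "y \<in> carrier G"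
  shows "x = y \<oplus> (x \<ominus> y)"
  using assms by (simp add: minus_eq a_lcomm r_neg)

context cring
begin

text \<open>The largest power of \<open>x\<close> dividing \<open>a\<close> exists by separatedness,
  and the cofactor is not divisible by \<open>x\<close>, hence a unit.\<close>

lemma adic_factor:
  assumes x: "x \<in> carrier R" and local: "\<And>a. a \<in> carrier R \<Longrightarrow> a \<in> Units R \<or> (\<exists>b\<in>carrier R. a = x \<otimes> b)"
    and sep: "adic_separated R x" and a: "a \<in> carrier R" "a \<noteq> \<zero>"
  shows "\<exists>k u. u \<in> Units R \<and> a = x [^] (k::nat) \<otimes> u"
proof -
  obtain n :: nat where n: "\<not> (\<exists>b\<in>carrier R. a = x [^] n \<otimes> b)" using adic_separatedD[OF sep a(1)] a(2) by blast
  define m where "m = (LEAST n::nat. \<not> (\<exists>b\<in>carrier R. a = x [^] n \<otimes> b))"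
  have m: "\<not> (\<exists>b\<in>carrier R. a = x [^] m \<otimes> b)" unfolding m_def by (rule LeastI[of _ n], rule n)
  have "m \<noteq> 0"
  proof
    assume "m = 0"
    then have "a = x [^] m \<otimes> a" using a by simp
    then show False using m a by blast
  qed
  then obtain k where k: "m = Suc k" by (cases m) auto
  have "\<exists>b\<in>carrier R. a = x [^] k \<otimes> b"
    using not_less_Least[of k "\<lambda>n::nat. \<not> (\<exists>b\<in>carrier R. a = x [^] n \<otimes> b)"] k unfolding m_def[symmetric] by auto
  then obtain b where b: "b \<in> carrier R" "a = x [^] k \<otimes> b" by blast
  have "b \<in> Units R"
  proof (rule ccontr)
    assume "b \<notin> Units R"
    then obtain c where "c \<in> carrier R" "b = x \<otimes> c" using local b by blast
    then have "c \<in> carrier R" "a = x [^] m \<otimes> c" using b x k by (auto simp: m_assoc)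
    then show False using m by blast
  qed
  then show ?thesis using b by blast
qed

end

lemma padic_int_simps:
  "a \<in> carrier (padic_int p) \<longleftrightarrow> (\<forall>n. 0 \<le> a n \<and> a n < int p ^ n \<and> a (Suc n) mod int p ^ n = a n)"
  "a \<otimes>\<^bsub>padic_int p\<^esub> b = (\<lambda>n. (a n * b n) mod int p ^ n)"
  "\<one>\<^bsub>padic_int p\<^esub> = (\<lambda>n. 1 mod int p ^ n)"
  "\<zero>\<^bsub>padic_int p\<^esub> = (\<lambda>n. 0)"
  "a \<oplus>\<^bsub>padic_int p\<^esub> b = (\<lambda>n. (a n + b n) mod int p ^ n)"
  by (simp_all add: padic_int_def)

lemma padic_int_mod: "a \<in> carrier (padic_int p) \<Longrightarrow> a n mod int p ^ n = a n"
  by (simp add: padic_int_simps)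

lemma padic_int_mod_le:
  assumes "a \<in> carrier (padic_int p)" "n \<le> m"
  shows "a m mod int p ^ n = a n"
  using assms(2)
proof (induction m rule: dec_induct)
  case base
  then show ?case using assms padic_int_mod by blast
next
  case (step m)
  have "a (Suc m) mod int p ^ n = (a (Suc m) mod int p ^ m) mod int p ^ n"
    using step by (simp add: mod_mod_cancel le_imp_power_dvd)
  also have "a (Suc m) mod int p ^ m = a m" using assms(1) by (simp add: padic_int_simps)
  finally show ?case using step by simp
qed

lemma padic_intI:
  assumes "p > 0" "\<And>n. f (Suc n) mod int p ^ n = f n mod int p ^ n"
  shows "(\<lambda>n. f n mod int p ^ n) \<in> carrier (padic_int p)"
  using assms by (simp add: padic_int_simps mod_mod_cancel)

lemma cring_padic_int:
  assumes "p > 0"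
  shows "cring (padic_int p)"
proof -
  have cl: "(\<lambda>n. (f n) mod int p ^ n) \<in> carrier (padic_int p)"
    if "\<And>n. f (Suc n) mod int p ^ n = f n mod int p ^ n" for f
    by (rule padic_intI[OF assms that])
  show ?thesis
  proof (intro cringI abelian_groupI comm_monoidI)
    fix a b assume a: "a \<in> carrier (padic_int p)" and b: "b \<in> carrier (padic_int p)"
    show "a \<oplus>\<^bsub>padic_int p\<^esub> b \<in> carrier (padic_int p)"
      unfolding padic_int_simps(5) using a b
      by (intro cl) (metis mod_add_eq padic_int_mod padic_int_mod_le lessI less_imp_le_nat)
    show "a \<otimes>\<^bsub>padic_int p\<^esub> b \<in> carrier (padic_int p)"
      unfolding padic_int_simps(2) using a b
      by (intro cl) (metis mod_mult_eq padic_int_mod padic_int_mod_le lessI less_imp_le_nat)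
    show "a \<oplus>\<^bsub>padic_int p\<^esub> b = b \<oplus>\<^bsub>padic_int p\<^esub> a" "a \<otimes>\<^bsub>padic_int p\<^esub> b = b \<otimes>\<^bsub>padic_int p\<^esub> a"
      by (simp_all add: padic_int_simps add.commute mult.commute)
  next
    fix a assume a: "a \<in> carrier (padic_int p)"
    show "\<zero>\<^bsub>padic_int p\<^esub> \<oplus>\<^bsub>padic_int p\<^esub> a = a" "\<one>\<^bsub>padic_int p\<^esub> \<otimes>\<^bsub>padic_int p\<^esub> a = a"
      using padic_int_mod[OF a] by (simp_all add: padic_int_simps mod_mult_left_eq)
    have "(\<lambda>n. (- a n) mod int p ^ n) \<in> carrier (padic_int p)"
      using a by (intro cl) (metis mod_minus_eq padic_int_mod padic_int_mod_le lessI less_imp_le_nat)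
    then show "\<exists>y\<in>carrier (padic_int p). y \<oplus>\<^bsub>padic_int p\<^esub> a = \<zero>\<^bsub>padic_int p\<^esub>"
      by (intro bexI[of _ "\<lambda>n. (- a n) mod int p ^ n"]) (simp_all add: padic_int_simps mod_add_left_eq)
  next
    show "\<one>\<^bsub>padic_int p\<^esub> \<in> carrier (padic_int p)"
      unfolding padic_int_simps(3) by (intro cl) auto
    show "\<zero>\<^bsub>padic_int p\<^esub> \<in> carrier (padic_int p)" using assms by (simp add: padic_int_simps)
  qed (simp_all add: padic_int_simps mod_simps algebra_simps)
qed

text \<open>A nonzero element is a power of \<open>x\<close> times a unit, and both factors can be
  cancelled.\<close>

lemma domain_of_adic:
  assumes "cring R" "x \<in> carrier R" "\<And>a. a \<in> carrier R \<Longrightarrow> a \<in> Units R \<or> (\<exists>b\<in>carrier R. a = x \<otimes>\<^bsub>R\<^esub> b)"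
    and "adic_separated R x" "\<one>\<^bsub>R\<^esub> \<noteq> \<zero>\<^bsub>R\<^esub>"
    and tf: "\<And>b. b \<in> carrier R \<Longrightarrow> x \<otimes>\<^bsub>R\<^esub> b = \<zero>\<^bsub>R\<^esub> \<Longrightarrow> b = \<zero>\<^bsub>R\<^esub>"
  shows "domain R"
proof -
  interpret cring R by fact
  have tfk: "b = \<zero>\<^bsub>R\<^esub>" if "b \<in> carrier R" "x [^]\<^bsub>R\<^esub> k \<otimes>\<^bsub>R\<^esub> b = \<zero>\<^bsub>R\<^esub>" for b and k :: nat
    using that by (induction k arbitrary: b) (auto simp: m_assoc assms(2) intro: tf)
  show ?thesis
  proof (intro domainI assms)
    fix a b assume ab: "a \<otimes>\<^bsub>R\<^esub> b = \<zero>\<^bsub>R\<^esub>" "a \<in> carrier R" "b \<in> carrier R"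
    show "a = \<zero>\<^bsub>R\<^esub> \<or> b = \<zero>\<^bsub>R\<^esub>"
    proof (cases "a = \<zero>\<^bsub>R\<^esub>")
      case False
      then obtain k u where u: "u \<in> Units R" "a = x [^]\<^bsub>R\<^esub> (k::nat) \<otimes>\<^bsub>R\<^esub> u"
        using adic_factor[OF assms(2,3,4) ab(2)] by blast
      then have "x [^]\<^bsub>R\<^esub> k \<otimes>\<^bsub>R\<^esub> (u \<otimes>\<^bsub>R\<^esub> b) = \<zero>\<^bsub>R\<^esub>" using ab assms(2) by (simp add: m_assoc Units_closed)
      then have "u \<otimes>\<^bsub>R\<^esub> b = \<zero>\<^bsub>R\<^esub>" using tfk u ab by auto
      then show ?thesis
        using u ab by (metis Units_inv_closed Units_l_inv Units_closed l_one m_assoc r_null)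
    qed simp
  qed
qed

abbreviation nat_elem :: "('a, 'm) ring_scheme \<Rightarrow> nat \<Rightarrow> 'a" where
  "nat_elem R k \<equiv> [k] \<cdot>\<^bsub>R\<^esub> \<one>\<^bsub>R\<^esub>"

locale padic =
  fixes p :: nat
  assumes prime: "Factorial_Ring.prime p"
begin

abbreviation "Z \<equiv> padic_int p"
abbreviation "pz \<equiv> nat_elem Z p"

lemma p_pos: "p > 0" "int p > 0" "int p > 1"
  using prime prime_gt_0_nat prime_gt_1_nat by auto

sublocale Z: cring "padic_int p"
  by (rule cring_padic_int[OF p_pos(1)])

lemma nat_elem_nth: "nat_elem Z k = (\<lambda>n. int k mod int p ^ n)"
proof (induction k)
  case 0
  then show ?case by (simp add: padic_int_simps)
next
  case (Suc k)
  then show ?case by (simp add: padic_int_simps mod_simps algebra_simps)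
qed

lemma pz_closed [simp]: "pz \<in> carrier Z"
  by simp

lemma pz_pow_nth: "pz [^]\<^bsub>Z\<^esub> (k::nat) = (\<lambda>n. int p ^ k mod int p ^ n)"
proof (induction k)
  case 0
  then show ?case by (simp add: padic_int_simps)
next
  case (Suc k)
  then show ?case by (simp add: nat_elem_nth) (simp add: padic_int_simps mod_simps algebra_simps)
qed

lemma pz_pow_mult_nth: "(pz [^]\<^bsub>Z\<^esub> (k::nat) \<otimes>\<^bsub>Z\<^esub> a) n = int p ^ k * a n mod int p ^ n"
  by (simp add: pz_pow_nth) (simp add: padic_int_simps mod_simps)

lemma pz_mult_nth: "(pz \<otimes>\<^bsub>Z\<^esub> a) n = int p * a n mod int p ^ n"
  using pz_pow_mult_nth[of 1 a n] by simp

lemma divisible: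
  assumes a: "a \<in> carrier Z" "a m = 0"
  shows "\<exists>b\<in>carrier Z. a = pz [^]\<^bsub>Z\<^esub> m \<otimes>\<^bsub>Z\<^esub> b"
proof -
  \<comment> \<open>The index is shifted because dividing by \<open>p^m\<close> costs
    \<open>m\<close> digits: the quotient modulo \<open>p^n\<close> is determined by
    \<open>a\<close> modulo \<open>p^(n + m)\<close>.\<close>
  define b where "b n = a (n + m) div int p ^ m" for n
  have d: "a (n + m) = int p ^ m * b n" for n
    using padic_int_mod_le[OF a(1), of m "n + m"] a(2) by (simp add: b_def mod_eq_0_iff_dvd)
  have "b \<in> carrier Z"
    unfolding padic_int_simps(1)
  proof (intro allI conjI)
    fix n
    have q: "int p ^ m > 0" using p_pos by simp
    have "0 \<le> a (n + m)" "a (n + m) < int p ^ (m + n)"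
      using a(1) by (auto simp: padic_int_simps add.commute[of m n])
    then have 1: "0 \<le> int p ^ m * b n" "int p ^ m * b n < int p ^ m * int p ^ n"
      unfolding d power_add by auto
    show "0 \<le> b n" using 1(1) q by (simp only: zero_le_mult_iff) linarith
    show "b n < int p ^ n" by (rule mult_less_cancel_left_pos[OF q, THEN iffD1, OF 1(2)])
    have "int p ^ m * (b (Suc n) mod int p ^ n) = (int p ^ m * b (Suc n)) mod (int p ^ m * int p ^ n)"
      by (rule mult_mod_right)
    also have "\<dots> = a (Suc (n + m)) mod int p ^ (m + n)" using d[of "Suc n"] by (simp only: power_add add_Suc)
    also have "\<dots> = a (n + m)" using a(1) by (simp add: padic_int_simps add.commute[of m n])
    also have "\<dots> = int p ^ m * b n" by (rule d)
    finally show "b (Suc n) mod int p ^ n = b n" using p_pos by simp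
  qed
  moreover have "a n = int p ^ m * b n mod int p ^ n" for n
    using padic_int_mod_le[OF a(1), of n "n + m"] d[of n] by simp
  then have "a = pz [^]\<^bsub>Z\<^esub> m \<otimes>\<^bsub>Z\<^esub> b" by (intro ext) (simp add: pz_pow_mult_nth)
  ultimately show ?thesis by blast
qed

lemma unit_of_nth:
  assumes a: "a \<in> carrier Z" "a 1 \<noteq> 0"
  shows "a \<in> Units Z"
proof -
  have cop: "coprime (a n) (int p ^ n)" for n
  proof (cases n)
    case (Suc k)
    have "a n mod int p = a 1" using padic_int_mod_le[OF a(1), of 1 n] Suc by simp
    then have "\<not> int p dvd a n" using a(2) by auto
    then have "coprime (int p) (a n)" using prime by (intro prime_imp_coprime) auto
    then show ?thesis by (simp add: ac_simps)
  qed simp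
  \<comment> \<open>A Bezout coefficient inverts \<open>a n\<close> modulo \<open>p^n\<close>. These
    inverses are chosen independently for each \<open>n\<close>, so their compatibility has to be
    proved.\<close>
  define b where "b n = fst (bezout_coefficients (a n) (int p ^ n))" for n
  have ab: "int p ^ n dvd a n * b n - 1" for n
  proof -
    have "b n * a n + snd (bezout_coefficients (a n) (int p ^ n)) * int p ^ n = gcd (a n) (int p ^ n)"
      unfolding b_def by (rule bezout_coefficients_fst_snd)
    then have "b n * a n + snd (bezout_coefficients (a n) (int p ^ n)) * int p ^ n = 1"
      using cop[of n] by simp
    then have "a n * b n - 1 = int p ^ n * (- snd (bezout_coefficients (a n) (int p ^ n)))"
      by (simp add: algebra_simps)
    then show ?thesis by simp
  qed
  have bc: "(\<lambda>n. b n mod int p ^ n) \<in> carrier Z"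
  proof (rule padic_intI[OF p_pos(1)])
    fix n
    have "int p ^ n dvd a (Suc n) - a n"
      using padic_int_mod_le[OF a(1), of n "Suc n"] padic_int_mod[OF a(1), of n]
      by (metis le_add2 mod_eq_dvd_iff plus_1_eq_Suc)
    then have 1: "int p ^ n dvd (a (Suc n) - a n) * b (Suc n)" by simp
    have "int p ^ n dvd int p ^ Suc n" by simp
    then have 2: "int p ^ n dvd a (Suc n) * b (Suc n) - 1" using ab[of "Suc n"] dvd_trans by blast
    \<comment> \<open>Modulo \<open>p^n\<close> both \<open>b (Suc n)\<close> and \<open>b n\<close>
      invert \<open>a n\<close>, and inverses are unique.\<close>
    have "a n * (b (Suc n) - b n) = (a (Suc n) * b (Suc n) - 1) - (a n * b n - 1) - (a (Suc n) - a n) * b (Suc n)"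
      by (simp add: algebra_simps)
    then have "int p ^ n dvd a n * (b (Suc n) - b n)" using 1 2 ab[of n] by (metis dvd_diff)
    then have "int p ^ n dvd b (Suc n) - b n"
      using cop[of n] by (simp add: coprime_dvd_mult_right_iff coprime_commute)
    then show "b (Suc n) mod int p ^ n = b n mod int p ^ n" by (simp add: mod_eq_dvd_iff)
  qed
  moreover have "a \<otimes>\<^bsub>Z\<^esub> (\<lambda>n. b n mod int p ^ n) = \<one>\<^bsub>Z\<^esub>"
    using ab by (auto simp: padic_int_simps mod_simps mod_eq_dvd_iff)
  ultimately show ?thesis using a(1) Z.m_comm[OF a(1) bc] unfolding Units_def by auto
qed

lemma local: "a \<in> carrier Z \<Longrightarrow> a \<in> Units Z \<or> (\<exists>b\<in>carrier Z. a = pz \<otimes>\<^bsub>Z\<^esub> b)"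
  using unit_of_nth[of a] divisible[of a 1] by auto

lemma separated: "adic_separated Z pz"
  unfolding adic_separated_def
proof (intro ballI impI)
  fix a assume "\<forall>n::nat. \<exists>b\<in>carrier Z. a = pz [^]\<^bsub>Z\<^esub> n \<otimes>\<^bsub>Z\<^esub> b"
  then have "a n = 0" for n using pz_pow_mult_nth[of n _ n] by (metis mod_mult_self1_is_0)
  then show "a = \<zero>\<^bsub>Z\<^esub>" by (auto simp: padic_int_simps)
qed

lemma finsum_nth:
  assumes "finite I" "f \<in> I \<rightarrow> carrier Z"
  shows "(\<Oplus>\<^bsub>Z\<^esub>i\<in>I. f i) n = (\<Sum>i\<in>I. f i n) mod int p ^ n"
  using assms
proof (induction I)
  case empty
  then show ?case by (simp add: padic_int_simps)
next
  case (insert i I)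
  then show ?case by (simp add: Z.finsum_insert Pi_iff) (simp add: padic_int_simps mod_simps)
qed

lemma minus_nth:
  assumes "a \<in> carrier Z" "b \<in> carrier Z"
  shows "(a \<ominus>\<^bsub>Z\<^esub> b) n = (a n - b n) mod int p ^ n"
proof -
  have "((a \<ominus>\<^bsub>Z\<^esub> b) \<oplus>\<^bsub>Z\<^esub> b) n = a n" using assms by (simp add: Z.minus_eq Z.a_assoc Z.l_neg)
  then have "((a \<ominus>\<^bsub>Z\<^esub> b) n + b n) mod int p ^ n = a n" by (simp add: padic_int_simps)
  then have "(a n - b n) mod int p ^ n = (a \<ominus>\<^bsub>Z\<^esub> b) n mod int p ^ n" by (metis add_diff_cancel_right' mod_diff_left_eq)
  then show ?thesis using padic_int_mod[of "a \<ominus>\<^bsub>Z\<^esub> b" p n] assms by simp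
qed

lemma complete: "adic_complete Z pz"
  unfolding adic_complete_def
proof (intro ballI)
  fix s assume "s \<in> (UNIV :: nat set) \<rightarrow> carrier Z"
  then have s: "s k \<in> carrier Z" for k by auto
  \<comment> \<open>At level \<open>n\<close> the series stops before \<open>k = n\<close>, since
    all further terms are divisible by \<open>p^n\<close>.\<close>
  define f where "f n = (\<Sum>k<n. int p ^ k * s k n)" for n
  define l where "l n = f n mod int p ^ n" for n
  have "l \<in> carrier Z"
    unfolding l_def
  proof (rule padic_intI[OF p_pos(1)])
    fix n
    have "(int p ^ k * s k (Suc n)) mod int p ^ n = (int p ^ k * s k n) mod int p ^ n" for k
      using padic_int_mod_le[OF s, of n "Suc n" k] padic_int_mod[OF s, of k n] by (metis le_add2 mod_mult_right_eq plus_1_eq_Suc)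
    then have "(\<Sum>k<n. int p ^ k * s k (Suc n)) mod int p ^ n = (\<Sum>k<n. int p ^ k * s k n) mod int p ^ n"
      by (subst (1 2) mod_sum_eq[symmetric]) simp
    then show "f (Suc n) mod int p ^ n = f n mod int p ^ n" by (simp add: f_def)
  qed
  moreover have "\<exists>t\<in>carrier Z. l = (\<Oplus>\<^bsub>Z\<^esub>k\<in>{..<n}. pz [^]\<^bsub>Z\<^esub> k \<otimes>\<^bsub>Z\<^esub> s k) \<oplus>\<^bsub>Z\<^esub> pz [^]\<^bsub>Z\<^esub> n \<otimes>\<^bsub>Z\<^esub> t" for n
  proof -
    let ?S = "\<Oplus>\<^bsub>Z\<^esub>k\<in>{..<n}. pz [^]\<^bsub>Z\<^esub> k \<otimes>\<^bsub>Z\<^esub> s k"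
    have S: "?S \<in> carrier Z" using s by (intro Z.finsum_closed) auto
    have "?S n = f n mod int p ^ n"
    proof -
      have "?S n = (\<Sum>k<n. (pz [^]\<^bsub>Z\<^esub> k \<otimes>\<^bsub>Z\<^esub> s k) n) mod int p ^ n" using s by (intro finsum_nth) auto
      then show ?thesis by (simp only: pz_pow_mult_nth f_def mod_sum_eq)
    qed
    then have "(l \<ominus>\<^bsub>Z\<^esub> ?S) n = 0" unfolding minus_nth[OF \<open>l \<in> carrier Z\<close> S] by (simp add: l_def)
    then obtain t where t: "t \<in> carrier Z" "l \<ominus>\<^bsub>Z\<^esub> ?S = pz [^]\<^bsub>Z\<^esub> n \<otimes>\<^bsub>Z\<^esub> t"
      using divisible[OF Z.minus_closed[OF \<open>l \<in> carrier Z\<close> S]] by blast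
    have "l = ?S \<oplus>\<^bsub>Z\<^esub> (l \<ominus>\<^bsub>Z\<^esub> ?S)" by (rule Z.eq_add_diff[OF \<open>l \<in> carrier Z\<close> S])
    then show ?thesis unfolding t(2) using t(1) by blast
  qed
  ultimately show "\<exists>l\<in>carrier Z. \<forall>n. \<exists>t\<in>carrier Z.
      l = (\<Oplus>\<^bsub>Z\<^esub>k\<in>{..<n}. pz [^]\<^bsub>Z\<^esub> k \<otimes>\<^bsub>Z\<^esub> s k) \<oplus>\<^bsub>Z\<^esub> pz [^]\<^bsub>Z\<^esub> n \<otimes>\<^bsub>Z\<^esub> t" by blast
qed

lemma pz_cancel:
  assumes "b \<in> carrier Z" "pz \<otimes>\<^bsub>Z\<^esub> b = \<zero>\<^bsub>Z\<^esub>"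
  shows "b = \<zero>\<^bsub>Z\<^esub>"
proof -
  have "b n = 0" for n
  proof -
    \<comment> \<open>The level \<open>Suc n\<close> is inspected because multiplication by
      \<open>p\<close> loses one digit: it yields \<open>b (Suc n)\<close> only modulo
      \<open>p^n\<close>, which is exactly what determines \<open>b n\<close>.\<close>
    have "int p * b (Suc n) mod int p ^ Suc n = 0"
      unfolding pz_mult_nth[symmetric] assms(2) by (simp add: padic_int_simps)
    then have "int p ^ n dvd b (Suc n)" using p_pos(1) by (simp only: mod_eq_0_iff_dvd) simp
    then show ?thesis using padic_int_mod_le[OF assms(1), of n "Suc n"] by simp
  qed
  then show ?thesis by (auto simp: padic_int_simps)
qed

lemma Z_one_not_zero: "\<one>\<^bsub>Z\<^esub> \<noteq> \<zero>\<^bsub>Z\<^esub>"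
proof
  assume "\<one>\<^bsub>Z\<^esub> = \<zero>\<^bsub>Z\<^esub>"
  then have "\<one>\<^bsub>Z\<^esub> 1 = \<zero>\<^bsub>Z\<^esub> 1" by simp
  then show False using p_pos by (simp add: padic_int_simps)
qed

sublocale Z: domain "padic_int p"
  using domain_of_adic[OF Z.is_cring pz_closed local separated Z_one_not_zero pz_cancel] .

lemma nat_elem_unit: "\<not> p dvd k \<Longrightarrow> nat_elem Z k \<in> Units Z"
  by (rule unit_of_nth) (simp, simp add: nat_elem_nth mod_eq_0_iff_dvd)

lemma pz_not_unit: "pz \<notin> Units Z"
proof
  assume "pz \<in> Units Z"
  then obtain b where "b \<in> carrier Z" "pz \<otimes>\<^bsub>Z\<^esub> b = \<one>\<^bsub>Z\<^esub>" by (auto simp: Units_def)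
  then have "int p * b 1 mod int p ^ 1 = 1 mod int p ^ 1"
    unfolding pz_mult_nth[symmetric] by (simp add: padic_int_simps)
  then show False using p_pos by simp
qed

lemma factor: "a \<in> carrier Z \<Longrightarrow> a \<noteq> \<zero>\<^bsub>Z\<^esub> \<Longrightarrow> \<exists>k u. u \<in> Units Z \<and> a = pz [^]\<^bsub>Z\<^esub> (k::nat) \<otimes>\<^bsub>Z\<^esub> u"
  by (rule Z.adic_factor[OF pz_closed local separated])

end

section \<open>Integer polynomials, their induction principle and their evaluation\<close>

definition class_ring :: "'a::comm_ring_1 ring" where
  "class_ring = \<lparr>carrier = UNIV, monoid.mult = (*), one = 1, ring.zero = 0, add = (+)\<rparr>"

lemma class_ring_simps [simp]:
  "carrier class_ring = UNIV" "x \<otimes>\<^bsub>class_ring\<^esub> y = x * y" "\<one>\<^bsub>class_ring\<^esub> = 1"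
  "\<zero>\<^bsub>class_ring\<^esub> = 0" "x \<oplus>\<^bsub>class_ring\<^esub> y = x + y"
  by (simp_all add: class_ring_def)

lemma cring_class_ring: "cring class_ring"
  by (intro cringI abelian_groupI comm_monoidI)
     (auto simp: algebra_simps intro: exI[of _ "- x" for x])

text \<open>The variable for an arbitrary index type. Besides the index type of
  \<open>witt_var\<close>, ring elements serve as indices (for presenting a ring as a quotient of a
  polynomial ring) and booleans (for identities in two variables).\<close>

definition mvar :: "'v \<Rightarrow> (('v \<Rightarrow>\<^sub>0 nat) \<Rightarrow>\<^sub>0 int)" where
  "mvar v = Poly_Mapping.single (Poly_Mapping.single v 1) 1"

lemma witt_var_eq: "witt_var = mvar"
  by (auto simp: witt_var_def mvar_def)

lemma poly_mapping_add_induct [case_names zero single add]: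
  assumes "P 0" "\<And>a b. P (Poly_Mapping.single a b)" "\<And>f g. P f \<Longrightarrow> P g \<Longrightarrow> P (f + g)"
  shows "P (f :: 'a \<Rightarrow>\<^sub>0 'b::comm_monoid_add)"
proof (induction f rule: update_induct)
  case const
  then show ?case using assms by simp
next
  case (update f a b)
  have "Poly_Mapping.update a b f = f + Poly_Mapping.single a b"
    using update(1) by (intro poly_mapping_eqI) (auto simp: lookup_update lookup_add lookup_single when_def in_keys_iff)
  then show ?case using assms update by simp
qed

text \<open>A polynomial ring over the integers is generated as a ring by the variables and
  \<open>-1\<close>. Starting from \<open>-1\<close> instead of \<open>1\<close> makes closure under
  differences automatic.\<close>

lemma mpoly_ring_induct [case_names uminus_one var add mult]:
  assumes m1: "P (-1)" and v: "\<And>v. P (mvar v)" and add: "\<And>f g. P f \<Longrightarrow> P g \<Longrightarrow> P (f + g)"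
    and mult: "\<And>f g. P f \<Longrightarrow> P g \<Longrightarrow> P (f * g)"
  shows "P (f :: ('v \<Rightarrow>\<^sub>0 nat) \<Rightarrow>\<^sub>0 int)"
proof -
  have 1: "P 1" using mult[OF m1 m1] by simp
  have 0: "P 0" using add[OF m1 1] by simp
  have n: "P (of_nat k)" for k using 0 1 add by (induction k) auto
  have i: "P (of_int k)" for k :: int
  proof (cases "k \<ge> 0")
    case True
    then show ?thesis using n[of "nat k"] by (metis of_int_of_nat_eq nat_0_le)
  next
    case False
    then have e: "of_int k = (-1) * of_nat (nat (- k))" by simp
    show ?thesis by (subst e) (rule mult[OF m1 n])
  qed
  have vp: "P (Poly_Mapping.single (Poly_Mapping.single v k) 1)" for v and k :: nat
  proof (induction k)
    case 0
    then show ?case using 1 by simp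
  next
    case (Suc k)
    have "Poly_Mapping.single (Poly_Mapping.single v (Suc k)) 1
        = Poly_Mapping.single (Poly_Mapping.single v k) (1::int) * mvar v"
      by (simp add: mvar_def mult_single flip: single_add)
    then show ?case using mult Suc v by simp
  qed
  have m: "P (Poly_Mapping.single m 1)" for m :: "'v \<Rightarrow>\<^sub>0 nat"
  proof (induction m rule: poly_mapping_add_induct)
    case (add f g)
    have "Poly_Mapping.single (f + g) (1::int) = Poly_Mapping.single f 1 * Poly_Mapping.single g 1"
      by (simp add: mult_single)
    then show ?case using mult add by simp
  qed (use 1 vp in auto)
  show ?thesis
  proof (induction f rule: poly_mapping_add_induct)
    case (single a b)
    have "Poly_Mapping.single a b = of_int b * Poly_Mapping.single a 1"
      by (simp add: mult_single flip: single_of_int)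
    then show ?case using mult i m by simp
  qed (use 0 add in auto)
qed

definition mon_eval :: "('a, 'm) ring_scheme \<Rightarrow> ('v \<Rightarrow> 'a) \<Rightarrow> ('v \<Rightarrow>\<^sub>0 nat) \<Rightarrow> 'a" where
  "mon_eval R \<nu> m = (\<Otimes>\<^bsub>R\<^esub>v\<in>Poly_Mapping.keys m. \<nu> v [^]\<^bsub>R\<^esub> Poly_Mapping.lookup m v)"

context cring
begin

lemma mon_eval_closed [simp]: "(\<And>v. \<nu> v \<in> carrier R) \<Longrightarrow> mon_eval R \<nu> m \<in> carrier R"
  unfolding mon_eval_def by (intro finprod_closed) auto

lemma mon_eval_superset:
  assumes "\<And>v. \<nu> v \<in> carrier R" "finite F" "Poly_Mapping.keys m \<subseteq> F"
  shows "mon_eval R \<nu> m = (\<Otimes>v\<in>F. \<nu> v [^] Poly_Mapping.lookup m v)"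
  unfolding mon_eval_def using assms
  by (intro finprod_mono_neutral_cong_left) (auto simp: in_keys_iff)

lemma mon_eval_add:
  assumes \<nu>: "\<And>v. \<nu> v \<in> carrier R"
  shows "mon_eval R \<nu> (m + m') = mon_eval R \<nu> m \<otimes> mon_eval R \<nu> m'"
proof -
  let ?F = "Poly_Mapping.keys m \<union> Poly_Mapping.keys m'"
  have "mon_eval R \<nu> (m + m') = (\<Otimes>v\<in>?F. \<nu> v [^] Poly_Mapping.lookup (m + m') v)"
    using \<nu> Poly_Mapping.keys_add[of m m'] by (intro mon_eval_superset) auto
  also have "\<dots> = (\<Otimes>v\<in>?F. \<nu> v [^] Poly_Mapping.lookup m v \<otimes> \<nu> v [^] Poly_Mapping.lookup m' v)"
    using \<nu> by (intro finprod_cong') (auto simp: lookup_add nat_pow_mult)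
  also have "\<dots> = (\<Otimes>v\<in>?F. \<nu> v [^] Poly_Mapping.lookup m v) \<otimes> (\<Otimes>v\<in>?F. \<nu> v [^] Poly_Mapping.lookup m' v)"
    using \<nu> by (intro finprod_multf) auto
  finally show ?thesis using mon_eval_superset[OF \<nu>, of ?F] by simp
qed

lemma mpoly_eval_superset:
  assumes "\<And>v. \<nu> v \<in> carrier R" "finite F" "Poly_Mapping.keys q \<subseteq> F"
  shows "mpoly_eval R \<nu> q = (\<Oplus>m\<in>F. [Poly_Mapping.lookup q m] \<cdot> mon_eval R \<nu> m)"
  unfolding mpoly_eval_def mon_eval_def[symmetric] using assms
  by (intro add.finprod_mono_neutral_cong_left) (auto simp: in_keys_iff add_pow_int_ge)

lemma mpoly_eval_closed [simp]: "(\<And>v. \<nu> v \<in> carrier R) \<Longrightarrow> mpoly_eval R \<nu> q \<in> carrier R"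
  unfolding mpoly_eval_def mon_eval_def[symmetric] by (intro finsum_closed) auto

lemma mpoly_eval_add:
  assumes \<nu>: "\<And>v. \<nu> v \<in> carrier R"
  shows "mpoly_eval R \<nu> (q + r) = mpoly_eval R \<nu> q \<oplus> mpoly_eval R \<nu> r"
proof -
  let ?F = "Poly_Mapping.keys q \<union> Poly_Mapping.keys r"
  have "mpoly_eval R \<nu> (q + r) = (\<Oplus>m\<in>?F. [Poly_Mapping.lookup (q + r) m] \<cdot> mon_eval R \<nu> m)"
    using \<nu> Poly_Mapping.keys_add[of q r] by (intro mpoly_eval_superset) auto
  also have "\<dots> = (\<Oplus>m\<in>?F. [Poly_Mapping.lookup q m] \<cdot> mon_eval R \<nu> m \<oplus> [Poly_Mapping.lookup r m] \<cdot> mon_eval R \<nu> m)"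
    using \<nu> by (intro finsum_cong') (auto simp: lookup_add add.int_pow_mult)
  also have "\<dots> = (\<Oplus>m\<in>?F. [Poly_Mapping.lookup q m] \<cdot> mon_eval R \<nu> m) \<oplus> (\<Oplus>m\<in>?F. [Poly_Mapping.lookup r m] \<cdot> mon_eval R \<nu> m)"
    using \<nu> by (intro finsum_addf) auto
  finally show ?thesis using mpoly_eval_superset[OF \<nu>, of ?F] by simp
qed

lemma mpoly_eval_zero [simp]: "mpoly_eval R \<nu> 0 = \<zero>"
  by (simp add: mpoly_eval_def)

lemma mpoly_eval_single:
  assumes \<nu>: "\<And>v. \<nu> v \<in> carrier R"
  shows "mpoly_eval R \<nu> (Poly_Mapping.single m c) = [c] \<cdot> mon_eval R \<nu> m"
proof -
  have "mpoly_eval R \<nu> (Poly_Mapping.single m c) = (\<Oplus>m'\<in>{m}. [Poly_Mapping.lookup (Poly_Mapping.single m c) m'] \<cdot> mon_eval R \<nu> m')"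
    using \<nu> by (intro mpoly_eval_superset) auto
  then show ?thesis using \<nu> by (simp add: finsum_insert)
qed

lemma mpoly_eval_mult:
  assumes \<nu>: "\<And>v. \<nu> v \<in> carrier R"
  shows "mpoly_eval R \<nu> (q * r) = mpoly_eval R \<nu> q \<otimes> mpoly_eval R \<nu> r"
proof (induction q rule: poly_mapping_add_induct)
  case zero
  then show ?case using \<nu> by simp
next
  case (single m c)
  show ?case
  proof (induction r rule: poly_mapping_add_induct)
    case zero
    then show ?case using \<nu> by simp
  next
    case (single m' c')
    have "[(c * c')] \<cdot> (mon_eval R \<nu> m \<otimes> mon_eval R \<nu> m') = [c] \<cdot> mon_eval R \<nu> m \<otimes> [c'] \<cdot> mon_eval R \<nu> m'"
      using \<nu> by (simp add: add_pow_ldistr_int add_pow_rdistr_int add.int_pow_pow mult.commute)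
    then show ?case using \<nu> by (simp add: mult_single mpoly_eval_single mon_eval_add)
  next
    case (add f g)
    then show ?case using \<nu> by (simp add: mpoly_eval_add r_distr distrib_left)
  qed
next
  case (add f g)
  then show ?case using \<nu> by (simp add: mpoly_eval_add l_distr distrib_right)
qed

lemma mpoly_eval_one [simp]: "(\<And>v. \<nu> v \<in> carrier R) \<Longrightarrow> mpoly_eval R \<nu> 1 = \<one>"
  using mpoly_eval_single[of \<nu> 0 1] by (simp add: mon_eval_def)

lemma mpoly_eval_var [simp]:
  assumes \<nu>: "\<And>v. \<nu> v \<in> carrier R"
  shows "mpoly_eval R \<nu> (mvar v) = \<nu> v"
  using \<nu> by (simp add: mvar_def mpoly_eval_single mon_eval_def finprod_insert)

lemma mpoly_eval_hom: "(\<And>v. \<nu> v \<in> carrier R) \<Longrightarrow> mpoly_eval R \<nu> \<in> ring_hom class_ring R"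
  by (rule ring_hom_memI) (auto simp: mpoly_eval_add mpoly_eval_mult)

lemma mpoly_eval_uminus_one:
  assumes \<nu>: "\<And>v. \<nu> v \<in> carrier R"
  shows "mpoly_eval R \<nu> (-1) = \<ominus> \<one>"
proof -
  have "mpoly_eval R \<nu> (-1) \<oplus> mpoly_eval R \<nu> 1 = mpoly_eval R \<nu> (-1 + 1)"
    using \<nu> by (rule mpoly_eval_add[symmetric])
  then show ?thesis using \<nu> by (simp add: minus_equality)
qed

text \<open>Substitution followed by evaluation. The inner evaluation takes place in a polynomial
  ring, which \<open>class_ring\<close> presents as a ring record; the identity holds on ring
  generators and passes to sums and products.\<close>

lemma mpoly_eval_class:
  fixes f :: "'w \<Rightarrow> (('v \<Rightarrow>\<^sub>0 nat) \<Rightarrow>\<^sub>0 int)"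
  assumes \<nu>: "\<And>v. \<nu> v \<in> carrier R"
  shows "mpoly_eval R \<nu> (mpoly_eval class_ring f q) = mpoly_eval R (\<lambda>v. mpoly_eval R \<nu> (f v)) q"
proof -
  interpret C: cring "class_ring :: (('v \<Rightarrow>\<^sub>0 nat) \<Rightarrow>\<^sub>0 int) ring" by (rule cring_class_ring)
  show ?thesis
  proof (induction q rule: mpoly_ring_induct)
    case uminus_one
    have "mpoly_eval class_ring f (-1) + 1 = 0"
      using C.mpoly_eval_uminus_one[of f] C.l_neg[of 1] by (simp add: C.l_neg[of 1, simplified])
    then have "mpoly_eval class_ring f (-1) = -1" by (simp add: add_eq_0_iff2)
    then show ?case using \<nu> by (simp add: mpoly_eval_uminus_one)
  next
    case (var v)
    then show ?case using \<nu> by simp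
  next
    case (add q r)
    then show ?case using \<nu> by (simp add: mpoly_eval_add C.mpoly_eval_add)
  next
    case (mult q r)
    then show ?case using \<nu> by (simp add: mpoly_eval_mult C.mpoly_eval_mult)
  qed
qed

lemma mpoly_eval_of_nat:
  assumes \<nu>: "\<And>v. \<nu> v \<in> carrier R"
  shows "mpoly_eval R \<nu> (of_nat k * q) = [k] \<cdot> mpoly_eval R \<nu> q"
  using \<nu> by (induction k) (simp_all add: distrib_right mpoly_eval_add a_comm)

end

section \<open>Ghost components and Dwork's lemma\<close>

text \<open>A prime divides all the inner binomial coefficients.\<close>

lemma freshman:
  fixes x y :: "'r::comm_ring_1"
  assumes "Factorial_Ring.prime p"
  shows "of_nat p dvd (x + y) ^ p - x ^ p - y ^ p"
proof -
  have p0: "p > 0" using assms prime_gt_0_nat by blast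
  have "(x + y) ^ p = (\<Sum>k\<le>p. of_nat (p choose k) * x ^ k * y ^ (p - k))" by (rule binomial_ring)
  also have "{..p} = insert 0 (insert p {0<..<p})" using p0 by auto
  finally have "(x + y) ^ p - x ^ p - y ^ p = (\<Sum>k\<in>{0<..<p}. of_nat (p choose k) * x ^ k * y ^ (p - k))"
    using p0 by (simp add: algebra_simps)
  moreover have "of_nat p dvd (of_nat (p choose k) * x ^ k * y ^ (p - k) :: 'r)" if "k \<in> {0<..<p}" for k
  proof -
    have "p dvd (p choose k)" using that assms by (intro dvd_choose_prime) auto
    then have "(of_nat p :: 'r) dvd of_nat (p choose k)" by (metis dvdE dvd_triv_left of_nat_mult)
    then show ?thesis by (simp add: dvd_mult2)
  qed
  ultimately show ?thesis by (simp only:) (rule dvd_sum)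
qed

text \<open>Each \<open>p\<close>-th power gains one factor \<open>p\<close>: in
  \<open>a^p - b^p = (a - b) (\<Sum> b^(p-1-i) a^i)\<close> the sum has \<open>p\<close> terms, all
  congruent to \<open>b^(p-1)\<close> modulo \<open>p\<close>.\<close>

lemma dvd_power_diff:
  fixes x y :: "'r::comm_ring_1"
  assumes "k \<ge> 1" "of_nat p ^ k dvd x - y"
  shows "of_nat p ^ (k + j) dvd x ^ (p ^ j) - y ^ (p ^ j)"
proof (induction j)
  case 0
  then show ?case using assms by simp
next
  case (Suc j)
  define a b where "a = x ^ (p ^ j)" and "b = y ^ (p ^ j)"
  have d: "of_nat p ^ (k + j) dvd a - b" using Suc by (simp add: a_def b_def)
  have "(of_nat p :: 'r) dvd of_nat p ^ (k + j)" using assms(1) by (intro dvd_power) auto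
  then have d1: "of_nat p dvd a - b" using d dvd_trans by blast
  have "of_nat p dvd (\<Sum>i<p. b ^ (p - Suc i) * a ^ i)"
  proof -
    have 1: "of_nat p dvd b ^ (p - Suc i) * a ^ i - b ^ (p - 1)" if "i < p" for i
    proof -
      have e: "b ^ (p - 1) = b ^ (p - Suc i) * b ^ i" using that by (simp flip: power_add)
      have "of_nat p dvd a ^ i - b ^ i" using d1 by (simp add: power_diff_sumr2)
      then have "of_nat p dvd b ^ (p - Suc i) * (a ^ i - b ^ i)" by simp
      then show ?thesis unfolding e by (simp add: algebra_simps)
    qed
    have "(\<Sum>i<p. b ^ (p - Suc i) * a ^ i) = (\<Sum>i<p. b ^ (p - Suc i) * a ^ i - b ^ (p - 1)) + of_nat p * b ^ (p - 1)"
      by (simp add: sum_subtractf)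
    moreover have "of_nat p dvd (\<Sum>i<p. b ^ (p - Suc i) * a ^ i - b ^ (p - 1))" using 1 by (intro dvd_sum) auto
    ultimately show ?thesis by simp
  qed
  then have "of_nat p ^ (k + j) * of_nat p dvd (a - b) * (\<Sum>i<p. b ^ (p - Suc i) * a ^ i)"
    using d by (intro mult_dvd_mono)
  then have "of_nat p ^ (k + Suc j) dvd a ^ p - b ^ p" by (simp add: power_diff_sumr2 mult.commute)
  then show ?case by (simp add: a_def b_def mult.commute flip: power_mult)
qed

text \<open>In the \<open>i\<close>-th summand the powers contribute \<open>p^(1 + n - i)\<close>
  and the coefficient contributes \<open>p^i\<close>, in total \<open>p^(n + 1)\<close>
  independently of \<open>i\<close>.\<close>

lemma ghost_dvd_diff:
  fixes a b :: "nat \<Rightarrow> 'r::comm_ring_1"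
  assumes "\<And>i. i \<le> n \<Longrightarrow> of_nat p dvd a i - b i"
  shows "of_nat p ^ Suc n dvd ghost_component p n a - ghost_component p n b"
proof -
  have "of_nat p ^ Suc n dvd of_nat p ^ i * a i ^ (p ^ (n - i)) - of_nat p ^ i * b i ^ (p ^ (n - i))" if "i \<le> n" for i
  proof -
    have "of_nat p ^ (1 + (n - i)) dvd a i ^ (p ^ (n - i)) - b i ^ (p ^ (n - i))"
      using assms[OF that] by (intro dvd_power_diff) auto
    then have "of_nat p ^ i * of_nat p ^ (1 + (n - i)) dvd of_nat p ^ i * (a i ^ (p ^ (n - i)) - b i ^ (p ^ (n - i)))"
      by (intro mult_dvd_mono) auto
    moreover have "(of_nat p ^ i * of_nat p ^ (1 + (n - i)) :: 'r) = of_nat p ^ Suc n"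
      using that by (simp flip: power_add power_Suc)
    ultimately show ?thesis by (simp add: right_diff_distrib)
  qed
  then show ?thesis unfolding ghost_component_def sum_subtractf[symmetric] by (intro dvd_sum) auto
qed

lemma ghost_lessThan:
  "ghost_component p n a = (\<Sum>i<n. of_nat p ^ i * a i ^ (p ^ (n - i))) + of_nat p ^ n * a n"
  by (simp add: ghost_component_def lessThan_Suc_atMost[symmetric])

lemma ghost_0 [simp]: "ghost_component p 0 a = a 0"
  by (simp add: ghost_component_def)

lemma ghost_Suc:
  "ghost_component p (Suc n) a = ghost_component p n (\<lambda>i. a i ^ p) + of_nat p ^ Suc n * a (Suc n)"
proof -
  have "(\<Sum>i<Suc n. of_nat p ^ i * a i ^ (p ^ (Suc n - i))) = ghost_component p n (\<lambda>i. a i ^ p)"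
    unfolding ghost_component_def lessThan_Suc_atMost
    by (intro sum.cong) (auto simp: Suc_diff_le mult.commute simp flip: power_mult)
  then show ?thesis by (simp only: ghost_lessThan[of p "Suc n"])
qed

text \<open>The ghost map is triangular: once the earlier components agree, the last one is
  determined by its term \<open>p^n a n\<close>, and \<open>p\<close> can be cancelled.\<close>

lemma ghost_inj:
  fixes a b :: "nat \<Rightarrow> 'r::comm_ring_1"
  assumes tf: "\<And>x :: 'r. of_nat p * x = 0 \<Longrightarrow> x = 0"
    and eq: "\<And>n. ghost_component p n a = ghost_component p n b"
  shows "a = b"
proof
  have tfn: "x = 0" if "of_nat p ^ n * x = 0" for n and x :: 'r
    using that by (induction n) (auto simp: mult.assoc dest: tf)
  fix n show "a n = b n"
  proof (induction n rule: less_induct)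
    case (less n)
    have "(\<Sum>i<n. of_nat p ^ i * a i ^ (p ^ (n - i))) = (\<Sum>i<n. of_nat p ^ i * b i ^ (p ^ (n - i)))"
      using less by (intro sum.cong) auto
    then have "of_nat p ^ n * (a n - b n) = 0" using eq[of n] by (simp add: ghost_lessThan right_diff_distrib)
    then show ?case using tfn by fastforce
  qed
qed

text \<open>A converse to \<open>ghost_dvd_diff\<close>. It makes congruences between Witt vectors
  modulo \<open>p\<close> accessible through ghost components, and so leads to the formula for
  multiplication by \<open>p\<close> in characteristic \<open>p\<close>.\<close>

lemma dvd_of_ghost_dvd:
  fixes a b :: "nat \<Rightarrow> 'r::comm_ring_1"
  assumes tf: "\<And>x :: 'r. of_nat p * x = 0 \<Longrightarrow> x = 0"
    and eq: "\<And>n. of_nat p ^ Suc n dvd ghost_component p n a - ghost_component p n b"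
  shows "of_nat p dvd a n - b n"
proof (induction n rule: less_induct)
  case (less n)
  have tfn: "x = 0" if "of_nat p ^ n * x = 0" for n and x :: 'r
    using that by (induction n) (auto simp: mult.assoc dest: tf)
  \<comment> \<open>Agrees with \<open>b\<close> below \<open>n\<close> and with \<open>a\<close>
    from \<open>n\<close> on. It is congruent to \<open>a\<close> in all components up to
    \<open>n\<close>, while its ghost component differs from that of \<open>b\<close> only in the
    top term.\<close>
  define b' where "b' = (\<lambda>i. if i < n then b i else a i)"
  have "of_nat p ^ Suc n dvd ghost_component p n a - ghost_component p n b'"
    using less by (intro ghost_dvd_diff) (auto simp: b'_def)
  then have "of_nat p ^ Suc n dvd (ghost_component p n a - ghost_component p n b) - (ghost_component p n a - ghost_component p n b')"
    using eq[of n] by (rule dvd_diff[rotated])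
  moreover have "(\<Sum>i<n. of_nat p ^ i * b' i ^ (p ^ (n - i))) = (\<Sum>i<n. of_nat p ^ i * b i ^ (p ^ (n - i)))"
    by (intro sum.cong) (auto simp: b'_def)
  then have "ghost_component p n b' - ghost_component p n b = of_nat p ^ n * (a n - b n)"
    by (simp add: ghost_lessThan b'_def right_diff_distrib)
  ultimately obtain c where "of_nat p ^ n * (a n - b n) = of_nat p ^ Suc n * c"
    by (auto elim!: dvdE simp: algebra_simps)
  then have "of_nat p ^ n * (a n - b n - of_nat p * c) = 0" by (simp add: algebra_simps)
  then show ?case using tfn by fastforce
qed

text \<open>The setting of Dwork's lemma: a ring without \<open>p\<close>-torsion with an
  endomorphism that lifts the \<open>p\<close>-th power map modulo \<open>p\<close>. In such a ring
  the sequences of ghost components are recognised by congruences.\<close>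

locale frobenius_lift =
  fixes p :: nat and \<psi> :: "'r::comm_ring_1 \<Rightarrow> 'r"
  assumes prime: "Factorial_Ring.prime p"
    and tf: "\<And>x :: 'r. of_nat p * x = 0 \<Longrightarrow> x = 0"
    and psi_add: "\<And>x y. \<psi> (x + y) = \<psi> x + \<psi> y"
    and psi_mult: "\<And>x y. \<psi> (x * y) = \<psi> x * \<psi> y"
    and psi_one: "\<psi> 1 = 1"
    and psi_cong: "\<And>x. of_nat p dvd \<psi> x - x ^ p"
begin

lemma psi_zero: "\<psi> 0 = 0"
  using psi_add[of 0 0] by simp

lemma psi_uminus: "\<psi> (- x) = - \<psi> x"
  using psi_add[of x "- x"] psi_zero by (simp add: eq_neg_iff_add_eq_0 add.commute)

lemma psi_of_nat: "\<psi> (of_nat k) = of_nat k"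
  by (induction k) (simp_all add: psi_zero psi_add psi_one)

lemma psi_power: "\<psi> (x ^ k) = \<psi> x ^ k"
  by (induction k) (simp_all add: psi_mult psi_one)

lemma psi_sum: "finite I \<Longrightarrow> \<psi> (\<Sum>i\<in>I. f i) = (\<Sum>i\<in>I. \<psi> (f i))"
  by (induction I rule: finite_induct) (simp_all add: psi_zero psi_add)

lemma psi_ghost: "\<psi> (ghost_component p n a) = ghost_component p n (\<lambda>i. \<psi> (a i))"
  unfolding ghost_component_def by (simp add: psi_sum psi_mult psi_power psi_of_nat)

text \<open>Necessity of Dwork's congruences. By \<open>ghost_Suc\<close>, the component with index
  \<open>n + 1\<close> is the \<open>n\<close>-th one of the \<open>p\<close>-th powers up to a
  multiple of \<open>p^(n+1)\<close>, and the \<open>p\<close>-th powers are congruent to the values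
  of \<open>\<psi>\<close> modulo \<open>p\<close>.\<close>

lemma ghost_dwork: "of_nat p ^ Suc n dvd ghost_component p (Suc n) a - \<psi> (ghost_component p n a)"
proof -
  have "of_nat p ^ Suc n dvd ghost_component p n (\<lambda>i. a i ^ p) - ghost_component p n (\<lambda>i. \<psi> (a i))"
    using psi_cong by (intro ghost_dvd_diff) (metis dvd_minus_iff minus_diff_eq)
  then have "of_nat p ^ Suc n dvd ghost_component p n (\<lambda>i. a i ^ p) - ghost_component p n (\<lambda>i. \<psi> (a i)) + of_nat p ^ Suc n * a (Suc n)"
    by (intro dvd_add) auto
  then show ?thesis by (simp add: ghost_Suc psi_ghost algebra_simps)
qed

text \<open>Solves the triangular system one component at a time. Whether the required division by
  \<open>p^n\<close> is possible depends on the sequence, hence the choice operator; solvability is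
  established in \<open>dwork\<close>.\<close>

function ghost_inverse :: "(nat \<Rightarrow> 'r) \<Rightarrow> nat \<Rightarrow> 'r" where
  "ghost_inverse x n = (SOME r. x n = (\<Sum>i<n. of_nat p ^ i * ghost_inverse x i ^ (p ^ (n - i))) + of_nat p ^ n * r)"
  by pat_completeness auto
termination by (relation "measure snd") auto

declare ghost_inverse.simps [simp del]

lemma dwork:
  assumes "\<And>n. of_nat p ^ Suc n dvd x (Suc n) - \<psi> (x n)"
  shows "\<exists>a. \<forall>n. ghost_component p n a = x n"
proof -
  let ?a = "ghost_inverse x"
  have eq: "ghost_component p n ?a = x n"
    if ex: "\<exists>r. x n = (\<Sum>i<n. of_nat p ^ i * ?a i ^ (p ^ (n - i))) + of_nat p ^ n * r" for n
    using someI_ex[OF ex] unfolding ghost_lessThan by (subst (2) ghost_inverse.simps) simp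
  have "ghost_component p n ?a = x n" for n
  proof (induction n)
    case 0
    show ?case by (rule eq) (auto intro: exI[of _ "x 0"])
  next
    case (Suc n)
    \<comment> \<open>The terms below \<open>Suc n\<close> are completed to a full ghost component,
      to which \<open>ghost_dwork\<close> applies. The value already chosen at \<open>Suc n\<close>
      is harmless, since it enters only with the factor \<open>p^(n+1)\<close>.\<close>
    have e: "(\<Sum>i<Suc n. of_nat p ^ i * ?a i ^ (p ^ (Suc n - i))) = ghost_component p (Suc n) ?a - of_nat p ^ Suc n * ?a (Suc n)"
      unfolding ghost_lessThan[of p "Suc n"] by simp
    have "of_nat p ^ Suc n dvd ghost_component p (Suc n) ?a - \<psi> (x n)" using ghost_dwork[of n ?a] Suc by simp
    then have "of_nat p ^ Suc n dvd (x (Suc n) - \<psi> (x n)) - (ghost_component p (Suc n) ?a - \<psi> (x n)) + of_nat p ^ Suc n * ?a (Suc n)"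
      by (rule dvd_add[OF dvd_diff[OF assms[of n]] dvd_triv_left])
    then obtain r where "x (Suc n) - (\<Sum>i<Suc n. of_nat p ^ i * ?a i ^ (p ^ (Suc n - i))) = of_nat p ^ Suc n * r"
      unfolding e by (auto elim!: dvdE simp: algebra_simps)
    then show ?case by (intro eq exI[of _ r]) (simp add: algebra_simps)
  qed
  then show ?thesis by blast
qed

text \<open>Dwork's congruences are stable under the ring operations because \<open>\<psi>\<close>
  is a homomorphism. Hence sums, negatives and products of ghost sequences are ghost sequences,
  which is the existence part of Witt's theorem.\<close>

lemma dwork_add:
  fixes a b :: "nat \<Rightarrow> 'r"
  shows "\<exists>c. \<forall>n. ghost_component p n c = ghost_component p n a + ghost_component p n b"
proof (rule dwork)
  fix n
  have "of_nat p ^ Suc n dvd (ghost_component p (Suc n) a - \<psi> (ghost_component p n a)) + (ghost_component p (Suc n) b - \<psi> (ghost_component p n b))"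
    by (intro dvd_add ghost_dwork)
  then show "of_nat p ^ Suc n dvd ghost_component p (Suc n) a + ghost_component p (Suc n) b - \<psi> (ghost_component p n a + ghost_component p n b)"
    by (simp add: psi_add algebra_simps)
qed

lemma dwork_uminus:
  fixes a :: "nat \<Rightarrow> 'r"
  shows "\<exists>c. \<forall>n. ghost_component p n c = - ghost_component p n a"
proof (rule dwork)
  fix n
  have "of_nat p ^ Suc n dvd - (ghost_component p (Suc n) a - \<psi> (ghost_component p n a))"
    unfolding dvd_minus_iff by (rule ghost_dwork)
  then show "of_nat p ^ Suc n dvd - ghost_component p (Suc n) a - \<psi> (- ghost_component p n a)"
    by (simp add: psi_uminus algebra_simps)
qed

lemma dwork_mult:
  fixes a b :: "nat \<Rightarrow> 'r"
  shows "\<exists>c. \<forall>n. ghost_component p n c = ghost_component p n a * ghost_component p n b"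
proof (rule dwork)
  fix n
  have "of_nat p ^ Suc n dvd (ghost_component p (Suc n) a - \<psi> (ghost_component p n a)) * ghost_component p (Suc n) b
      + \<psi> (ghost_component p n a) * (ghost_component p (Suc n) b - \<psi> (ghost_component p n b))"
    by (intro dvd_add dvd_mult dvd_mult2 ghost_dwork)
  then show "of_nat p ^ Suc n dvd ghost_component p (Suc n) a * ghost_component p (Suc n) b - \<psi> (ghost_component p n a * ghost_component p n b)"
    by (simp add: psi_mult algebra_simps)
qed

end

section \<open>Witt vectors\<close>

lemma lookup_of_nat_mult:
  fixes f :: "('v \<Rightarrow>\<^sub>0 nat) \<Rightarrow>\<^sub>0 int"
  shows "Poly_Mapping.lookup (of_nat k * f) m = int k * Poly_Mapping.lookup f m"
  by (induction k) (simp_all add: distrib_right lookup_add)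

lemma mpoly_of_nat_mult_eq_0:
  fixes f :: "('v \<Rightarrow>\<^sub>0 nat) \<Rightarrow>\<^sub>0 int"
  assumes "k > 0" "of_nat k * f = 0"
  shows "f = 0"
proof (rule poly_mapping_eqI)
  fix m
  have "Poly_Mapping.lookup (of_nat k * f) m = 0" using assms(2) by simp
  then have "int k * Poly_Mapping.lookup f m = 0" unfolding lookup_of_nat_mult .
  then show "Poly_Mapping.lookup f m = Poly_Mapping.lookup 0 m" using assms(1) by simp
qed

lemma class_hom_ghost:
  fixes h :: "'a::comm_ring_1 \<Rightarrow> 'b::comm_ring_1"
  assumes "h \<in> ring_hom class_ring class_ring"
  shows "h (ghost_component p n a) = ghost_component p n (\<lambda>i. h (a i))"
proof -
  have add: "h (x + y) = h x + h y" and mult: "h (x * y) = h x * h y" and one: "h 1 = 1" for x y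
    using ring_hom_add[OF assms, of x y] ring_hom_mult[OF assms, of x y] ring_hom_one[OF assms] by auto
  have zero: "h 0 = 0" using add[of 0 0] by simp
  have pow: "h (x ^ k) = h x ^ k" for x k by (induction k) (simp_all add: one mult)
  have nat: "h (of_nat k) = of_nat k" for k by (induction k) (simp_all add: one add zero)
  have sum: "h (\<Sum>i\<in>I. f i) = (\<Sum>i\<in>I. h (f i))" if "finite I" for f and I :: "nat set"
    using that by (induction I rule: finite_induct) (simp_all add: zero add)
  show ?thesis unfolding ghost_component_def by (simp add: sum mult pow nat)
qed

context padic
begin

text \<open>On integer polynomials the endomorphism raises every variable to the power
  \<open>p\<close>. The congruence is checked on ring generators; it survives sums by
  \<open>freshman\<close> and products by the product rule for differences.\<close>

lemma frobenius_lift_mpoly: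
  "frobenius_lift p (mpoly_eval class_ring (\<lambda>v::'v. mvar v ^ p))"
proof -
  interpret C: cring "class_ring :: (('v \<Rightarrow>\<^sub>0 nat) \<Rightarrow>\<^sub>0 int) ring" by (rule cring_class_ring)
  let ?\<psi> = "mpoly_eval class_ring (\<lambda>v::'v. mvar v ^ p)"
  have add: "?\<psi> (x + y) = ?\<psi> x + ?\<psi> y" for x y using C.mpoly_eval_add[of "\<lambda>v. mvar v ^ p" x y] by simp
  have mult: "?\<psi> (x * y) = ?\<psi> x * ?\<psi> y" for x y using C.mpoly_eval_mult[of "\<lambda>v. mvar v ^ p" x y] by simp
  have one: "?\<psi> 1 = 1" using C.mpoly_eval_one[of "\<lambda>v. mvar v ^ p"] by simp
  have zero: "?\<psi> 0 = 0" using add[of 0 0] by simp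
  show ?thesis
  proof (rule frobenius_lift.intro[OF prime _ add mult one])
    fix x :: "('v \<Rightarrow>\<^sub>0 nat) \<Rightarrow>\<^sub>0 int"
    assume "of_nat p * x = 0" then show "x = 0" using mpoly_of_nat_mult_eq_0 p_pos by blast
  next
    fix x :: "('v \<Rightarrow>\<^sub>0 nat) \<Rightarrow>\<^sub>0 int"
    show "of_nat p dvd ?\<psi> x - x ^ p"
    proof (induction x rule: mpoly_ring_induct)
      case uminus_one
      have e: "?\<psi> (-1) = -1" using add[of 1 "-1"] one zero by (simp add: eq_neg_iff_add_eq_0 add.commute)
      \<comment> \<open>Expanding \<open>0 = (1 + (-1))^p\<close> treats odd \<open>p\<close> and
        \<open>p = 2\<close> alike.\<close>
      have "(of_nat p :: ('v \<Rightarrow>\<^sub>0 nat) \<Rightarrow>\<^sub>0 int) dvd (1 + -1) ^ p - 1 ^ p - (-1) ^ p" by (rule freshman[OF prime])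
      then show ?case using p_pos unfolding e by (simp add: zero_power)
    next
      case (var v)
      then show ?case using C.mpoly_eval_var[of "\<lambda>v. mvar v ^ p" v] by simp
    next
      case (add f g)
      have "of_nat p dvd (?\<psi> f - f ^ p) + (?\<psi> g - g ^ p) - ((f + g) ^ p - f ^ p - g ^ p)"
        by (intro dvd_add dvd_diff add freshman[OF prime])
      moreover have "?\<psi> (f + g) - (f + g) ^ p = (?\<psi> f - f ^ p) + (?\<psi> g - g ^ p) - ((f + g) ^ p - f ^ p - g ^ p)"
        unfolding \<open>\<And>x y. ?\<psi> (x + y) = ?\<psi> x + ?\<psi> y\<close> by simp
      ultimately show ?case by metis
    next
      case (mult f g)
      have "of_nat p dvd (?\<psi> f - f ^ p) * ?\<psi> g + f ^ p * (?\<psi> g - g ^ p)"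
        by (intro dvd_add dvd_mult dvd_mult2 mult)
      moreover have "?\<psi> (f * g) - (f * g) ^ p = (?\<psi> f - f ^ p) * ?\<psi> g + f ^ p * (?\<psi> g - g ^ p)"
        unfolding \<open>\<And>x y. ?\<psi> (x * y) = ?\<psi> x * ?\<psi> y\<close> by (simp add: algebra_simps)
      ultimately show ?case by metis
    qed
  qed
qed

lemma mpoly_tf: "of_nat p * x = 0 \<Longrightarrow> x = 0" for x :: "('v \<Rightarrow>\<^sub>0 nat) \<Rightarrow>\<^sub>0 int"
  using mpoly_of_nat_mult_eq_0 p_pos by blast

text \<open>Shows that the definite description defining the sum polynomials denotes: existence
  comes from Dwork's lemma, uniqueness from injectivity of the ghost map on polynomials without
  \<open>p\<close>-torsion.\<close>

lemma ghost_sum_poly: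
  "ghost_component p n (witt_sum_poly p) =
     ghost_component p n (\<lambda>i. mvar (Inl i)) + ghost_component p n (\<lambda>i. mvar (Inr i))"
proof -
  let ?P = "\<lambda>S. \<forall>n. ghost_component p n S =
     ghost_component p n (\<lambda>i. witt_var (Inl i)) + ghost_component p n (\<lambda>i. witt_var (Inr i))"
  have "\<exists>S. ?P S" by (rule frobenius_lift.dwork_add[OF frobenius_lift_mpoly])
  moreover have "S = S'" if "?P S" "?P S'" for S S'
    using ghost_inj[OF mpoly_tf, where a = S and b = S'] that by metis
  ultimately have "\<exists>!S. ?P S" by blast
  from theI'[OF this] show ?thesis unfolding witt_sum_poly_def witt_var_eq by blast
qed

lemma ghost_prod_poly:
  "ghost_component p n (witt_prod_poly p) =
     ghost_component p n (\<lambda>i. mvar (Inl i)) * ghost_component p n (\<lambda>i. mvar (Inr i))"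
proof -
  let ?P = "\<lambda>S. \<forall>n. ghost_component p n S =
     ghost_component p n (\<lambda>i. witt_var (Inl i)) * ghost_component p n (\<lambda>i. witt_var (Inr i))"
  have "\<exists>S. ?P S" by (rule frobenius_lift.dwork_mult[OF frobenius_lift_mpoly])
  moreover have "S = S'" if "?P S" "?P S'" for S S'
    using ghost_inj[OF mpoly_tf, where a = S and b = S'] that by metis
  ultimately have "\<exists>!S. ?P S" by blast
  from theI'[OF this] show ?thesis unfolding witt_prod_poly_def witt_var_eq by blast
qed

end

section \<open>Witt vector operations computed on polynomial lifts\<close>

definition class_eval :: "('v \<Rightarrow> 'r::comm_ring_1) \<Rightarrow> (('v \<Rightarrow>\<^sub>0 nat) \<Rightarrow>\<^sub>0 int) \<Rightarrow> 'r" where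
  "class_eval = mpoly_eval class_ring"

lemma class_eval_var: "class_eval \<nu> (mvar v) = \<nu> v"
  unfolding class_eval_def by (rule cring.mpoly_eval_var[OF cring_class_ring]) simp

lemma class_eval_hom: "class_eval \<nu> \<in> ring_hom class_ring class_ring"
  unfolding class_eval_def by (rule cring.mpoly_eval_hom[OF cring_class_ring]) simp

lemma class_eval_add: "class_eval \<nu> (x + y) = class_eval \<nu> x + class_eval \<nu> y"
  using ring_hom_add[OF class_eval_hom, of x y \<nu>] by simp

lemma class_eval_mult: "class_eval \<nu> (x * y) = class_eval \<nu> x * class_eval \<nu> y"
  using ring_hom_mult[OF class_eval_hom, of x y \<nu>] by simp

text \<open>Witt addition over a type-class ring. It is applied in the polynomial ring over the
  elements of \<open>R\<close>, where ghost components detect equality, and then transported by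
  \<open>ev\<close>.\<close>

definition witt_add :: "nat \<Rightarrow> (nat \<Rightarrow> 'r::comm_ring_1) \<Rightarrow> (nat \<Rightarrow> 'r) \<Rightarrow> nat \<Rightarrow> 'r" where
  "witt_add p x y n = class_eval (case_sum x y) (witt_sum_poly p n)"

definition witt_mult :: "nat \<Rightarrow> (nat \<Rightarrow> 'r::comm_ring_1) \<Rightarrow> (nat \<Rightarrow> 'r) \<Rightarrow> nat \<Rightarrow> 'r" where
  "witt_mult p x y n = class_eval (case_sum x y) (witt_prod_poly p n)"

definition witt_one :: "nat \<Rightarrow> 'r::comm_ring_1" where
  "witt_one n = (if n = 0 then 1 else 0)"

text \<open>Verschiebung after the componentwise \<open>p\<close>-th power. In characteristic
  \<open>p\<close> this is multiplication by \<open>p\<close>, which is why it is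
  introduced.\<close>

definition verschiebung_frobenius :: "nat \<Rightarrow> (nat \<Rightarrow> 'r::comm_ring_1) \<Rightarrow> nat \<Rightarrow> 'r" where
  "verschiebung_frobenius p x n = (case n of 0 \<Rightarrow> 0 | Suc m \<Rightarrow> x m ^ p)"

locale witt = padic + cring R for R :: "('a, 'm) ring_scheme" (structure)
begin

lemma ghost_witt_add: "ghost_component p n (witt_add p x y) = ghost_component p n x + ghost_component p n y"
proof -
  have "ghost_component p n (witt_add p x y) = class_eval (case_sum x y) (ghost_component p n (witt_sum_poly p))"
    unfolding witt_add_def by (rule class_hom_ghost[OF class_eval_hom, symmetric])
  then show ?thesis
    unfolding ghost_sum_poly class_eval_add class_hom_ghost[OF class_eval_hom] class_eval_var by simp
qed

lemma ghost_witt_mult: "ghost_component p n (witt_mult p x y) = ghost_component p n x * ghost_component p n y"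
proof -
  have "ghost_component p n (witt_mult p x y) = class_eval (case_sum x y) (ghost_component p n (witt_prod_poly p))"
    unfolding witt_mult_def by (rule class_hom_ghost[OF class_eval_hom, symmetric])
  then show ?thesis
    unfolding ghost_prod_poly class_eval_mult class_hom_ghost[OF class_eval_hom] class_eval_var by simp
qed

lemma ghost_zero: "ghost_component p n (\<lambda>i. 0 :: 'r::comm_ring_1) = 0"
  unfolding ghost_component_def using p_pos by (intro sum.neutral) (auto simp: zero_power)

lemma ghost_witt_one: "ghost_component p n (witt_one :: nat \<Rightarrow> 'r::comm_ring_1) = 1"
proof -
  have "ghost_component p n (witt_one :: nat \<Rightarrow> 'r) = (\<Sum>i\<in>{0}. of_nat p ^ i * witt_one i ^ p ^ (n - i))"
    unfolding ghost_component_def using p_pos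
    by (intro sum.mono_neutral_right) (auto simp: witt_one_def zero_power)
  then show ?thesis by (simp add: witt_one_def)
qed

text \<open>Presents \<open>R\<close> as a quotient of the polynomial ring on its own elements, a
  ring without \<open>p\<close>-torsion. Variables indexed by values outside the carrier are sent to
  zero, so that \<open>ev\<close> is a homomorphism on the whole polynomial type.\<close>

definition ev :: "(('a \<Rightarrow>\<^sub>0 nat) \<Rightarrow>\<^sub>0 int) \<Rightarrow> 'a" where
  "ev = mpoly_eval R (\<lambda>v. if v \<in> carrier R then v else \<zero>)"

lemma ev_closed [simp]: "ev x \<in> carrier R"
  unfolding ev_def by (rule mpoly_eval_closed) simp

lemma ev_mvar [simp]: "a \<in> carrier R \<Longrightarrow> ev (mvar a) = a"
  unfolding ev_def by (subst mpoly_eval_var) auto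

lemma ev_hom: "ev \<in> ring_hom class_ring R"
  unfolding ev_def by (rule mpoly_eval_hom) simp

lemma ev_simps: "ev (x + y) = ev x \<oplus> ev y" "ev (x * y) = ev x \<otimes> ev y" "ev 1 = \<one>" "ev 0 = \<zero>"
  using ring_hom_add[OF ev_hom, of x y] ring_hom_mult[OF ev_hom, of x y] ring_hom_one[OF ev_hom]
  by (auto simp: ev_def)

lemma ev_of_nat: "ev (of_nat k * q) = [k] \<cdot> ev q"
  unfolding ev_def by (rule mpoly_eval_of_nat) simp

lemma ev_power: "ev (x ^ k) = ev x [^] k"
  by (induction k) (simp_all add: ev_simps m_comm)

lemma ev_class_eval: "ev (class_eval f q) = mpoly_eval R (\<lambda>v. ev (f v)) q"
  unfolding ev_def class_eval_def by (rule mpoly_eval_class) simp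

abbreviation "W \<equiv> witt_ring p R"

lemma witt_carrier: "w \<in> carrier W \<longleftrightarrow> (\<forall>n. w n \<in> carrier R)"
  by (auto simp: witt_ring_def Pi_iff)

lemma ev_case_sum: "(\<lambda>v. ev (case_sum x y v)) = case_sum (\<lambda>n. ev (x n)) (\<lambda>n. ev (y n))"
  by (auto simp: fun_eq_iff split: sum.split)

lemma witt_add_ev: "(\<lambda>n. ev (x n)) \<oplus>\<^bsub>W\<^esub> (\<lambda>n. ev (y n)) = (\<lambda>n. ev (witt_add p x y n))"
  by (simp add: witt_ring_def witt_add_def ev_class_eval ev_case_sum)

lemma witt_mult_ev: "(\<lambda>n. ev (x n)) \<otimes>\<^bsub>W\<^esub> (\<lambda>n. ev (y n)) = (\<lambda>n. ev (witt_mult p x y n))"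
  by (simp add: witt_ring_def witt_mult_def ev_class_eval ev_case_sum)

lemma witt_zero_ev: "\<zero>\<^bsub>W\<^esub> = (\<lambda>n. ev 0)"
  by (simp add: witt_ring_def ev_simps)

lemma witt_one_ev: "\<one>\<^bsub>W\<^esub> = (\<lambda>n. ev (witt_one n))"
  by (auto simp: witt_ring_def ev_simps witt_one_def)

lemma witt_lift:
  assumes "w \<in> carrier W"
  obtains x where "w = (\<lambda>n. ev (x n))"
  by (rule that[of "\<lambda>n. mvar (w n)"]) (use assms in \<open>auto simp: witt_carrier\<close>)

lemma ev_in_witt [simp]: "(\<lambda>n. ev (x n)) \<in> carrier W"
  by (simp add: witt_carrier)

text \<open>The principle by which Witt vector identities over an arbitrary commutative ring are
  proved: lift to polynomials, compare ghost components there, and map back. The ghost map over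
  \<open>R\<close> itself need not be injective.\<close>

lemma witt_eqI:
  fixes x y :: "nat \<Rightarrow> (('a \<Rightarrow>\<^sub>0 nat) \<Rightarrow>\<^sub>0 int)"
  assumes "\<And>n. ghost_component p n x = ghost_component p n y"
  shows "(\<lambda>n. ev (x n)) = (\<lambda>n. ev (y n))"
  using ghost_inj[OF mpoly_tf assms] by simp

lemmas witt_ev = witt_add_ev witt_mult_ev witt_zero_ev witt_one_ev

lemmas ghost_simps = ghost_witt_add ghost_witt_mult ghost_zero ghost_witt_one

text \<open>On ghost components all operations are componentwise, so every axiom reduces to the same
  law in a polynomial ring. The negative is supplied by Dwork's lemma.\<close>

lemma cring_witt: "cring W"
proof (intro cringI abelian_groupI comm_monoidI)
  fix a b assume "a \<in> carrier W" "b \<in> carrier W"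
  then obtain x y where e: "a = (\<lambda>n. ev (x n))" "b = (\<lambda>n. ev (y n))" using witt_lift by metis
  show "a \<oplus>\<^bsub>W\<^esub> b \<in> carrier W" "a \<otimes>\<^bsub>W\<^esub> b \<in> carrier W" unfolding e witt_ev by simp_all
  show "a \<oplus>\<^bsub>W\<^esub> b = b \<oplus>\<^bsub>W\<^esub> a" "a \<otimes>\<^bsub>W\<^esub> b = b \<otimes>\<^bsub>W\<^esub> a"
    unfolding e witt_ev by (rule witt_eqI; simp add: ghost_simps algebra_simps)+
next
  fix a b c assume "a \<in> carrier W" "b \<in> carrier W" "c \<in> carrier W"
  then obtain x y z where e: "a = (\<lambda>n. ev (x n))" "b = (\<lambda>n. ev (y n))" "c = (\<lambda>n. ev (z n))"
    using witt_lift by metis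
  show "a \<oplus>\<^bsub>W\<^esub> b \<oplus>\<^bsub>W\<^esub> c = a \<oplus>\<^bsub>W\<^esub> (b \<oplus>\<^bsub>W\<^esub> c)" "a \<otimes>\<^bsub>W\<^esub> b \<otimes>\<^bsub>W\<^esub> c = a \<otimes>\<^bsub>W\<^esub> (b \<otimes>\<^bsub>W\<^esub> c)"
    "(a \<oplus>\<^bsub>W\<^esub> b) \<otimes>\<^bsub>W\<^esub> c = a \<otimes>\<^bsub>W\<^esub> c \<oplus>\<^bsub>W\<^esub> b \<otimes>\<^bsub>W\<^esub> c"
    unfolding e witt_ev by (rule witt_eqI; simp add: ghost_simps algebra_simps)+
next
  show "\<zero>\<^bsub>W\<^esub> \<in> carrier W" "\<one>\<^bsub>W\<^esub> \<in> carrier W" unfolding witt_ev by simp_all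
  fix a assume "a \<in> carrier W"
  then obtain x where e: "a = (\<lambda>n. ev (x n))" using witt_lift by metis
  show "\<zero>\<^bsub>W\<^esub> \<oplus>\<^bsub>W\<^esub> a = a" "\<one>\<^bsub>W\<^esub> \<otimes>\<^bsub>W\<^esub> a = a"
    unfolding e witt_ev by (rule witt_eqI; simp add: ghost_simps)+
  obtain y where y: "\<And>n. ghost_component p n y = - ghost_component p n x"
    using frobenius_lift.dwork_uminus[OF frobenius_lift_mpoly, of x] by blast
  have "(\<lambda>n. ev (y n)) \<oplus>\<^bsub>W\<^esub> a = \<zero>\<^bsub>W\<^esub>" unfolding e witt_ev by (rule witt_eqI) (simp add: ghost_simps y)
  then show "\<exists>y\<in>carrier W. y \<oplus>\<^bsub>W\<^esub> a = \<zero>\<^bsub>W\<^esub>" using ev_in_witt by blast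
qed

sublocale W: cring "witt_ring p R"
  by (rule cring_witt)

lemma witt_sum_poly_0: "witt_sum_poly p 0 = mvar (Inl 0) + mvar (Inr 0)"
  using ghost_sum_poly[of 0] by simp

lemma witt_prod_poly_0: "witt_prod_poly p 0 = mvar (Inl 0) * mvar (Inr 0)"
  using ghost_prod_poly[of 0] by simp

lemma witt_first_hom: "(\<lambda>w. w 0) \<in> ring_hom W R"
proof (rule ring_hom_memI)
  fix a b assume "a \<in> carrier W" "b \<in> carrier W"
  then obtain x y where e: "a = (\<lambda>n. ev (x n))" "b = (\<lambda>n. ev (y n))" using witt_lift by metis
  show "(a \<oplus>\<^bsub>W\<^esub> b) 0 = a 0 \<oplus> b 0"
    unfolding e witt_ev by (simp add: witt_add_def witt_sum_poly_0 class_eval_add class_eval_var ev_simps)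
  show "(a \<otimes>\<^bsub>W\<^esub> b) 0 = a 0 \<otimes> b 0"
    unfolding e witt_ev by (simp add: witt_mult_def witt_prod_poly_0 class_eval_mult class_eval_var ev_simps)
qed (auto simp: witt_carrier, simp add: witt_ring_def)

text \<open>The point of the formula is the size of the error: the ghost components agree with those
  of \<open>p x\<close> modulo \<open>p^(n+1)\<close>, exactly what \<open>dvd_of_ghost_dvd\<close>
  asks for.\<close>

lemma ghost_verschiebung_frobenius:
  "ghost_component p n (verschiebung_frobenius p x) = of_nat p * ghost_component p n x - of_nat p ^ Suc n * x n"
proof (cases n)
  case 0
  then show ?thesis by (simp add: verschiebung_frobenius_def)
next
  case (Suc m)
  have "{..n} = insert 0 (Suc ` {..m})" using Suc by (auto simp: image_iff) (metis Suc_le_D Suc_le_mono atMost_iff not0_implies_Suc)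
  then have "ghost_component p n (verschiebung_frobenius p x)
      = (\<Sum>i\<in>Suc ` {..m}. of_nat p ^ i * verschiebung_frobenius p x i ^ (p ^ (n - i)))"
    using p_pos by (simp add: ghost_component_def verschiebung_frobenius_def zero_power)
  also have "\<dots> = (\<Sum>i\<le>m. of_nat p ^ Suc i * (x i ^ p) ^ (p ^ (m - i)))"
    by (simp add: sum.reindex Suc verschiebung_frobenius_def)
  also have "\<dots> = of_nat p * ghost_component p m (\<lambda>i. x i ^ p)"
    by (simp add: ghost_component_def sum_distrib_left mult.assoc)
  finally show ?thesis by (simp add: Suc ghost_Suc algebra_simps)
qed

text \<open>On lifts, \<open>p w\<close> and Verschiebung after Frobenius are congruent modulo
  \<open>p\<close> in every component, and characteristic \<open>p\<close> removes the
  difference.\<close>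

lemma nat_mult_witt:
  assumes char: "[p] \<cdot> \<one> = \<zero>" and w: "w \<in> carrier W"
  shows "[p] \<cdot>\<^bsub>W\<^esub> w = (\<lambda>n. case n of 0 \<Rightarrow> \<zero> | Suc m \<Rightarrow> w m [^] p)"
proof -
  obtain x where e: "w = (\<lambda>n. ev (x n))" using witt_lift[OF w] by metis
  have "\<exists>f. (\<forall>n. ghost_component p n f = of_nat k * ghost_component p n x) \<and> [k] \<cdot>\<^bsub>W\<^esub> w = (\<lambda>n. ev (f n))" for k
  proof (induction k)
    case 0
    show ?case by (rule exI[of _ "\<lambda>n. 0"]) (simp add: ghost_simps witt_ev)
  next
    case (Suc k)
    then obtain f where f: "\<forall>n. ghost_component p n f = of_nat k * ghost_component p n x" "[k] \<cdot>\<^bsub>W\<^esub> w = (\<lambda>n. ev (f n))"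
      by blast
    have "[Suc k] \<cdot>\<^bsub>W\<^esub> w = [k] \<cdot>\<^bsub>W\<^esub> w \<oplus>\<^bsub>W\<^esub> w" using w by simp
    then have "[Suc k] \<cdot>\<^bsub>W\<^esub> w = (\<lambda>n. ev (witt_add p f x n))" unfolding f(2) unfolding e witt_ev .
    then show ?case using f by (intro exI[of _ "witt_add p f x"]) (simp add: ghost_simps algebra_simps)
  qed
  then obtain f where f: "\<And>n. ghost_component p n f = of_nat p * ghost_component p n x" "[p] \<cdot>\<^bsub>W\<^esub> w = (\<lambda>n. ev (f n))"
    by blast
  have "of_nat p dvd f n - verschiebung_frobenius p x n" for n
    by (rule dvd_of_ghost_dvd[OF mpoly_tf]) (simp_all add: f ghost_verschiebung_frobenius)
  then have "ev (f n) = ev (verschiebung_frobenius p x n)" for n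
  proof -
    obtain c where "f n - verschiebung_frobenius p x n = of_nat p * c"
      using \<open>of_nat p dvd f n - verschiebung_frobenius p x n\<close> by (auto elim: dvdE)
    then have "f n = verschiebung_frobenius p x n + of_nat p * c" by (simp add: algebra_simps)
    moreover have "[p] \<cdot> ev c = \<zero>" using char add_pow_ldistr[of \<one> "ev c" p] by simp
    ultimately show ?thesis by (simp add: ev_simps(1) ev_of_nat)
  qed
  then show ?thesis unfolding f(2)
    by (auto simp: fun_eq_iff e verschiebung_frobenius_def ev_simps ev_power split: nat.split)
qed

end

section \<open>Tensor products of algebras\<close>

definition pair_times :: "('a, 'm) ring_scheme \<Rightarrow> ('b, 'n) ring_scheme
    \<Rightarrow> ('a \<times> 'b \<Rightarrow>\<^sub>0 int) \<Rightarrow> ('a \<times> 'b \<Rightarrow>\<^sub>0 int) \<Rightarrow> ('a \<times> 'b \<Rightarrow>\<^sub>0 int)" where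
  "pair_times A B t u = frag_extend (\<lambda>(a, b). frag_extend (\<lambda>(a', b').
       frag_of (a \<otimes>\<^bsub>A\<^esub> a', b \<otimes>\<^bsub>B\<^esub> b')) u) t"

lemma pair_ring_simps:
  "t \<in> carrier (pair_ring A B) \<longleftrightarrow> Poly_Mapping.keys t \<subseteq> carrier A \<times> carrier B"
  "t \<otimes>\<^bsub>pair_ring A B\<^esub> u = pair_times A B t u"
  "\<one>\<^bsub>pair_ring A B\<^esub> = frag_of (\<one>\<^bsub>A\<^esub>, \<one>\<^bsub>B\<^esub>)"
  "\<zero>\<^bsub>pair_ring A B\<^esub> = 0"
  "t \<oplus>\<^bsub>pair_ring A B\<^esub> u = t + u"
  by (simp_all add: pair_ring_def pair_times_def)

lemma frag_extend_fun_diff: "frag_extend (\<lambda>x. F x - G x) t = frag_extend F t - frag_extend G t"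
proof -
  have "Poly_Mapping.keys t \<subseteq> UNIV" by simp
  then show ?thesis
    by (induction t rule: frag_induction) (simp_all add: frag_extend_diff)
qed

lemma pair_times_of [simp]:
  "pair_times A B (frag_of (a, b)) (frag_of (a', b')) = frag_of (a \<otimes>\<^bsub>A\<^esub> a', b \<otimes>\<^bsub>B\<^esub> b')"
  by (simp add: pair_times_def)

lemma pair_times_diff_left: "pair_times A B (t - t') u = pair_times A B t u - pair_times A B t' u"
  by (simp add: pair_times_def frag_extend_diff)

lemma pair_times_diff_right: "pair_times A B t (u - u') = pair_times A B t u - pair_times A B t u'"
  unfolding pair_times_def frag_extend_fun_diff[symmetric]
  by (rule arg_cong[where f = "\<lambda>F. frag_extend F t"]) (auto simp: fun_eq_iff frag_extend_diff)

lemma pair_times_0 [simp]: "pair_times A B 0 u = 0" "pair_times A B t 0 = 0"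
  using pair_times_diff_left[of A B 0 0 u] pair_times_diff_right[of A B t 0 0] by auto

lemma pair_times_add_left: "pair_times A B (t + t') u = pair_times A B t u + pair_times A B t' u"
  using pair_times_diff_left[of A B t "0 - t'" u] pair_times_diff_left[of A B 0 t' u] by simp

locale tensor = S: cring S + A: cring A + B: cring B
  for S :: "('s, 'k) ring_scheme" and A :: "('a, 'm) ring_scheme" and B :: "('b, 'n) ring_scheme" +
  fixes f g
  assumes f: "f \<in> ring_hom S A" and g: "g \<in> ring_hom S B"
begin

abbreviation "PR \<equiv> pair_ring A B"
abbreviation "Rel \<equiv> tensor_relations S (algebra_module f A) (algebra_module g B)"
abbreviation "T \<equiv> tensor_ring S f A g B"

lemma f_closed [simp]: "s \<in> carrier S \<Longrightarrow> f s \<in> carrier A" and g_closed [simp]: "s \<in> carrier S \<Longrightarrow> g s \<in> carrier B"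
  using ring_hom_closed[OF f] ring_hom_closed[OF g] by auto

lemma PR_induct [consumes 1, case_names zero of_pair diff]:
  assumes "t \<in> carrier PR" "P 0" "\<And>a b. a \<in> carrier A \<Longrightarrow> b \<in> carrier B \<Longrightarrow> P (frag_of (a, b))"
    "\<And>x y. x \<in> carrier PR \<Longrightarrow> y \<in> carrier PR \<Longrightarrow> P x \<Longrightarrow> P y \<Longrightarrow> P (x - y)"
  shows "P t"
  using assms(1) unfolding pair_ring_simps(1)
  by (rule free_Abelian_group_induct) (use assms in \<open>auto simp: pair_ring_simps(1)\<close>)

lemma PR_0 [simp]: "0 \<in> carrier PR" by (simp add: pair_ring_simps)
lemma PR_diff [simp]: "t \<in> carrier PR \<Longrightarrow> u \<in> carrier PR \<Longrightarrow> t - u \<in> carrier PR"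
  using keys_diff[of t u] by (auto simp: pair_ring_simps)
lemma PR_add [simp]: "t \<in> carrier PR \<Longrightarrow> u \<in> carrier PR \<Longrightarrow> t + u \<in> carrier PR"
  using Poly_Mapping.keys_add[of t u] by (auto simp: pair_ring_simps)
lemma PR_uminus [simp]: "t \<in> carrier PR \<Longrightarrow> - t \<in> carrier PR"
  by (simp add: pair_ring_simps)
lemma PR_of [simp]: "a \<in> carrier A \<Longrightarrow> b \<in> carrier B \<Longrightarrow> frag_of (a, b) \<in> carrier PR"
  by (simp add: pair_ring_simps)

lemma PR_times_of_left [simp]:
  assumes "a \<in> carrier A" "b \<in> carrier B" "u \<in> carrier PR"
  shows "pair_times A B (frag_of (a, b)) u \<in> carrier PR"
  using assms(3) by (induction u rule: PR_induct) (simp_all add: assms(1,2) pair_times_diff_right)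

lemma PR_times [simp]: "t \<in> carrier PR \<Longrightarrow> u \<in> carrier PR \<Longrightarrow> pair_times A B t u \<in> carrier PR"
  by (induction t rule: PR_induct) (simp_all add: pair_times_diff_left)

lemma PR_times_comm:
  assumes "t \<in> carrier PR" "u \<in> carrier PR"
  shows "pair_times A B t u = pair_times A B u t"
  using assms(1)
proof (induction t rule: PR_induct)
  case (of_pair a b)
  from assms(2) show ?case
    by (induction u rule: PR_induct)
       (use of_pair in \<open>simp_all add: pair_times_diff_left pair_times_diff_right A.m_comm B.m_comm\<close>)
qed (simp_all add: pair_times_diff_left pair_times_diff_right)

lemma PR_times_assoc:
  assumes "t \<in> carrier PR" "u \<in> carrier PR" "v \<in> carrier PR"
  shows "pair_times A B (pair_times A B t u) v = pair_times A B t (pair_times A B u v)"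
  using assms(1)
proof (induction t rule: PR_induct)
  case (of_pair a b)
  from assms(2) show ?case
  proof (induction u rule: PR_induct)
    case (of_pair a' b')
    from assms(3) show ?case
      by (induction v rule: PR_induct)
         (use of_pair \<open>a \<in> carrier A\<close> \<open>b \<in> carrier B\<close> in \<open>simp_all add: pair_times_diff_right A.m_assoc B.m_assoc\<close>)
  qed (simp_all add: pair_times_diff_left pair_times_diff_right)
qed (simp_all add: pair_times_diff_left)

lemma PR_times_one: "t \<in> carrier PR \<Longrightarrow> pair_times A B (frag_of (\<one>\<^bsub>A\<^esub>, \<one>\<^bsub>B\<^esub>)) t = t"
  by (induction t rule: PR_induct) (simp_all add: pair_times_diff_right)

lemma cring_PR: "cring PR"
  by (intro cringI abelian_groupI comm_monoidI)
     (auto simp: pair_ring_simps(2-) PR_times_assoc PR_times_one pair_times_add_left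
        intro: PR_times_comm bexI[of _ "- x" for x])

sublocale PR: cring "pair_ring A B"
  by (rule cring_PR)

lemma PR_a_inv: "t \<in> carrier PR \<Longrightarrow> \<ominus>\<^bsub>PR\<^esub> t = - t"
  using PR.minus_equality[of "- t" t] by (simp add: pair_ring_simps)

lemma PR_minus: "t \<in> carrier PR \<Longrightarrow> u \<in> carrier PR \<Longrightarrow> t \<ominus>\<^bsub>PR\<^esub> u = t - u"
  by (simp add: PR.minus_eq PR_a_inv pair_ring_simps(5))

lemma Rel_add_left: "a \<in> carrier A \<Longrightarrow> a' \<in> carrier A \<Longrightarrow> b \<in> carrier B \<Longrightarrow>
    frag_of (a \<oplus>\<^bsub>A\<^esub> a', b) - frag_of (a, b) - frag_of (a', b) \<in> Rel"
  unfolding tensor_relations_def by (rule generate.incl) auto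

lemma Rel_add_right: "a \<in> carrier A \<Longrightarrow> b \<in> carrier B \<Longrightarrow> b' \<in> carrier B \<Longrightarrow>
    frag_of (a, b \<oplus>\<^bsub>B\<^esub> b') - frag_of (a, b) - frag_of (a, b') \<in> Rel"
  unfolding tensor_relations_def by (rule generate.incl) auto

lemma Rel_balanced: "s \<in> carrier S \<Longrightarrow> a \<in> carrier A \<Longrightarrow> b \<in> carrier B \<Longrightarrow>
    frag_of (f s \<otimes>\<^bsub>A\<^esub> a, b) - frag_of (a, g s \<otimes>\<^bsub>B\<^esub> b) \<in> Rel"
  unfolding tensor_relations_def by (rule generate.incl) auto

lemma Rel_induct [consumes 1, case_names add_left add_right balanced diff]:
  assumes r: "r \<in> Rel"
    and 1: "\<And>a a' b. a \<in> carrier A \<Longrightarrow> a' \<in> carrier A \<Longrightarrow> b \<in> carrier B \<Longrightarrow>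
      P (frag_of (a \<oplus>\<^bsub>A\<^esub> a', b) - frag_of (a, b) - frag_of (a', b))"
    and 2: "\<And>a b b'. a \<in> carrier A \<Longrightarrow> b \<in> carrier B \<Longrightarrow> b' \<in> carrier B \<Longrightarrow>
      P (frag_of (a, b \<oplus>\<^bsub>B\<^esub> b') - frag_of (a, b) - frag_of (a, b'))"
    and 3: "\<And>s a b. s \<in> carrier S \<Longrightarrow> a \<in> carrier A \<Longrightarrow> b \<in> carrier B \<Longrightarrow>
      P (frag_of (f s \<otimes>\<^bsub>A\<^esub> a, b) - frag_of (a, g s \<otimes>\<^bsub>B\<^esub> b))"
    and d: "\<And>x y. x \<in> carrier PR \<Longrightarrow> y \<in> carrier PR \<Longrightarrow> P x \<Longrightarrow> P y \<Longrightarrow> P (x - y)"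
  shows "r \<in> carrier PR \<and> P r"
proof -
  let ?G = "{frag_of (x \<oplus>\<^bsub>A\<^esub> x', y) - frag_of (x, y) - frag_of (x', y) | x x' y.
         x \<in> carrier A \<and> x' \<in> carrier A \<and> y \<in> carrier B} \<union>
      {frag_of (x, y \<oplus>\<^bsub>B\<^esub> y') - frag_of (x, y) - frag_of (x, y') | x y y'.
         x \<in> carrier A \<and> y \<in> carrier B \<and> y' \<in> carrier B} \<union>
      {frag_of (f s \<otimes>\<^bsub>A\<^esub> x, y) - frag_of (x, g s \<otimes>\<^bsub>B\<^esub> y) | s x y.
         s \<in> carrier S \<and> x \<in> carrier A \<and> y \<in> carrier B}"
  have G: "h \<in> carrier PR \<and> P h" if "h \<in> ?G" for h using that 1 2 3 by auto
  \<comment> \<open>Any relation would do: subtracting it from itself yields \<open>P 0\<close>,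
    from which closure under negatives and sums follows.\<close>
  have "P (frag_of (\<zero>\<^bsub>A\<^esub> \<oplus>\<^bsub>A\<^esub> \<zero>\<^bsub>A\<^esub>, \<zero>\<^bsub>B\<^esub>) - frag_of (\<zero>\<^bsub>A\<^esub>, \<zero>\<^bsub>B\<^esub>) - frag_of (\<zero>\<^bsub>A\<^esub>, \<zero>\<^bsub>B\<^esub>))"
    by (rule 1) auto
  from d[OF _ _ this this] have 0: "P 0" by simp
  have u: "P (- x)" if "x \<in> carrier PR" "P x" for x using d[OF _ that(1) 0 that(2)] by simp
  have a: "P (x + y)" if "x \<in> carrier PR" "P x" "y \<in> carrier PR" "P y" for x y
    using d[OF that(1) _ that(2) u[OF that(3,4)]] that by simp
  have "r \<in> generate (free_Abelian_group (carrier A \<times> carrier B)) ?G"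
    using r unfolding tensor_relations_def by simp
  then show ?thesis
  proof (induction r rule: generate.induct)
    case one
    then show ?case using 0 by simp
  next
    case (incl h)
    then show ?case by (rule G)
  next
    case (inv h)
    then have h: "h \<in> carrier PR" "P h" using G by auto
    then have "inv\<^bsub>free_Abelian_group (carrier A \<times> carrier B)\<^esub> h = - h"
      by (intro inv_free_Abelian_group) (simp add: pair_ring_simps)
    then show ?case using h u by simp
  next
    case (eng h1 h2)
    then show ?case using a by simp
  qed
qed

lemma Rel_PR: "r \<in> Rel \<Longrightarrow> r \<in> carrier PR"
  using Rel_induct[of r "\<lambda>_. True"] by simp

lemma Rel_subgroup: "subgroup Rel (free_Abelian_group (carrier A \<times> carrier B))"
proof -
  have "h \<in> carrier PR" if "h \<in> {frag_of (x \<oplus>\<^bsub>A\<^esub> x', y) - frag_of (x, y) - frag_of (x', y) | x x' y.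
         x \<in> carrier A \<and> x' \<in> carrier A \<and> y \<in> carrier B} \<union>
      {frag_of (x, y \<oplus>\<^bsub>B\<^esub> y') - frag_of (x, y) - frag_of (x, y') | x y y'.
         x \<in> carrier A \<and> y \<in> carrier B \<and> y' \<in> carrier B} \<union>
      {frag_of (f s \<otimes>\<^bsub>A\<^esub> x, y) - frag_of (x, g s \<otimes>\<^bsub>B\<^esub> y) | s x y.
         s \<in> carrier S \<and> x \<in> carrier A \<and> y \<in> carrier B}" for h
    using that by auto
  then show ?thesis
    unfolding tensor_relations_def algebra_module_simps
    by (intro group.generate_is_subgroup[OF group_free_Abelian_group])
       (simp only: subset_iff carrier_free_Abelian_group_iff pair_ring_simps(1) mem_Collect_eq Un_iff, blast)
qed

lemma Rel_zero: "0 \<in> Rel"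
  using subgroup.one_closed[OF Rel_subgroup] by simp

lemma Rel_add: "x \<in> Rel \<Longrightarrow> y \<in> Rel \<Longrightarrow> x + y \<in> Rel"
  using subgroup.m_closed[OF Rel_subgroup] by simp

lemma Rel_uminus: "x \<in> Rel \<Longrightarrow> - x \<in> Rel"
  using subgroup.m_inv_closed[OF Rel_subgroup, of x] Rel_PR[of x] by (simp add: pair_ring_simps)

lemma Rel_diff: "x \<in> Rel \<Longrightarrow> y \<in> Rel \<Longrightarrow> x - y \<in> Rel"
  using Rel_add[of x "- y"] Rel_uminus[of y] by simp

lemma Rel_absorb_of:
  assumes "a \<in> carrier A" "b \<in> carrier B" "r \<in> Rel"
  shows "pair_times A B (frag_of (a, b)) r \<in> Rel"
proof -
  have "r \<in> carrier PR \<and> pair_times A B (frag_of (a, b)) r \<in> Rel"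
    using assms(3)
  proof (induction r rule: Rel_induct)
    case (add_left x x' y)
    then show ?case
      using assms Rel_add_left[of "a \<otimes>\<^bsub>A\<^esub> x" "a \<otimes>\<^bsub>A\<^esub> x'" "b \<otimes>\<^bsub>B\<^esub> y"] by (simp add: pair_times_diff_right A.r_distr)
  next
    case (add_right x y y')
    then show ?case
      using assms Rel_add_right[of "a \<otimes>\<^bsub>A\<^esub> x" "b \<otimes>\<^bsub>B\<^esub> y" "b \<otimes>\<^bsub>B\<^esub> y'"] by (simp add: pair_times_diff_right B.r_distr)
  next
    case (balanced s x y)
    then show ?case
      using assms Rel_balanced[of s "a \<otimes>\<^bsub>A\<^esub> x" "b \<otimes>\<^bsub>B\<^esub> y"] by (simp add: pair_times_diff_right A.m_lcomm B.m_lcomm)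
  next
    case (diff x y)
    then show ?case by (simp add: pair_times_diff_right Rel_diff)
  qed
  then show ?thesis ..
qed

lemma Rel_absorb:
  assumes "t \<in> carrier PR" "r \<in> Rel"
  shows "pair_times A B t r \<in> Rel"
  using assms(1) by (induction t rule: PR_induct)
    (simp_all add: Rel_zero Rel_absorb_of assms(2) pair_times_diff_left Rel_diff)

lemma ideal_Rel: "ideal Rel PR"
proof (rule idealI[OF PR.ring_axioms])
  show "subgroup Rel (add_monoid PR)"
    using Rel_PR Rel_add Rel_uminus Rel_zero PR_a_inv
    by (intro PR.add.subgroupI) (auto simp: pair_ring_simps(5) simp flip: a_inv_def)
  fix r t assume r: "r \<in> Rel" and t: "t \<in> carrier PR"
  show "t \<otimes>\<^bsub>PR\<^esub> r \<in> Rel" using Rel_absorb[OF t r] by (simp add: pair_ring_simps)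
  then show "r \<otimes>\<^bsub>PR\<^esub> t \<in> Rel" using PR.m_comm[OF t Rel_PR[OF r]] by simp
qed

sublocale Rel: ideal "tensor_relations S (algebra_module f A) (algebra_module g B)" "pair_ring A B"
  by (rule ideal_Rel)

lemma T_eq: "T = PR Quot Rel"
  by (simp add: tensor_ring_def)

sublocale T: cring "tensor_ring S f A g B"
  unfolding T_eq by (rule Rel.quotient_is_cring[OF PR.is_cring])

definition proj :: "('a \<times> 'b \<Rightarrow>\<^sub>0 int) \<Rightarrow> ('a \<times> 'b \<Rightarrow>\<^sub>0 int) set" where
  "proj t = Rel +>\<^bsub>PR\<^esub> t"

lemma proj_hom: "proj \<in> ring_hom PR T"
  unfolding proj_def T_eq by (rule Rel.rcos_ring_hom)

lemma proj_closed [simp]: "t \<in> carrier PR \<Longrightarrow> proj t \<in> carrier T"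
  using ring_hom_closed[OF proj_hom] .

lemma proj_surj: "Y \<in> carrier T \<Longrightarrow> \<exists>t\<in>carrier PR. Y = proj t"
  unfolding T_eq proj_def by (auto simp: FactRing_def A_RCOSETS_def')

lemma proj_set: "proj t = (\<lambda>r. r + t) ` Rel"
  by (auto simp: proj_def a_r_coset_def r_coset_def pair_ring_simps)

lemma proj_eq_iff: "t \<in> carrier PR \<Longrightarrow> u \<in> carrier PR \<Longrightarrow> proj t = proj u \<longleftrightarrow> t - u \<in> Rel"
  using PR.quotient_eq_iff_same_a_r_cos[OF ideal_Rel, of t u] by (simp add: proj_def PR_minus)

lemma proj_add: "t \<in> carrier PR \<Longrightarrow> u \<in> carrier PR \<Longrightarrow> proj (t + u) = proj t \<oplus>\<^bsub>T\<^esub> proj u"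
  using ring_hom_add[OF proj_hom, of t u] by (simp add: pair_ring_simps(5))

lemma proj_mult: "t \<in> carrier PR \<Longrightarrow> u \<in> carrier PR \<Longrightarrow> proj (pair_times A B t u) = proj t \<otimes>\<^bsub>T\<^esub> proj u"
  using ring_hom_mult[OF proj_hom, of t u] by (simp add: pair_ring_simps(2))

lemma proj_zero: "proj 0 = \<zero>\<^bsub>T\<^esub>"
  using proj_add[of 0 0] T.add.l_cancel_one[of "proj 0" "proj 0"] by simp

lemma proj_diff: "t \<in> carrier PR \<Longrightarrow> u \<in> carrier PR \<Longrightarrow> proj (t - u) = proj t \<ominus>\<^bsub>T\<^esub> proj u"
  using proj_add[of "t - u" u] by (simp add: T.minus_eq T.a_assoc T.r_neg)

definition inl :: "'a \<Rightarrow> ('a \<times> 'b \<Rightarrow>\<^sub>0 int) set" where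
  "inl a = proj (frag_of (a, \<one>\<^bsub>B\<^esub>))"

definition inr :: "'b \<Rightarrow> ('a \<times> 'b \<Rightarrow>\<^sub>0 int) set" where
  "inr b = proj (frag_of (\<one>\<^bsub>A\<^esub>, b))"

lemma T_one: "\<one>\<^bsub>T\<^esub> = proj (frag_of (\<one>\<^bsub>A\<^esub>, \<one>\<^bsub>B\<^esub>))"
  using ring_hom_one[OF proj_hom] by (simp add: pair_ring_simps)

lemma inl_hom: "inl \<in> ring_hom A T"
proof (rule ring_hom_memI)
  fix x y assume xy: "x \<in> carrier A" "y \<in> carrier A"
  show "inl x \<in> carrier T" using xy by (simp add: inl_def)
  show "inl (x \<otimes>\<^bsub>A\<^esub> y) = inl x \<otimes>\<^bsub>T\<^esub> inl y" using xy by (simp add: inl_def flip: proj_mult)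
  have "proj (frag_of (x \<oplus>\<^bsub>A\<^esub> y, \<one>\<^bsub>B\<^esub>)) = proj (frag_of (x, \<one>\<^bsub>B\<^esub>) + frag_of (y, \<one>\<^bsub>B\<^esub>))"
    using xy Rel_add_left[of x y "\<one>\<^bsub>B\<^esub>"] by (subst proj_eq_iff) (auto simp: algebra_simps)
  then show "inl (x \<oplus>\<^bsub>A\<^esub> y) = inl x \<oplus>\<^bsub>T\<^esub> inl y" using xy by (simp add: inl_def proj_add)
qed (simp add: inl_def T_one)

lemma inr_hom: "inr \<in> ring_hom B T"
proof (rule ring_hom_memI)
  fix x y assume xy: "x \<in> carrier B" "y \<in> carrier B"
  show "inr x \<in> carrier T" using xy by (simp add: inr_def)
  show "inr (x \<otimes>\<^bsub>B\<^esub> y) = inr x \<otimes>\<^bsub>T\<^esub> inr y" using xy by (simp add: inr_def flip: proj_mult)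
  have "proj (frag_of (\<one>\<^bsub>A\<^esub>, x \<oplus>\<^bsub>B\<^esub> y)) = proj (frag_of (\<one>\<^bsub>A\<^esub>, x) + frag_of (\<one>\<^bsub>A\<^esub>, y))"
    using xy Rel_add_right[of "\<one>\<^bsub>A\<^esub>" x y] by (subst proj_eq_iff) (auto simp: algebra_simps)
  then show "inr (x \<oplus>\<^bsub>B\<^esub> y) = inr x \<oplus>\<^bsub>T\<^esub> inr y" using xy by (simp add: inr_def proj_add)
qed (simp add: inr_def T_one)

lemma inl_closed [simp]: "a \<in> carrier A \<Longrightarrow> inl a \<in> carrier T" and inr_closed [simp]: "b \<in> carrier B \<Longrightarrow> inr b \<in> carrier T"
  using ring_hom_closed[OF inl_hom] ring_hom_closed[OF inr_hom] by auto

lemma inl_inr: "a \<in> carrier A \<Longrightarrow> b \<in> carrier B \<Longrightarrow> inl a \<otimes>\<^bsub>T\<^esub> inr b = proj (frag_of (a, b))"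
  by (simp add: inl_def inr_def flip: proj_mult)

lemma inl_f: "s \<in> carrier S \<Longrightarrow> inl (f s) = inr (g s)"
  using Rel_balanced[of s "\<one>\<^bsub>A\<^esub>" "\<one>\<^bsub>B\<^esub>"] by (simp add: inl_def inr_def proj_eq_iff)

lemma T_induct [consumes 1, case_names zero tensor diff]:
  assumes "x \<in> carrier T" "P \<zero>\<^bsub>T\<^esub>" "\<And>a b. a \<in> carrier A \<Longrightarrow> b \<in> carrier B \<Longrightarrow> P (inl a \<otimes>\<^bsub>T\<^esub> inr b)"
    "\<And>x y. x \<in> carrier T \<Longrightarrow> y \<in> carrier T \<Longrightarrow> P x \<Longrightarrow> P y \<Longrightarrow> P (x \<ominus>\<^bsub>T\<^esub> y)"
  shows "P x"
proof -
  obtain t where t: "t \<in> carrier PR" "x = proj t" using proj_surj[OF assms(1)] by blast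
  have "P (proj t)" using t(1)
    by (induction t rule: PR_induct) (use assms in \<open>simp_all add: proj_zero inl_inr proj_diff\<close>)
  then show ?thesis using t by simp
qed

text \<open>The universal property of the tensor product, for values in an abelian group. Only
  additivity is claimed, which suffices for coordinate maps and for the map that identifies
  \<open>A \<otimes> A'\<close> with \<open>A'\<close>.\<close>

lemma bilinear_descends:
  fixes G :: "('c, 'q) ring_scheme"
  assumes G: "abelian_group G"
    and F: "\<And>a b. a \<in> carrier A \<Longrightarrow> b \<in> carrier B \<Longrightarrow> F a b \<in> carrier G"
    and F1: "\<And>a a' b. a \<in> carrier A \<Longrightarrow> a' \<in> carrier A \<Longrightarrow> b \<in> carrier B \<Longrightarrow> F (a \<oplus>\<^bsub>A\<^esub> a') b = F a b \<oplus>\<^bsub>G\<^esub> F a' b"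
    and F2: "\<And>a b b'. a \<in> carrier A \<Longrightarrow> b \<in> carrier B \<Longrightarrow> b' \<in> carrier B \<Longrightarrow> F a (b \<oplus>\<^bsub>B\<^esub> b') = F a b \<oplus>\<^bsub>G\<^esub> F a b'"
    and F3: "\<And>s a b. s \<in> carrier S \<Longrightarrow> a \<in> carrier A \<Longrightarrow> b \<in> carrier B \<Longrightarrow> F (f s \<otimes>\<^bsub>A\<^esub> a) b = F a (g s \<otimes>\<^bsub>B\<^esub> b)"
  shows "\<exists>h. (\<forall>x\<in>carrier T. h x \<in> carrier G) \<and> (\<forall>x\<in>carrier T. \<forall>y\<in>carrier T. h (x \<oplus>\<^bsub>T\<^esub> y) = h x \<oplus>\<^bsub>G\<^esub> h y)
    \<and> (\<forall>a\<in>carrier A. \<forall>b\<in>carrier B. h (inl a \<otimes>\<^bsub>T\<^esub> inr b) = F a b)"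
proof -
  interpret G: abelian_group G by fact
  have "(\<lambda>(a, b). F a b) ` (carrier A \<times> carrier B) \<subseteq> carrier (add_monoid G)" using F by auto
  then obtain k where k: "k \<in> hom (free_Abelian_group (carrier A \<times> carrier B)) (add_monoid G)"
      and "\<And>z. z \<in> carrier A \<times> carrier B \<Longrightarrow> k (frag_of z) = (\<lambda>(a, b). F a b) z"
    using comm_group.free_Abelian_group_universal[OF G.a_comm_group] by metis
  then have kof: "k (frag_of (a, b)) = F a b" if "a \<in> carrier A" "b \<in> carrier B" for a b using that by auto
  have kc: "k t \<in> carrier G" if "t \<in> carrier PR" for t
    using k that unfolding hom_def by (auto simp: pair_ring_simps)
  have ka: "k (t + u) = k t \<oplus>\<^bsub>G\<^esub> k u" if "t \<in> carrier PR" "u \<in> carrier PR" for t u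
    using hom_mult[OF k, of t u] that by (simp add: pair_ring_simps)
  have kd: "k (t - u) = k t \<ominus>\<^bsub>G\<^esub> k u" if "t \<in> carrier PR" "u \<in> carrier PR" for t u
    using ka[of "t - u" u] that kc[OF that(1)] kc[OF that(2)] kc[OF PR_diff[OF that]]
    by (simp add: G.minus_eq G.a_assoc G.r_neg)
  have k0: "k 0 = \<zero>\<^bsub>G\<^esub>" using kd[of 0 0] kc[of 0] by (simp add: G.minus_eq G.r_neg)
  have kR: "k r = \<zero>\<^bsub>G\<^esub>" if "r \<in> Rel" for r
  proof -
    have "r \<in> carrier PR \<and> k r = \<zero>\<^bsub>G\<^esub>" using that
    proof (induction r rule: Rel_induct)
      case (add_left a a' b)
      then show ?case using F by (simp add: kd kof F1 G.minus_eq G.a_ac G.r_neg)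
    next
      case (add_right a b b')
      then show ?case using F by (simp add: kd kof F2 G.minus_eq G.a_ac G.r_neg)
    next
      case (balanced s a b)
      then show ?case using F by (simp add: kd kof F3 G.minus_eq G.r_neg)
    next
      case (diff x y)
      then show ?case by (simp add: kd G.minus_eq G.r_neg)
    qed
    then show ?thesis ..
  qed
  \<comment> \<open>A representative of each coset is chosen; since \<open>k\<close> kills all
    relations, the choice does not affect the value.\<close>
  define h where "h Y = k (SOME t. t \<in> carrier PR \<and> Y = proj t)" for Y
  have hp: "h (proj t) = k t" if t: "t \<in> carrier PR" for t
  proof -
    define u where "u = (SOME u. u \<in> carrier PR \<and> proj t = proj u)"
    have u: "u \<in> carrier PR \<and> proj t = proj u" unfolding u_def by (rule someI[of _ t]) (simp add: t)
    then have "t - u \<in> Rel" using proj_eq_iff[OF t, of u] by simp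
    then have "k (u + (t - u)) = k u \<oplus>\<^bsub>G\<^esub> \<zero>\<^bsub>G\<^esub>" using kR[of "t - u"] ka[of u "t - u"] u t by simp
    then show ?thesis using u kc unfolding h_def u_def[symmetric] by simp
  qed
  have "h (x \<oplus>\<^bsub>T\<^esub> y) = h x \<oplus>\<^bsub>G\<^esub> h y" if xy: "x \<in> carrier T" "y \<in> carrier T" for x y
  proof -
    obtain t u where "t \<in> carrier PR" "x = proj t" "u \<in> carrier PR" "y = proj u"
      using proj_surj[OF xy(1)] proj_surj[OF xy(2)] by blast
    then show ?thesis using hp[of "t + u"] hp[of t] hp[of u] by (simp add: proj_add ka)
  qed
  moreover have "h x \<in> carrier G" if "x \<in> carrier T" for x
    using proj_surj[OF that] hp kc by fastforce
  moreover have "h (inl a \<otimes>\<^bsub>T\<^esub> inr b) = F a b" if "a \<in> carrier A" "b \<in> carrier B" for a b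
    using that by (simp add: inl_inr hp kof)
  ultimately show ?thesis by (intro exI[of _ h] conjI ballI)
qed

end

section \<open>Functoriality of the tensor product in its first factor\<close>

locale tensor_mor = D: tensor S A B f g + C: tensor S A' B "\<phi> \<circ> f" g
  for S :: "('s, 'k) ring_scheme" and A :: "('a, 'm) ring_scheme" and B :: "('b, 'n) ring_scheme" and f g
    and A' :: "('c, 'q) ring_scheme" and \<phi> +
  assumes phi: "\<phi> \<in> ring_hom A A'"
begin

text \<open>The map on free abelian groups that underlies \<open>tensor_map\<close>. Working with it
  reduces the homomorphism property of the induced map to the free level.\<close>

definition ext :: "('a \<times> 'b \<Rightarrow>\<^sub>0 int) \<Rightarrow> ('c \<times> 'b \<Rightarrow>\<^sub>0 int)" where
  "ext t = frag_extend (\<lambda>(x, y). frag_of (\<phi> x, y)) t"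

lemma ext_of [simp]: "ext (frag_of (a, b)) = frag_of (\<phi> a, b)"
  by (simp add: ext_def)

lemma ext_diff: "ext (t - u) = ext t - ext u" and ext_add: "ext (t + u) = ext t + ext u"
  and ext_zero [simp]: "ext 0 = 0"
  by (simp_all add: ext_def frag_extend_diff frag_extend_add)

lemma phi_closed [simp]: "a \<in> carrier A \<Longrightarrow> \<phi> a \<in> carrier A'"
  using ring_hom_closed[OF phi] .

lemma ext_closed [simp]: "t \<in> carrier D.PR \<Longrightarrow> ext t \<in> carrier C.PR"
  by (induction t rule: D.PR_induct) (simp_all add: ext_diff)

lemma ext_times_of:
  assumes "a \<in> carrier A" "b \<in> carrier B" "u \<in> carrier D.PR"
  shows "ext (pair_times A B (frag_of (a, b)) u) = pair_times A' B (frag_of (\<phi> a, b)) (ext u)"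
  using assms(3)
proof (induction u rule: D.PR_induct)
  case (of_pair a' b')
  then show ?case using assms by (simp add: ring_hom_mult[OF phi])
qed (simp_all add: pair_times_diff_right ext_diff)

lemma ext_times:
  assumes "t \<in> carrier D.PR" "u \<in> carrier D.PR"
  shows "ext (pair_times A B t u) = pair_times A' B (ext t) (ext u)"
  using assms(1)
proof (induction t rule: D.PR_induct)
  case (of_pair a b)
  then show ?case using assms ext_times_of[of a b u] by simp
qed (simp_all add: pair_times_diff_left ext_diff)

lemma ext_Rel:
  assumes "r \<in> D.Rel" shows "ext r \<in> C.Rel"
proof -
  have "r \<in> carrier D.PR \<and> ext r \<in> C.Rel" using assms
  proof (induction r rule: D.Rel_induct)
    case (add_left a a' b)
    then have "ext (frag_of (a \<oplus>\<^bsub>A\<^esub> a', b) - frag_of (a, b) - frag_of (a', b))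
        = frag_of (\<phi> a \<oplus>\<^bsub>A'\<^esub> \<phi> a', b) - frag_of (\<phi> a, b) - frag_of (\<phi> a', b)"
      by (simp add: ext_diff ring_hom_add[OF phi])
    then show ?case using C.Rel_add_left[of "\<phi> a" "\<phi> a'" b] add_left phi_closed by metis
  next
    case (add_right a b b')
    then have "ext (frag_of (a, b \<oplus>\<^bsub>B\<^esub> b') - frag_of (a, b) - frag_of (a, b'))
        = frag_of (\<phi> a, b \<oplus>\<^bsub>B\<^esub> b') - frag_of (\<phi> a, b) - frag_of (\<phi> a, b')"
      by (simp add: ext_diff)
    then show ?case using C.Rel_add_right[of "\<phi> a" b b'] add_right phi_closed by metis
  next
    case (balanced s a b)
    then have "ext (frag_of (f s \<otimes>\<^bsub>A\<^esub> a, b) - frag_of (a, g s \<otimes>\<^bsub>B\<^esub> b))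
        = frag_of ((\<phi> \<circ> f) s \<otimes>\<^bsub>A'\<^esub> \<phi> a, b) - frag_of (\<phi> a, g s \<otimes>\<^bsub>B\<^esub> b)"
      by (simp add: ext_diff ring_hom_mult[OF phi])
    then show ?case using C.Rel_balanced[of s "\<phi> a" b] balanced phi_closed by metis
  next
    case (diff x y)
    then show ?case unfolding ext_diff by (intro C.Rel_diff)
  qed
  then show ?thesis ..
qed

abbreviation "tmap \<equiv> tensor_map S (algebra_module (\<phi> \<circ> f) A') (algebra_module g B) \<phi> (\<lambda>w. w)"

lemma tmap_proj:
  assumes t: "t \<in> carrier D.PR"
  shows "tmap (D.proj t) = C.proj (ext t)"
proof -
  have r: "r_coset (tensor_free (algebra_module (\<phi> \<circ> f) A') (algebra_module g B)) C.Rel u = C.proj u" for u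
    by (auto simp: C.proj_set r_coset_def)
  have "(\<lambda>t. r_coset (tensor_free (algebra_module (\<phi> \<circ> f) A') (algebra_module g B)) C.Rel
             (frag_extend (\<lambda>(x, y). frag_of (\<phi> x, y)) t)) ` D.proj t = {C.proj (ext t)}"
  proof -
    \<comment> \<open>All representatives of a coset have the same image, so the set in
      \<open>tensor_map\<close> is a singleton and \<open>the_elem\<close> returns the induced
      map.\<close>
    have "C.proj (ext (r + t)) = C.proj (ext t)" if "r \<in> D.Rel" for r
      using that t D.Rel_PR[OF that] ext_Rel[OF that] by (subst C.proj_eq_iff) (auto simp: ext_add)
    moreover have "t \<in> D.proj t" using D.Rel_zero by (auto simp: D.proj_set intro!: exI[of _ 0])
    ultimately show ?thesis unfolding r ext_def[symmetric] by (auto simp: D.proj_set)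
  qed
  then show ?thesis by (simp add: tensor_map_def)
qed

lemma tmap_hom: "tmap \<in> ring_hom D.T C.T"
proof (rule ring_hom_memI)
  fix x y assume "x \<in> carrier D.T" "y \<in> carrier D.T"
  then obtain t u where e: "t \<in> carrier D.PR" "x = D.proj t" "u \<in> carrier D.PR" "y = D.proj u"
    using D.proj_surj by meson
  show "tmap x \<in> carrier C.T" using e by (simp add: tmap_proj)
  show "tmap (x \<oplus>\<^bsub>D.T\<^esub> y) = tmap x \<oplus>\<^bsub>C.T\<^esub> tmap y"
    using e by (simp add: tmap_proj C.proj_add ext_add flip: D.proj_add)
  show "tmap (x \<otimes>\<^bsub>D.T\<^esub> y) = tmap x \<otimes>\<^bsub>C.T\<^esub> tmap y"
    using e by (simp add: tmap_proj ext_times flip: D.proj_mult C.proj_mult)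
qed (simp add: D.T_one C.T_one tmap_proj ring_hom_one[OF phi])

lemma tmap_inl: "a \<in> carrier A \<Longrightarrow> tmap (D.inl a) = C.inl (\<phi> a)"
  and tmap_inr: "b \<in> carrier B \<Longrightarrow> tmap (D.inr b) = C.inr b"
  by (simp_all add: D.inl_def C.inl_def D.inr_def C.inr_def tmap_proj ring_hom_one[OF phi])

end

section \<open>Power series modules\<close>

definition ps_const :: "('a, 'm) ring_scheme \<Rightarrow> 'a \<Rightarrow> nat \<Rightarrow> 'a" where
  "ps_const T t = (\<lambda>n. if n = 0 then t else \<zero>\<^bsub>T\<^esub>)"

definition ps_var :: "('a, 'm) ring_scheme \<Rightarrow> nat \<Rightarrow> 'a" where
  "ps_var T = (\<lambda>n. if n = 1 then \<one>\<^bsub>T\<^esub> else \<zero>\<^bsub>T\<^esub>)"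

lemma ps_const_nth: "ps_const T t n = (if n = 0 then t else \<zero>\<^bsub>T\<^esub>)"
  by (simp add: ps_const_def)

lemma power_series_simps:
  "F \<in> carrier (power_series_ring T) \<longleftrightarrow> (\<forall>n. F n \<in> carrier T)"
  "F \<otimes>\<^bsub>power_series_ring T\<^esub> G = (\<lambda>n. \<Oplus>\<^bsub>T\<^esub>i\<in>{..n}. F i \<otimes>\<^bsub>T\<^esub> G (n - i))"
  "\<one>\<^bsub>power_series_ring T\<^esub> = ps_const T \<one>\<^bsub>T\<^esub>"
  "\<zero>\<^bsub>power_series_ring T\<^esub> = (\<lambda>n. \<zero>\<^bsub>T\<^esub>)"
  "F \<oplus>\<^bsub>power_series_ring T\<^esub> G = (\<lambda>n. F n \<oplus>\<^bsub>T\<^esub> G n)"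
  by (auto simp: power_series_ring_def ps_const_def)

text \<open>That the power series form a commutative ring is an assumption of this locale. It is
  supplied in the end by the module hypotheses of the theorem, since the predicate
  \<open>module\<close> contains that its scalars form a commutative ring.\<close>

locale power_series = T: cring T + P: cring "power_series_ring T" for T :: "('a, 'm) ring_scheme"
begin

abbreviation "P \<equiv> power_series_ring T"
abbreviation "cst \<equiv> ps_const T"
abbreviation "uvar \<equiv> ps_var T"

lemma nth_closed [simp]: "F \<in> carrier P \<Longrightarrow> F n \<in> carrier T"
  by (simp add: power_series_simps)

lemma const_closed [simp]: "t \<in> carrier T \<Longrightarrow> cst t \<in> carrier P"
  by (simp add: power_series_simps ps_const_def)

lemma var_closed [simp]: "uvar \<in> carrier P"
  by (simp add: power_series_simps ps_var_def)

lemma const_mult_nth: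
  assumes "t \<in> carrier T" "F \<in> carrier P"
  shows "(cst t \<otimes>\<^bsub>P\<^esub> F) n = t \<otimes>\<^bsub>T\<^esub> F n"
proof -
  have "(cst t \<otimes>\<^bsub>P\<^esub> F) n = (\<Oplus>\<^bsub>T\<^esub>i\<in>{..n}. if 0 = i then t \<otimes>\<^bsub>T\<^esub> F (n - i) else \<zero>\<^bsub>T\<^esub>)"
    unfolding power_series_simps(2) using assms
    by (intro T.finsum_cong') (auto simp: ps_const_def)
  also have "\<dots> = t \<otimes>\<^bsub>T\<^esub> F (n - 0)" using assms by (intro T.finsum_singleton) auto
  finally show ?thesis by simp
qed

lemma var_mult_nth:
  assumes "F \<in> carrier P"
  shows "(uvar \<otimes>\<^bsub>P\<^esub> F) n = (case n of 0 \<Rightarrow> \<zero>\<^bsub>T\<^esub> | Suc m \<Rightarrow> F m)"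
proof (cases n)
  case 0
  then show ?thesis using assms by (simp add: power_series_simps ps_var_def T.finsum_insert)
next
  case (Suc m)
  have "(uvar \<otimes>\<^bsub>P\<^esub> F) n = (\<Oplus>\<^bsub>T\<^esub>i\<in>{..n}. if 1 = i then F (n - i) else \<zero>\<^bsub>T\<^esub>)"
    unfolding power_series_simps(2) using assms
    by (intro T.finsum_cong') (auto simp: ps_var_def)
  also have "\<dots> = F (n - 1)" using assms Suc by (intro T.finsum_singleton) auto
  finally show ?thesis using Suc by simp
qed

lemma var_pow_mult_nth:
  assumes "F \<in> carrier P"
  shows "(uvar [^]\<^bsub>P\<^esub> k \<otimes>\<^bsub>P\<^esub> F) n = (if n < k then \<zero>\<^bsub>T\<^esub> else F (n - k))"
  using assms
proof (induction k arbitrary: n)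
  case 0
  then show ?case by simp
next
  case (Suc k)
  have "uvar [^]\<^bsub>P\<^esub> Suc k \<otimes>\<^bsub>P\<^esub> F = uvar \<otimes>\<^bsub>P\<^esub> (uvar [^]\<^bsub>P\<^esub> k \<otimes>\<^bsub>P\<^esub> F)"
    using Suc.prems by (simp add: P.m_comm P.m_lcomm P.m_assoc)
  then show ?case using Suc var_mult_nth[of "uvar [^]\<^bsub>P\<^esub> k \<otimes>\<^bsub>P\<^esub> F" n] by (auto split: nat.split)
qed

lemma const_hom: "cst \<in> ring_hom T P"
proof (rule ring_hom_memI)
  fix x y assume xy: "x \<in> carrier T" "y \<in> carrier T"
  show "cst (x \<otimes>\<^bsub>T\<^esub> y) = cst x \<otimes>\<^bsub>P\<^esub> cst y"
    using xy by (auto simp: fun_eq_iff const_mult_nth ps_const_nth)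
  show "cst (x \<oplus>\<^bsub>T\<^esub> y) = cst x \<oplus>\<^bsub>P\<^esub> cst y"
    by (auto simp: fun_eq_iff power_series_simps ps_const_nth)
qed (auto simp: power_series_simps(3))

lemma divisible_var_pow:
  assumes F: "F \<in> carrier P" "\<And>k. k < n \<Longrightarrow> F k = \<zero>\<^bsub>T\<^esub>"
  shows "\<exists>G\<in>carrier P. F = uvar [^]\<^bsub>P\<^esub> n \<otimes>\<^bsub>P\<^esub> G"
proof -
  let ?G = "\<lambda>k. F (k + n)"
  have G: "?G \<in> carrier P" using F by (auto simp: power_series_simps)
  then show ?thesis using F by (intro bexI[of _ ?G]) (auto simp: fun_eq_iff var_pow_mult_nth)
qed

lemma divisible_var:
  assumes F: "F \<in> carrier P" "F 0 = \<zero>\<^bsub>T\<^esub>"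
  shows "\<exists>G\<in>carrier P. F = uvar \<otimes>\<^bsub>P\<^esub> G"
  using divisible_var_pow[of F 1] F by (simp add: P.nat_pow_eone)

lemma minus_nth:
  assumes "F \<in> carrier P" "G \<in> carrier P"
  shows "(F \<ominus>\<^bsub>P\<^esub> G) n = F n \<ominus>\<^bsub>T\<^esub> G n"
proof -
  have "((F \<ominus>\<^bsub>P\<^esub> G) \<oplus>\<^bsub>P\<^esub> G) n = F n" using assms by (simp add: P.minus_eq P.a_assoc P.l_neg)
  then have "(F \<ominus>\<^bsub>P\<^esub> G) n \<oplus>\<^bsub>T\<^esub> G n = F n" by (simp add: power_series_simps)
  then show ?thesis using assms nth_closed[of "F \<ominus>\<^bsub>P\<^esub> G" n] P.minus_closed[OF assms]
    by (metis T.minus_eq T.add.inv_solve_right' nth_closed)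
qed

lemma eq_const_plus:
  assumes "F \<in> carrier P"
  shows "\<exists>G\<in>carrier P. F = cst (F 0) \<oplus>\<^bsub>P\<^esub> uvar \<otimes>\<^bsub>P\<^esub> G"
proof -
  have "(F \<ominus>\<^bsub>P\<^esub> cst (F 0)) 0 = \<zero>\<^bsub>T\<^esub>"
    using assms by (simp add: minus_nth ps_const_nth T.minus_eq T.r_neg)
  then obtain G where "G \<in> carrier P" "F \<ominus>\<^bsub>P\<^esub> cst (F 0) = uvar \<otimes>\<^bsub>P\<^esub> G"
    using divisible_var[of "F \<ominus>\<^bsub>P\<^esub> cst (F 0)"] assms by auto
  then show ?thesis using P.eq_add_diff[of F "cst (F 0)"] assms by auto
qed

lemma finsum_nth:
  assumes "finite I" "f \<in> I \<rightarrow> carrier P"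
  shows "(\<Oplus>\<^bsub>P\<^esub>i\<in>I. f i) n = (\<Oplus>\<^bsub>T\<^esub>i\<in>I. f i n)"
  using assms
proof (induction I)
  case empty
  then show ?case by (simp add: power_series_simps)
next
  case (insert i I)
  then have "f i n \<in> carrier T" "(\<lambda>i. f i n) \<in> I \<rightarrow> carrier T"
    using nth_closed by (auto simp: Pi_iff)
  moreover have "(\<Oplus>\<^bsub>P\<^esub>i\<in>insert i I. f i) n = f i n \<oplus>\<^bsub>T\<^esub> (\<Oplus>\<^bsub>P\<^esub>i\<in>I. f i) n"
    using insert by (simp add: P.finsum_insert Pi_iff) (simp add: power_series_simps(5))
  ultimately show ?case using insert by (simp add: T.finsum_insert Pi_iff)
qed

lemma var_separated: "adic_separated P uvar"
  unfolding adic_separated_def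
proof (intro ballI impI)
  fix F assume "F \<in> carrier P" and F: "\<forall>n::nat. \<exists>b\<in>carrier P. F = uvar [^]\<^bsub>P\<^esub> n \<otimes>\<^bsub>P\<^esub> b"
  have "F n = \<zero>\<^bsub>T\<^esub>" for n
  proof -
    obtain b where "b \<in> carrier P" "F = uvar [^]\<^bsub>P\<^esub> Suc n \<otimes>\<^bsub>P\<^esub> b" using F by blast
    then show ?thesis using var_pow_mult_nth[of b "Suc n" n] by simp
  qed
  then show "F = \<zero>\<^bsub>P\<^esub>" by (auto simp: power_series_simps)
qed

lemma var_cancel:
  assumes "F \<in> carrier P" "uvar \<otimes>\<^bsub>P\<^esub> F = \<zero>\<^bsub>P\<^esub>"
  shows "F = \<zero>\<^bsub>P\<^esub>"
proof -
  have "F n = \<zero>\<^bsub>T\<^esub>" for n using var_mult_nth[OF assms(1), of "Suc n"] unfolding assms(2) by (simp add: power_series_simps(4))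
  then show ?thesis by (auto simp: power_series_simps)
qed

lemma var_complete: "adic_complete P uvar"
  unfolding adic_complete_def
proof (intro ballI)
  fix s assume "s \<in> (UNIV :: nat set) \<rightarrow> carrier P"
  then have s: "s k \<in> carrier P" for k by auto
  \<comment> \<open>Multiplication by \<open>u^i\<close> shifts by \<open>i\<close>, so only the
    terms up to \<open>k\<close> reach the coefficient with index \<open>k\<close>, and the infinite
    sum is finite in each coefficient.\<close>
  define l where "l k = (\<Oplus>\<^bsub>T\<^esub>i\<in>{..k}. s i (k - i))" for k
  have l: "l \<in> carrier P" unfolding power_series_simps(1) l_def using s by (auto intro!: T.finsum_closed)
  have "\<exists>t\<in>carrier P. l = (\<Oplus>\<^bsub>P\<^esub>k\<in>{..<n}. uvar [^]\<^bsub>P\<^esub> k \<otimes>\<^bsub>P\<^esub> s k) \<oplus>\<^bsub>P\<^esub> uvar [^]\<^bsub>P\<^esub> n \<otimes>\<^bsub>P\<^esub> t" for n :: nat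
  proof -
    let ?S = "\<Oplus>\<^bsub>P\<^esub>k\<in>{..<n}. uvar [^]\<^bsub>P\<^esub> k \<otimes>\<^bsub>P\<^esub> s k"
    have S: "?S \<in> carrier P" using s by (intro P.finsum_closed) auto
    have "?S k = l k" if "k < n" for k
    proof -
      have "?S k = (\<Oplus>\<^bsub>T\<^esub>i\<in>{..<n}. (uvar [^]\<^bsub>P\<^esub> i \<otimes>\<^bsub>P\<^esub> s i) k)" using s by (intro finsum_nth) auto
      also have "\<dots> = (\<Oplus>\<^bsub>T\<^esub>i\<in>{..<n}. if k < i then \<zero>\<^bsub>T\<^esub> else s i (k - i))"
        using s by (intro T.finsum_cong') (auto simp: var_pow_mult_nth)
      also have "\<dots> = (\<Oplus>\<^bsub>T\<^esub>i\<in>{..k}. s i (k - i))"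
        using s that by (intro T.add.finprod_mono_neutral_cong_right) auto
      finally show ?thesis by (simp add: l_def)
    qed
    then have "(l \<ominus>\<^bsub>P\<^esub> ?S) k = \<zero>\<^bsub>T\<^esub>" if "k < n" for k
      using that minus_nth[OF l S, of k] nth_closed[OF l, of k] by (simp add: T.minus_eq T.r_neg)
    then obtain t where t: "t \<in> carrier P" "l \<ominus>\<^bsub>P\<^esub> ?S = uvar [^]\<^bsub>P\<^esub> n \<otimes>\<^bsub>P\<^esub> t"
      using divisible_var_pow[OF P.minus_closed[OF l S], of n] by blast
    have "l = ?S \<oplus>\<^bsub>P\<^esub> (l \<ominus>\<^bsub>P\<^esub> ?S)" by (rule P.eq_add_diff[OF l S])
    then show ?thesis unfolding t(2) using t(1) by blast
  qed
  then show "\<exists>l\<in>carrier P. \<forall>n. \<exists>t\<in>carrier P.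
      l = (\<Oplus>\<^bsub>P\<^esub>k\<in>{..<n}. uvar [^]\<^bsub>P\<^esub> k \<otimes>\<^bsub>P\<^esub> s k) \<oplus>\<^bsub>P\<^esub> uvar [^]\<^bsub>P\<^esub> n \<otimes>\<^bsub>P\<^esub> t" using l by blast
qed

end

lemma power_series_map_const: "h \<zero>\<^bsub>T\<^esub> = \<zero>\<^bsub>T'\<^esub> \<Longrightarrow> power_series_map h (ps_const T t) = ps_const T' (h t)"
  by (auto simp: power_series_map_def ps_const_def)

lemma power_series_map_var: "h \<zero>\<^bsub>T\<^esub> = \<zero>\<^bsub>T'\<^esub> \<Longrightarrow> h \<one>\<^bsub>T\<^esub> = \<one>\<^bsub>T'\<^esub> \<Longrightarrow> power_series_map h (ps_var T) = ps_var T'"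
  by (auto simp: power_series_map_def ps_var_def)

lemma ex1_eq: "\<exists>!x. Q x \<Longrightarrow> Q a \<Longrightarrow> Q b \<Longrightarrow> a = b"
  by blast

context module
begin

text \<open>Passes from an independent spanning family to the set-based notion with unique
  extensional coefficients. The family is injective, since equal members would give a relation with
  a coefficient \<open>1\<close>.\<close>

lemma finite_free_of_basis:
  assumes sp: "spans_mod R M {\<zero>\<^bsub>M\<^esub>} (carrier M) I e" and ind: "indep_mod R M {\<zero>\<^bsub>M\<^esub>} I e"
  shows "finite_free_module R M"
proof (cases "\<one> = \<zero>")
  case True
  \<comment> \<open>Over the zero ring every module is zero and an independent family may repeat
    vectors, so the empty basis is taken instead of the image of the family.\<close>
  then have 0: "x = \<zero>\<^bsub>M\<^esub>" if "x \<in> carrier M" for x using that smult_one[of x] by simp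
  show ?thesis
    unfolding finite_free_module_def using module_axioms 0
    by (intro conjI exI[of _ "{}"]) auto
next
  case False
  have fin: "finite I" and e: "e \<in> I \<rightarrow> carrier M" using ind by (auto simp: indep_mod_def)
  have inj: "inj_on e I"
  proof (rule inj_onI, rule ccontr)
    fix i j assume ij: "i \<in> I" "j \<in> I" "e i = e j" "i \<noteq> j"
    let ?c = "\<lambda>k. (if k = i then \<one> else \<zero>) \<ominus> (if k = j then \<one> else \<zero>)"
    have "lincomb R M I ?c e = \<one> \<odot>\<^bsub>M\<^esub> e i \<ominus>\<^bsub>M\<^esub> \<one> \<odot>\<^bsub>M\<^esub> e j"
      using e ij fin by (subst lincomb_diff) (auto simp: lincomb_single)
    also have "\<dots> = \<zero>\<^bsub>M\<^esub>" using ij funcset_mem[OF e ij(1)] by (simp add: M.minus_eq M.r_neg)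
    finally have "lincomb R M I ?c e \<in> {\<zero>\<^bsub>M\<^esub>}" by simp
    moreover have "?c \<in> I \<rightarrow> carrier R" by auto
    ultimately have "?c i = \<zero>" using ind ij unfolding indep_mod_def by blast
    then show False using ij False by (simp add: R.minus_eq)
  qed
  have re: "(\<Oplus>\<^bsub>M\<^esub>b\<in>e ` I. c b \<odot>\<^bsub>M\<^esub> b) = lincomb R M I (\<lambda>i. c (e i)) e" if "c \<in> e ` I \<rightarrow> carrier R" for c
    unfolding lincomb_def using that e inj by (intro M.finsum_reindex) (auto simp: Pi_iff)
  show ?thesis
    unfolding finite_free_module_def
  proof (intro conjI exI[of _ "e ` I"] ballI)
    show "module R M" by (rule module_axioms)
    show "e ` I \<subseteq> carrier M" "finite (e ` I)" using e fin by auto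
    fix x assume x: "x \<in> carrier M"
    then obtain c where c: "c \<in> I \<rightarrow> carrier R" "x = lincomb R M I c e"
      using spans_modD[OF sp, of x] mcong_trivial by metis
    define d where "d = restrict (\<lambda>b. c (inv_into I e b)) (e ` I)"
    have d: "d \<in> e ` I \<rightarrow>\<^sub>E carrier R" "\<And>i. i \<in> I \<Longrightarrow> d (e i) = c i"
      using c inj by (auto simp: d_def inv_into_f_f)
    have "x = (\<Oplus>\<^bsub>M\<^esub>b\<in>e ` I. d b \<odot>\<^bsub>M\<^esub> b)"
      using d c e by (subst re) (auto intro!: lincomb_cong)
    moreover have "d' = d" if d': "d' \<in> e ` I \<rightarrow>\<^sub>E carrier R" "x = (\<Oplus>\<^bsub>M\<^esub>b\<in>e ` I. d' b \<odot>\<^bsub>M\<^esub> b)" for d'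
    proof
      fix b
      show "d' b = d b"
      proof (cases "b \<in> e ` I")
        case True
        then obtain i where i: "i \<in> I" "b = e i" by blast
        have xx: "x = lincomb R M I (\<lambda>i. d' (e i)) e" using d' by (subst re[symmetric]) auto
        have dd: "(\<lambda>i. d' (e i)) \<in> I \<rightarrow> carrier R" using d' by auto
        have "lincomb R M I (\<lambda>i. d' (e i) \<ominus> c i) e = x \<ominus>\<^bsub>M\<^esub> x"
          using lincomb_diff[OF dd c(1) e] xx c(2) by simp
        then have "lincomb R M I (\<lambda>i. d' (e i) \<ominus> c i) e \<in> {\<zero>\<^bsub>M\<^esub>}" using x by (simp add: M.minus_eq M.r_neg)
        moreover have "(\<lambda>i. d' (e i) \<ominus> c i) \<in> I \<rightarrow> carrier R" using dd c by auto
        ultimately have "d' (e i) \<ominus> c i = \<zero>" using ind i unfolding indep_mod_def by blast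
        then show ?thesis using i dd c d by (metis R.r_right_minus_eq funcset_mem)
      next
        case False
        then show ?thesis using d d' by (auto simp: PiE_def extensional_def)
      qed
    qed
    ultimately show "\<exists>!c. c \<in> e ` I \<rightarrow>\<^sub>E carrier R \<and> x = (\<Oplus>\<^bsub>M\<^esub>b\<in>e ` I. c b \<odot>\<^bsub>M\<^esub> b)"
      using d(1) by (intro ex1I[of _ d] conjI) auto
  qed
qed

lemma basis_of_finite_free:
  assumes "finite_free_module R M"
  shows "\<exists>B. spans_mod R M {\<zero>\<^bsub>M\<^esub>} (carrier M) B (\<lambda>b. b) \<and> indep_mod R M {\<zero>\<^bsub>M\<^esub>} B (\<lambda>b. b)"
proof -
  obtain B where B: "B \<subseteq> carrier M" "finite B"
    and u': "\<forall>x\<in>carrier M. \<exists>!c. c \<in> B \<rightarrow>\<^sub>E carrier R \<and> x = (\<Oplus>\<^bsub>M\<^esub>b\<in>B. c b \<odot>\<^bsub>M\<^esub> b)"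
    using assms[unfolded finite_free_module_def] by (elim conjE exE) (rule that; assumption)
  note u = bspec[OF u']
  have BM: "(\<lambda>b. b) \<in> B \<rightarrow> carrier M" using B by auto
  have "spans_mod R M {\<zero>\<^bsub>M\<^esub>} (carrier M) B (\<lambda>b. b)"
    unfolding spans_mod_def mcong_trivial
  proof (intro conjI ballI B(2) BM)
    fix d assume d: "d \<in> carrier M"
    obtain c where "c \<in> B \<rightarrow>\<^sub>E carrier R" "d = (\<Oplus>\<^bsub>M\<^esub>b\<in>B. c b \<odot>\<^bsub>M\<^esub> b)"
      using ex1_implies_ex[OF u[OF d]] by (elim exE conjE) (rule that)
    then show "\<exists>c\<in>B \<rightarrow> carrier R. d \<in> carrier M \<and> d = lincomb R M B c (\<lambda>b. b)"
      using d by (intro bexI[of _ c]) (auto simp: lincomb_def)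
  qed
  moreover have "indep_mod R M {\<zero>\<^bsub>M\<^esub>} B (\<lambda>b. b)"
    unfolding indep_mod_def
  proof (intro conjI ballI impI B(2) BM)
    fix c b assume c: "c \<in> B \<rightarrow> carrier R" "lincomb R M B c (\<lambda>b. b) \<in> {\<zero>\<^bsub>M\<^esub>}" and b: "b \<in> B"
    let ?z = "restrict (\<lambda>b. \<zero>) B" and ?c = "restrict c B"
    have "(\<Oplus>\<^bsub>M\<^esub>b\<in>B. ?c b \<odot>\<^bsub>M\<^esub> b) = lincomb R M B c (\<lambda>b. b)"
      unfolding lincomb_def using c BM by (intro M.finsum_cong') (auto simp: Pi_iff)
    moreover have "(\<Oplus>\<^bsub>M\<^esub>b\<in>B. ?z b \<odot>\<^bsub>M\<^esub> b) = lincomb R M B ?z (\<lambda>b. b)" by (simp add: lincomb_def)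
    moreover have "lincomb R M B ?z (\<lambda>b. b) = \<zero>\<^bsub>M\<^esub>" using BM by (intro lincomb_zero) auto
    ultimately have "?c = ?z" using c
      by (intro ex1_eq[OF u[OF M.zero_closed]]) auto
    then show "c b = \<zero>" using b by (metis restrict_apply')
  qed
  ultimately show ?thesis by blast
qed

end

section \<open>Descent along idempotents\<close>

lemma restrict_restrict_scalars:
  "restrict_scalars \<alpha> (restrict_scalars h M) = restrict_scalars (\<lambda>a. h (\<alpha> a)) M"
  by (simp add: restrict_scalars_def)

lemma (in module) submodule_restrict:
  assumes "submodule L R M" "cring S" "h \<in> ring_hom S R"
  shows "submodule L S (restrict_scalars h M)"
proof -
  interpret N: module S "restrict_scalars h M" by (rule module_restrict_scalars[OF assms(2,3) module_axioms])
  have inv: "\<ominus>\<^bsub>restrict_scalars h M\<^esub> x = \<ominus>\<^bsub>M\<^esub> x" for x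
    by (simp add: a_inv_def m_inv_def)
  show ?thesis
    using submoduleE[OF assms(1)] submodule_zero[OF assms(1)] ring_hom_closed[OF assms(3)]
    by (intro N.submoduleI) (auto simp: inv)
qed

lemma (in abelian_group) add_minus_cancel_left:
  assumes "x \<in> carrier G" "y \<in> carrier G"
  shows "(x \<oplus> y) \<ominus> x = y"
  using assms by (simp add: minus_eq a_assoc) (metis a_comm a_inv_closed r_neg2)

context module
begin

lemma lincomb_reindex:
  assumes "bij_betw f J I" "c \<in> I \<rightarrow> carrier R" "e \<in> I \<rightarrow> carrier M"
  shows "lincomb R M I c e = lincomb R M J (\<lambda>j. c (f j)) (\<lambda>j. e (f j))"
proof -
  have "I = f ` J" "inj_on f J" using assms(1) by (auto simp: bij_betw_def)
  then show ?thesis unfolding lincomb_def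
    using assms(2,3) by (simp add: M.finsum_reindex Pi_iff)
qed

lemma spans_mod_reindex:
  assumes f: "bij_betw f J I" and s: "spans_mod R M L D I e" and D: "D \<subseteq> carrier M"
  shows "spans_mod R M L D J (\<lambda>j. e (f j))"
  unfolding spans_mod_def
proof (intro conjI ballI)
  have fJ: "f \<in> J \<rightarrow> I" using f by (auto simp: bij_betw_def)
  have eM: "e \<in> I \<rightarrow> carrier M" using s D unfolding spans_mod_def Pi_def by blast
  show "finite J" using s bij_betw_finite[OF f] by (simp add: spans_mod_def)
  show "(\<lambda>j. e (f j)) \<in> J \<rightarrow> D" using s fJ by (auto simp: spans_mod_def Pi_iff)
  fix d assume "d \<in> D"
  then obtain c where c: "c \<in> I \<rightarrow> carrier R" "mcong M L d (lincomb R M I c e)" using spans_modD[OF s] by blast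
  then show "\<exists>c\<in>J \<rightarrow> carrier R. mcong M L d (lincomb R M J c (\<lambda>j. e (f j)))"
    using lincomb_reindex[OF f c(1) eM] fJ by (intro bexI[of _ "\<lambda>j. c (f j)"]) (auto simp: Pi_iff)
qed

lemma indep_mod_reindex:
  assumes f: "bij_betw f J I" and n: "indep_mod R M L I e"
  shows "indep_mod R M L J (\<lambda>j. e (f j))"
  unfolding indep_mod_def
proof (intro conjI ballI impI)
  have fJ: "f \<in> J \<rightarrow> I" using f by (auto simp: bij_betw_def)
  have eM: "e \<in> I \<rightarrow> carrier M" using n unfolding indep_mod_def by blast
  show "finite J" using n bij_betw_finite[OF f] by (simp add: indep_mod_def)
  show "(\<lambda>j. e (f j)) \<in> J \<rightarrow> carrier M" using eM fJ by (auto simp: Pi_iff)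
  fix c j assume c: "c \<in> J \<rightarrow> carrier R" "lincomb R M J c (\<lambda>j. e (f j)) \<in> L" and j: "j \<in> J"
  let ?g = "inv_into J f"
  have g: "?g (f i) = i" if "i \<in> J" for i using f that by (auto simp: bij_betw_def inv_into_f_f)
  have gI: "?g i \<in> J" if "i \<in> I" for i using f that by (metis bij_betw_imp_surj_on inv_into_into)
  have cg: "(\<lambda>i. c (?g i)) \<in> I \<rightarrow> carrier R" using c gI by (auto simp: Pi_iff)
  have "lincomb R M I (\<lambda>i. c (?g i)) e = lincomb R M J (\<lambda>j. c (?g (f j))) (\<lambda>j. e (f j))"
    by (rule lincomb_reindex[OF f cg eM])
  also have "\<dots> = lincomb R M J c (\<lambda>j. e (f j))" using c eM fJ by (intro lincomb_cong) (auto simp: g Pi_iff)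
  finally have "lincomb R M I (\<lambda>i. c (?g i)) e \<in> L" using c by simp
  then have "c (?g (f j)) = \<zero>" using n cg fJ j unfolding indep_mod_def by (auto simp: Pi_iff)
  then show "c j = \<zero>" using g j by simp
qed

end

lemma ring_hom_zero':
  assumes "h \<in> ring_hom R S" "ring R" "ring S"
  shows "h \<zero>\<^bsub>R\<^esub> = \<zero>\<^bsub>S\<^esub>"
  using assms ring_hom_zero by blast

lemma ring_hom_comp: "f \<in> ring_hom R S \<Longrightarrow> g \<in> ring_hom S T \<Longrightarrow> (\<lambda>x. g (f x)) \<in> ring_hom R T"
  using ring_hom_trans[of f R S g T] by (simp add: comp_def)

text \<open>The part of the argument that knows nothing about Witt vectors. \<open>T\<close> and
  \<open>T'\<close> stand for the two tensor products, \<open>\<epsilon>\<close> for the eigenspace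
  idempotents, \<open>x\<close> for a generator of the maximal ideal of \<open>A'\<close>, and
  \<open>z\<close> for \<open>p\<close>. By \<open>eps_T\<close> and \<open>eps_free\<close> each
  nonzero \<open>\<epsilon> i T\<close> is free over \<open>A\<close> on the generator
  \<open>\<epsilon> i\<close>; on the primed side generation suffices. The relation
  \<open>c x = \<phi> (\<alpha> z)\<close> turns \<open>z\<close>-torsion into control over
  \<open>x\<close>-torsion.\<close>

locale descent = Z: domain Z + A: cring A + A': cring A' + T: cring T + T': cring T'
  + PS: power_series T + PS': power_series T' + M: module "power_series_ring T'" M
  for Z :: "('z, 'z1) ring_scheme" and A :: "('a, 'a1) ring_scheme" and A' :: "('b, 'b1) ring_scheme"
    and T :: "('c, 'c1) ring_scheme" and T' :: "('d, 'd1) ring_scheme"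
    and M :: "(nat \<Rightarrow> 'd, 'x, 'x1) module_scheme" +
  fixes \<alpha> :: "'z \<Rightarrow> 'a" and \<phi> :: "'a \<Rightarrow> 'b" and l :: "'a \<Rightarrow> 'c" and l' :: "'b \<Rightarrow> 'd" and h :: "'c \<Rightarrow> 'd"
    and I :: "nat set" and \<epsilon> :: "nat \<Rightarrow> 'c" and x c :: 'b and z :: 'z
  assumes alpha: "\<alpha> \<in> ring_hom Z A" and phi: "\<phi> \<in> ring_hom A A'"
    and l: "l \<in> ring_hom A T" and l': "l' \<in> ring_hom A' T'" and h: "h \<in> ring_hom T T'"
    and compat: "\<And>a. a \<in> carrier A \<Longrightarrow> h (l a) = l' (\<phi> a)"
    and I: "finite I" and eps: "\<And>i. i \<in> I \<Longrightarrow> \<epsilon> i \<in> carrier T"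
    and eps_sum: "(\<Oplus>\<^bsub>T\<^esub>i\<in>I. \<epsilon> i) = \<one>\<^bsub>T\<^esub>"
    and eps_orth: "\<And>i j. i \<in> I \<Longrightarrow> j \<in> I \<Longrightarrow> i \<noteq> j \<Longrightarrow> \<epsilon> i \<otimes>\<^bsub>T\<^esub> \<epsilon> j = \<zero>\<^bsub>T\<^esub>"
    and eps_T: "\<And>i t. i \<in> I \<Longrightarrow> t \<in> carrier T \<Longrightarrow> \<exists>a\<in>carrier A. \<epsilon> i \<otimes>\<^bsub>T\<^esub> t = l a \<otimes>\<^bsub>T\<^esub> \<epsilon> i"
    and eps_T': "\<And>i t. i \<in> I \<Longrightarrow> t \<in> carrier T' \<Longrightarrow> \<exists>a\<in>carrier A'. h (\<epsilon> i) \<otimes>\<^bsub>T'\<^esub> t = l' a \<otimes>\<^bsub>T'\<^esub> h (\<epsilon> i)"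
    and eps_free: "\<And>i a. i \<in> I \<Longrightarrow> a \<in> carrier A \<Longrightarrow> \<epsilon> i \<noteq> \<zero>\<^bsub>T\<^esub> \<Longrightarrow> l a \<otimes>\<^bsub>T\<^esub> \<epsilon> i = \<zero>\<^bsub>T\<^esub> \<Longrightarrow> a = \<zero>\<^bsub>A\<^esub>"
    and x: "x \<in> carrier A'" and c: "c \<in> carrier A'" and z: "z \<in> carrier Z" and cx: "c \<otimes>\<^bsub>A'\<^esub> x = \<phi> (\<alpha> z)"
    and T_tf: "\<And>t. t \<in> carrier T \<Longrightarrow> l (\<alpha> z) \<otimes>\<^bsub>T\<^esub> t = \<zero>\<^bsub>T\<^esub> \<Longrightarrow> t = \<zero>\<^bsub>T\<^esub>"
    and A'_local: "\<And>a. a \<in> carrier A' \<Longrightarrow> a \<in> Units A' \<or> (\<exists>b\<in>carrier A'. a = x \<otimes>\<^bsub>A'\<^esub> b)"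
    and A'_sep: "adic_separated A' x"
    and M_free: "finite_free_module (power_series_ring T) (restrict_scalars (power_series_map h) M)"
begin

abbreviation "P \<equiv> power_series_ring T"
abbreviation "P' \<equiv> power_series_ring T'"
abbreviation "u \<equiv> ps_var T"
abbreviation "u' \<equiv> ps_var T'"
abbreviation "MP \<equiv> restrict_scalars (power_series_map h) M"
abbreviation act (infixl "\<bullet>" 70) where "t \<bullet> m \<equiv> ps_const T' t \<odot>\<^bsub>M\<^esub> m"
abbreviation "L \<equiv> (\<lambda>m. u' \<odot>\<^bsub>M\<^esub> m) ` carrier M"
text \<open>The one additive group \<open>M\<close> is regarded as a module over \<open>T\<close>,
  \<open>A'\<close>, \<open>A\<close> and \<open>Z\<close> by letting them act through constant
  power series. Congruences modulo \<open>L\<close> then mean the same over all of them.\<close>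

abbreviation "MT \<equiv> restrict_scalars (\<lambda>t. ps_const T' (h t)) M"
abbreviation "MA' \<equiv> restrict_scalars (\<lambda>a. ps_const T' (l' a)) M"
abbreviation "MA \<equiv> restrict_scalars (\<lambda>a. ps_const T' (l' (\<phi> a))) M"
abbreviation "MZ \<equiv> restrict_scalars (\<lambda>a. ps_const T' (l' (\<phi> (\<alpha> a)))) M"
abbreviation "D i \<equiv> (\<lambda>m. h (\<epsilon> i) \<bullet> m) ` carrier M"

lemma h_closed [simp]: "t \<in> carrier T \<Longrightarrow> h t \<in> carrier T'" using ring_hom_closed[OF h] .
lemma l_closed [simp]: "a \<in> carrier A \<Longrightarrow> l a \<in> carrier T" using ring_hom_closed[OF l] .
lemma l'_closed [simp]: "a \<in> carrier A' \<Longrightarrow> l' a \<in> carrier T'" using ring_hom_closed[OF l'] .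
lemma phi_closed [simp]: "a \<in> carrier A \<Longrightarrow> \<phi> a \<in> carrier A'" using ring_hom_closed[OF phi] .
lemma alpha_closed [simp]: "a \<in> carrier Z \<Longrightarrow> \<alpha> a \<in> carrier A" using ring_hom_closed[OF alpha] .

lemma h_zero: "h \<zero>\<^bsub>T\<^esub> = \<zero>\<^bsub>T'\<^esub>" by (rule ring_hom_zero'[OF h T.ring_axioms T'.ring_axioms])
lemma h_one: "h \<one>\<^bsub>T\<^esub> = \<one>\<^bsub>T'\<^esub>" using ring_hom_one[OF h] .

lemma hom_MT: "(\<lambda>t. ps_const T' (h t)) \<in> ring_hom T P'" by (rule ring_hom_comp[OF h PS'.const_hom])
lemma hom_MA': "(\<lambda>a. ps_const T' (l' a)) \<in> ring_hom A' P'" by (rule ring_hom_comp[OF l' PS'.const_hom])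
lemma hom_MA: "(\<lambda>a. ps_const T' (l' (\<phi> a))) \<in> ring_hom A P'" by (rule ring_hom_comp[OF phi hom_MA'])
lemma hom_MZ: "(\<lambda>a. ps_const T' (l' (\<phi> (\<alpha> a)))) \<in> ring_hom Z P'" by (rule ring_hom_comp[OF alpha hom_MA])

sublocale MP: module P MP using M_free by (simp add: finite_free_module_def)
sublocale MT: module T MT by (rule module_restrict_scalars[OF T.is_cring hom_MT M.module_axioms])
sublocale MA': module A' MA' by (rule module_restrict_scalars[OF A'.is_cring hom_MA' M.module_axioms])
sublocale MA: module A MA by (rule module_restrict_scalars[OF A.is_cring hom_MA M.module_axioms])
sublocale MZ: module Z MZ by (rule module_restrict_scalars[OF Z.is_cring hom_MZ M.module_axioms])

lemma L_M: "submodule L P' M" by (rule M.submodule_image[OF M.carrier_is_submodule]) simp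
lemma L_MT: "submodule L T MT" by (rule M.submodule_restrict[OF L_M T.is_cring hom_MT])
lemma L_MA': "submodule L A' MA'" by (rule M.submodule_restrict[OF L_M A'.is_cring hom_MA'])
lemma L_MZ: "submodule L Z MZ" by (rule M.submodule_restrict[OF L_M Z.is_cring hom_MZ])

lemma D_M: "i \<in> I \<Longrightarrow> submodule (D i) P' M"
  using eps by (intro M.submodule_image[OF M.carrier_is_submodule]) simp
lemma D_MA': "i \<in> I \<Longrightarrow> submodule (D i) A' MA'" by (rule M.submodule_restrict[OF D_M A'.is_cring hom_MA'])
lemma D_MA: "i \<in> I \<Longrightarrow> submodule (D i) A MA" by (rule M.submodule_restrict[OF D_M A.is_cring hom_MA])

lemma act_mult: "s \<in> carrier T' \<Longrightarrow> t \<in> carrier T' \<Longrightarrow> m \<in> carrier M \<Longrightarrow> (s \<otimes>\<^bsub>T'\<^esub> t) \<bullet> m = s \<bullet> (t \<bullet> m)"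
  by (simp add: ring_hom_mult[OF PS'.const_hom] M.smult_assoc1)

lemma smult_MP_const: "t \<in> carrier T \<Longrightarrow> ps_const T t \<odot>\<^bsub>MP\<^esub> m = h t \<bullet> m"
  by (simp add: power_series_map_const[of h T T', OF h_zero])

lemma smult_MP_var: "u \<odot>\<^bsub>MP\<^esub> m = u' \<odot>\<^bsub>M\<^esub> m"
  by (simp add: power_series_map_var[of h T T', OF h_zero h_one])

lemma smult_P'_mod_L:
  assumes "F \<in> carrier P'" "m \<in> carrier M"
  shows "mcong M L (F \<odot>\<^bsub>M\<^esub> m) (F 0 \<bullet> m)"
proof -
  obtain G where G: "G \<in> carrier P'" "F = ps_const T' (F 0) \<oplus>\<^bsub>P'\<^esub> u' \<otimes>\<^bsub>P'\<^esub> G"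
    using PS'.eq_const_plus[OF assms(1)] by blast
  have "F \<odot>\<^bsub>M\<^esub> m = F 0 \<bullet> m \<oplus>\<^bsub>M\<^esub> u' \<odot>\<^bsub>M\<^esub> (G \<odot>\<^bsub>M\<^esub> m)"
    using arg_cong[OF G(2), of "\<lambda>F. F \<odot>\<^bsub>M\<^esub> m"] G(1) assms PS'.nth_closed[OF assms(1), of 0]
    by (simp add: M.smult_l_distr M.smult_assoc1)
  then have "F \<odot>\<^bsub>M\<^esub> m \<ominus>\<^bsub>M\<^esub> F 0 \<bullet> m = u' \<odot>\<^bsub>M\<^esub> (G \<odot>\<^bsub>M\<^esub> m)"
    using G assms PS'.nth_closed[OF assms(1), of 0] by (simp add: M.add_minus_cancel_left)
  then show ?thesis using G assms PS'.nth_closed[OF assms(1), of 0] by (simp add: mcong_def)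
qed

lemma smult_MP_mod_L:
  assumes "F \<in> carrier P" "m \<in> carrier M"
  shows "mcong M L (F \<odot>\<^bsub>MP\<^esub> m) (F 0 \<odot>\<^bsub>MT\<^esub> m)"
  using smult_P'_mod_L[of "power_series_map h F" m] assms by (simp add: power_series_map_def power_series_simps(1))

lemma lincomb_MA: "lincomb A MA J a e = lincomb T MT J (\<lambda>j. l (a j)) e" if "a \<in> J \<rightarrow> carrier A" "e \<in> J \<rightarrow> carrier M"
  unfolding lincomb_def restrict_scalars_finsum
  using that by (intro M.finsum_cong') (auto simp: compat Pi_iff)

lemma h_eps: "i \<in> I \<Longrightarrow> h (\<epsilon> i) \<in> carrier T'"
  using eps by simp

text \<open>Multiply the decomposition of \<open>1\<close> by \<open>\<epsilon> i\<close>;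
  orthogonality removes all other terms.\<close>

lemma eps_idem: "i \<in> I \<Longrightarrow> \<epsilon> i \<otimes>\<^bsub>T\<^esub> \<epsilon> i = \<epsilon> i"
proof -
  assume i: "i \<in> I"
  have "\<epsilon> i = \<epsilon> i \<otimes>\<^bsub>T\<^esub> (\<Oplus>\<^bsub>T\<^esub>j\<in>I. \<epsilon> j)" using i eps by (simp add: eps_sum)
  also have "\<dots> = (\<Oplus>\<^bsub>T\<^esub>j\<in>I. \<epsilon> i \<otimes>\<^bsub>T\<^esub> \<epsilon> j)" using i eps I by (intro T.finsum_rdistr) auto
  also have "\<dots> = (\<Oplus>\<^bsub>T\<^esub>j\<in>I. if i = j then \<epsilon> i \<otimes>\<^bsub>T\<^esub> \<epsilon> j else \<zero>\<^bsub>T\<^esub>)"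
    using i eps by (intro T.finsum_cong') (auto simp: eps_orth)
  also have "\<dots> = \<epsilon> i \<otimes>\<^bsub>T\<^esub> \<epsilon> i" using i eps I by (intro T.finsum_singleton) auto
  finally show ?thesis by simp
qed

lemma h_eps_mult:
  assumes "i \<in> I" "j \<in> I"
  shows "h (\<epsilon> i) \<otimes>\<^bsub>T'\<^esub> h (\<epsilon> j) = (if i = j then h (\<epsilon> i) else \<zero>\<^bsub>T'\<^esub>)"
  using assms eps eps_idem eps_orth h_zero by (auto simp flip: ring_hom_mult[OF h])

lemma h_eps_sum: "(\<Oplus>\<^bsub>T'\<^esub>i\<in>I. h (\<epsilon> i)) = \<one>\<^bsub>T'\<^esub>"
proof -
  interpret H: ring_hom_cring T T' h
    by (rule ring_hom_cringI[OF T.is_cring T'.is_cring h])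
  have "(\<Oplus>\<^bsub>T'\<^esub>i\<in>I. h (\<epsilon> i)) = h (\<Oplus>\<^bsub>T\<^esub>i\<in>I. \<epsilon> i)" using eps by (subst H.hom_finsum) (auto simp: comp_def)
  then show ?thesis by (simp add: eps_sum h_one)
qed

lemma act_eps_D: "i \<in> I \<Longrightarrow> d \<in> D i \<Longrightarrow> h (\<epsilon> i) \<bullet> d = d"
  using h_eps h_eps_mult by (auto simp flip: act_mult)

lemma act_eps_orth: "i \<in> I \<Longrightarrow> j \<in> I \<Longrightarrow> i \<noteq> j \<Longrightarrow> d \<in> D i \<Longrightarrow> h (\<epsilon> j) \<bullet> d = \<zero>\<^bsub>M\<^esub>"
proof -
  assume a: "i \<in> I" "j \<in> I" "i \<noteq> j" "d \<in> D i"
  then obtain m where m: "m \<in> carrier M" "d = h (\<epsilon> i) \<bullet> m" by blast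
  have "ps_const T' \<zero>\<^bsub>T'\<^esub> = \<zero>\<^bsub>P'\<^esub>" by (auto simp: ps_const_def power_series_simps)
  then show "h (\<epsilon> j) \<bullet> d = \<zero>\<^bsub>M\<^esub>" using a m h_eps h_eps_mult[of j i] by (simp flip: act_mult)
qed

lemma act_zero: "m \<in> carrier M \<Longrightarrow> \<zero>\<^bsub>T'\<^esub> \<bullet> m = \<zero>\<^bsub>M\<^esub>"
proof -
  have "ps_const T' \<zero>\<^bsub>T'\<^esub> = \<zero>\<^bsub>P'\<^esub>" by (auto simp: ps_const_def power_series_simps)
  then show "m \<in> carrier M \<Longrightarrow> \<zero>\<^bsub>T'\<^esub> \<bullet> m = \<zero>\<^bsub>M\<^esub>" by simp
qed

definition B where
  "B = (SOME B. spans_mod P MP {\<zero>\<^bsub>M\<^esub>} (carrier M) B (\<lambda>b. b) \<and> indep_mod P MP {\<zero>\<^bsub>M\<^esub>} B (\<lambda>b. b))"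

lemma B: "spans_mod P MP {\<zero>\<^bsub>M\<^esub>} (carrier M) B (\<lambda>b. b)" "indep_mod P MP {\<zero>\<^bsub>M\<^esub>} B (\<lambda>b. b)"
  using someI_ex[OF MP.basis_of_finite_free[OF M_free]] unfolding B_def by auto

lemma finite_B: "finite B" and B_M: "(\<lambda>b. b) \<in> B \<rightarrow> carrier M"
  using B by (auto simp: spans_mod_def)

lemma B_expand:
  assumes "m \<in> carrier M"
  obtains cc where "cc \<in> B \<rightarrow> carrier P" "m = lincomb P MP B cc (\<lambda>b. b)"
proof -
  obtain cc where "cc \<in> B \<rightarrow> carrier P" "mcong MP {\<zero>\<^bsub>MP\<^esub>} m (lincomb P MP B cc (\<lambda>b. b))"
    using MP.spans_modD[OF B(1), of m] assms by auto
  then show ?thesis using that MP.mcong_trivial by metis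
qed

lemma B_eq_zero:
  assumes "cc \<in> B \<rightarrow> carrier P" "lincomb P MP B cc (\<lambda>b. b) = \<zero>\<^bsub>M\<^esub>" "b \<in> B"
  shows "cc b = \<zero>\<^bsub>P\<^esub>"
  using B(2) assms unfolding indep_mod_def by auto

lemma lincomb_MP_mod_L:
  assumes "cc \<in> B \<rightarrow> carrier P"
  shows "mcong M L (lincomb P MP B cc (\<lambda>b. b)) (lincomb T MT B (\<lambda>b. cc b 0) (\<lambda>b. b))"
  unfolding lincomb_def restrict_scalars_finsum
  using assms B_M by (intro M.mcong_finsum[OF L_M] smult_MP_mod_L) auto

lemma spans_MT: "spans_mod T MT L (carrier M) B (\<lambda>b. b)"
  unfolding spans_mod_def
proof (intro conjI ballI finite_B B_M)
  fix d assume "d \<in> carrier M"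
  then obtain cc where cc: "cc \<in> B \<rightarrow> carrier P" "d = lincomb P MP B cc (\<lambda>b. b)" by (rule B_expand)
  have "(\<lambda>b. cc b 0) \<in> B \<rightarrow> carrier T" using cc by (auto simp: Pi_iff)
  then show "\<exists>cc\<in>B \<rightarrow> carrier T. mcong MT L d (lincomb T MT B cc (\<lambda>b. b))"
    using lincomb_MP_mod_L[OF cc(1)] cc(2) by auto
qed

text \<open>If a combination with constant coefficients lies in \<open>u M\<close>, expand the
  cofactor of \<open>u\<close> in the basis \<open>B\<close> and compare coefficients over the power
  series: each constant equals a multiple of \<open>u\<close>, hence vanishes.\<close>

lemma indep_MT:
  assumes t: "t \<in> B \<rightarrow> carrier T" "lincomb T MT B t (\<lambda>b. b) \<in> L" "b \<in> B"
  shows "t b = \<zero>\<^bsub>T\<^esub>"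
proof -
  have BM: "(\<lambda>b. b) \<in> B \<rightarrow> carrier MP" using B_M by simp
  obtain m where m: "m \<in> carrier M" "lincomb T MT B t (\<lambda>b. b) = u' \<odot>\<^bsub>M\<^esub> m" using t(2) by blast
  obtain d where d: "d \<in> B \<rightarrow> carrier P" "m = lincomb P MP B d (\<lambda>b. b)" using B_expand[OF m(1)] by blast
  have ct: "(\<lambda>b. ps_const T (t b)) \<in> B \<rightarrow> carrier P" using t(1) by (auto simp: Pi_iff)
  have ud: "(\<lambda>b. u \<otimes>\<^bsub>P\<^esub> d b) \<in> B \<rightarrow> carrier P" using d by auto
  have "lincomb P MP B (\<lambda>b. ps_const T (t b)) (\<lambda>b. b) = lincomb T MT B t (\<lambda>b. b)"
    unfolding lincomb_def restrict_scalars_finsum using t B_M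
    by (intro M.finsum_cong') (auto simp: smult_MP_const[simplified] Pi_iff)
  also have "\<dots> = u \<odot>\<^bsub>MP\<^esub> m" using m smult_MP_var by simp
  also have "\<dots> = lincomb P MP B (\<lambda>b. u \<otimes>\<^bsub>P\<^esub> d b) (\<lambda>b. b)"
    unfolding d(2) using MP.lincomb_smult[OF _ d(1) BM, of u] by simp
  finally have e: "lincomb P MP B (\<lambda>b. ps_const T (t b)) (\<lambda>b. b) = lincomb P MP B (\<lambda>b. u \<otimes>\<^bsub>P\<^esub> d b) (\<lambda>b. b)" .
  have "lincomb P MP B (\<lambda>b. ps_const T (t b) \<ominus>\<^bsub>P\<^esub> u \<otimes>\<^bsub>P\<^esub> d b) (\<lambda>b. b) = \<zero>\<^bsub>MP\<^esub>"
    using MP.lincomb_diff[OF ct ud BM] e MP.lincomb_closed[OF ud BM] by (simp add: M.minus_eq M.r_neg)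
  then have "ps_const T (t b) \<ominus>\<^bsub>P\<^esub> u \<otimes>\<^bsub>P\<^esub> d b = \<zero>\<^bsub>P\<^esub>"
    using B_eq_zero[of "\<lambda>b. ps_const T (t b) \<ominus>\<^bsub>P\<^esub> u \<otimes>\<^bsub>P\<^esub> d b" b] ct ud t(3) by auto
  then have "ps_const T (t b) = u \<otimes>\<^bsub>P\<^esub> d b"
    using PS.P.r_right_minus_eq[OF funcset_mem[OF ct t(3)] funcset_mem[OF ud t(3)]] by simp
  then have "t b = (u \<otimes>\<^bsub>P\<^esub> d b) 0" using ps_const_nth[of T "t b" 0] by simp
  then show ?thesis using PS.var_mult_nth[of "d b" 0] d t(3) by auto
qed

lemma lincomb_eps:
  assumes i: "i \<in> I" and a: "a \<in> J \<rightarrow> carrier A" and e: "e \<in> J \<rightarrow> carrier M"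
  shows "lincomb A MA J a (\<lambda>b. h (\<epsilon> i) \<bullet> e b) = lincomb T MT J (\<lambda>b. l (a b) \<otimes>\<^bsub>T\<^esub> \<epsilon> i) e"
proof -
  have "lincomb A MA J a (\<lambda>b. h (\<epsilon> i) \<bullet> e b) = lincomb T MT J (\<lambda>b. l (a b)) (\<lambda>b. h (\<epsilon> i) \<bullet> e b)"
    using a e i h_eps by (intro lincomb_MA) auto
  also have "\<dots> = lincomb T MT J (\<lambda>b. l (a b) \<otimes>\<^bsub>T\<^esub> \<epsilon> i) e"
    unfolding lincomb_def restrict_scalars_finsum using a e i eps
    by (intro M.finsum_cong') (auto simp: ring_hom_mult[OF h] act_mult Pi_iff)
  finally show ?thesis .
qed

text \<open>After multiplication by \<open>\<epsilon> i\<close> every coefficient from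
  \<open>T\<close> can be replaced by one from \<open>A\<close>, by \<open>eps_T\<close>. So the
  projected basis of \<open>M\<close> generates the part at \<open>\<epsilon> i\<close> over the
  small ring \<open>A\<close>.\<close>

lemma spans_D:
  assumes i: "i \<in> I"
  shows "spans_mod A MA L (D i) B (\<lambda>b. h (\<epsilon> i) \<bullet> b)"
  unfolding spans_mod_def
proof (intro conjI ballI finite_B)
  show "(\<lambda>b. h (\<epsilon> i) \<bullet> b) \<in> B \<rightarrow> D i" using B_M by auto
  fix d assume "d \<in> D i"
  then obtain m where m: "m \<in> carrier M" "d = h (\<epsilon> i) \<bullet> m" by blast
  obtain t where t: "t \<in> B \<rightarrow> carrier T" "mcong MT L m (lincomb T MT B t (\<lambda>b. b))"
    using MT.spans_modD[OF spans_MT m(1)] by blast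
  have "\<exists>a. \<forall>b\<in>B. a b \<in> carrier A \<and> \<epsilon> i \<otimes>\<^bsub>T\<^esub> t b = l (a b) \<otimes>\<^bsub>T\<^esub> \<epsilon> i"
    by (rule bchoice) (use eps_T[OF i] t in \<open>auto simp: Pi_iff Bex_def\<close>)
  then obtain a where a: "\<And>b. b \<in> B \<Longrightarrow> a b \<in> carrier A \<and> \<epsilon> i \<otimes>\<^bsub>T\<^esub> t b = l (a b) \<otimes>\<^bsub>T\<^esub> \<epsilon> i" by blast
  have BM: "(\<lambda>b. b) \<in> B \<rightarrow> carrier MT" using B_M by simp
  have "mcong MT L (\<epsilon> i \<odot>\<^bsub>MT\<^esub> m) (\<epsilon> i \<odot>\<^bsub>MT\<^esub> lincomb T MT B t (\<lambda>b. b))"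
    by (rule MT.mcong_smult[OF L_MT t(2) eps[OF i]])
  also have "\<epsilon> i \<odot>\<^bsub>MT\<^esub> lincomb T MT B t (\<lambda>b. b) = lincomb T MT B (\<lambda>b. \<epsilon> i \<otimes>\<^bsub>T\<^esub> t b) (\<lambda>b. b)"
    using MT.lincomb_smult[OF eps[OF i] t(1) BM] by simp
  also have "\<dots> = lincomb T MT B (\<lambda>b. l (a b) \<otimes>\<^bsub>T\<^esub> \<epsilon> i) (\<lambda>b. b)"
    using a BM eps[OF i] by (intro MT.lincomb_cong) auto
  also have "\<dots> = lincomb A MA B a (\<lambda>b. h (\<epsilon> i) \<bullet> b)"
    using a B_M by (intro lincomb_eps[OF i, symmetric]) auto
  finally have "mcong MA L d (lincomb A MA B a (\<lambda>b. h (\<epsilon> i) \<bullet> b))" using m by simp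
  then show "\<exists>a\<in>B \<rightarrow> carrier A. mcong MA L d (lincomb A MA B a (\<lambda>b. h (\<epsilon> i) \<bullet> b))"
    using a by (intro bexI[of _ a]) auto
qed

lemma indep_D:
  assumes i: "i \<in> I" "\<epsilon> i \<noteq> \<zero>\<^bsub>T\<^esub>"
  shows "indep_mod A MA L B (\<lambda>b. h (\<epsilon> i) \<bullet> b)"
  unfolding indep_mod_def
proof (intro conjI ballI impI finite_B)
  show "(\<lambda>b. h (\<epsilon> i) \<bullet> b) \<in> B \<rightarrow> carrier MA" using B_M i h_eps by auto
  fix a b assume a: "a \<in> B \<rightarrow> carrier A" "lincomb A MA B a (\<lambda>b. h (\<epsilon> i) \<bullet> b) \<in> L" and b: "b \<in> B"
  have "lincomb T MT B (\<lambda>b. l (a b) \<otimes>\<^bsub>T\<^esub> \<epsilon> i) (\<lambda>b. b) \<in> L"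
    using a(2) lincomb_eps[OF i(1) a(1) B_M] by simp
  moreover have "(\<lambda>b. l (a b) \<otimes>\<^bsub>T\<^esub> \<epsilon> i) \<in> B \<rightarrow> carrier T" using a(1) eps[OF i(1)] by (auto simp: Pi_iff)
  ultimately have "l (a b) \<otimes>\<^bsub>T\<^esub> \<epsilon> i = \<zero>\<^bsub>T\<^esub>"
    using indep_MT[of "\<lambda>b. l (a b) \<otimes>\<^bsub>T\<^esub> \<epsilon> i" b] b by blast
  then show "a b = \<zero>\<^bsub>A\<^esub>" using eps_free[OF i(1) _ i(2)] a b by auto
qed

text \<open>Multiplying by \<open>c\<close> turns \<open>x\<close> into \<open>z\<close>, and
  \<open>z\<close> acts without torsion on \<open>M / u M\<close> because this quotient is free over
  \<open>T\<close>.\<close>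

lemma torsion_free_mod_L:
  assumes "m \<in> carrier M" "x \<odot>\<^bsub>MA'\<^esub> m \<in> L"
  shows "m \<in> L"
proof -
  have "c \<odot>\<^bsub>MA'\<^esub> (x \<odot>\<^bsub>MA'\<^esub> m) \<in> L" using MA'.submoduleE(4)[OF L_MA' c assms(2)] .
  then have "\<phi> (\<alpha> z) \<odot>\<^bsub>MA'\<^esub> m \<in> L" using MA'.smult_assoc1[OF c x, of m] assms(1) by (simp add: cx)
  then have zm: "l (\<alpha> z) \<odot>\<^bsub>MT\<^esub> m \<in> L" using z by (simp add: compat)
  obtain t where t: "t \<in> B \<rightarrow> carrier T" "mcong MT L m (lincomb T MT B t (\<lambda>b. b))"
    using MT.spans_modD[OF spans_MT assms(1)] by blast
  have lz: "l (\<alpha> z) \<in> carrier T" using z by simp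
  have BM: "(\<lambda>b. b) \<in> B \<rightarrow> carrier MT" using B_M by simp
  have "l (\<alpha> z) \<odot>\<^bsub>MT\<^esub> lincomb T MT B t (\<lambda>b. b) \<in> L"
    using MT.mcong_in[OF L_MT MT.mcong_smult[OF L_MT t(2) lz]] zm by simp
  then have "lincomb T MT B (\<lambda>b. l (\<alpha> z) \<otimes>\<^bsub>T\<^esub> t b) (\<lambda>b. b) \<in> L"
    using MT.lincomb_smult[OF lz t(1) BM] by simp
  then have "l (\<alpha> z) \<otimes>\<^bsub>T\<^esub> t b = \<zero>\<^bsub>T\<^esub>" if "b \<in> B" for b
    using indep_MT[of "\<lambda>b. l (\<alpha> z) \<otimes>\<^bsub>T\<^esub> t b" b] that t lz by auto
  then have "t b = \<zero>\<^bsub>T\<^esub>" if "b \<in> B" for b using T_tf that t by auto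
  then have "lincomb T MT B t (\<lambda>b. b) = \<zero>\<^bsub>MT\<^esub>" using BM by (intro MT.lincomb_zero) auto
  then show ?thesis using MT.mcong_in[OF L_MT t(2)] MT.submodule_zero[OF L_MT] by simp
qed

text \<open>Generators over \<open>A\<close> are generators over \<open>A'\<close>, and
  torsion-freeness lets a basis be selected among them. Taking a subset of \<open>B\<close> keeps
  the bases for different \<open>i\<close> finite and of the same kind.\<close>

lemma A'_basis:
  assumes i: "i \<in> I"
  shows "\<exists>J\<subseteq>B. spans_mod A' MA' L (D i) J (\<lambda>b. h (\<epsilon> i) \<bullet> b) \<and> indep_mod A' MA' L J (\<lambda>b. h (\<epsilon> i) \<bullet> b)"
proof (rule MA'.torsion_free_basis[OF L_MA' D_MA'[OF i] x A'_local A'_sep])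
  have "restrict_scalars \<phi> MA' = MA" by (simp add: restrict_restrict_scalars)
  then show "spans_mod A' MA' L (D i) B (\<lambda>b. h (\<epsilon> i) \<bullet> b)"
    using MA'.spans_mod_extend_scalars[OF phi, of L "D i" B] spans_D[OF i] by simp
  show "d \<in> L" if "d \<in> D i" "x \<odot>\<^bsub>MA'\<^esub> d \<in> L" for d
    using torsion_free_mod_L[of d] that MA'.submodule_carrier[OF D_MA'[OF i]] by simp
qed

definition basis :: "nat \<Rightarrow> 'x set" where
  "basis i = (SOME J. J \<subseteq> B \<and> spans_mod A' MA' L (D i) J (\<lambda>b. h (\<epsilon> i) \<bullet> b) \<and> indep_mod A' MA' L J (\<lambda>b. h (\<epsilon> i) \<bullet> b))"

lemma basis:
  assumes "i \<in> I"
  shows "basis i \<subseteq> B" "spans_mod A' MA' L (D i) (basis i) (\<lambda>b. h (\<epsilon> i) \<bullet> b)"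
    "indep_mod A' MA' L (basis i) (\<lambda>b. h (\<epsilon> i) \<bullet> b)"
  using someI_ex[OF A'_basis[OF assms]] unfolding basis_def by auto

text \<open>Both counts below are the rank over \<open>Z\<close> of the image of \<open>\<epsilon>\<^sub>i M\<close> in \<open>M / uM\<close>.\<close>

lemma card_basis:
  assumes i: "i \<in> I" "\<epsilon> i \<noteq> \<zero>\<^bsub>T\<^esub>"
    and K: "spans_mod Z (algebra_module \<alpha> A) {\<zero>\<^bsub>A\<^esub>} (carrier A) K g" "indep_mod Z (algebra_module \<alpha> A) {\<zero>\<^bsub>A\<^esub>} K g"
    and K': "spans_mod Z (algebra_module (\<phi> \<circ> \<alpha>) A') {\<zero>\<^bsub>A'\<^esub>} (carrier A') K' g'"
      "indep_mod Z (algebra_module (\<phi> \<circ> \<alpha>) A') {\<zero>\<^bsub>A'\<^esub>} K' g'"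
  shows "card B * card K = card (basis i) * card K'"
proof -
  have pa: "\<phi> \<circ> \<alpha> \<in> ring_hom Z A'" by (rule ring_hom_trans[OF alpha phi])
  have e1: "restrict_scalars \<alpha> MA = MZ" by (simp add: restrict_restrict_scalars)
  have e2: "restrict_scalars (\<phi> \<circ> \<alpha>) MA' = MZ" by (simp add: restrict_restrict_scalars comp_def)
  note s1 = MA.spans_mod_Times[OF Z.is_cring alpha D_MA[OF i(1)] spans_D[OF i(1)] K(1), unfolded e1]
  note i1 = MA.indep_mod_Times[OF Z.is_cring alpha indep_D[OF i] K(2), unfolded e1]
  note s2 = MA'.spans_mod_Times[OF Z.is_cring pa D_MA'[OF i(1)] basis(2)[OF i(1)] K'(1), unfolded e2]
  note i2 = MA'.indep_mod_Times[OF Z.is_cring pa basis(3)[OF i(1)] K'(2), unfolded e2]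
  \<comment> \<open>Two bases of the same quotient are compared in both directions, one as the
    spanning family and the other as the independent one; no denominators are needed, so
    \<open>s\<close> is \<open>1\<close>.\<close>
  have le: "card J1 \<le> card J2"
    if s: "spans_mod Z MZ L (D i) J2 e2" and n: "indep_mod Z MZ L J1 e1" and D: "e1 \<in> J1 \<rightarrow> D i" for J1 J2 e1 e2
  proof (rule MZ.indep_card_le[OF Z.domain_axioms L_MZ _ _ _ n])
    show "finite J2" "e2 \<in> J2 \<rightarrow> carrier MZ"
      using s M.submoduleE(1)[OF D_M[OF i(1)]] unfolding spans_mod_def Pi_def restrict_scalars_simps by blast+
    fix j assume "j \<in> J1"
    then have "e1 j \<in> D i" using D by auto
    then obtain cc where "cc \<in> J2 \<rightarrow> carrier Z" "mcong MZ L (e1 j) (lincomb Z MZ J2 cc e2)"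
      using MZ.spans_modD[OF s] by blast
    moreover have "\<one>\<^bsub>Z\<^esub> \<odot>\<^bsub>MZ\<^esub> e1 j = e1 j"
      using MZ.smult_one[of "e1 j"] M.submodule_carrier[OF D_M[OF i(1)] \<open>e1 j \<in> D i\<close>] by simp
    ultimately show "\<exists>s\<in>carrier Z - {\<zero>\<^bsub>Z\<^esub>}. \<exists>c\<in>J2 \<rightarrow> carrier Z. mcong MZ L (s \<odot>\<^bsub>MZ\<^esub> e1 j) (lincomb Z MZ J2 c e2)"
      using Z.one_not_zero by (intro bexI[of _ "\<one>\<^bsub>Z\<^esub>"] bexI[of _ cc]) auto
  qed
  have "card (B \<times> K) \<le> card (basis i \<times> K')" by (rule le[OF s2 i1]) (use s1 in \<open>simp add: spans_mod_def\<close>)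
  moreover have "card (basis i \<times> K') \<le> card (B \<times> K)" by (rule le[OF s1 i2]) (use s2 in \<open>simp add: spans_mod_def\<close>)
  ultimately show ?thesis by (simp add: card_cartesian_product)
qed

text \<open>Read off in coordinates with respect to \<open>B\<close>: divisibility of
  \<open>m\<close> by all powers of \<open>u\<close> passes to its coefficients, and power series
  are separated.\<close>

lemma M_separated:
  assumes m: "m \<in> carrier M" "\<And>n::nat. \<exists>d\<in>carrier M. m = (u' [^]\<^bsub>P'\<^esub> n) \<odot>\<^bsub>M\<^esub> d"
  shows "m = \<zero>\<^bsub>M\<^esub>"
proof -
  have BM: "(\<lambda>b. b) \<in> B \<rightarrow> carrier MP" using B_M by simp
  \<comment> \<open>The powers of \<open>u'\<close> are exchanged for those of \<open>u\<close> one
    factor at a time, through their actions on \<open>M\<close>.\<close>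
  have pow: "(u' [^]\<^bsub>P'\<^esub> n) \<odot>\<^bsub>M\<^esub> d = (u [^]\<^bsub>P\<^esub> n) \<odot>\<^bsub>MP\<^esub> d" if "d \<in> carrier M" for n :: nat and d
    using that
  proof (induction n arbitrary: d)
    case 0
    then show ?case using MP.smult_one[of d] by simp
  next
    case (Suc n)
    have "(u [^]\<^bsub>P\<^esub> Suc n) \<odot>\<^bsub>MP\<^esub> d = (u [^]\<^bsub>P\<^esub> n) \<odot>\<^bsub>MP\<^esub> (u \<odot>\<^bsub>MP\<^esub> d)"
      using MP.smult_assoc1[of "u [^]\<^bsub>P\<^esub> n" u d] Suc.prems by simp
    also have "\<dots> = (u' [^]\<^bsub>P'\<^esub> n) \<odot>\<^bsub>M\<^esub> (u' \<odot>\<^bsub>M\<^esub> d)"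
      using Suc.IH[of "u' \<odot>\<^bsub>M\<^esub> d"] Suc.prems smult_MP_var[of d] by simp
    also have "\<dots> = (u' [^]\<^bsub>P'\<^esub> Suc n) \<odot>\<^bsub>M\<^esub> d" using Suc.prems by (simp add: M.smult_assoc1)
    finally show ?case by simp
  qed
  obtain cc where cc: "cc \<in> B \<rightarrow> carrier P" "m = lincomb P MP B cc (\<lambda>b. b)" using B_expand[OF m(1)] by blast
  have "cc b = \<zero>\<^bsub>P\<^esub>" if b: "b \<in> B" for b
  proof (rule adic_separatedD[OF PS.var_separated])
    show "cc b \<in> carrier P" using cc b by auto
    fix n :: nat
    obtain d where d: "d \<in> carrier M" "m = (u' [^]\<^bsub>P'\<^esub> n) \<odot>\<^bsub>M\<^esub> d" using m(2) by blast
    obtain dd where dd: "dd \<in> B \<rightarrow> carrier P" "d = lincomb P MP B dd (\<lambda>b. b)" using B_expand[OF d(1)] by blast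
    have ud: "(\<lambda>b. u [^]\<^bsub>P\<^esub> n \<otimes>\<^bsub>P\<^esub> dd b) \<in> B \<rightarrow> carrier P" using dd by auto
    have "m = (u [^]\<^bsub>P\<^esub> n) \<odot>\<^bsub>MP\<^esub> d" using d pow by simp
    also have "\<dots> = lincomb P MP B (\<lambda>b. u [^]\<^bsub>P\<^esub> n \<otimes>\<^bsub>P\<^esub> dd b) (\<lambda>b. b)"
      unfolding dd(2) using MP.lincomb_smult[OF _ dd(1) BM, of "u [^]\<^bsub>P\<^esub> n"] by simp
    finally have "lincomb P MP B (\<lambda>b. cc b \<ominus>\<^bsub>P\<^esub> u [^]\<^bsub>P\<^esub> n \<otimes>\<^bsub>P\<^esub> dd b) (\<lambda>b. b) = \<zero>\<^bsub>M\<^esub>"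
      using MP.lincomb_diff[OF cc(1) ud BM] cc(2) m(1) by (simp add: M.minus_eq M.r_neg)
    then have "cc b \<ominus>\<^bsub>P\<^esub> u [^]\<^bsub>P\<^esub> n \<otimes>\<^bsub>P\<^esub> dd b = \<zero>\<^bsub>P\<^esub>"
      using B_eq_zero[of "\<lambda>b. cc b \<ominus>\<^bsub>P\<^esub> u [^]\<^bsub>P\<^esub> n \<otimes>\<^bsub>P\<^esub> dd b" b] cc ud b by auto
    then have "cc b = u [^]\<^bsub>P\<^esub> n \<otimes>\<^bsub>P\<^esub> dd b" using PS.P.r_right_minus_eq[OF funcset_mem[OF cc(1) b] funcset_mem[OF ud b]] by simp
    then show "\<exists>b'\<in>carrier P. cc b = u [^]\<^bsub>P\<^esub> n \<otimes>\<^bsub>P\<^esub> b'" using dd b by auto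
  qed
  then have "lincomb P MP B cc (\<lambda>b. b) = \<zero>\<^bsub>MP\<^esub>" using BM by (intro MP.lincomb_zero) auto
  then show ?thesis using cc by simp
qed

lemma var_torsion_free:
  assumes m: "m \<in> carrier M" "u' \<odot>\<^bsub>M\<^esub> m = \<zero>\<^bsub>M\<^esub>"
  shows "m = \<zero>\<^bsub>M\<^esub>"
proof -
  have BM: "(\<lambda>b. b) \<in> B \<rightarrow> carrier MP" using B_M by simp
  obtain cc where cc: "cc \<in> B \<rightarrow> carrier P" "m = lincomb P MP B cc (\<lambda>b. b)" using B_expand[OF m(1)] by blast
  have "u \<odot>\<^bsub>MP\<^esub> m = lincomb P MP B (\<lambda>b. u \<otimes>\<^bsub>P\<^esub> cc b) (\<lambda>b. b)"
    unfolding cc(2) using MP.lincomb_smult[OF _ cc(1) BM, of u] by simp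
  then have "lincomb P MP B (\<lambda>b. u \<otimes>\<^bsub>P\<^esub> cc b) (\<lambda>b. b) = \<zero>\<^bsub>M\<^esub>" using m smult_MP_var[of m] by simp
  then have "u \<otimes>\<^bsub>P\<^esub> cc b = \<zero>\<^bsub>P\<^esub>" if "b \<in> B" for b
    using B_eq_zero[of "\<lambda>b. u \<otimes>\<^bsub>P\<^esub> cc b" b] cc(1) that by (auto simp: Pi_iff)
  then have "cc b = \<zero>\<^bsub>P\<^esub>" if "b \<in> B" for b using PS.var_cancel[of "cc b"] cc that by auto
  then have "lincomb P MP B cc (\<lambda>b. b) = \<zero>\<^bsub>MP\<^esub>" using BM by (intro MP.lincomb_zero) auto
  then show ?thesis using cc by simp
qed

text \<open>Since the parts at all nonzero idempotents have bases of the same size, these can be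
  added index by index to vectors \<open>e t\<close>. Multiplication by \<open>\<epsilon> j\<close>
  recovers the \<open>j\<close>-th basis, so \<open>e\<close> is a basis modulo \<open>u\<close>,
  which is then lifted.\<close>

theorem finite_free:
  assumes K: "spans_mod Z (algebra_module \<alpha> A) {\<zero>\<^bsub>A\<^esub>} (carrier A) K g" "indep_mod Z (algebra_module \<alpha> A) {\<zero>\<^bsub>A\<^esub>} K g"
    and K': "spans_mod Z (algebra_module (\<phi> \<circ> \<alpha>) A') {\<zero>\<^bsub>A'\<^esub>} (carrier A') K' g'"
      "indep_mod Z (algebra_module (\<phi> \<circ> \<alpha>) A') {\<zero>\<^bsub>A'\<^esub>} K' g'" "K' \<noteq> {}"
  shows "finite_free_module P' M"
proof -
  \<comment> \<open>A vanishing idempotent contributes the zero part of \<open>M\<close>, whose rank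
    would spoil the common value \<open>s\<close>; it is left out.\<close>
  define I' where "I' = {i \<in> I. \<epsilon> i \<noteq> \<zero>\<^bsub>T\<^esub>}"
  \<comment> \<open>The common rank. The division is exact by \<open>card_basis\<close>, and
    \<open>K'\<close> is nonempty.\<close>
  define s where "s = card B * card K div card K'"
  have I': "finite I'" "I' \<subseteq> I" using I by (auto simp: I'_def)
  have "finite K'" using K'(1) by (simp add: spans_mod_def)
  then have "card (basis i) = s" if "i \<in> I'" for i
    using card_basis[OF _ _ K K'(1,2), of i] that K'(3) by (auto simp: I'_def s_def)
  moreover have "finite (basis i)" if "i \<in> I'" for i using basis(1)[of i] that I' finite_B finite_subset by blast
  ultimately have "\<exists>f. bij_betw f {0..<s} (basis i)" if "i \<in> I'" for i using ex_bij_betw_nat_finite that by metis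
  then obtain \<beta> where beta: "\<And>i. i \<in> I' \<Longrightarrow> bij_betw (\<beta> i) {0..<s} (basis i)" by metis
  let ?S = "{0..<s}"
  define v where "v i t = h (\<epsilon> i) \<bullet> \<beta> i t" for i t
  have sv: "spans_mod A' MA' L (D i) ?S (v i)" if "i \<in> I'" for i
    using MA'.spans_mod_reindex[OF beta[OF that] basis(2)[of i]] that I' M.submoduleE(1)[OF D_M[of i]]
    unfolding v_def by auto
  have nv: "indep_mod A' MA' L ?S (v i)" if "i \<in> I'" for i
    using MA'.indep_mod_reindex[OF beta[OF that] basis(3)[of i]] that I' unfolding v_def by auto
  have vD: "v i t \<in> D i" if "i \<in> I'" "t \<in> ?S" for i t using sv[OF that(1)] that unfolding spans_mod_def by blast
  have vM: "v i t \<in> carrier M" if "i \<in> I'" "t \<in> ?S" for i t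
    using vD[OF that] M.submodule_carrier[OF D_M[of i]] that I' by blast
  define e where "e t = (\<Oplus>\<^bsub>M\<^esub>i\<in>I'. v i t)" for t
  have eM: "e \<in> ?S \<rightarrow> carrier M" unfolding e_def using vM by (auto intro!: M.finsum_closed)
  have Ee: "h (\<epsilon> j) \<bullet> e t = v j t" if j: "j \<in> I'" and t: "t \<in> ?S" for j t
  proof -
    have "h (\<epsilon> j) \<bullet> e t = (\<Oplus>\<^bsub>M\<^esub>i\<in>I'. h (\<epsilon> j) \<bullet> v i t)"
      unfolding e_def using j t vM h_eps I' by (intro M.finsum_smult_ldistr) auto
    also have "\<dots> = (\<Oplus>\<^bsub>M\<^esub>i\<in>I'. if j = i then v j t else \<zero>\<^bsub>M\<^esub>)"
    proof (intro M.finsum_cong' refl)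
      fix i assume i: "i \<in> I'"
      then have ij: "i \<in> I" "j \<in> I" using j I' by auto
      show "h (\<epsilon> j) \<bullet> v i t = (if j = i then v j t else \<zero>\<^bsub>M\<^esub>)"
        using act_eps_D[OF ij(2), of "v j t"] act_eps_orth[OF ij _ vD[OF i t]] vD[OF j t] by auto
    qed (use vM[OF j t] in auto)
    also have "\<dots> = v j t" using I' j t vM by (intro M.finsum_singleton) auto
    finally show ?thesis .
  qed
  \<comment> \<open>Combinations of the \<open>i\<close>-th basis over \<open>A'\<close> are
    combinations of the glued vectors, with coefficients supported at \<open>\<epsilon> i\<close>.
    This translation is used for spanning and, backwards, for independence.\<close>
  have lv: "lincomb A' MA' ?S a (v i) = lincomb P' M ?S (\<lambda>t. ps_const T' (l' (a t) \<otimes>\<^bsub>T'\<^esub> h (\<epsilon> i))) e"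
    if "i \<in> I'" "a \<in> ?S \<rightarrow> carrier A'" for i a
    unfolding lincomb_def restrict_scalars_finsum restrict_scalars_simps
  proof (intro M.finsum_cong' refl)
    fix t assume t: "t \<in> ?S"
    have "i \<in> I" "a t \<in> carrier A'" "e t \<in> carrier M" using that t I' eM by auto
    then show "l' (a t) \<bullet> v i t = ps_const T' (l' (a t) \<otimes>\<^bsub>T'\<^esub> h (\<epsilon> i)) \<odot>\<^bsub>M\<^esub> e t"
      using Ee[OF that(1) t] h_eps by (simp add: act_mult)
  qed (use that I' eM h_eps in \<open>auto simp: Pi_iff subset_iff\<close>)
  have gen: "\<exists>cc\<in>?S \<rightarrow> carrier P'. \<exists>d\<in>carrier M. m = lincomb P' M ?S cc e \<oplus>\<^bsub>M\<^esub> u' \<odot>\<^bsub>M\<^esub> d" if m: "m \<in> carrier M" for m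
  proof -
    have "\<exists>a. a \<in> ?S \<rightarrow> carrier A' \<and> mcong M L (h (\<epsilon> i) \<bullet> m) (lincomb A' MA' ?S a (v i))" if i: "i \<in> I'" for i
    proof -
      have "h (\<epsilon> i) \<bullet> m \<in> D i" using m by (rule imageI)
      then obtain a where "a \<in> ?S \<rightarrow> carrier A'" "mcong MA' L (h (\<epsilon> i) \<bullet> m) (lincomb A' MA' ?S a (v i))"
        by (rule MA'.spans_modD[OF sv[OF i]])
      then show ?thesis unfolding M.mcong_restrict_scalars by (intro exI conjI)
    qed
    then obtain a where a: "\<And>i. i \<in> I' \<Longrightarrow> a i \<in> ?S \<rightarrow> carrier A'"
        and am: "\<And>i. i \<in> I' \<Longrightarrow> mcong M L (h (\<epsilon> i) \<bullet> m) (lincomb A' MA' ?S (a i) (v i))"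
      by metis
    define C where "C i t = ps_const T' (l' (a i t) \<otimes>\<^bsub>T'\<^esub> h (\<epsilon> i))" for i t
    have C_eq: "C i = (\<lambda>t. ps_const T' (l' (a i t) \<otimes>\<^bsub>T'\<^esub> h (\<epsilon> i)))" for i by (simp add: C_def fun_eq_iff)
    have C: "C i \<in> ?S \<rightarrow> carrier P'" if "i \<in> I'" for i
      using a[OF that] that I' h_eps unfolding C_def by (auto simp: Pi_iff subset_iff)
    have "m = (\<Oplus>\<^bsub>T\<^esub>i\<in>I. \<epsilon> i) \<odot>\<^bsub>MT\<^esub> m" using m MT.smult_one[of m] by (simp add: eps_sum)
    also have "\<dots> = (\<Oplus>\<^bsub>M\<^esub>i\<in>I. h (\<epsilon> i) \<bullet> m)"
      using MT.finsum_smult_rdistr[of \<epsilon> I m] m eps by auto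
    also have "\<dots> = (\<Oplus>\<^bsub>M\<^esub>i\<in>I'. h (\<epsilon> i) \<bullet> m)"
      using m h_eps I I' by (intro M.add.finprod_mono_neutral_cong_right) (auto simp: I'_def h_zero act_zero)
    finally have 1: "m = (\<Oplus>\<^bsub>M\<^esub>i\<in>I'. h (\<epsilon> i) \<bullet> m)" .
    have "mcong M L (\<Oplus>\<^bsub>M\<^esub>i\<in>I'. h (\<epsilon> i) \<bullet> m) (\<Oplus>\<^bsub>M\<^esub>i\<in>I'. lincomb A' MA' ?S (a i) (v i))"
      using am by (intro M.mcong_finsum[OF L_M])
    also have "(\<Oplus>\<^bsub>M\<^esub>i\<in>I'. lincomb A' MA' ?S (a i) (v i)) = lincomb P' M I' (\<lambda>_. \<one>\<^bsub>P'\<^esub>) (\<lambda>i. lincomb P' M ?S (C i) e)"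
      unfolding lincomb_def[of P' M I'] using C eM M.lincomb_closed[OF C eM]
      by (intro M.finsum_cong') (auto simp: lv[OF _ a] C_eq)
    also have "\<dots> = lincomb P' M ?S (\<lambda>t. \<Oplus>\<^bsub>P'\<^esub>i\<in>I'. \<one>\<^bsub>P'\<^esub> \<otimes>\<^bsub>P'\<^esub> C i t) e"
      using I' C eM by (intro M.lincomb_lincomb) auto
    finally have "mcong M L m (lincomb P' M ?S (\<lambda>t. \<Oplus>\<^bsub>P'\<^esub>i\<in>I'. \<one>\<^bsub>P'\<^esub> \<otimes>\<^bsub>P'\<^esub> C i t) e)" using 1 by simp
    then obtain d where d: "d \<in> carrier M" "m \<ominus>\<^bsub>M\<^esub> lincomb P' M ?S (\<lambda>t. \<Oplus>\<^bsub>P'\<^esub>i\<in>I'. \<one>\<^bsub>P'\<^esub> \<otimes>\<^bsub>P'\<^esub> C i t) e = u' \<odot>\<^bsub>M\<^esub> d"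
      by (auto simp: mcong_def)
    have CC: "(\<lambda>t. \<Oplus>\<^bsub>P'\<^esub>i\<in>I'. \<one>\<^bsub>P'\<^esub> \<otimes>\<^bsub>P'\<^esub> C i t) \<in> ?S \<rightarrow> carrier P'"
      using C by (auto intro!: PS'.P.finsum_closed)
    show ?thesis
      by (rule bexI[OF bexI[OF _ d(1)] CC]) (rule M.eq_add_diff[OF m M.lincomb_closed[OF CC eM], unfolded d(2)])
  qed
  have sp: "spans_mod P' M {\<zero>\<^bsub>M\<^esub>} (carrier M) ?S e"
    by (rule M.span_lift[OF PS'.var_closed PS'.var_complete M.carrier_is_submodule M_separated _ eM gen]) auto
  have "indep_mod P' M {\<zero>\<^bsub>M\<^esub>} ?S e"
  proof (rule M.indep_lift[OF _ eM M.carrier_is_submodule PS'.var_closed PS'.var_separated var_torsion_free])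
    fix cc t assume cc: "cc \<in> ?S \<rightarrow> carrier P'" and 0: "lincomb P' M ?S cc e \<in> L" and t: "t \<in> ?S"
    have c0: "cc t 0 \<in> carrier T'" if "t \<in> ?S" for t using cc that by (auto simp: Pi_iff)
    have "mcong M L (lincomb P' M ?S cc e) (lincomb P' M ?S (\<lambda>t. ps_const T' (cc t 0)) e)"
      unfolding lincomb_def using cc eM by (intro M.mcong_finsum[OF L_M] smult_P'_mod_L) auto
    then have L0: "lincomb P' M ?S (\<lambda>t. ps_const T' (cc t 0)) e \<in> L" using 0 M.mcong_in[OF L_M] by blast
    \<comment> \<open>Multiplying the relation by \<open>\<epsilon> i\<close> isolates the
      \<open>i\<close>-th part, where the coefficients may be taken from \<open>A'\<close> and
      independence of the \<open>i\<close>-th basis applies.\<close>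
    have ep: "h (\<epsilon> i) \<otimes>\<^bsub>T'\<^esub> cc t 0 = \<zero>\<^bsub>T'\<^esub>" if i: "i \<in> I" for i
    proof (cases "\<epsilon> i = \<zero>\<^bsub>T\<^esub>")
      case True
      then show ?thesis using c0[OF t] h_zero by simp
    next
      case False
      then have i': "i \<in> I'" using i by (simp add: I'_def)
      have "\<exists>a. \<forall>t\<in>?S. a t \<in> carrier A' \<and> h (\<epsilon> i) \<otimes>\<^bsub>T'\<^esub> cc t 0 = l' (a t) \<otimes>\<^bsub>T'\<^esub> h (\<epsilon> i)"
        by (rule bchoice) (use eps_T'[OF i] c0 in \<open>auto simp: Bex_def\<close>)
      then obtain a where a: "\<And>t. t \<in> ?S \<Longrightarrow> a t \<in> carrier A' \<and> h (\<epsilon> i) \<otimes>\<^bsub>T'\<^esub> cc t 0 = l' (a t) \<otimes>\<^bsub>T'\<^esub> h (\<epsilon> i)"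
        by blast
      have aA: "a \<in> ?S \<rightarrow> carrier A'" using a by auto
      have pc: "(\<lambda>t. ps_const T' (cc t 0)) \<in> ?S \<rightarrow> carrier P'" using c0 by auto
      have "h (\<epsilon> i) \<bullet> lincomb P' M ?S (\<lambda>t. ps_const T' (cc t 0)) e \<in> L"
        using M.submoduleE(4)[OF L_M _ L0, of "ps_const T' (h (\<epsilon> i))"] h_eps[OF i] by simp
      also have "h (\<epsilon> i) \<bullet> lincomb P' M ?S (\<lambda>t. ps_const T' (cc t 0)) e
          = lincomb P' M ?S (\<lambda>t. ps_const T' (h (\<epsilon> i)) \<otimes>\<^bsub>P'\<^esub> ps_const T' (cc t 0)) e"
        using h_eps[OF i] pc eM by (intro M.lincomb_smult[symmetric]) auto
      also have "\<dots> = lincomb P' M ?S (\<lambda>t. ps_const T' (l' (a t) \<otimes>\<^bsub>T'\<^esub> h (\<epsilon> i))) e"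
        using a c0 h_eps[OF i] eM by (intro M.lincomb_cong) (auto simp flip: ring_hom_mult[OF PS'.const_hom])
      also have "\<dots> = lincomb A' MA' ?S a (v i)" by (rule lv[OF i' aA, symmetric])
      finally have "a t = \<zero>\<^bsub>A'\<^esub>" using nv[OF i'] aA t unfolding indep_mod_def by blast
      then show ?thesis
        using a[OF t] h_eps[OF i] ring_hom_zero'[OF l' A'.ring_axioms T'.ring_axioms] by simp
    qed
    \<comment> \<open>The constant term is the sum of its projections, all of which vanish; hence
      the coefficient is divisible by \<open>u'\<close>.\<close>
    have "cc t 0 = (\<Oplus>\<^bsub>T'\<^esub>i\<in>I. h (\<epsilon> i)) \<otimes>\<^bsub>T'\<^esub> cc t 0" using c0[OF t] by (simp add: h_eps_sum)
    also have "\<dots> = (\<Oplus>\<^bsub>T'\<^esub>i\<in>I. h (\<epsilon> i) \<otimes>\<^bsub>T'\<^esub> cc t 0)"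
      using I h_eps c0[OF t] by (intro T'.finsum_ldistr) auto
    also have "\<dots> = \<zero>\<^bsub>T'\<^esub>" using ep by (intro T'.add.finprod_one_eqI) auto
    finally show "\<exists>b\<in>carrier P'. cc t = u' \<otimes>\<^bsub>P'\<^esub> b" using PS'.divisible_var[OF funcset_mem[OF cc t]] by simp
  qed auto
  then show ?thesis by (rule M.finite_free_of_basis[OF sp])
qed

end

section \<open>Arithmetic of fractions over a domain\<close>

context domain
begin

lemma fraction_rel_iff:
  "((a, b), (c, d)) \<in> fraction_rel R \<longleftrightarrow>
     a \<in> carrier R \<and> b \<in> carrier R \<and> b \<noteq> \<zero> \<and> c \<in> carrier R \<and> d \<in> carrier R \<and> d \<noteq> \<zero> \<and> a \<otimes> d = c \<otimes> b"
  by (auto simp: fraction_rel_def)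

lemma equiv_fraction_rel: "equiv (carrier R \<times> (carrier R - {\<zero>})) (fraction_rel R)"
proof (rule equivI)
  show "fraction_rel R \<subseteq> (carrier R \<times> (carrier R - {\<zero>})) \<times> (carrier R \<times> (carrier R - {\<zero>}))"
    by (auto simp: fraction_rel_def)
  show "refl_on (carrier R \<times> (carrier R - {\<zero>})) (fraction_rel R)"
    by (auto simp: refl_on_def fraction_rel_def)
  show "sym (fraction_rel R)" by (auto simp: sym_def fraction_rel_def)
  show "trans (fraction_rel R)"
  proof (rule transI)
    fix x y w assume "(x, y) \<in> fraction_rel R" "(y, w) \<in> fraction_rel R"
    then obtain a b c d e f where [simp]: "x = (a, b)" "y = (c, d)" "w = (e, f)"
      and 1: "((a, b), (c, d)) \<in> fraction_rel R" "((c, d), (e, f)) \<in> fraction_rel R"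
      by (cases x, cases y, cases w) auto
    then have c: "a \<in> carrier R" "b \<in> carrier R" "c \<in> carrier R" "d \<in> carrier R" "e \<in> carrier R" "f \<in> carrier R" "d \<noteq> \<zero>"
      and eq: "a \<otimes> d = c \<otimes> b" "c \<otimes> f = e \<otimes> d" by (auto simp: fraction_rel_iff)
    have "d \<otimes> (a \<otimes> f) = (a \<otimes> d) \<otimes> f" using c by (simp add: m_ac)
    also have "\<dots> = (c \<otimes> f) \<otimes> b" unfolding eq(1) using c by (simp add: m_ac)
    also have "\<dots> = d \<otimes> (e \<otimes> b)" unfolding eq(2) using c by (simp add: m_ac)
    finally have "a \<otimes> f = e \<otimes> b" using c m_lcancel by auto
    then show "(x, w) \<in> fraction_rel R" using 1 by (auto simp: fraction_rel_iff)
  qed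
qed

lemma fraction_eqI:
  "((a, b), (c, d)) \<in> fraction_rel R \<Longrightarrow> fraction R a b = fraction R c d"
  unfolding fraction_def by (rule equiv_class_eq[OF equiv_fraction_rel])

lemma fraction_self:
  "a \<in> carrier R \<Longrightarrow> b \<in> carrier R \<Longrightarrow> b \<noteq> \<zero> \<Longrightarrow> (a, b) \<in> fraction R a b"
  by (simp add: fraction_def fraction_rel_iff)

lemma fraction_closed:
  "a \<in> carrier R \<Longrightarrow> b \<in> carrier R \<Longrightarrow> b \<noteq> \<zero> \<Longrightarrow> fraction R a b \<in> carrier (fraction_field R)"
  unfolding fraction_field_def fraction_def by (auto intro: quotientI)

lemma fraction_cases:
  assumes "U \<in> carrier (fraction_field R)"
  obtains a b where "a \<in> carrier R" "b \<in> carrier R" "b \<noteq> \<zero>" "U = fraction R a b"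
  using assms unfolding fraction_field_def fraction_def by (auto elim!: quotientE)

text \<open>The product in \<open>fraction_field\<close> is a union over all representatives. It
  collapses because every pair of representatives gives the same class.\<close>

lemma fraction_mult:
  assumes "a \<in> carrier R" "b \<in> carrier R" "b \<noteq> \<zero>" "c \<in> carrier R" "d \<in> carrier R" "d \<noteq> \<zero>"
  shows "fraction R a b \<otimes>\<^bsub>fraction_field R\<^esub> fraction R c d = fraction R (a \<otimes> c) (b \<otimes> d)"
proof -
  have "fraction R (x \<otimes> z) (y \<otimes> w) = fraction R (a \<otimes> c) (b \<otimes> d)"
    if "(x, y) \<in> fraction R a b" "(z, w) \<in> fraction R c d" for x y z w
  proof (rule fraction_eqI)
    have 1: "x \<in> carrier R" "y \<in> carrier R" "z \<in> carrier R" "w \<in> carrier R" "y \<noteq> \<zero>" "w \<noteq> \<zero>"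
      "a \<otimes> y = x \<otimes> b" "c \<otimes> w = z \<otimes> d" using that by (auto simp: fraction_def fraction_rel_iff)
    have "(x \<otimes> z) \<otimes> (b \<otimes> d) = (x \<otimes> b) \<otimes> (z \<otimes> d)" using assms 1(1-4) by (simp add: m_ac)
    also have "\<dots> = (a \<otimes> c) \<otimes> (y \<otimes> w)" unfolding 1(7,8)[symmetric] using assms 1(1-4) by (simp add: m_ac)
    finally show "((x \<otimes> z, y \<otimes> w), (a \<otimes> c, b \<otimes> d)) \<in> fraction_rel R"
      using assms 1 integral_iff by (auto simp: fraction_rel_iff)
  qed
  then have 2: "(\<Union>(z, w)\<in>fraction R c d. fraction R (x \<otimes> z) (y \<otimes> w)) = fraction R (a \<otimes> c) (b \<otimes> d)"
    if "(x, y) \<in> fraction R a b" for x y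
    by (intro UN_constant_eq[OF fraction_self[OF assms(4-6)]]) (use that in auto)
  have "(\<Union>(x, y)\<in>fraction R a b. \<Union>(z, w)\<in>fraction R c d. fraction R (x \<otimes> z) (y \<otimes> w)) = fraction R (a \<otimes> c) (b \<otimes> d)"
    by (intro UN_constant_eq[OF fraction_self[OF assms(1-3)]]) (use 2 in auto)
  then show ?thesis by (simp add: fraction_field_def)
qed

lemma fraction_add:
  assumes "a \<in> carrier R" "b \<in> carrier R" "b \<noteq> \<zero>" "c \<in> carrier R" "d \<in> carrier R" "d \<noteq> \<zero>"
  shows "fraction R a b \<oplus>\<^bsub>fraction_field R\<^esub> fraction R c d = fraction R (a \<otimes> d \<oplus> c \<otimes> b) (b \<otimes> d)"
proof -
  have "fraction R (x \<otimes> w \<oplus> z \<otimes> y) (y \<otimes> w) = fraction R (a \<otimes> d \<oplus> c \<otimes> b) (b \<otimes> d)"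
    if "(x, y) \<in> fraction R a b" "(z, w) \<in> fraction R c d" for x y z w
  proof (rule fraction_eqI)
    have 1: "x \<in> carrier R" "y \<in> carrier R" "z \<in> carrier R" "w \<in> carrier R" "y \<noteq> \<zero>" "w \<noteq> \<zero>"
      "a \<otimes> y = x \<otimes> b" "c \<otimes> w = z \<otimes> d" using that by (auto simp: fraction_def fraction_rel_iff)
    have "(x \<otimes> w \<oplus> z \<otimes> y) \<otimes> (b \<otimes> d) = (x \<otimes> b) \<otimes> (w \<otimes> d) \<oplus> (z \<otimes> d) \<otimes> (y \<otimes> b)"
      using assms 1(1-4) by (simp add: l_distr r_distr m_ac)
    also have "\<dots> = (a \<otimes> d \<oplus> c \<otimes> b) \<otimes> (y \<otimes> w)" unfolding 1(7,8)[symmetric] using assms 1(1-4) by (simp add: l_distr r_distr m_ac)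
    finally show "((x \<otimes> w \<oplus> z \<otimes> y, y \<otimes> w), (a \<otimes> d \<oplus> c \<otimes> b, b \<otimes> d)) \<in> fraction_rel R"
      using assms 1 integral_iff by (auto simp: fraction_rel_iff)
  qed
  then have 2: "(\<Union>(z, w)\<in>fraction R c d. fraction R (x \<otimes> w \<oplus> z \<otimes> y) (y \<otimes> w)) = fraction R (a \<otimes> d \<oplus> c \<otimes> b) (b \<otimes> d)"
    if "(x, y) \<in> fraction R a b" for x y
    by (intro UN_constant_eq[OF fraction_self[OF assms(4-6)]]) (use that in auto)
  have "(\<Union>(x, y)\<in>fraction R a b. \<Union>(z, w)\<in>fraction R c d. fraction R (x \<otimes> w \<oplus> z \<otimes> y) (y \<otimes> w)) = fraction R (a \<otimes> d \<oplus> c \<otimes> b) (b \<otimes> d)"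
    by (intro UN_constant_eq[OF fraction_self[OF assms(1-3)]]) (use 2 in auto)
  then show ?thesis by (simp add: fraction_field_def)
qed

end

section \<open>Congruences and limits\<close>

definition eqmod :: "('a, 'm) ring_scheme \<Rightarrow> 'a \<Rightarrow> 'a \<Rightarrow> 'a \<Rightarrow> bool" where
  "eqmod R y a b \<longleftrightarrow> a \<in> carrier R \<and> b \<in> carrier R \<and> (\<exists>t\<in>carrier R. a = b \<oplus>\<^bsub>R\<^esub> y \<otimes>\<^bsub>R\<^esub> t)"

context cring
begin

lemma eqmod_refl: "y \<in> carrier R \<Longrightarrow> a \<in> carrier R \<Longrightarrow> eqmod R y a a"
  unfolding eqmod_def by (auto intro!: bexI[of _ \<zero>])

lemma eqmod_sym:
  assumes y: "y \<in> carrier R" and "eqmod R y a b" shows "eqmod R y b a"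
proof -
  obtain t where t: "t \<in> carrier R" "a = b \<oplus> y \<otimes> t" and ab: "a \<in> carrier R" "b \<in> carrier R" using assms by (auto simp: eqmod_def)
  have "b = a \<oplus> y \<otimes> (\<ominus> t)" using y t(1) ab(2) unfolding t(2) by (simp add: a_assoc r_minus r_neg)
  then show ?thesis using ab t y unfolding eqmod_def by blast
qed

lemma eqmod_trans:
  assumes y: "y \<in> carrier R" and "eqmod R y a b" "eqmod R y b c" shows "eqmod R y a c"
proof -
  obtain t s where t: "t \<in> carrier R" "a = b \<oplus> y \<otimes> t" "s \<in> carrier R" "b = c \<oplus> y \<otimes> s"
    and ab: "a \<in> carrier R" "b \<in> carrier R" "c \<in> carrier R" using assms by (auto simp: eqmod_def)
  have "a = c \<oplus> y \<otimes> (s \<oplus> t)" using y t(1,3) ab(3) unfolding t(2) unfolding t(4) by (simp add: a_assoc r_distr)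
  then show ?thesis using ab t y unfolding eqmod_def by blast
qed

lemma eqmod_mult:
  assumes y: "y \<in> carrier R" and "eqmod R y a b" "eqmod R y c d" shows "eqmod R y (a \<otimes> c) (b \<otimes> d)"
proof -
  obtain t s where t: "t \<in> carrier R" "a = b \<oplus> y \<otimes> t" "s \<in> carrier R" "c = d \<oplus> y \<otimes> s"
    and ab: "a \<in> carrier R" "b \<in> carrier R" "c \<in> carrier R" "d \<in> carrier R" using assms by (auto simp: eqmod_def)
  have "a \<otimes> c = b \<otimes> d \<oplus> y \<otimes> (b \<otimes> s \<oplus> t \<otimes> c)"
    using y t(1,3) ab(2,4) unfolding t(2,4) by (simp add: a_assoc r_distr l_distr m_ac) (simp add: a_ac)
  then show ?thesis using ab t y unfolding eqmod_def by blast
qed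

lemma eqmod_pow: "y \<in> carrier R \<Longrightarrow> eqmod R y a b \<Longrightarrow> eqmod R y (a [^] (n::nat)) (b [^] n)"
  by (induction n) (auto intro: eqmod_refl eqmod_mult)

lemma eqmod_dvd:
  assumes "eqmod R (x \<otimes> y) a b" "x \<in> carrier R" "y \<in> carrier R" shows "eqmod R x a b"
  using assms unfolding eqmod_def by (metis m_assoc m_closed)

lemma eqmod_pow_le:
  assumes "eqmod R (x [^] m) a b" "x \<in> carrier R" "n \<le> m" shows "eqmod R (x [^] (n::nat)) a b"
  using eqmod_dvd[of "x [^] n" "x [^] (m - n)" a b] assms by (simp add: nat_pow_mult)

text \<open>The binomial expansion up to second order, with the remainder in the form
  \<open>d^2 w\<close>; this is all that is needed to follow a congruence through a
  \<open>p\<close>-th power.\<close>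

lemma pow_add_expansion:
  assumes "b \<in> carrier R" "d \<in> carrier R"
  shows "\<exists>w\<in>carrier R. (b \<oplus> d) [^] Suc n = b [^] Suc n \<oplus> [Suc n] \<cdot> (b [^] n \<otimes> d) \<oplus> d \<otimes> d \<otimes> w"
proof (induction n)
  case 0
  then show ?case using assms by (intro bexI[of _ \<zero>]) auto
next
  case (Suc n)
  then obtain w where w: "w \<in> carrier R" "(b \<oplus> d) [^] Suc n = b [^] Suc n \<oplus> [Suc n] \<cdot> (b [^] n \<otimes> d) \<oplus> d \<otimes> d \<otimes> w" by blast
  define k where "k = [Suc n] \<cdot> (b [^] n)"
  have k: "k \<in> carrier R" using assms by (simp add: k_def)
  have e: "[Suc n] \<cdot> (b [^] n \<otimes> d) = k \<otimes> d" using assms by (simp only: k_def add_pow_ldistr nat_pow_closed)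
  have e': "[Suc (Suc n)] \<cdot> (b [^] Suc n \<otimes> d) = b [^] Suc n \<otimes> d \<oplus> k \<otimes> b \<otimes> d"
  proof -
    have "[Suc (Suc n)] \<cdot> (b [^] Suc n \<otimes> d) = [Suc n] \<cdot> (b [^] Suc n \<otimes> d) \<oplus> b [^] Suc n \<otimes> d"
      using assms by (simp del: nat_pow_Suc)
    also have "[Suc n] \<cdot> (b [^] Suc n \<otimes> d) = k \<otimes> b \<otimes> d"
      using assms unfolding k_def nat_pow_Suc by (simp only: add_pow_ldistr nat_pow_closed m_closed)
    finally show ?thesis using assms k by (simp add: a_comm)
  qed
  define B where "B = b [^] Suc n"
  have B: "B \<in> carrier R" using assms by (simp add: B_def)
  have "(b \<oplus> d) [^] Suc (Suc n) = (B \<oplus> k \<otimes> d \<oplus> d \<otimes> d \<otimes> w) \<otimes> (b \<oplus> d)"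
    using w(2) e by (simp only: nat_pow_Suc[of _ "Suc n"] B_def)
  also have "\<dots> = B \<otimes> b \<oplus> (B \<otimes> d \<oplus> k \<otimes> b \<otimes> d) \<oplus> d \<otimes> d \<otimes> (k \<oplus> w \<otimes> b \<oplus> w \<otimes> d)"
    using assms k w(1) B by algebra
  also have "\<dots> = b [^] Suc (Suc n) \<oplus> [Suc (Suc n)] \<cdot> (b [^] Suc n \<otimes> d) \<oplus> d \<otimes> d \<otimes> (k \<oplus> w \<otimes> b \<oplus> w \<otimes> d)"
    unfolding e' by (simp add: B_def)
  finally show ?case using assms k w(1) by (intro bexI[of _ "k \<oplus> w \<otimes> b \<oplus> w \<otimes> d"]) auto
qed

lemma nat_elem_mult: "a \<in> carrier R \<Longrightarrow> [n] \<cdot> a = nat_elem R n \<otimes> a"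
  using add_pow_ldistr[of \<one> a n] by simp

text \<open>Put \<open>a = b + d\<close> with \<open>d\<close> divisible by \<open>x^(n+1)\<close>.
  The linear term of the expansion gains a factor \<open>x\<close> from \<open>p = x c\<close>, and
  the quadratic remainder is divisible by \<open>x^(2 n + 2)\<close>.\<close>

lemma eqmod_pow_prime:
  assumes x: "x \<in> carrier R" and c: "c \<in> carrier R" "nat_elem R p = x \<otimes> c" and p: "p > 0"
    and ab: "eqmod R (x [^] Suc n) a b"
  shows "eqmod R (x [^] Suc (Suc n)) (a [^] p) (b [^] p)"
proof -
  obtain t where t: "t \<in> carrier R" "a = b \<oplus> x [^] Suc n \<otimes> t" and cab: "a \<in> carrier R" "b \<in> carrier R"
    using ab by (auto simp: eqmod_def)
  let ?X = "x [^] n" and ?d = "x [^] Suc n \<otimes> t"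
  obtain q where q: "p = Suc q" using p by (cases p) auto
  have d: "?d \<in> carrier R" "?X \<in> carrier R" using x t by auto
  obtain w where w: "w \<in> carrier R" "a [^] p = b [^] p \<oplus> [p] \<cdot> (b [^] q \<otimes> ?d) \<oplus> ?d \<otimes> ?d \<otimes> w"
    using pow_add_expansion[OF cab(2) d(1), of q] t q by auto
  define B where "B = b [^] q"
  have B: "B \<in> carrier R" using cab by (simp add: B_def)
  have "[p] \<cdot> (b [^] q \<otimes> ?d) = x \<otimes> c \<otimes> (B \<otimes> ?d)"
    using nat_elem_mult[of "b [^] q \<otimes> ?d" p] cab d by (simp only: c(2) B_def m_closed nat_pow_closed)
  also have "\<dots> = x [^] Suc (Suc n) \<otimes> (c \<otimes> B \<otimes> t)" using x c t B d(2) by (simp add: m_ac)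
  finally have 1: "[p] \<cdot> (b [^] q \<otimes> ?d) = x [^] Suc (Suc n) \<otimes> (c \<otimes> B \<otimes> t)" .
  have 2: "?d \<otimes> ?d \<otimes> w = x [^] Suc (Suc n) \<otimes> (?X \<otimes> t \<otimes> t \<otimes> w)" using x t w(1) d(2) by (simp add: m_ac)
  have "a [^] p = b [^] p \<oplus> x [^] Suc (Suc n) \<otimes> (c \<otimes> B \<otimes> t \<oplus> ?X \<otimes> t \<otimes> t \<otimes> w)"
    unfolding w(2) 1 2 using x c t w(1) B cab d(2) by (simp only: r_distr a_assoc m_closed nat_pow_closed)
  then show ?thesis unfolding eqmod_def using cab x c t w(1) B d(2) by blast
qed

lemma eqmod_pow_prime_pow:
  assumes x: "x \<in> carrier R" and c: "c \<in> carrier R" "nat_elem R p = x \<otimes> c" and p: "p > 0"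
    and ab: "eqmod R x a b"
  shows "eqmod R (x [^] Suc n) (a [^] (p ^ n)) (b [^] (p ^ n))"
proof (induction n)
  case 0
  then show ?case using ab x by (simp add: eqmod_def)
next
  case (Suc n)
  have "eqmod R (x [^] Suc (Suc n)) ((a [^] (p ^ n)) [^] p) ((b [^] (p ^ n)) [^] p)"
    by (rule eqmod_pow_prime[OF x c p Suc])
  then show ?case using ab by (simp add: nat_pow_pow mult.commute eqmod_def)
qed

text \<open>Completeness is available for series, so the sequence is written as a telescoping series
  with terms \<open>x^n t n\<close>.\<close>

lemma cauchy_limit:
  assumes x: "x \<in> carrier R" and compl: "adic_complete R x"
    and s: "\<And>n::nat. eqmod R (x [^] n) (s (Suc n)) (s n)"
  shows "\<exists>l\<in>carrier R. \<forall>n::nat. eqmod R (x [^] n) l (s n)"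
proof -
  have sR: "s n \<in> carrier R" for n using s[of n] by (simp add: eqmod_def)
  have "\<exists>t. t \<in> carrier R \<and> s (Suc n) = s n \<oplus> x [^] n \<otimes> t" for n using s[of n] by (auto simp: eqmod_def)
  then obtain t where t: "\<And>n. t n \<in> carrier R" "\<And>n. s (Suc n) = s n \<oplus> x [^] n \<otimes> t n" by metis
  define S where "S n = (\<Oplus>k\<in>{..<n}. x [^] k \<otimes> t k)" for n
  have SR: "S n \<in> carrier R" for n unfolding S_def using x t(1) by (intro finsum_closed) auto
  have S_Suc: "S (Suc n) = S n \<oplus> x [^] n \<otimes> t n" for n
    unfolding S_def lessThan_Suc using x t(1) by (subst finsum_insert) (auto simp: a_comm)
  have sS: "s n = s 0 \<oplus> S n" for n
  proof (induction n)
    case 0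
    then show ?case using sR by (simp add: S_def)
  next
    case (Suc n)
    then show ?case using t S_Suc[of n] SR sR x by (simp add: a_assoc)
  qed
  obtain l where l: "l \<in> carrier R" "\<forall>n::nat. \<exists>r\<in>carrier R. l = S n \<oplus> x [^] n \<otimes> r"
    using compl t(1) unfolding adic_complete_def S_def by blast
  have "eqmod R (x [^] n) (s 0 \<oplus> l) (s n)" for n :: nat
  proof -
    obtain r where r: "r \<in> carrier R" "l = S n \<oplus> x [^] n \<otimes> r" using l(2) by blast
    have "s 0 \<oplus> l = s n \<oplus> x [^] n \<otimes> r"
      unfolding sS[of n] unfolding r(2) using sR SR r(1) x by (simp add: a_assoc)
    then show ?thesis unfolding eqmod_def using r l(1) sR by blast
  qed
  then show ?thesis using l(1) sR by (intro bexI[of _ "s 0 \<oplus> l"]) auto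
qed

lemma eqmod_separated:
  assumes x: "x \<in> carrier R" and sep: "adic_separated R x"
    and ab: "\<And>n::nat. eqmod R (x [^] n) a b"
  shows "a = b"
proof -
  have c: "a \<in> carrier R" "b \<in> carrier R" using ab[of 0] by (auto simp: eqmod_def)
  have "a \<ominus> b = \<zero>"
  proof (rule adic_separatedD[OF sep])
    fix n :: nat
    obtain t where t: "t \<in> carrier R" "a = b \<oplus> x [^] n \<otimes> t" using ab[of n] by (auto simp: eqmod_def)
    have "a \<ominus> b = x [^] n \<otimes> t" unfolding t(2) using c(2) t(1) x by (intro add_minus_cancel_left) auto
    then show "\<exists>r\<in>carrier R. a \<ominus> b = x [^] n \<otimes> r" using t by blast
  qed (use c in auto)
  then show ?thesis using c by simp
qed

text \<open>The root of unity is the limit of the powers \<open>a^(p^(f n))\<close>.\<close>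

lemma teichmueller_root:
  assumes x: "x \<in> carrier R" and compl: "adic_complete R x" and sep: "adic_separated R x"
    and c: "c \<in> carrier R" "nat_elem R p = x \<otimes> c" and p: "p > 0"
    and a: "eqmod R x (a [^] m) \<one>" "a \<in> carrier R" and m: "m dvd p ^ f - 1" and f: "f > 0"
  shows "\<exists>\<zeta>\<in>carrier R. \<zeta> [^] m = \<one> \<and> eqmod R x \<zeta> a"
proof -
  let ?Q = "p ^ f"
  have Q: "?Q > 0" using p by simp
  have pw: "eqmod R (x [^] n) ((a [^] m) [^] (?Q ^ n)) \<one>" for n
  proof -
    have "eqmod R (x [^] Suc (f * n)) ((a [^] m) [^] (p ^ (f * n))) (\<one> [^] (p ^ (f * n)))"
      by (rule eqmod_pow_prime_pow[OF x c p a(1)])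
    then have "eqmod R (x [^] Suc (f * n)) ((a [^] m) [^] (?Q ^ n)) \<one>" by (simp add: power_mult)
    moreover have "n \<le> Suc (f * n)" using f by (simp add: le_SucI)
    ultimately show ?thesis by (rule eqmod_pow_le[OF _ x])
  qed
  obtain r where r: "?Q - 1 = m * r" using m by blast
  have QQ: "a [^] ?Q = a \<otimes> (a [^] m) [^] r"
  proof -
    \<comment> \<open>Passing from \<open>a\<close> to its power with exponent \<open>p^f\<close>
      multiplies it by a power of \<open>a^m\<close>. As \<open>a^m\<close> tends to
      \<open>1\<close> under iterated \<open>p\<close>-th powers, the iterates of \<open>a\<close>
      form a Cauchy sequence.\<close>
    have "?Q = 1 + m * r" using r Q by linarith
    then have "a [^] ?Q = a [^] (1 + m * r)" by simp
    then show ?thesis using a by (simp add: nat_pow_pow m_comm flip: nat_pow_mult)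
  qed
  define s where "s n = a [^] (?Q ^ n)" for n
  have sR: "s n \<in> carrier R" for n using a by (simp add: s_def)
  have "eqmod R (x [^] n) (s (Suc n)) (s n)" for n
  proof -
    have "s (Suc n) = (a \<otimes> (a [^] m) [^] r) [^] (?Q ^ n)" unfolding QQ[symmetric] s_def using a by (simp add: nat_pow_pow)
    also have "\<dots> = s n \<otimes> ((a [^] m) [^] (?Q ^ n)) [^] r"
      using a by (simp add: s_def nat_pow_distrib nat_pow_pow mult_ac)
    finally have e: "s (Suc n) = s n \<otimes> ((a [^] m) [^] (?Q ^ n)) [^] r" .
    have "eqmod R (x [^] n) (s n \<otimes> ((a [^] m) [^] (?Q ^ n)) [^] r) (s n \<otimes> \<one> [^] r)"
      using x sR by (intro eqmod_mult eqmod_pow pw eqmod_refl) auto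
    then show ?thesis unfolding e using sR by simp
  qed
  then obtain l where l: "l \<in> carrier R" "\<And>n::nat. eqmod R (x [^] n) l (s n)"
    using cauchy_limit[OF x compl, of s] by blast
  have "l [^] m = \<one>"
  proof (rule eqmod_separated[OF x sep])
    fix n :: nat
    have "eqmod R (x [^] n) (l [^] m) (s n [^] m)" using l x by (intro eqmod_pow) auto
    moreover have "s n [^] m = (a [^] m) [^] (?Q ^ n)" using a by (simp add: s_def nat_pow_pow mult.commute)
    ultimately show "eqmod R (x [^] n) (l [^] m) \<one>" using pw[of n] x eqmod_trans[of "x [^] n"] by simp
  qed
  moreover have "eqmod R x l a"
  proof -
    have "eqmod R x l (s 1)" using l(2)[of 1] x by simp
    moreover have "eqmod R x (a \<otimes> (a [^] m) [^] r) (a \<otimes> \<one> [^] r)"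
      using a x by (intro eqmod_mult eqmod_pow eqmod_refl) auto
    ultimately show ?thesis using a x eqmod_trans[of x l "s 1" a] by (simp add: s_def QQ)
  qed
  ultimately show ?thesis using l(1) by blast
qed

text \<open>The polynomial congruence \<open>freshman\<close> in two variables, indexed by the
  booleans, is evaluated at \<open>x\<close> and \<open>y\<close>; the multiple of \<open>p\<close>
  dies in characteristic \<open>p\<close>.\<close>

lemma freshman_char:
  assumes p: "Factorial_Ring.prime p" and char: "[p] \<cdot> \<one> = \<zero>" and xy: "x \<in> carrier R" "y \<in> carrier R"
  shows "(x \<oplus> y) [^] (p::nat) = x [^] p \<oplus> y [^] p"
proof -
  let ?e = "mpoly_eval R (\<lambda>b::bool. if b then x else y)"
  have v: "(if b then x else y) \<in> carrier R" for b using xy by simp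
  have hom: "?e (s + t) = ?e s \<oplus> ?e t" "?e (s * t) = ?e s \<otimes> ?e t" "?e 1 = \<one>" for s t
    using v by (auto simp: mpoly_eval_add mpoly_eval_mult)
  have pow: "?e (s ^ k) = ?e s [^] k" for s and k :: nat
    using v by (induction k) (auto simp: hom m_comm)
  obtain q where q: "(mvar True + mvar False) ^ p - mvar True ^ p - mvar False ^ p = of_nat p * (q :: (bool \<Rightarrow>\<^sub>0 nat) \<Rightarrow>\<^sub>0 int)"
    using freshman[OF p, of "mvar True" "mvar False"] by (auto elim: dvdE)
  have "(mvar True + mvar False) ^ p = mvar True ^ p + mvar False ^ p + of_nat p * q" using q by (simp add: algebra_simps)
  then have "?e ((mvar True + mvar False) ^ p) = ?e (mvar True ^ p + mvar False ^ p + of_nat p * q)" by simp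
  then have "(x \<oplus> y) [^] p = x [^] p \<oplus> y [^] p \<oplus> [p] \<cdot> ?e q"
    using v by (simp add: hom(1) pow mpoly_eval_of_nat)
  moreover have "[p] \<cdot> ?e q = \<zero>" using nat_elem_mult[of "?e q" p] v char by simp
  ultimately show ?thesis using xy by simp
qed

text \<open>Multiplication by \<open>w\<close> permutes the powers of \<open>w\<close> cyclically.
  The induction uses the telescoping identity in a form without subtraction.\<close>

lemma geometric_fixed:
  assumes w: "w \<in> carrier R" "w [^] (m::nat) = \<one>"
  shows "w \<otimes> (\<Oplus>k\<in>{..<m}. w [^] k) = (\<Oplus>k\<in>{..<m}. w [^] k)"
proof -
  have "w \<otimes> (\<Oplus>k\<in>{..<n}. w [^] k) \<oplus> \<one> = (\<Oplus>k\<in>{..<n}. w [^] k) \<oplus> w [^] n" for n :: nat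
  proof (induction n)
    case (Suc n)
    have c: "(\<Oplus>k\<in>{..<n}. w [^] k) \<in> carrier R" using w by (intro finsum_closed) auto
    have e: "(\<Oplus>k\<in>{..<Suc n}. w [^] k) = w [^] n \<oplus> (\<Oplus>k\<in>{..<n}. w [^] k)"
      unfolding lessThan_Suc using w by (subst finsum_insert) auto
    have "w \<otimes> (w [^] n \<oplus> (\<Oplus>k\<in>{..<n}. w [^] k)) \<oplus> \<one> = w [^] Suc n \<oplus> (w \<otimes> (\<Oplus>k\<in>{..<n}. w [^] k) \<oplus> \<one>)"
      using w c by (simp add: r_distr a_assoc m_comm)
    also have "\<dots> = (w [^] n \<oplus> (\<Oplus>k\<in>{..<n}. w [^] k)) \<oplus> w [^] Suc n"
      unfolding Suc using w c by (simp add: a_ac)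
    finally show ?case unfolding e .
  qed (use w in simp)
  from this[of m] show ?thesis using w by (simp add: finsum_closed Pi_def)
qed

end

section \<open>Finite algebras over the $p$-adic integers\<close>

context padic
begin

abbreviation "zspans C j I e \<equiv> spans_mod Z (algebra_module j C) {\<zero>\<^bsub>C\<^esub>} (carrier C) I e"
abbreviation "zindep C j I e \<equiv> indep_mod Z (algebra_module j C) {\<zero>\<^bsub>C\<^esub>} I e"

definition zalg :: "('c, 'm) ring_scheme \<Rightarrow> ((nat \<Rightarrow> int) \<Rightarrow> 'c) \<Rightarrow> bool" where
  "zalg C j \<longleftrightarrow> cring C \<and> j \<in> ring_hom Z C"

lemma zalg_module: "zalg C j \<Longrightarrow> module Z (algebra_module j C)"
  unfolding zalg_def using module_algebra_module[OF Z.is_cring] by blast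

lemma hom_nat_elem:
  assumes "zalg C j" shows "j (nat_elem Z k) = nat_elem C k"
proof -
  interpret C: cring C using assms by (simp add: zalg_def)
  have j: "j \<in> ring_hom Z C" using assms by (simp add: zalg_def)
  show ?thesis
  proof (induction k)
    case 0
    then show ?case using ring_hom_zero'[OF j Z.ring_axioms C.ring_axioms] by simp
  next
    case (Suc k)
    then show ?case using ring_hom_add[OF j] ring_hom_one[OF j] by simp
  qed
qed

lemma hom_pow:
  assumes "zalg C j" "a \<in> carrier Z" shows "j (a [^]\<^bsub>Z\<^esub> (k::nat)) = j a [^]\<^bsub>C\<^esub> k"
proof -
  have j: "j \<in> ring_hom Z C" using assms by (simp add: zalg_def)
  show ?thesis using assms(2) ring_hom_mult[OF j] ring_hom_one[OF j] by (induction k) auto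
qed

text \<open>\<open>d\<close> is the lowest nonzero coefficient of a linear relation between the powers of \<open>y\<close>.\<close>

lemma power_relation:
  fixes C (structure)
  assumes C: "zalg C j" and y: "y \<in> carrier C"
    and bound: "\<And>m f. zindep C j {..<m::nat} f \<Longrightarrow> m \<le> N"
  shows "\<exists>(i::nat) d w. d \<in> carrier Z \<and> d \<noteq> \<zero>\<^bsub>Z\<^esub> \<and> w \<in> carrier C \<and> y [^] i \<otimes> (j d \<oplus> y \<otimes> w) = \<zero>"
proof -
  interpret C: cring C using C by (simp add: zalg_def)
  interpret D: module Z "algebra_module j C" by (rule zalg_module[OF C])
  have j: "j \<in> ring_hom Z C" using C by (simp add: zalg_def)
  have jc: "j a \<in> carrier C" if "a \<in> carrier Z" for a using ring_hom_closed[OF j that] .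
  have step: "\<exists>(i::nat) d w. d \<in> carrier Z \<and> d \<noteq> \<zero>\<^bsub>Z\<^esub> \<and> w \<in> carrier C \<and>
      (\<Oplus>k\<in>{..n}. j (c k) \<otimes> y [^] k) = y [^] i \<otimes> (j d \<oplus> y \<otimes> w)"
    if "\<And>k. c k \<in> carrier Z" "\<exists>k\<le>n. c k \<noteq> \<zero>\<^bsub>Z\<^esub>" for n :: nat and c
    using that
  proof (induction n arbitrary: c)
    case 0
    then show ?case using y jc
      by (intro exI[of _ 0] exI[of _ "c 0"] exI[of _ "\<zero>"]) (auto simp: C.finsum_insert)
  next
    case (Suc n)
    let ?S = "\<Oplus>k\<in>{..n}. j (c (Suc k)) \<otimes> y [^] k"
    have S: "?S \<in> carrier C" using y jc Suc.prems by (intro C.finsum_closed) auto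
    have "(\<Oplus>k\<in>{..Suc n}. j (c k) \<otimes> y [^] k)
        = (\<Oplus>k\<in>{..n}. j (c (Suc k)) \<otimes> y [^] Suc k) \<oplus> j (c 0) \<otimes> y [^] (0::nat)"
      using y jc Suc.prems by (intro C.finsum_Suc2) auto
    also have "(\<Oplus>k\<in>{..n}. j (c (Suc k)) \<otimes> y [^] Suc k) = (\<Oplus>k\<in>{..n}. y \<otimes> (j (c (Suc k)) \<otimes> y [^] k))"
      using y jc Suc.prems by (intro C.finsum_cong') (auto simp: C.m_ac)
    also have "\<dots> = y \<otimes> ?S" using y jc Suc.prems by (intro C.finsum_rdistr[symmetric]) auto
    finally have e: "(\<Oplus>k\<in>{..Suc n}. j (c k) \<otimes> y [^] k) = y \<otimes> ?S \<oplus> j (c 0)"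
      using jc Suc.prems by simp
    show ?case
    proof (cases "c 0 = \<zero>\<^bsub>Z\<^esub>")
      case False
      then show ?thesis unfolding e using S y jc Suc.prems
        by (intro exI[of _ 0] exI[of _ "c 0"] exI[of _ ?S]) (auto simp: C.a_comm)
    next
      case True
      then have "\<exists>k\<le>n. c (Suc k) \<noteq> \<zero>\<^bsub>Z\<^esub>" using Suc.prems(2) by (metis Suc_le_mono not0_implies_Suc)
      then obtain i d w where w: "d \<in> carrier Z" "d \<noteq> \<zero>\<^bsub>Z\<^esub>" "w \<in> carrier C"
          "?S = y [^] (i::nat) \<otimes> (j d \<oplus> y \<otimes> w)"
        using Suc.IH[of "\<lambda>k. c (Suc k)"] Suc.prems by blast
      have "y \<otimes> ?S \<oplus> j (c 0) = y \<otimes> ?S"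
        using True S y ring_hom_zero'[OF j Z.ring_axioms C.ring_axioms] by simp
      also have "\<dots> = y [^] Suc i \<otimes> (j d \<oplus> y \<otimes> w)"
        unfolding w(4) using w y jc by (simp add: C.m_ac)
      finally show ?thesis unfolding e using w
        by (intro exI[of _ "Suc i"] exI[of _ d] exI[of _ w]) simp
    qed
  qed
  have "\<not> zindep C j {..<Suc N} (\<lambda>k. y [^] k)"
    using bound[of "Suc N" "\<lambda>k. y [^] k"] by auto
  then obtain c k where c: "c \<in> {..<Suc N} \<rightarrow> carrier Z" "lincomb Z (algebra_module j C) {..<Suc N} c (\<lambda>k. y [^] k) = \<zero>"
      "k < Suc N" "c k \<noteq> \<zero>\<^bsub>Z\<^esub>"
    using y unfolding indep_mod_def by auto
  let ?c = "\<lambda>k. if k < Suc N then c k else \<zero>\<^bsub>Z\<^esub>"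
  have "(\<Oplus>k\<in>{..N}. j (?c k) \<otimes> y [^] k) = (\<Oplus>k\<in>{..<Suc N}. j (c k) \<otimes> y [^] k)"
    unfolding lessThan_Suc_atMost using y c(1) jc by (intro C.finsum_cong') (auto simp: Pi_iff lessThan_Suc_atMost)
  then have "(\<Oplus>k\<in>{..N}. j (?c k) \<otimes> y [^] k) = \<zero>" using c(2) by (simp add: lincomb_def)
  moreover have cZ: "?c k \<in> carrier Z" for k using c(1) by auto
  moreover have ex: "\<exists>k\<le>N. ?c k \<noteq> \<zero>\<^bsub>Z\<^esub>" using c(3,4) by (intro exI[of _ k]) auto
  moreover obtain i :: nat and d w where "d \<in> carrier Z" "d \<noteq> \<zero>\<^bsub>Z\<^esub>" "w \<in> carrier C"
      "(\<Oplus>k\<in>{..N}. j (?c k) \<otimes> y [^] k) = y [^] i \<otimes> (j d \<oplus> y \<otimes> w)"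
    using step[of ?c N, OF cZ ex] by (elim exE conjE) (rule that)
  ultimately show ?thesis by (intro exI[of _ i] exI[of _ d] exI[of _ w]) simp
qed

text \<open>Every term of the series is written in the generators and the limit is taken in each
  coordinate; the remainders of the coordinates combine to the remainder of the series.\<close>

lemma adic_complete_of_span:
  fixes C (structure)
  assumes C: "zalg C j" and sp: "zspans C j I e"
  shows "adic_complete C (j pz)"
  unfolding adic_complete_def
proof (intro ballI)
  interpret C: cring C using C by (simp add: zalg_def)
  interpret D: module Z "algebra_module j C" by (rule zalg_module[OF C])
  have j: "j \<in> ring_hom Z C" using C by (simp add: zalg_def)
  have jc: "j a \<in> carrier C" if "a \<in> carrier Z" for a using ring_hom_closed[OF j that] .
  have P: "j pz \<in> carrier C" using jc by simp
  have fin: "finite I" and e: "e \<in> I \<rightarrow> carrier (algebra_module j C)" using sp by (auto simp: spans_mod_def)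
  fix s assume "s \<in> (UNIV :: nat set) \<rightarrow> carrier C"
  then have s: "s k \<in> carrier C" for k by auto
  have "\<exists>c. c \<in> I \<rightarrow> carrier Z \<and> s k = lincomb Z (algebra_module j C) I c e" for k
    using D.spans_modD[OF sp s, of k] D.mcong_trivial by (metis algebra_module_simps(2))
  then obtain c where c: "\<And>k. c k \<in> I \<rightarrow> carrier Z" and sc: "\<And>k. s k = lincomb Z (algebra_module j C) I (c k) e"
    by metis
  define S where "S n i = (\<Oplus>\<^bsub>Z\<^esub>k\<in>{..<n}. pz [^]\<^bsub>Z\<^esub> k \<otimes>\<^bsub>Z\<^esub> c k i)" for n :: nat and i
  have SZ: "S n \<in> I \<rightarrow> carrier Z" for n unfolding S_def using c by (auto intro!: Z.finsum_closed simp: Pi_iff)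
  have "\<exists>l\<in>carrier Z. \<forall>n. \<exists>t\<in>carrier Z. l = S n i \<oplus>\<^bsub>Z\<^esub> pz [^]\<^bsub>Z\<^esub> n \<otimes>\<^bsub>Z\<^esub> t" if i: "i \<in> I" for i
  proof -
    have "(\<lambda>k. c k i) \<in> UNIV \<rightarrow> carrier Z" using c i by (auto simp: Pi_iff)
    then show ?thesis using complete unfolding adic_complete_def S_def by (rule bspec[rotated])
  qed
  then obtain l t where l: "\<And>i. i \<in> I \<Longrightarrow> l i \<in> carrier Z" and t: "\<And>i n. i \<in> I \<Longrightarrow> t i n \<in> carrier Z"
      and lt: "\<And>i n. i \<in> I \<Longrightarrow> l i = S n i \<oplus>\<^bsub>Z\<^esub> pz [^]\<^bsub>Z\<^esub> n \<otimes>\<^bsub>Z\<^esub> t i n"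
    by metis
  let ?lc = "\<lambda>c. lincomb Z (algebra_module j C) I c e"
  have lcc: "?lc c \<in> carrier C" if "c \<in> I \<rightarrow> carrier Z" for c using D.lincomb_closed[OF that e] by simp
  have sm: "?lc (\<lambda>i. pz [^]\<^bsub>Z\<^esub> n \<otimes>\<^bsub>Z\<^esub> b i) = j pz [^] n \<otimes> ?lc b" if "b \<in> I \<rightarrow> carrier Z" for b and n :: nat
    using D.lincomb_smult[OF _ that e, of "pz [^]\<^bsub>Z\<^esub> n"] hom_pow[OF C pz_closed] by simp
  have SS: "?lc (S n) = (\<Oplus>k\<in>{..<n}. j pz [^] k \<otimes> s k)" for n
  proof (induction n)
    case 0
    have "?lc (S 0) = \<zero>\<^bsub>algebra_module j C\<^esub>" by (rule D.lincomb_zero[OF _ e]) (simp add: S_def)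
    then show ?case by simp
  next
    case (Suc n)
    have cn: "(\<lambda>i. pz [^]\<^bsub>Z\<^esub> n \<otimes>\<^bsub>Z\<^esub> c n i) \<in> I \<rightarrow> carrier Z" using c[of n] by (auto simp: Pi_iff)
    have "?lc (S (Suc n)) = ?lc (\<lambda>i. S n i \<oplus>\<^bsub>Z\<^esub> pz [^]\<^bsub>Z\<^esub> n \<otimes>\<^bsub>Z\<^esub> c n i)"
    proof (intro D.lincomb_cong)
      fix i assume i: "i \<in> I"
      have ci: "c k i \<in> carrier Z" for k using c i by (auto simp: Pi_iff)
      then show "S (Suc n) i = S n i \<oplus>\<^bsub>Z\<^esub> pz [^]\<^bsub>Z\<^esub> n \<otimes>\<^bsub>Z\<^esub> c n i"
        unfolding S_def lessThan_Suc by (subst Z.finsum_insert) (auto simp: Z.a_comm intro!: Z.finsum_closed)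
    qed (use SZ[of n] cn e in \<open>auto simp: Pi_iff\<close>)
    also have "\<dots> = ?lc (S n) \<oplus> j pz [^] n \<otimes> s n"
      using D.lincomb_add[OF SZ cn e, of n] sm[OF c[of n], of n] sc[of n] by simp
    also have "\<dots> = (\<Oplus>k\<in>{..<Suc n}. j pz [^] k \<otimes> s k)"
      unfolding Suc lessThan_Suc using P s by (subst C.finsum_insert) (auto simp: C.a_comm intro!: C.finsum_closed)
    finally show ?case .
  qed
  have R: "\<exists>r\<in>carrier C. ?lc l = (\<Oplus>k\<in>{..<n}. j pz [^] k \<otimes> s k) \<oplus> j pz [^] n \<otimes> r" for n :: nat
  proof (rule bexI)
    have tn: "(\<lambda>i. t i n) \<in> I \<rightarrow> carrier Z" using t by auto
    have ptn: "(\<lambda>i. pz [^]\<^bsub>Z\<^esub> n \<otimes>\<^bsub>Z\<^esub> t i n) \<in> I \<rightarrow> carrier Z" using t by auto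
    have "?lc l = ?lc (\<lambda>i. S n i \<oplus>\<^bsub>Z\<^esub> pz [^]\<^bsub>Z\<^esub> n \<otimes>\<^bsub>Z\<^esub> t i n)"
      using lt[of _ n] SZ[of n] ptn e by (intro D.lincomb_cong) (auto simp: Pi_iff)
    also have "\<dots> = ?lc (S n) \<oplus> j pz [^] n \<otimes> ?lc (\<lambda>i. t i n)"
      using D.lincomb_add[OF SZ ptn e, of n] sm[OF tn, of n] by simp
    finally show "?lc l = (\<Oplus>k\<in>{..<n}. j pz [^] k \<otimes> s k) \<oplus> j pz [^] n \<otimes> ?lc (\<lambda>i. t i n)"
      unfolding SS .
    show "?lc (\<lambda>i. t i n) \<in> carrier C" using lcc[OF tn] .
  qed
  have lC: "?lc l \<in> carrier C" using l by (intro lcc) auto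
  show "\<exists>l\<in>carrier C. \<forall>n. \<exists>r\<in>carrier C. l = (\<Oplus>k\<in>{..<n}. j pz [^] k \<otimes> s k) \<oplus> j pz [^] n \<otimes> r"
    by (rule bexI[where x = "?lc l"], rule allI, rule R, rule lC)
qed

lemma eqmod_of_nth:
  assumes "a \<in> carrier Z" "b \<in> carrier Z" "a 1 = b 1"
  shows "eqmod Z pz a b"
proof -
  have "(a \<ominus>\<^bsub>Z\<^esub> b) 1 = 0" using assms by (simp add: minus_nth)
  then obtain t where t: "t \<in> carrier Z" "a \<ominus>\<^bsub>Z\<^esub> b = pz [^]\<^bsub>Z\<^esub> (1::nat) \<otimes>\<^bsub>Z\<^esub> t"
    using divisible[of "a \<ominus>\<^bsub>Z\<^esub> b" 1] assms by auto
  have "a = b \<oplus>\<^bsub>Z\<^esub> (a \<ominus>\<^bsub>Z\<^esub> b)" using Z.eq_add_diff[of a b] assms by simp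
  also have "a \<ominus>\<^bsub>Z\<^esub> b = pz \<otimes>\<^bsub>Z\<^esub> t" using t(2) pz_closed by (simp only: Z.nat_pow_eone)
  finally show ?thesis using assms t unfolding eqmod_def by blast
qed

text \<open>Finiteness of \<open>C / p C\<close> without forming the quotient: \<open>r\<close>
  records chosen coordinates modulo \<open>p\<close>, that is, their components with index
  \<open>1\<close>, and equal records force congruent elements.\<close>

lemma finite_residues:
  fixes C (structure) and I :: "'i set"
  assumes C: "zalg C j" and sp: "zspans C j I e"
  shows "\<exists>(F :: ('i \<Rightarrow> int) set) r. finite F \<and> r \<in> carrier C \<rightarrow> F \<and> (\<forall>a\<in>carrier C. \<forall>b\<in>carrier C. r a = r b \<longrightarrow> eqmod C (j pz) a b)"
proof -
  interpret C: cring C using C by (simp add: zalg_def)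
  interpret D: module Z "algebra_module j C" by (rule zalg_module[OF C])
  have j: "j \<in> ring_hom Z C" using C by (simp add: zalg_def)
  have jc: "j a \<in> carrier C" if "a \<in> carrier Z" for a using ring_hom_closed[OF j that] .
  have fin: "finite I" and e: "e \<in> I \<rightarrow> carrier (algebra_module j C)" using sp by (auto simp: spans_mod_def)
  have "\<exists>c. c \<in> I \<rightarrow> carrier Z \<and> a = lincomb Z (algebra_module j C) I c e" if "a \<in> carrier C" for a
    using D.spans_modD[OF sp that] D.mcong_trivial by (metis algebra_module_simps(2))
  then obtain c where c: "\<And>a. a \<in> carrier C \<Longrightarrow> c a \<in> I \<rightarrow> carrier Z"
      and ac: "\<And>a. a \<in> carrier C \<Longrightarrow> a = lincomb Z (algebra_module j C) I (c a) e" by metis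
  let ?F = "I \<rightarrow>\<^sub>E {0..<int p}" and ?r = "\<lambda>a. restrict (\<lambda>i. c a i 1) I"
  have F: "finite ?F" using fin by (intro finite_PiE) auto
  have r: "?r \<in> carrier C \<rightarrow> ?F"
  proof
    fix a assume a: "a \<in> carrier C"
    have "c a i 1 \<in> {0..<int p}" if "i \<in> I" for i
    proof -
      have "c a i \<in> carrier Z" using c[OF a] that by auto
      then have "0 \<le> c a i 1 \<and> c a i 1 < int p ^ 1" unfolding padic_int_simps(1) by blast
      then show ?thesis by simp
    qed
    then show "?r a \<in> ?F" by auto
  qed
  have "eqmod C (j pz) a b" if ab: "a \<in> carrier C" "b \<in> carrier C" "?r a = ?r b" for a b
  proof -
    have cZ: "c a i \<in> carrier Z" "c b i \<in> carrier Z" if "i \<in> I" for i using c ab that by auto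
    have c1: "c a i 1 = c b i 1" if "i \<in> I" for i using fun_cong[OF ab(3), of i] that by simp
    have "\<exists>t. t \<in> carrier Z \<and> c a i = c b i \<oplus>\<^bsub>Z\<^esub> pz \<otimes>\<^bsub>Z\<^esub> t" if "i \<in> I" for i
      using eqmod_of_nth[OF cZ[OF that] c1[OF that]] by (auto simp: eqmod_def)
    then obtain t where t: "\<And>i. i \<in> I \<Longrightarrow> t i \<in> carrier Z \<and> c a i = c b i \<oplus>\<^bsub>Z\<^esub> pz \<otimes>\<^bsub>Z\<^esub> t i" by metis
    have tI: "t \<in> I \<rightarrow> carrier Z" "(\<lambda>i. pz \<otimes>\<^bsub>Z\<^esub> t i) \<in> I \<rightarrow> carrier Z" using t by auto
    have "a = lincomb Z (algebra_module j C) I (\<lambda>i. c b i \<oplus>\<^bsub>Z\<^esub> pz \<otimes>\<^bsub>Z\<^esub> t i) e"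
      using t cZ e tI by (subst ac[OF ab(1)]) (intro D.lincomb_cong; auto simp: Pi_iff)
    also have "\<dots> = b \<oplus> j pz \<otimes> lincomb Z (algebra_module j C) I t e"
      using D.lincomb_add[OF c[OF ab(2)] tI(2) e] D.lincomb_smult[OF pz_closed tI(1) e] ac[OF ab(2)] by simp
    finally show ?thesis using ab D.lincomb_closed[OF tI(1) e] by (auto simp: eqmod_def)
  qed
  then have "\<forall>a\<in>carrier C. \<forall>b\<in>carrier C. ?r a = ?r b \<longrightarrow> eqmod C (j pz) a b" by (intro ballI impI)
  with F r show ?thesis by - (rule exI[of _ ?F], rule exI[of _ ?r], intro conjI; assumption)
qed

text \<open>The pigeonhole principle among residues modulo \<open>p\<close>. It replaces structure
  theory of finite rings in three places: for nilpotence, for prime chains and for the generator of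
  the maximal ideal.\<close>

lemma power_collision:
  fixes C (structure) and I :: "'i set"
  assumes C: "zalg C j" and sp: "zspans C j I e" and y: "y \<in> carrier C"
  shows "\<exists>(k::nat) d. d > 0 \<and> eqmod C (j pz) (y [^] k) (y [^] (k + d))"
proof -
  interpret C: cring C using C by (simp add: zalg_def)
  obtain F :: "('i \<Rightarrow> int) set" and r where F: "finite F" "r \<in> carrier C \<rightarrow> F"
    and r': "\<forall>a\<in>carrier C. \<forall>b\<in>carrier C. r a = r b \<longrightarrow> eqmod C (j pz) a b"
    using finite_residues[OF C sp] by (elim exE conjE) (rule that)
  note r = r'[rule_format]
  have "range (\<lambda>k::nat. r (y [^] k)) \<subseteq> F" using F y by auto
  then have "finite (range (\<lambda>k::nat. r (y [^] k)))" using F(1) finite_subset by blast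
  then have "\<not> inj (\<lambda>k::nat. r (y [^] k))" using finite_imageD infinite_UNIV_nat by blast
  then obtain k l :: nat where kl: "k < l" "r (y [^] k) = r (y [^] l)"
    unfolding inj_def by (metis linorder_neqE_nat)
  then show ?thesis using r[of "y [^] k" "y [^] l"] y
    by (intro exI[of _ k] exI[of _ "l - k"]) auto
qed

text \<open>The powers of an element that is neither a unit nor nilpotent modulo \<open>p\<close> would accumulate at a
  nontrivial idempotent.\<close>

lemma nilpotent_mod_p:
  fixes C (structure)
  assumes C: "zalg C j" and sp: "zspans C j I e"
    and dom: "domain C" and sep: "adic_separated C (j pz)" and y: "y \<in> carrier C"
    and nu: "\<And>N. N > 0 \<Longrightarrow> \<not> eqmod C (j pz) (y [^] (N::nat)) \<one>"
  shows "\<exists>(N::nat) c. c \<in> carrier C \<and> y [^] N = j pz \<otimes> c"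
proof -
  interpret C: domain C by fact
  have j: "j \<in> ring_hom Z C" using C by (simp add: zalg_def)
  let ?P = "j pz"
  have P: "?P \<in> carrier C" using ring_hom_closed[OF j] by simp
  have pP: "nat_elem C p = ?P \<otimes> \<one>" using hom_nat_elem[OF C, of p] P by simp
  obtain k d :: nat where d: "d > 0" and kd: "eqmod C ?P (y [^] k) (y [^] (k + d))"
    using power_collision[OF C sp y] by blast
  have shift: "eqmod C ?P (y [^] n) (y [^] (n + d))" if "n \<ge> k" for n
  proof -
    have "eqmod C ?P (y [^] k \<otimes> y [^] (n - k)) (y [^] (k + d) \<otimes> y [^] (n - k))"
      using P y kd by (intro C.eqmod_mult C.eqmod_refl) auto
    then show ?thesis using y that by (simp add: C.nat_pow_mult add.commute)
  qed
  have shifts: "eqmod C ?P (y [^] n) (y [^] (n + d * m))" if "n \<ge> k" for n m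
  proof (induction m)
    case 0
    then show ?case using P y by (simp add: C.eqmod_refl)
  next
    case (Suc m)
    have "eqmod C ?P (y [^] (n + d * m)) (y [^] (n + d * m + d))" using that by (intro shift) auto
    moreover have "n + d * m + d = n + d * Suc m" by simp
    ultimately show ?case using C.eqmod_trans[OF P Suc] by simp
  qed
  \<comment> \<open>A multiple of the period \<open>d\<close> that is past the preperiod
    \<open>k\<close>, so that the powers with exponents \<open>N\<close> and \<open>2 N\<close> are
    congruent: \<open>q\<close> is idempotent modulo \<open>p\<close>.\<close>
  define N where "N = d * (k + 1)"
  have N: "N > 0" "N \<ge> k" using d mult_le_mono1[of 1 d "k + 1"] by (simp_all add: N_def)
  define q where "q = y [^] N"
  have q: "q \<in> carrier C" using y by (simp add: q_def)
  have qq: "eqmod C ?P q (q [^] (2::nat))"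
    using shifts[OF N(2), of "k + 1", folded N_def] y by (simp add: q_def C.nat_pow_pow mult_2_right)
  have qn: "eqmod C ?P (q [^] Suc n) q" for n
  proof (induction n)
    case 0
    then show ?case using P q by (simp add: C.eqmod_refl)
  next
    case (Suc n)
    have "eqmod C ?P (q [^] Suc n \<otimes> q) (q \<otimes> q)" using Suc P q by (intro C.eqmod_mult C.eqmod_refl) auto
    moreover have "eqmod C ?P (q \<otimes> q) q" using qq C.eqmod_sym[OF P] q by (simp add: numeral_2_eq_2)
    ultimately show ?case using C.eqmod_trans[OF P] by simp
  qed
  obtain p' where p': "p = Suc p'" using p_pos(1) by (cases p) auto
  \<comment> \<open>The iterated \<open>p\<close>-th powers of an idempotent modulo \<open>p\<close>
    converge to a true idempotent with the same residue.\<close>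
  define s where "s n = q [^] (p ^ n)" for n
  have s: "s n \<in> carrier C" for n using q by (simp add: s_def)
  have "eqmod C (?P [^] n) (s (Suc n)) (s n)" for n
  proof -
    have "eqmod C (?P [^] Suc n) ((q [^] p) [^] (p ^ n)) (q [^] (p ^ n))"
      using qn[of p'] p_pos(1) unfolding p'[symmetric] by (intro C.eqmod_pow_prime_pow[OF P C.one_closed pP])
    then show ?thesis using q P C.eqmod_pow_le[of ?P "Suc n"] by (simp add: s_def C.nat_pow_pow)
  qed
  then obtain E where E: "E \<in> carrier C" "\<And>n. eqmod C (?P [^] n) E (s n)"
    using C.cauchy_limit[OF P adic_complete_of_span[OF C sp], of s] by blast
  have "E \<otimes> E = E"
  proof (rule C.eqmod_separated[OF P sep])
    fix n :: nat
    have Pn: "?P [^] n \<in> carrier C" using P by simp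
    have 1: "eqmod C (?P [^] n) (E \<otimes> E) (s n \<otimes> s n)" by (intro C.eqmod_mult[OF Pn] E)
    have "eqmod C (?P [^] Suc n) ((q [^] (2::nat)) [^] (p ^ n)) (q [^] (p ^ n))"
      using C.eqmod_sym[OF P qq] p_pos(1) by (intro C.eqmod_pow_prime_pow[OF P C.one_closed pP])
    then have "eqmod C (?P [^] n) ((q [^] (2::nat)) [^] (p ^ n)) (s n)"
      using P C.eqmod_pow_le[of ?P "Suc n"] by (simp add: s_def)
    moreover have "(q [^] (2::nat)) [^] (p ^ n) = s n \<otimes> s n"
      using q by (simp add: s_def C.nat_pow_pow mult_2 flip: C.nat_pow_mult)
    ultimately have 2: "eqmod C (?P [^] n) (s n \<otimes> s n) (s n)" by simp
    show "eqmod C (?P [^] n) (E \<otimes> E) E"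
      using C.eqmod_trans[OF Pn C.eqmod_trans[OF Pn 1 2] C.eqmod_sym[OF Pn E(2)]] .
  qed
  then have "E \<otimes> E = \<one> \<otimes> E" using E by simp
  \<comment> \<open>A domain has only the trivial idempotents; \<open>1\<close> would make a
    positive power of \<open>y\<close> congruent to \<open>1\<close>, so \<open>q\<close> is
    congruent to zero.\<close>
  then have "E = \<zero> \<or> E = \<one>" using E C.m_rcancel[of E E "\<one>"] by auto
  moreover have Eq: "eqmod C ?P E q"
  proof -
    have "eqmod C ?P E (s 1)" using E(2)[of 1] P by simp
    moreover have "eqmod C ?P (s 1) q" using qn[of p'] by (simp add: s_def p')
    ultimately show ?thesis using C.eqmod_trans[OF P] by blast
  qed
  ultimately have "eqmod C ?P q \<zero>" using nu[OF N(1)] C.eqmod_sym[OF P Eq] unfolding q_def by auto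
  then show ?thesis unfolding eqmod_def q_def using P by (intro exI[of _ N]) auto
qed

end

lemma (in domain) pow_cancel_zero:
  "y \<in> carrier R \<Longrightarrow> y \<noteq> \<zero> \<Longrightarrow> t \<in> carrier R \<Longrightarrow> y [^] (n::nat) \<otimes> t = \<zero> \<Longrightarrow> t = \<zero>"
proof (induction n arbitrary: t)
  case (Suc n)
  have "y [^] n \<otimes> (y \<otimes> t) = \<zero>" using Suc.prems by (simp add: m_assoc)
  then have "y \<otimes> t = \<zero>" using Suc by simp
  then show ?case using integral Suc.prems by blast
qed simp

context padic
begin

text \<open>In a domain the leading power of \<open>y\<close> can be cancelled from the relation of
  \<open>power_relation\<close>, so \<open>y\<close> divides the nonzero p-adic integer
  \<open>d\<close>, which is a power of \<open>p\<close> times a unit.\<close>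

lemma power_of_p_multiple:
  fixes C (structure)
  assumes C: "zalg C j" "domain C" and y: "y \<in> carrier C" "y \<noteq> \<zero>"
    and bound: "\<And>m f. zindep C j {..<m::nat} f \<Longrightarrow> m \<le> N"
  shows "\<exists>(m::nat) w. w \<in> carrier C \<and> y \<otimes> w = j pz [^] m"
proof -
  interpret C: domain C by fact
  have j: "j \<in> ring_hom Z C" using C by (simp add: zalg_def)
  have jc: "j a \<in> carrier C" if "a \<in> carrier Z" for a using ring_hom_closed[OF j that] .
  have "\<exists>(i::nat) d w. d \<in> carrier Z \<and> d \<noteq> \<zero>\<^bsub>Z\<^esub> \<and> w \<in> carrier C \<and> y [^] i \<otimes> (j d \<oplus> y \<otimes> w) = \<zero>"
    by (rule power_relation[OF C(1) y(1)]) (rule bound)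
  then obtain i :: nat and d w where w: "d \<in> carrier Z" "d \<noteq> \<zero>\<^bsub>Z\<^esub>" "w \<in> carrier C"
      "y [^] i \<otimes> (j d \<oplus> y \<otimes> w) = \<zero>"
    by (elim exE conjE) (rule that)
  have "j d \<oplus> y \<otimes> w = \<zero>" using C.pow_cancel_zero[OF y _ w(4)] w y jc by simp
  then have jd: "j d = y \<otimes> (\<ominus> w)" using w y jc by (simp add: C.minus_equality C.r_minus)
  obtain m :: nat and u where u: "u \<in> Units Z" "d = pz [^]\<^bsub>Z\<^esub> m \<otimes>\<^bsub>Z\<^esub> u" using factor[OF w(1,2)] by blast
  then have uc: "u \<in> carrier Z" "inv\<^bsub>Z\<^esub> u \<in> carrier Z" by (auto intro: Z.Units_closed)
  have "j pz [^] m = j (d \<otimes>\<^bsub>Z\<^esub> inv\<^bsub>Z\<^esub> u)"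
    using u uc by (simp add: Z.m_assoc hom_pow[OF C(1)])
  also have "\<dots> = y \<otimes> (\<ominus> w \<otimes> j (inv\<^bsub>Z\<^esub> u))"
    using w uc y jc by (simp add: ring_hom_mult[OF j] jd C.m_assoc)
  finally show ?thesis using w uc jc by (intro exI[of _ m] exI[of _ "\<ominus> w \<otimes> j (inv\<^bsub>Z\<^esub> u)"]) simp
qed

end

text \<open>A commutative algebra that is finite free over the p-adic integers, given with a basis.
  It is instantiated with both \<open>R\<close> and \<open>R'\<close>.\<close>

locale padic_order = padic p + C: cring C for p and C :: "('c, 'm) ring_scheme" (structure) +
  fixes j :: "(nat \<Rightarrow> int) \<Rightarrow> 'c" and I :: "'i set" and e :: "'i \<Rightarrow> 'c"
  assumes hom: "j \<in> ring_hom (padic_int p) C"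
    and sp: "spans_mod (padic_int p) (algebra_module j C) {\<zero>} (carrier C) I e"
    and ind: "indep_mod (padic_int p) (algebra_module j C) {\<zero>} I e"
begin

abbreviation "P \<equiv> j pz"
abbreviation "lc c \<equiv> lincomb Z (algebra_module j C) I c e"

lemma alg: "zalg C j" using hom C.is_cring by (simp add: zalg_def)

sublocale D: module "padic_int p" "algebra_module j C" by (rule zalg_module[OF alg])

lemma j_closed [simp]: "a \<in> carrier Z \<Longrightarrow> j a \<in> carrier C" using ring_hom_closed[OF hom] .

lemma P_closed [simp]: "P \<in> carrier C" by simp

lemma fin: "finite I" and e_closed: "e \<in> I \<rightarrow> carrier (algebra_module j C)"
  using sp by (auto simp: spans_mod_def)

lemma coords:
  assumes "a \<in> carrier C" obtains c where "c \<in> I \<rightarrow> carrier Z" "a = lc c"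
  using D.spans_modD[OF sp assms] D.mcong_trivial by (metis algebra_module_simps(2))

lemma lc_closed [simp]: "c \<in> I \<rightarrow> carrier Z \<Longrightarrow> lc c \<in> carrier C"
  using D.lincomb_closed[OF _ e_closed] by simp

lemma lc_pow: "c \<in> I \<rightarrow> carrier Z \<Longrightarrow> P [^] (n::nat) \<otimes> lc c = lc (\<lambda>i. pz [^]\<^bsub>Z\<^esub> n \<otimes>\<^bsub>Z\<^esub> c i)"
  using D.lincomb_smult[OF _ _ e_closed, of "pz [^]\<^bsub>Z\<^esub> n" c] hom_pow[OF alg pz_closed, of n] by simp

lemma bound: "zindep C j {..<m::nat} f \<Longrightarrow> m \<le> card I"
proof -
  assume f: "zindep C j {..<m} f"
  then have fc: "f k \<in> carrier C" if "k < m" for k using that unfolding indep_mod_def by auto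
  have "card {..<m} \<le> card I"
  proof (rule D.indep_card_le[OF Z.domain_axioms _ fin e_closed _ f])
    show "submodule {\<zero>} Z (algebra_module j C)" using D.zero_submodule by simp
    fix k assume "k \<in> {..<m}"
    then have k: "f k \<in> carrier C" using fc by simp
    obtain c where c: "c \<in> I \<rightarrow> carrier Z" "f k = lc c" using coords[OF k] .
    have mc: "mcong (algebra_module j C) {\<zero>} (\<one>\<^bsub>Z\<^esub> \<odot>\<^bsub>algebra_module j C\<^esub> f k) (lc c)"
      using D.mcong_trivial[of "\<one>\<^bsub>Z\<^esub> \<odot>\<^bsub>algebra_module j C\<^esub> f k" "lc c"] c k ring_hom_one[OF hom] by simp
    show "\<exists>s\<in>carrier Z - {\<zero>\<^bsub>Z\<^esub>}. \<exists>c\<in>I \<rightarrow> carrier Z. mcong (algebra_module j C) {\<zero>} (s \<odot>\<^bsub>algebra_module j C\<^esub> f k) (lc c)"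
      by (rule bexI[where x = "\<one>\<^bsub>Z\<^esub>"], rule bexI[where x = c], rule mc, rule c(1)) (use Z_one_not_zero in simp)
  qed
  then show ?thesis by simp
qed

lemma lc_eq_zero: "c \<in> I \<rightarrow> carrier Z \<Longrightarrow> lc c = \<zero> \<Longrightarrow> i \<in> I \<Longrightarrow> c i = \<zero>\<^bsub>Z\<^esub>"
  using ind unfolding indep_mod_def by simp

lemma P_cancel:
  assumes "a \<in> carrier C" "P \<otimes> a = \<zero>"
  shows "a = \<zero>"
proof -
  obtain c where c: "c \<in> I \<rightarrow> carrier Z" "a = lc c" using coords[OF assms(1)] .
  have "lc (\<lambda>i. pz [^]\<^bsub>Z\<^esub> (1::nat) \<otimes>\<^bsub>Z\<^esub> c i) = \<zero>" using lc_pow[OF c(1), of 1] assms c by simp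
  then have "pz [^]\<^bsub>Z\<^esub> (1::nat) \<otimes>\<^bsub>Z\<^esub> c i = \<zero>\<^bsub>Z\<^esub>" if "i \<in> I" for i
    using lc_eq_zero[of "\<lambda>i. pz [^]\<^bsub>Z\<^esub> (1::nat) \<otimes>\<^bsub>Z\<^esub> c i" i] c that by (auto simp: Pi_iff)
  then have "pz \<otimes>\<^bsub>Z\<^esub> c i = \<zero>\<^bsub>Z\<^esub>" if "i \<in> I" for i using that Z.nat_pow_eone[OF pz_closed] by simp
  then have "c i = \<zero>\<^bsub>Z\<^esub>" if "i \<in> I" for i using that pz_cancel c(1) by (auto simp: Pi_iff)
  then show ?thesis using D.lincomb_zero[OF _ e_closed] c(2) by simp
qed

lemma P_separated: "adic_separated C P"
  unfolding adic_separated_def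
proof (intro ballI impI)
  fix a assume a: "a \<in> carrier C" "\<forall>n::nat. \<exists>b\<in>carrier C. a = P [^] n \<otimes> b"
  obtain c where c: "c \<in> I \<rightarrow> carrier Z" "a = lc c" using coords[OF a(1)] .
  have "c i = \<zero>\<^bsub>Z\<^esub>" if i: "i \<in> I" for i
  proof (rule adic_separatedD[OF separated])
    show "c i \<in> carrier Z" using c i by auto
    fix n :: nat
    obtain b where b: "b \<in> carrier C" "a = P [^] n \<otimes> b" using a by blast
    obtain d where d: "d \<in> I \<rightarrow> carrier Z" "b = lc d" using coords[OF b(1)] .
    have d': "(\<lambda>i. pz [^]\<^bsub>Z\<^esub> n \<otimes>\<^bsub>Z\<^esub> d i) \<in> I \<rightarrow> carrier Z" using d by (auto simp: Pi_iff)
    have cd: "(\<lambda>i. c i \<ominus>\<^bsub>Z\<^esub> pz [^]\<^bsub>Z\<^esub> n \<otimes>\<^bsub>Z\<^esub> d i) \<in> I \<rightarrow> carrier Z" using c(1) d' by (auto simp: Pi_iff)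
    have "lc (\<lambda>i. c i \<ominus>\<^bsub>Z\<^esub> pz [^]\<^bsub>Z\<^esub> n \<otimes>\<^bsub>Z\<^esub> d i) = \<zero>"
      using D.lincomb_diff[OF c(1) d' e_closed] lc_pow[OF d(1), of n] b(2) c(2) d(2)
        C.r_right_minus_eq[OF lc_closed[OF d'] lc_closed[OF d']] by simp
    then have "c i \<ominus>\<^bsub>Z\<^esub> pz [^]\<^bsub>Z\<^esub> n \<otimes>\<^bsub>Z\<^esub> d i = \<zero>\<^bsub>Z\<^esub>" using lc_eq_zero[OF cd _ i] by simp
    then have "c i = pz [^]\<^bsub>Z\<^esub> n \<otimes>\<^bsub>Z\<^esub> d i" using Z.r_right_minus_eq[of "c i" "pz [^]\<^bsub>Z\<^esub> n \<otimes>\<^bsub>Z\<^esub> d i"] c d i by (auto simp: Pi_iff)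
    then show "\<exists>b\<in>carrier Z. c i = pz [^]\<^bsub>Z\<^esub> n \<otimes>\<^bsub>Z\<^esub> b" using d i by auto
  qed
  then show "a = \<zero>" using D.lincomb_zero[OF _ e_closed] c(2) by simp
qed

lemma P_complete: "adic_complete C P"
  by (rule adic_complete_of_span[OF alg sp])

text \<open>The inverse is the geometric series.\<close>

lemma one_minus_P_mult_unit:
  assumes t: "t \<in> carrier C" shows "\<one> \<ominus> P \<otimes> t \<in> Units C"
proof -
  define s where "s n = (\<Oplus>k\<in>{..<n}. (P \<otimes> t) [^] k)" for n :: nat
  have sS: "s (Suc n) = (P \<otimes> t) [^] n \<oplus> s n" for n unfolding s_def lessThan_Suc using t
    by (subst C.finsum_insert) auto
  have s: "s n \<in> carrier C" for n unfolding s_def using t by (intro C.finsum_closed) auto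
  have "eqmod C (P [^] n) (s (Suc n)) (s n)" for n
    unfolding eqmod_def sS using t s[of n] C.nat_pow_distrib[of P t n]
    by (intro conjI bexI[of _ "t [^] n"]) (auto simp: C.a_comm)
  then obtain l where l: "l \<in> carrier C" "\<And>n::nat. eqmod C (P [^] n) l (s n)"
    using C.cauchy_limit[OF P_closed P_complete, of s] by blast
  let ?u = "\<one> \<ominus> P \<otimes> t"
  have u: "?u \<in> carrier C" using t by simp
  have us: "?u \<otimes> s n \<oplus> (P \<otimes> t) [^] n = \<one>" for n
  proof (induction n)
    case 0
    then show ?case using u by (simp add: s_def)
  next
    case (Suc n)
    define q where "q = (P \<otimes> t) [^] n"
    define v where "v = P \<otimes> t"
    have qv: "q \<in> carrier C" "v \<in> carrier C" using t by (auto simp: q_def v_def)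
    have "(\<one> \<ominus> v) \<otimes> (q \<oplus> s n) \<oplus> q \<otimes> v = (\<one> \<ominus> v) \<otimes> s n \<oplus> q"
      using qv s[of n] by algebra
    then show ?case using Suc unfolding sS C.nat_pow_Suc q_def v_def by simp
  qed
  have "?u \<otimes> l = \<one>"
  proof (rule C.eqmod_separated[OF P_closed P_separated])
    fix n :: nat
    have Pn: "P [^] n \<in> carrier C" by simp
    have 1: "eqmod C (P [^] n) (?u \<otimes> l) (?u \<otimes> s n)"
      by (intro C.eqmod_mult[OF Pn] C.eqmod_refl[OF Pn u] l(2))
    have 2: "eqmod C (P [^] n) \<one> (?u \<otimes> s n)"
      unfolding eqmod_def using us[of n] u s[of n] t C.nat_pow_distrib[of P t n]
      by (intro conjI bexI[of _ "t [^] n"]) auto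
    show "eqmod C (P [^] n) (?u \<otimes> l) \<one>" using C.eqmod_trans[OF Pn 1 C.eqmod_sym[OF Pn 2]] .
  qed
  then show ?thesis using u l(1) C.m_comm unfolding Units_def by auto
qed

text \<open>Otherwise \<open>1 = a + t p\<close> with \<open>a\<close> in the ideal, but
  \<open>1 - p t\<close> is a unit.\<close>

lemma P_in_maximalideal:
  assumes "maximalideal J C" shows "P \<in> J"
proof (rule ccontr)
  assume P: "P \<notin> J"
  interpret J: maximalideal J C by fact
  let ?L = "J <+>\<^bsub>C\<^esub> PIdl P"
  have L: "ideal ?L C" by (intro C.add_ideals J.is_ideal C.cgenideal_ideal P_closed)
  have mem: "x \<in> ?L \<longleftrightarrow> (\<exists>a\<in>J. \<exists>t\<in>carrier C. x = a \<oplus> t \<otimes> P)" for x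
    by (auto simp: set_add_def' cgenideal_def)
  have "J \<subseteq> ?L" unfolding subset_iff mem using J.a_subset
    by (intro allI impI bexI[of _ "\<zero>"] bexI) (auto intro: C.r_zero[symmetric])
  moreover have "P \<in> ?L" unfolding mem
    by (intro bexI[of _ "\<one>"] bexI[of _ "\<zero>"]) auto
  ultimately have "?L = carrier C" using J.I_maximal[OF L] P L ideal.Icarr[OF L] by blast
  then obtain a t where at: "a \<in> J" "t \<in> carrier C" "\<one> = a \<oplus> t \<otimes> P" using mem[of "\<one>"] C.one_closed by blast
  have a: "a \<in> carrier C" using at(1) by (rule J.Icarr)
  have "\<one> \<ominus> P \<otimes> t = a"
  proof -
    have "(a \<oplus> t \<otimes> P) \<ominus> P \<otimes> t = a" using a at(2) P_closed by algebra
    then show ?thesis using at(3) by simp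
  qed
  then have "a \<in> Units C" using one_minus_P_mult_unit[OF at(2)] by simp
  then have "\<one> \<in> J" using at(1) J.I_r_closed[of a "inv a"] by (simp add: C.Units_r_inv)
  then show False using J.one_imp_carrier J.I_notcarr by blast
qed

text \<open>The middle prime ideal would contain \<open>p\<close>, and then every element outside it would have a power
  congruent to \<open>1\<close>.\<close>

lemma no_prime_chain:
  assumes J: "primeideal J0 C" "primeideal J1 C" "primeideal J2 C" and sub: "J0 \<subset> J1" "J1 \<subset> J2"
  shows False
proof -
  interpret J0: primeideal J0 C by fact
  interpret J1: primeideal J1 C by fact
  interpret J2: primeideal J2 C by fact
  have pow0: "y [^] (n::nat) \<otimes> t \<in> L \<Longrightarrow> t \<in> L" if "primeideal L C" "y \<in> carrier C" "y \<notin> L" "t \<in> carrier C" for y n t L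
  proof (induction n)
    case (Suc n)
    have "y \<otimes> (y [^] n \<otimes> t) \<in> L" using Suc.prems that by (simp add: C.m_ac)
    then have "y \<in> L \<or> y [^] n \<otimes> t \<in> L"
      using that by (intro primeideal.I_prime[OF that(1)]) auto
    then show ?case using Suc.IH that(3) by auto
  qed (use that in simp)
  obtain y where y: "y \<in> J1" "y \<notin> J0" using sub by blast
  have yc: "y \<in> carrier C" using y J1.Icarr by blast
  have "\<exists>(i::nat) d w. d \<in> carrier Z \<and> d \<noteq> \<zero>\<^bsub>Z\<^esub> \<and> w \<in> carrier C \<and> y [^] i \<otimes> (j d \<oplus> y \<otimes> w) = \<zero>"
    by (rule power_relation[OF alg yc]) (rule bound)
  then obtain i :: nat and d w where w: "d \<in> carrier Z" "d \<noteq> \<zero>\<^bsub>Z\<^esub>" "w \<in> carrier C"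
      "y [^] i \<otimes> (j d \<oplus> y \<otimes> w) = \<zero>"
    by (elim exE conjE) (rule that)
  \<comment> \<open>An element \<open>y\<close> of \<open>J1\<close> outside \<open>J0\<close> can
    be cancelled from its power relation modulo \<open>J0\<close>. This puts a nonzero p-adic
    integer, hence a power of \<open>p\<close> and finally \<open>p\<close>, into
    \<open>J1\<close>.\<close>
  have "j d \<oplus> y \<otimes> w \<in> J1" using pow0[OF J(1) yc y(2), of "j d \<oplus> y \<otimes> w" i] w yc sub by auto
  then have "(j d \<oplus> y \<otimes> w) \<ominus> y \<otimes> w \<in> J1"
    using J1.I_r_closed[OF y(1) w(3)] unfolding a_minus_def by (rule J1.a_closed[OF _ J1.a_inv_closed])
  moreover have "(j d \<oplus> y \<otimes> w) \<ominus> y \<otimes> w = j d" using w yc j_closed[of d] by algebra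
  ultimately have jd: "j d \<in> J1" by simp
  obtain m :: nat and u where u: "u \<in> Units Z" "d = pz [^]\<^bsub>Z\<^esub> m \<otimes>\<^bsub>Z\<^esub> u" using factor[OF w(1,2)] by blast
  then have uc: "u \<in> carrier Z" "inv\<^bsub>Z\<^esub> u \<in> carrier Z" by (auto intro: Z.Units_closed)
  have "j (d \<otimes>\<^bsub>Z\<^esub> inv\<^bsub>Z\<^esub> u) \<in> J1"
    using J1.I_r_closed[OF jd, of "j (inv\<^bsub>Z\<^esub> u)"] w uc by (simp add: ring_hom_mult[OF hom])
  moreover have "d \<otimes>\<^bsub>Z\<^esub> inv\<^bsub>Z\<^esub> u = pz [^]\<^bsub>Z\<^esub> m" using u uc by (simp add: Z.m_assoc)
  ultimately have "P [^] m \<otimes> \<one> \<in> J1" using hom_pow[OF alg, of pz m] by simp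
  then have P1: "P \<in> J1" using pow0[OF J(2) P_closed _ C.one_closed, of m] J1.one_imp_carrier J1.I_notcarr by blast
  obtain z where z: "z \<in> J2" "z \<notin> J1" using sub by blast
  have zc: "z \<in> carrier C" using z J2.Icarr by blast
  \<comment> \<open>With \<open>p\<close> in \<open>J1\<close>, a collision of powers of
    \<open>z\<close> modulo \<open>p\<close> puts \<open>1 - z^d\<close> into \<open>J1\<close> and
    so into \<open>J2\<close>, which also contains \<open>z^d\<close>.\<close>
  obtain k d :: nat where d: "d > 0" "eqmod C P (z [^] k) (z [^] (k + d))"
    using power_collision[OF alg sp zc] by blast
  then obtain t where t: "t \<in> carrier C" "z [^] k = z [^] (k + d) \<oplus> P \<otimes> t" unfolding eqmod_def by blast
  have "z [^] k \<otimes> (\<one> \<ominus> z [^] d) = z [^] k \<ominus> z [^] (k + d)"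
    using zc C.nat_pow_closed[OF zc, of k] C.nat_pow_closed[OF zc, of d] unfolding C.nat_pow_mult[OF zc, symmetric] by algebra
  also have "\<dots> = P \<otimes> t"
  proof -
    have zk: "z [^] (k + d) \<in> carrier C" using zc by simp
    have "(z [^] (k + d) \<oplus> P \<otimes> t) \<ominus> z [^] (k + d) = P \<otimes> t" using zk t(1) P_closed by algebra
    then show ?thesis using t(2) by simp
  qed
  finally have "z [^] k \<otimes> (\<one> \<ominus> z [^] d) \<in> J1" using J1.I_r_closed[OF P1 t(1)] by simp
  then have "\<one> \<ominus> z [^] d \<in> J2" using pow0[OF J(2) zc z(2), of "\<one> \<ominus> z [^] d" k] zc sub by auto
  moreover have "z [^] d \<in> J2" using d(1) z(1) zc J2.I_l_closed by (cases d) auto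
  ultimately have "\<one> \<ominus> z [^] d \<oplus> z [^] d \<in> J2" by (rule J2.a_closed)
  moreover have "\<one> \<ominus> z [^] d \<oplus> z [^] d = \<one>" using C.nat_pow_closed[OF zc, of d] C.one_closed by algebra
  ultimately show False using J2.one_imp_carrier J2.I_notcarr by auto
qed

end

section \<open>The ring of integers of a $p$-adic field\<close>

lemma (in cring) Units_of_mult_one:
  assumes "a \<in> carrier R" "b \<in> carrier R" "a \<otimes> b = \<one>" shows "a \<in> Units R"
proof -
  have "b \<otimes> a = \<one>" using assms m_comm by simp
  then show ?thesis unfolding Units_def using assms by auto
qed

lemma finsum_subring:
  assumes A: "abelian_monoid A" and K: "abelian_monoid K"
    and add: "add A = add K" "ring.zero A = ring.zero K" and sub: "carrier A \<subseteq> carrier K"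
    and f: "f \<in> I \<rightarrow> carrier A"
  shows "finsum A f I = finsum K f I"
proof -
  interpret A: abelian_monoid A by fact
  interpret K: abelian_monoid K by fact
  show ?thesis using f
  proof (induction I rule: infinite_finite_induct)
    case (insert i I)
    then have "f i \<in> carrier K" "f \<in> I \<rightarrow> carrier K" using sub by auto
    with insert show ?case by (simp add: add)
  qed (simp_all add: add)
qed

text \<open>\<open>cring_A\<close>, which says that the integral elements form a ring, is a locale
  assumption. The theorem supplies it through the hypothesis that \<open>R'\<close> is a module over
  \<open>R\<close>, which contains that \<open>R\<close> is a commutative ring.\<close>

locale padic_extension = padic p + K: field K for p and K :: "('k, 'm) ring_scheme" (structure) +
  fixes \<iota> :: "((nat \<Rightarrow> int) \<times> (nat \<Rightarrow> int)) set \<Rightarrow> 'k"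
  assumes iota: "\<iota> \<in> ring_hom (padic_field p) K"
    and findim: "ring.finite_dimension K (\<iota> ` carrier (padic_field p)) (carrier K)"
    and cring_A: "cring (ring_of_integers p K \<iota>)"
begin

abbreviation "Q \<equiv> padic_field p"
abbreviation "\<alpha> \<equiv> \<iota> \<circ> padic_of_int p"
abbreviation "A \<equiv> ring_of_integers p K \<iota>"

lemma padic_of_int_hom: "padic_of_int p \<in> ring_hom Z Q"
proof (rule ring_hom_memI)
  fix x y assume xy: "x \<in> carrier Z" "y \<in> carrier Z"
  note [simp] = Z_one_not_zero
  show "padic_of_int p x \<in> carrier Q" using xy by (simp add: padic_of_int_def padic_field_def Z.fraction_closed)
  show "padic_of_int p (x \<otimes>\<^bsub>Z\<^esub> y) = padic_of_int p x \<otimes>\<^bsub>Q\<^esub> padic_of_int p y"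
    using xy by (simp add: padic_of_int_def padic_field_def Z.fraction_mult)
  show "padic_of_int p (x \<oplus>\<^bsub>Z\<^esub> y) = padic_of_int p x \<oplus>\<^bsub>Q\<^esub> padic_of_int p y"
    using xy by (simp add: padic_of_int_def padic_field_def Z.fraction_add)
qed (simp add: padic_of_int_def padic_field_def fraction_field_def)

lemma iota_mult: "x \<in> carrier Q \<Longrightarrow> y \<in> carrier Q \<Longrightarrow> \<iota> (x \<otimes>\<^bsub>Q\<^esub> y) = \<iota> x \<otimes> \<iota> y"
  by (rule ring_hom_mult[OF iota])

lemma alpha_hom_K: "\<alpha> \<in> ring_hom Z K"
  by (rule ring_hom_trans[OF padic_of_int_hom iota])

lemma alpha_K [simp]: "a \<in> carrier Z \<Longrightarrow> \<iota> (padic_of_int p a) \<in> carrier K"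
  using ring_hom_closed[OF alpha_hom_K] by simp

lemma alpha_simps:
  "a \<in> carrier Z \<Longrightarrow> b \<in> carrier Z \<Longrightarrow> \<alpha> (a \<otimes>\<^bsub>Z\<^esub> b) = \<alpha> a \<otimes> \<alpha> b"
  "a \<in> carrier Z \<Longrightarrow> b \<in> carrier Z \<Longrightarrow> \<alpha> (a \<oplus>\<^bsub>Z\<^esub> b) = \<alpha> a \<oplus> \<alpha> b"
  "\<alpha> \<one>\<^bsub>Z\<^esub> = \<one>" "\<alpha> \<zero>\<^bsub>Z\<^esub> = \<zero>"
  using ring_hom_mult[OF alpha_hom_K] ring_hom_add[OF alpha_hom_K] ring_hom_one[OF alpha_hom_K]
    ring_hom_zero'[OF alpha_hom_K Z.ring_axioms K.ring_axioms] by auto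

lemma alpha_uminus: "a \<in> carrier Z \<Longrightarrow> \<alpha> (\<ominus>\<^bsub>Z\<^esub> a) = \<ominus> \<alpha> a"
  using alpha_simps(2)[of "\<ominus>\<^bsub>Z\<^esub> a" a] alpha_simps(4)
  by (simp add: Z.l_neg K.minus_equality[symmetric])

lemma clear_denominator:
  assumes "k \<in> carrier Q"
  shows "\<exists>s a. s \<in> carrier Z \<and> s \<noteq> \<zero>\<^bsub>Z\<^esub> \<and> a \<in> carrier Z \<and> \<alpha> s \<otimes> \<iota> k = \<alpha> a"
proof -
  obtain a s where as: "a \<in> carrier Z" "s \<in> carrier Z" "s \<noteq> \<zero>\<^bsub>Z\<^esub>" "k = fraction Z a s"
    using Z.fraction_cases assms unfolding padic_field_def by metis
  have "padic_of_int p s \<otimes>\<^bsub>Q\<^esub> k = fraction Z (s \<otimes>\<^bsub>Z\<^esub> a) (\<one>\<^bsub>Z\<^esub> \<otimes>\<^bsub>Z\<^esub> s)"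
    unfolding padic_of_int_def padic_field_def as(4) using as Z_one_not_zero by (intro Z.fraction_mult) auto
  also have "\<dots> = padic_of_int p a"
    unfolding padic_of_int_def using as Z_one_not_zero
    by (intro Z.fraction_eqI) (auto simp: Z.fraction_rel_iff Z.m_comm)
  finally have e: "padic_of_int p s \<otimes>\<^bsub>Q\<^esub> k = padic_of_int p a" .
  have "\<alpha> s \<otimes> \<iota> k = \<alpha> a"
    using iota_mult[OF ring_hom_closed[OF padic_of_int_hom as(2)] assms] e by simp
  with as show ?thesis by blast
qed

lemma alpha_inj: assumes "a \<in> carrier Z" "\<alpha> a = \<zero>" shows "a = \<zero>\<^bsub>Z\<^esub>"
proof (rule ccontr)
  assume a: "a \<noteq> \<zero>\<^bsub>Z\<^esub>"
  have k: "fraction Z \<one>\<^bsub>Z\<^esub> a \<in> carrier Q" using assms a by (simp add: padic_field_def Z.fraction_closed)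
  have "padic_of_int p a \<otimes>\<^bsub>Q\<^esub> fraction Z \<one>\<^bsub>Z\<^esub> a = fraction Z (a \<otimes>\<^bsub>Z\<^esub> \<one>\<^bsub>Z\<^esub>) (\<one>\<^bsub>Z\<^esub> \<otimes>\<^bsub>Z\<^esub> a)"
    unfolding padic_of_int_def padic_field_def using assms a Z_one_not_zero by (intro Z.fraction_mult) auto
  also have "\<dots> = padic_of_int p \<one>\<^bsub>Z\<^esub>"
    unfolding padic_of_int_def using assms a Z_one_not_zero
    by (intro Z.fraction_eqI) (auto simp: Z.fraction_rel_iff)
  finally have "\<alpha> a \<otimes> \<iota> (fraction Z \<one>\<^bsub>Z\<^esub> a) = \<one>"
    using iota_mult[OF ring_hom_closed[OF padic_of_int_hom assms(1)] k] alpha_simps(3) by simp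
  then show False using assms ring_hom_closed[OF iota k] by simp
qed

sublocale KM: module "padic_int p" "algebra_module (\<iota> \<circ> padic_of_int p) K"
  by (rule module_algebra_module[OF Z.is_cring alpha_hom_K K.is_cring])

abbreviation "frac_comb n e y \<equiv> \<exists>s\<in>carrier Z - {\<zero>\<^bsub>Z\<^esub>}. \<exists>c\<in>{..<n::nat} \<rightarrow> carrier Z.
    \<alpha> s \<otimes> y = lincomb Z (algebra_module \<alpha> K) {..<n} c e"

text \<open>A space of dimension \<open>n\<close> over the p-adic numbers is spanned over the p-adic
  integers by \<open>n\<close> elements, up to denominators. The induction follows the definition of
  dimension by adjoining one vector at a time.\<close>

lemma fraction_span:
  assumes "K.dimension n (\<iota> ` carrier Q) E"
  shows "\<exists>e. e \<in> {..<n} \<rightarrow> carrier K \<and> (\<forall>y\<in>E. y \<in> carrier K \<and> frac_comb n e y)"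
  using assms
proof (induction n "\<iota> ` carrier Q" E)
  case zero_dim
  have l: "\<alpha> \<one>\<^bsub>Z\<^esub> \<otimes> \<zero> = lincomb Z (algebra_module \<alpha> K) {..<0::nat} (\<lambda>_. \<zero>\<^bsub>Z\<^esub>) (\<lambda>_. \<zero>)"
    using KM.lincomb_empty by (simp add: alpha_simps(3) del: comp_apply)
  have one: "\<one>\<^bsub>Z\<^esub> \<in> carrier Z - {\<zero>\<^bsub>Z\<^esub>}" using Z_one_not_zero by simp
  have zc: "(\<lambda>_. \<zero>\<^bsub>Z\<^esub>) \<in> {..<0::nat} \<rightarrow> carrier Z" by simp
  have "frac_comb 0 (\<lambda>_. \<zero>) \<zero>"
    by (rule bexI[OF _ one], rule bexI[OF _ zc], rule l)
  then show ?case
    by (intro exI[of _ "\<lambda>_. \<zero>"] conjI ballI) (simp_all only: singleton_iff K.zero_closed Pi_iff simp_thms ball_triv)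
next
  case (Suc_dim v E n)
  have "\<exists>e. e \<in> {..<n} \<rightarrow> carrier K \<and> (\<forall>y\<in>E. y \<in> carrier K \<and> frac_comb n e y)" by (rule Suc_dim.hyps(4))
  then obtain e where e: "e \<in> {..<n} \<rightarrow> carrier K"
    and E: "\<forall>y\<in>E. y \<in> carrier K \<and> frac_comb n e y"
    by (elim exE conjE) (rule that)
  let ?e = "e(n := v)"
  have e': "?e \<in> {..<Suc n} \<rightarrow> carrier K" using e Suc_dim.hyps by (auto simp: Pi_iff less_Suc_eq)
  have "y \<in> carrier K \<and> frac_comb (Suc n) ?e y"
    if y: "y \<in> K.line_extension (\<iota> ` carrier Q) v E" for y
  proof -
    obtain k u where ku: "k \<in> carrier Q" "u \<in> E" "y = \<iota> k \<otimes> v \<oplus> u"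
      using y unfolding K.line_extension_mem_iff by blast
    have kK: "\<iota> k \<in> carrier K" by (rule ring_hom_closed[OF iota ku(1)])
    obtain s2 a where s2: "s2 \<in> carrier Z" "s2 \<noteq> \<zero>\<^bsub>Z\<^esub>" "a \<in> carrier Z" "\<alpha> s2 \<otimes> \<iota> k = \<alpha> a"
      using clear_denominator[OF ku(1)] by blast
    have uK: "u \<in> carrier K" using E ku(2) by blast
    have "frac_comb n e u" using bspec[OF E ku(2)] by (rule conjunct2)
    then obtain s1 c where s1: "s1 \<in> carrier Z" "s1 \<noteq> \<zero>\<^bsub>Z\<^esub>" "c \<in> {..<n} \<rightarrow> carrier Z"
        "\<alpha> s1 \<otimes> u = lincomb Z (algebra_module \<alpha> K) {..<n} c e"
      by (elim bexE) (rule that, auto)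
    \<comment> \<open>Coefficients after multiplication by both denominators: \<open>s1\<close>
      belongs to the vector from the smaller space, \<open>s2\<close> to the new scalar.\<close>
    let ?c = "\<lambda>i. if i < n then s2 \<otimes>\<^bsub>Z\<^esub> c i else s1 \<otimes>\<^bsub>Z\<^esub> a"
    have c': "?c \<in> {..<Suc n} \<rightarrow> carrier Z" using s1 s2 by (auto simp: Pi_iff)
    have "lincomb Z (algebra_module \<alpha> K) {..<n} ?c ?e = lincomb Z (algebra_module \<alpha> K) {..<n} (\<lambda>i. s2 \<otimes>\<^bsub>Z\<^esub> c i) e"
      using s1 s2 e by (intro KM.lincomb_cong) (auto simp: Pi_iff)
    also have "\<dots> = \<alpha> s2 \<otimes> (\<alpha> s1 \<otimes> u)"
      using KM.lincomb_smult[OF s2(1) s1(3), of e] e s1(4) by simp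
    finally have l: "lincomb Z (algebra_module \<alpha> K) {..<n} ?c ?e = \<alpha> s2 \<otimes> (\<alpha> s1 \<otimes> u)" .
    have "lincomb Z (algebra_module \<alpha> K) (insert n {..<n}) ?c ?e
        = ?c n \<odot>\<^bsub>algebra_module \<alpha> K\<^esub> ?e n \<oplus>\<^bsub>algebra_module \<alpha> K\<^esub> lincomb Z (algebra_module \<alpha> K) {..<n} ?c ?e"
      using c' e' by (intro KM.lincomb_insert) (simp_all add: lessThan_Suc)
    then have L: "lincomb Z (algebra_module \<alpha> K) {..<Suc n} ?c ?e
        = \<alpha> (s1 \<otimes>\<^bsub>Z\<^esub> a) \<otimes> v \<oplus> \<alpha> s2 \<otimes> (\<alpha> s1 \<otimes> u)"
      unfolding l lessThan_Suc by simp
    have v: "v \<in> carrier K" by fact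
    have aK: "\<alpha> s1 \<in> carrier K" "\<alpha> s2 \<in> carrier K" using s1 s2 by simp_all
    have "\<alpha> (s2 \<otimes>\<^bsub>Z\<^esub> s1) \<otimes> y = \<alpha> s1 \<otimes> (\<alpha> s2 \<otimes> \<iota> k) \<otimes> v \<oplus> \<alpha> s2 \<otimes> (\<alpha> s1 \<otimes> u)"
      unfolding ku(3) alpha_simps(1)[OF s2(1) s1(1)] using aK kK v uK by algebra
    also have "\<dots> = lincomb Z (algebra_module \<alpha> K) {..<Suc n} ?c ?e"
      unfolding L s2(4) alpha_simps(1)[OF s1(1) s2(3)] ..
    finally have S: "\<alpha> (s2 \<otimes>\<^bsub>Z\<^esub> s1) \<otimes> y = lincomb Z (algebra_module \<alpha> K) {..<Suc n} ?c ?e" .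
    have s: "s2 \<otimes>\<^bsub>Z\<^esub> s1 \<in> carrier Z - {\<zero>\<^bsub>Z\<^esub>}" using s1 s2 Z.integral_iff by auto
    have "y \<in> carrier K" using ku(3) kK v uK by simp
    moreover have "frac_comb (Suc n) ?e y"
      by (rule bexI[OF _ s], rule bexI[where x = ?c], rule S, rule c')
    ultimately show ?thesis ..
  qed
  with e' show ?case by - (rule exI[of _ ?e], rule conjI, assumption, rule ballI, assumption)
qed

text \<open>Independence over the p-adic integers inside \<open>K\<close> is bounded by the
  dimension of \<open>K\<close>, because the rank comparison tolerates denominators.\<close>

lemma bound_K: "\<exists>N. \<forall>m f. zindep K \<alpha> {..<m::nat} f \<longrightarrow> m \<le> N"
proof -
  obtain n where n: "K.dimension n (\<iota> ` carrier Q) (carrier K)"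
    using findim unfolding K.finite_dimension_def by blast
  obtain e where e: "e \<in> {..<n} \<rightarrow> carrier K"
    and E: "\<forall>y\<in>carrier K. y \<in> carrier K \<and> frac_comb n e y"
    using fraction_span[OF n] by (elim exE conjE) (rule that)
  have "m \<le> n" if f: "zindep K \<alpha> {..<m::nat} f" for m f
  proof -
    have fc: "f k \<in> carrier K" if "k < m" for k using f that unfolding indep_mod_def by auto
    have "card {..<m} \<le> card {..<n}"
    proof (rule KM.indep_card_le[OF Z.domain_axioms _ _ _ _ f])
      show "submodule {\<zero>} Z (algebra_module \<alpha> K)" using KM.zero_submodule by simp
      show "e \<in> {..<n} \<rightarrow> carrier (algebra_module \<alpha> K)" using e by simp
      fix k assume "k \<in> {..<m}"
      then have k: "f k \<in> carrier K" using fc by simp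
      have "frac_comb n e (f k)" using bspec[OF E k] by (rule conjunct2)
      then obtain s c where s: "s \<in> carrier Z - {\<zero>\<^bsub>Z\<^esub>}" "c \<in> {..<n} \<rightarrow> carrier Z"
          "\<alpha> s \<otimes> f k = lincomb Z (algebra_module \<alpha> K) {..<n} c e"
        by (elim bexE) (rule that)
      have "lincomb Z (algebra_module \<alpha> K) {..<n} c e \<in> carrier K" using KM.lincomb_closed[OF s(2), of e] e by simp
      then have mc: "mcong (algebra_module \<alpha> K) {\<zero>} (s \<odot>\<^bsub>algebra_module \<alpha> K\<^esub> f k) (lincomb Z (algebra_module \<alpha> K) {..<n} c e)"
        using KM.mcong_trivial[of "s \<odot>\<^bsub>algebra_module \<alpha> K\<^esub> f k" "lincomb Z (algebra_module \<alpha> K) {..<n} c e"] s k by simp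
      show "\<exists>s\<in>carrier Z - {\<zero>\<^bsub>Z\<^esub>}. \<exists>c\<in>{..<n} \<rightarrow> carrier Z.
          mcong (algebra_module \<alpha> K) {\<zero>} (s \<odot>\<^bsub>algebra_module \<alpha> K\<^esub> f k) (lincomb Z (algebra_module \<alpha> K) {..<n} c e)"
        by (rule bexI[OF _ s(1)], rule bexI[where x = c], rule mc, rule s(2))
    qed simp
    then show ?thesis by simp
  qed
  then show ?thesis by - (rule exI[of _ n], intro allI impI)
qed

lemma A_carrier: "x \<in> carrier A \<longleftrightarrow> x \<in> carrier K \<and> integral_over K (\<alpha> ` carrier Z) x"
  by (simp add: ring_of_integers_def image_comp)

lemma A_ops [simp]: "monoid.mult A = monoid.mult K" "monoid.one A = monoid.one K" "add A = add K" "ring.zero A = ring.zero K"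
  by (simp_all add: ring_of_integers_def)

lemma A_sub: "carrier A \<subseteq> carrier K" by (auto simp: A_carrier)

sublocale A: cring "ring_of_integers p K \<iota>" by (rule cring_A)

sublocale A: domain "ring_of_integers p K \<iota>"
  by (intro domain.intro[OF cring_A] domain_axioms.intro) (use A_sub K.integral K.one_not_zero in auto)

lemma A_pow [simp]: "x [^]\<^bsub>A\<^esub> (n::nat) = x [^] n"
  by (simp add: nat_pow_def)

lemma alpha_integral: assumes a: "a \<in> carrier Z" shows "\<alpha> a \<in> carrier A"
proof -
  let ?q = "[\<one>, \<ominus> \<alpha> a]"
  have q: "?q \<in> carrier (univ_poly K (\<alpha> ` carrier Z))"
    unfolding univ_poly_carrier[symmetric] polynomial_def
  proof -
    have "\<one> \<in> \<alpha> ` carrier Z" by (rule image_eqI[of _ _ "\<one>\<^bsub>Z\<^esub>"]) (simp_all add: alpha_simps(3) del: comp_apply)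
    moreover have "\<ominus> \<alpha> a \<in> \<alpha> ` carrier Z"
      by (rule image_eqI[of _ _ "\<ominus>\<^bsub>Z\<^esub> a"]) (simp_all add: a alpha_uminus del: comp_apply)
    ultimately show "?q = [] \<or> set ?q \<subseteq> \<alpha> ` carrier Z \<and> lead_coeff ?q \<noteq> \<zero>" by simp
  qed
  have "K.eval ?q (\<alpha> a) = \<zero>" using a by (simp add: K.r_neg)
  then show ?thesis unfolding A_carrier integral_over_def using a q by (intro conjI bexI[OF _ q]) auto
qed

lemma alpha_hom: "\<alpha> \<in> ring_hom Z A"
  by (rule ring_hom_memI) (use alpha_integral alpha_simps in auto)

lemma alg_A: "zalg A \<alpha>" using alpha_hom cring_A by (simp add: zalg_def)

sublocale AM: module "padic_int p" "algebra_module (\<iota> \<circ> padic_of_int p) (ring_of_integers p K \<iota>)"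
  by (rule zalg_module[OF alg_A])

lemma bound_A: "\<exists>N. \<forall>m f. zindep A \<alpha> {..<m::nat} f \<longrightarrow> m \<le> N"
proof -
  have "zindep K \<alpha> {..<m} f"
    if f: "zindep A \<alpha> {..<m} f" for m :: nat and f
  proof -
    have fA: "f \<in> {..<m} \<rightarrow> carrier A" using f by (simp add: indep_mod_def)
    have "lincomb Z (algebra_module \<alpha> A) {..<m} c f = lincomb Z (algebra_module \<alpha> K) {..<m} c f"
      if c: "c \<in> {..<m} \<rightarrow> carrier Z" for c
    proof -
      have cf: "\<iota> (padic_of_int p (c i)) \<otimes>\<^bsub>A\<^esub> f i \<in> carrier A" if "i < m" for i
        using ring_hom_closed[OF alpha_hom, of "c i"] c fA that by (intro A.m_closed) auto
      show ?thesis
        using finsum_subring[OF A.abelian_monoid_axioms K.abelian_monoid_axioms _ _ A_sub,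
          of "\<lambda>i. \<iota> (padic_of_int p (c i)) \<otimes>\<^bsub>A\<^esub> f i" "{..<m}"] cf
        by (simp add: lincomb_def Pi_iff)
    qed
    then show ?thesis using f A_sub unfolding indep_mod_def by (auto simp: Pi_iff)
  qed
  then show ?thesis using bound_K by meson
qed

text \<open>An inverse \<open>y\<close> of \<open>p\<close> in \<open>R\<close> satisfies a monic
  equation of some degree \<open>n\<close>; multiplied by \<open>p^n\<close> it reads
  \<open>1 + p b = 0\<close> with a p-adic integer \<open>b\<close>, which would make
  \<open>p\<close> a unit among the p-adic integers.\<close>

lemma p_not_unit_A: "\<alpha> pz \<notin> Units A"
proof
  assume "\<alpha> pz \<in> Units A"
  then obtain y where y: "y \<in> carrier A" "\<alpha> pz \<otimes> y = \<one>"
    unfolding Units_def by auto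
  have yK: "y \<in> carrier K" using y(1) A_sub by auto
  have pK: "\<alpha> pz \<in> carrier K" by simp
  have PY: "\<alpha> pz [^] (n + k) \<otimes> y [^] k = \<alpha> pz [^] n" for n k :: nat
  proof -
    have "\<alpha> pz [^] (n + k) \<otimes> y [^] k = \<alpha> pz [^] n \<otimes> (\<alpha> pz [^] k \<otimes> y [^] k)"
      using pK yK by (simp add: K.m_assoc K.nat_pow_mult[symmetric])
    also have "\<alpha> pz [^] k \<otimes> y [^] k = \<one>" using K.nat_pow_distrib[OF pK yK, of k] y(2) by simp
    finally show ?thesis using pK by simp
  qed
  have evK: "K.eval q y \<in> carrier K" if "set q \<subseteq> \<alpha> ` carrier Z" for q
    using that yK by (intro K.eval_in_carrier) auto
  \<comment> \<open>In the terms below the leading one the exponent of \<open>y\<close> is less than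
    \<open>n\<close>, so at least one factor \<open>p\<close> survives the cancellation.\<close>
  have key: "\<exists>b\<in>carrier Z. \<alpha> pz [^] n \<otimes> K.eval q y = \<alpha> (pz \<otimes>\<^bsub>Z\<^esub> b)"
    if "set q \<subseteq> \<alpha> ` carrier Z" "length q \<le> n" for q and n :: nat
    using that
  proof (induction q)
    case Nil
    then show ?case using pK alpha_simps(4) by (intro bexI[of _ "\<zero>\<^bsub>Z\<^esub>"]) auto
  next
    case (Cons x q)
    then obtain b where b: "b \<in> carrier Z" "\<alpha> pz [^] n \<otimes> K.eval q y = \<alpha> (pz \<otimes>\<^bsub>Z\<^esub> b)" by auto
    obtain a where a: "a \<in> carrier Z" "x = \<alpha> a" using Cons.prems by auto
    obtain r where r: "n = Suc r + length q" using Cons.prems(2) by (metis Suc_le_eq less_iff_Suc_add add.commute add_Suc_right length_Cons)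
    have aK: "\<alpha> a \<in> carrier K" using a by simp
    have rZ: "pz [^]\<^bsub>Z\<^esub> r \<otimes>\<^bsub>Z\<^esub> a \<in> carrier Z" using a by simp
    have yq: "y [^] length q \<in> carrier K" "\<alpha> pz [^] n \<in> carrier K" using yK pK by simp_all
    have "\<alpha> pz [^] n \<otimes> K.eval (x # q) y
        = \<alpha> a \<otimes> (\<alpha> pz [^] n \<otimes> y [^] length q) \<oplus> \<alpha> pz [^] n \<otimes> K.eval q y"
    proof -
      have "K.eval (x # q) y = \<alpha> a \<otimes> y [^] length q \<oplus> K.eval q y" using a by simp
      moreover have "K.eval q y \<in> carrier K" using Cons.prems evK by simp
      ultimately show ?thesis using aK yq by algebra
    qed
    also have "\<alpha> pz [^] n \<otimes> y [^] length q = \<alpha> pz [^] Suc r" unfolding r by (rule PY)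
    also have "\<alpha> pz [^] Suc r = \<alpha> (pz [^]\<^bsub>Z\<^esub> Suc r)" using hom_pow[OF alg_A pz_closed, of "Suc r"] by simp
    also have "\<alpha> a \<otimes> \<alpha> (pz [^]\<^bsub>Z\<^esub> Suc r) \<oplus> \<alpha> pz [^] n \<otimes> K.eval q y
        = \<alpha> (a \<otimes>\<^bsub>Z\<^esub> pz [^]\<^bsub>Z\<^esub> Suc r \<oplus>\<^bsub>Z\<^esub> pz \<otimes>\<^bsub>Z\<^esub> b)"
      unfolding b(2) using a b by (simp only: alpha_simps Z.m_closed Z.nat_pow_closed pz_closed)
    also have "a \<otimes>\<^bsub>Z\<^esub> pz [^]\<^bsub>Z\<^esub> Suc r \<oplus>\<^bsub>Z\<^esub> pz \<otimes>\<^bsub>Z\<^esub> b = pz \<otimes>\<^bsub>Z\<^esub> (pz [^]\<^bsub>Z\<^esub> r \<otimes>\<^bsub>Z\<^esub> a \<oplus>\<^bsub>Z\<^esub> b)"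
      using a b by (simp add: Z.r_distr Z.m_ac)
    finally show ?case using rZ b(1) by (intro bexI[of _ "pz [^]\<^bsub>Z\<^esub> r \<otimes>\<^bsub>Z\<^esub> a \<oplus>\<^bsub>Z\<^esub> b"]) auto
  qed
  obtain q where q: "q \<in> carrier (univ_poly K (\<alpha> ` carrier Z))" "q \<noteq> []" "lead_coeff q = \<one>" "K.eval q y = \<zero>"
    using y(1) unfolding A_carrier integral_over_def by blast
  then obtain r where r: "q = \<one> # r" by (cases q) auto
  have rZ: "set r \<subseteq> \<alpha> ` carrier Z" using q(1) unfolding r univ_poly_carrier[symmetric] polynomial_def by auto
  let ?n = "length r"
  obtain b where b: "b \<in> carrier Z" "\<alpha> pz [^] ?n \<otimes> K.eval r y = \<alpha> (pz \<otimes>\<^bsub>Z\<^esub> b)" using key[OF rZ, of ?n] by auto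
  have "\<alpha> pz [^] ?n \<otimes> (y [^] ?n \<oplus> K.eval r y) = \<zero>" using q(4) r pK yK by simp
  then have "\<alpha> pz [^] (0 + ?n) \<otimes> y [^] ?n \<oplus> \<alpha> (pz \<otimes>\<^bsub>Z\<^esub> b) = \<zero>"
    using evK[OF rZ] pK yK b(2) by (simp add: K.r_distr)
  then have "\<alpha> (\<one>\<^bsub>Z\<^esub> \<oplus>\<^bsub>Z\<^esub> pz \<otimes>\<^bsub>Z\<^esub> b) = \<zero>" unfolding PY using b by (simp add: alpha_simps del: comp_apply)
  then have "\<one>\<^bsub>Z\<^esub> \<oplus>\<^bsub>Z\<^esub> pz \<otimes>\<^bsub>Z\<^esub> b = \<zero>\<^bsub>Z\<^esub>" using alpha_inj[of "\<one>\<^bsub>Z\<^esub> \<oplus>\<^bsub>Z\<^esub> pz \<otimes>\<^bsub>Z\<^esub> b"] b by simp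
  then have "pz \<otimes>\<^bsub>Z\<^esub> (\<ominus>\<^bsub>Z\<^esub> b) = \<one>\<^bsub>Z\<^esub>" using b Z.minus_equality[of "\<one>\<^bsub>Z\<^esub>" "pz \<otimes>\<^bsub>Z\<^esub> b"] by (simp add: Z.r_minus)
  then have "pz \<in> Units Z" by (rule Z.Units_of_mult_one[OF pz_closed Z.a_inv_closed[OF b(1)]])
  then show False using pz_not_unit by blast
qed

lemma alpha_pz_nonzero: "\<alpha> pz \<noteq> \<zero>"
  using alpha_inj[of pz] pz_cancel[of "\<one>\<^bsub>Z\<^esub>"] Z_one_not_zero by auto

lemma multiple_A:
  assumes "y \<in> carrier A" "y \<noteq> \<zero>\<^bsub>A\<^esub>"
  shows "\<exists>(m::nat) w. w \<in> carrier A \<and> y \<otimes>\<^bsub>A\<^esub> w = \<alpha> pz [^]\<^bsub>A\<^esub> m"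
proof -
  obtain N where N: "\<forall>m f. zindep A \<alpha> {..<m::nat} f \<longrightarrow> m \<le> N"
    using bound_A by (elim exE) (rule that)
  show ?thesis
    by (rule power_of_p_multiple[OF alg_A A.domain_axioms assms]) (rule N[rule_format])
qed

text \<open>A nonzero \<open>y\<close> divides some \<open>p^m\<close>. If \<open>y\<close> were
  divisible by \<open>p^(m+1)\<close>, cancelling \<open>p^m\<close> would make \<open>p\<close> a
  unit.\<close>

lemma separated_A: "adic_separated A (\<alpha> pz)"
  unfolding adic_separated_def
proof (intro ballI impI, rule ccontr)
  fix y assume y: "y \<in> carrier A" "\<forall>n::nat. \<exists>b\<in>carrier A. y = \<alpha> pz [^]\<^bsub>A\<^esub> n \<otimes>\<^bsub>A\<^esub> b" "y \<noteq> \<zero>\<^bsub>A\<^esub>"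
  obtain m :: nat and w where w: "w \<in> carrier A" "y \<otimes>\<^bsub>A\<^esub> w = \<alpha> pz [^]\<^bsub>A\<^esub> m"
    using multiple_A[OF y(1,3)] by (elim exE conjE) (rule that)
  obtain b where b: "b \<in> carrier A" "y = \<alpha> pz [^]\<^bsub>A\<^esub> Suc m \<otimes>\<^bsub>A\<^esub> b" using y(2) by blast
  define P where "P = \<alpha> pz"
  have P: "P \<in> carrier A" unfolding P_def by (rule alpha_integral) simp
  have "P [^]\<^bsub>A\<^esub> m \<otimes>\<^bsub>A\<^esub> (\<one>\<^bsub>A\<^esub> \<ominus>\<^bsub>A\<^esub> P \<otimes>\<^bsub>A\<^esub> (b \<otimes>\<^bsub>A\<^esub> w)) = P [^]\<^bsub>A\<^esub> m \<ominus>\<^bsub>A\<^esub> (P [^]\<^bsub>A\<^esub> m \<otimes>\<^bsub>A\<^esub> P \<otimes>\<^bsub>A\<^esub> b) \<otimes>\<^bsub>A\<^esub> w"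
    using P b(1) w(1) A.nat_pow_closed[OF P, of m] A.one_closed by algebra
  also have "\<dots> = \<zero>\<^bsub>A\<^esub>"
    using w(2) b P A.r_right_minus_eq[OF A.nat_pow_closed[OF P, of m] A.nat_pow_closed[OF P, of m]]
    unfolding P_def[symmetric] A.nat_pow_Suc by simp
  finally have z: "P [^]\<^bsub>A\<^esub> m \<otimes>\<^bsub>A\<^esub> (\<one>\<^bsub>A\<^esub> \<ominus>\<^bsub>A\<^esub> P \<otimes>\<^bsub>A\<^esub> (b \<otimes>\<^bsub>A\<^esub> w)) = \<zero>\<^bsub>A\<^esub>" .
  have P0: "P \<noteq> \<zero>\<^bsub>A\<^esub>" using alpha_pz_nonzero by (simp add: P_def)
  have "\<one>\<^bsub>A\<^esub> \<ominus>\<^bsub>A\<^esub> P \<otimes>\<^bsub>A\<^esub> (b \<otimes>\<^bsub>A\<^esub> w) = \<zero>\<^bsub>A\<^esub>"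
    using P b(1) w(1) by (intro A.pow_cancel_zero[OF P P0 _ z] A.minus_closed A.one_closed A.m_closed)
  then have "\<one>\<^bsub>A\<^esub> = P \<otimes>\<^bsub>A\<^esub> (b \<otimes>\<^bsub>A\<^esub> w)"
    using A.r_right_minus_eq[of "\<one>\<^bsub>A\<^esub>" "P \<otimes>\<^bsub>A\<^esub> (b \<otimes>\<^bsub>A\<^esub> w)"] P b(1) w(1) by (simp del: A_ops)
  then have "P \<in> Units A" using A.Units_of_mult_one[OF P A.m_closed[OF b(1) w(1)]] by simp
  then show False using p_not_unit_A by (simp add: P_def)
qed

text \<open>The ring of integers is finite free over the p-adic integers. Finite generation comes
  from the rank bound by lifting a maximal family that is independent modulo \<open>p\<close>,
  without traces or discriminants; a basis is then selected by torsion-freeness.\<close>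

lemma basis_A:
  "\<exists>(I :: nat set) e. zspans A \<alpha> I e \<and>
     zindep A \<alpha> I e"
proof -
  have carr: "submodule (carrier A) Z (algebra_module \<alpha> A)" using AM.carrier_is_submodule by simp
  have zero: "submodule {\<zero>\<^bsub>A\<^esub>} Z (algebra_module \<alpha> A)" using AM.zero_submodule by simp
  have tf: "d = \<zero>\<^bsub>A\<^esub>" if "d \<in> carrier A" "\<alpha> pz \<otimes>\<^bsub>A\<^esub> d = \<zero>\<^bsub>A\<^esub>" for d
    using A.integral[OF that(2) alpha_integral[OF pz_closed] that(1)] alpha_pz_nonzero by simp
  obtain N where N: "\<forall>m f. zindep A \<alpha> {..<m::nat} f \<longrightarrow> m \<le> N"
    using bound_A by (elim exE) (rule that)
  have "\<exists>m f. spans_mod Z (algebra_module \<alpha> A) {\<zero>\<^bsub>algebra_module \<alpha> A\<^esub>} (carrier A) {..<m::nat} f"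
  proof (rule AM.spans_of_bounded_rank[OF pz_closed local separated complete carr])
    show "d = \<zero>\<^bsub>algebra_module \<alpha> A\<^esub>" if "d \<in> carrier A" "pz \<odot>\<^bsub>algebra_module \<alpha> A\<^esub> d = \<zero>\<^bsub>algebra_module \<alpha> A\<^esub>" for d
      using tf[of d] that by simp
    show "d = \<zero>\<^bsub>algebra_module \<alpha> A\<^esub>" if d: "d \<in> carrier A"
      "\<And>n::nat. \<exists>d'\<in>carrier A. d = (pz [^]\<^bsub>Z\<^esub> n) \<odot>\<^bsub>algebra_module \<alpha> A\<^esub> d'" for d
      using adic_separatedD[OF separated_A d(1)] d(2) hom_pow[OF alg_A pz_closed] by simp
    show "m \<le> N" if "indep_mod Z (algebra_module \<alpha> A) {\<zero>\<^bsub>algebra_module \<alpha> A\<^esub>} {..<m} f" for m :: nat and f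
      using N[rule_format, of m f] that by simp
  qed
  then obtain m :: nat and f where f: "zspans A \<alpha> {..<m} f"
    by (elim exE) (rule that, simp)
  have "\<exists>J\<subseteq>{..<m}. zspans A \<alpha> J f \<and> zindep A \<alpha> J f"
  proof (rule AM.torsion_free_basis[OF zero carr pz_closed local separated _ f])
    show "d \<in> {\<zero>\<^bsub>A\<^esub>}" if "d \<in> carrier A" "pz \<odot>\<^bsub>algebra_module \<alpha> A\<^esub> d \<in> {\<zero>\<^bsub>A\<^esub>}" for d
      using tf[of d] that by simp
  qed
  then show ?thesis by (elim exE conjE) (intro exI conjI)
qed

end

section \<open>Finite flat regular extensions\<close>

lemma (in cring) exists_maximalideal_superset:
  assumes J: "ideal J R" "\<one> \<notin> J"
  shows "\<exists>L. maximalideal L R \<and> J \<subseteq> L"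
proof -
  define S where "S = {L. ideal L R \<and> J \<subseteq> L \<and> \<one> \<notin> L}"
  have "\<exists>L\<in>S. \<forall>Y\<in>S. L \<subseteq> Y \<longrightarrow> Y = L"
  proof (rule subset_Zorn_nonempty)
    show "S \<noteq> {}" using J by (auto simp: S_def)
    fix C assume C: "C \<noteq> {}" "subset.chain S C"
    then have sub: "C \<subseteq> S" by (simp add: subset_chain_def)
    have "subset.chain {I. ideal I R} C" using C(2) unfolding subset_chain_def S_def by blast
    then have "ideal (\<Union>C) R" using chain_Union_is_ideal[of C] C(1) by simp
    then show "\<Union>C \<in> S" using sub C(1) unfolding S_def by blast
  qed
  then obtain L where LS: "L \<in> S" and LY: "\<forall>Y\<in>S. L \<subseteq> Y \<longrightarrow> Y = L" by (elim bexE) (rule that)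
  have L: "ideal L R" "J \<subseteq> L" "\<one> \<notin> L" using LS by (simp_all add: S_def)
  have "maximalideal L R"
  proof (rule maximalidealI[OF L(1)])
    show "carrier R \<noteq> L" using L(3) by auto
    fix Y assume Y: "ideal Y R" "L \<subseteq> Y" "Y \<subseteq> carrier R"
    show "Y = L \<or> Y = carrier R"
    proof (cases "\<one> \<in> Y")
      case True
      then show ?thesis using ideal.one_imp_carrier[OF Y(1)] by simp
    next
      case False
      then have "Y \<in> S" using Y L by (auto simp: S_def)
      then show ?thesis using LY Y by simp
    qed
  qed
  with L(2) show ?thesis by blast
qed

context tensor
begin

text \<open>Covers maps that are only linear, such as multiplication by a fixed element, in contrast
  to the ring maps of \<open>tensor_mor\<close>.\<close>

lemma tensor_map_linear:
  assumes h: "\<And>a. a \<in> carrier A \<Longrightarrow> h a \<in> carrier A"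
    and add: "\<And>a b. a \<in> carrier A \<Longrightarrow> b \<in> carrier A \<Longrightarrow> h (a \<oplus>\<^bsub>A\<^esub> b) = h a \<oplus>\<^bsub>A\<^esub> h b"
    and lin: "\<And>s a. s \<in> carrier S \<Longrightarrow> a \<in> carrier A \<Longrightarrow> h (f s \<otimes>\<^bsub>A\<^esub> a) = f s \<otimes>\<^bsub>A\<^esub> h a"
    and ab: "a \<in> carrier A" "b \<in> carrier B"
  shows "tensor_map S (algebra_module f A) (algebra_module g B) h (\<lambda>x. x) (proj (frag_of (a, b))) = proj (frag_of (h a, b))"
proof -
  define E where "E t = frag_extend (\<lambda>(x, y). frag_of (h x, y)) t" for t :: "'a \<times> 'b \<Rightarrow>\<^sub>0 int"
  have E: "E (frag_of (x, y)) = frag_of (h x, y)" "E (t - u) = E t - E u" "E (t + u) = E t + E u" for x y t u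
    by (simp_all add: E_def frag_extend_diff frag_extend_add)
  have "r \<in> carrier PR \<and> E r \<in> Rel" if "r \<in> Rel" for r
    using that
  proof (induction r rule: Rel_induct)
    case (add_left a a' b)
    then show ?case using Rel_add_left[of "h a" "h a'" b] h by (simp add: E add)
  next
    case (add_right a b b')
    then show ?case using Rel_add_right[of "h a" b b'] h by (simp add: E)
  next
    case (balanced s a b)
    then show ?case using Rel_balanced[of s "h a" b] h by (simp add: E lin)
  next
    case (diff x y)
    then show ?case unfolding E by (intro Rel_diff)
  qed
  then have rel: "r \<in> Rel \<Longrightarrow> E r \<in> Rel" for r by blast
  have r: "r_coset (tensor_free (algebra_module f A) (algebra_module g B)) Rel u = proj u" for u
    by (auto simp: proj_set r_coset_def)
  let ?u = "frag_of (a, b)"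
  have "(\<lambda>t. r_coset (tensor_free (algebra_module f A) (algebra_module g B)) Rel (E t)) ` proj ?u = {proj (E ?u)}"
  proof -
    have "proj (E (r + ?u)) = proj (E ?u)" if "r \<in> Rel" for r
      using rel[OF that] Rel_PR[OF rel[OF that]] ab h by (subst proj_eq_iff) (auto simp: E)
    moreover have "?u \<in> proj ?u" using Rel_zero by (auto simp: proj_set intro!: exI[of _ 0])
    ultimately show ?thesis unfolding r by (auto simp: proj_set)
  qed
  then show ?thesis by (simp add: tensor_map_def E_def)
qed

end

text \<open>Multiplication by \<open>a\<close> is injective on the domain \<open>A\<close>; flatness
  preserves this after tensoring with \<open>A'\<close>, where it becomes multiplication by
  \<open>\<phi> a\<close> under the identification of \<open>A \<otimes> A'\<close> with
  \<open>A'\<close>.\<close>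

lemma flat_torsion_free:
  assumes A: "domain A" and A': "cring A'" and phi: "\<phi> \<in> ring_hom A A'" and flat: "flat_module A (algebra_module \<phi> A')"
    and a: "a \<in> carrier A" "a \<noteq> \<zero>\<^bsub>A\<^esub>" and x: "x \<in> carrier A'" "\<phi> a \<otimes>\<^bsub>A'\<^esub> x = \<zero>\<^bsub>A'\<^esub>"
  shows "x = \<zero>\<^bsub>A'\<^esub>"
proof -
  interpret A: domain A by fact
  interpret A': cring A' by fact
  have id: "(\<lambda>x. x) \<in> ring_hom A A" by (rule ring_hom_memI) auto
  interpret t: tensor A A A' "\<lambda>x. x" \<phi>
    by (intro tensor.intro tensor_axioms.intro A.is_cring A' id phi)
  let ?N = "algebra_module (\<lambda>x. x) A" and ?h = "\<lambda>x. a \<otimes>\<^bsub>A\<^esub> x"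
  have N: "module A ?N" by (rule module_algebra_module[OF A.is_cring id A.is_cring])
  have lin: "?h \<in> linear_maps A ?N ?N"
    unfolding linear_maps_def hom_def using a by (auto simp: A.r_distr A.m_lcomm)
  have inj: "inj_on ?h (carrier ?N)"
    by (rule inj_onI) (use a A.m_lcancel in auto)
  have "carrier (tensor_free A A') = carrier t.PR" by (auto simp: pair_ring_simps(1))
  \<comment> \<open>Flatness speaks of the tensor product as a group, the other arguments of the
    tensor ring; both have the same cosets as elements.\<close>
  then have carr: "carrier (tensor_product A ?N (algebra_module \<phi> A')) = carrier t.T"
    unfolding tensor_product_def tensor_ring_def FactGroup_def FactRing_def A_RCOSETS_def'
    by (simp add: RCOSETS_def pair_ring_simps r_coset_def a_r_coset_def)
  have inj': "inj_on (tensor_map A ?N (algebra_module \<phi> A') ?h (\<lambda>x. x)) (carrier t.T)"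
    using flat lin inj N unfolding flat_module_def carr[symmetric] by blast
  have map: "tensor_map A ?N (algebra_module \<phi> A') ?h (\<lambda>x. x) (t.proj (frag_of (\<one>\<^bsub>A\<^esub>, y))) = t.proj (frag_of (a, y))"
    if "y \<in> carrier A'" for y
    using t.tensor_map_linear[of ?h "\<one>\<^bsub>A\<^esub>" y] that a by (simp add: A.r_distr A.m_lcomm)
  have inr: "t.proj (frag_of (\<one>\<^bsub>A\<^esub>, y)) = t.inr y" if "y \<in> carrier A'" for y
    by (simp add: t.inr_def)
  have ay: "t.proj (frag_of (a, y)) = t.inr (\<phi> a \<otimes>\<^bsub>A'\<^esub> y)" if "y \<in> carrier A'" for y
    using that a t.inl_inr[of a y] t.inl_f[of a] ring_hom_mult[OF t.inr_hom, of "\<phi> a" y] ring_hom_closed[OF phi, of a] by simp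
  have "t.inr x = t.inr \<zero>\<^bsub>A'\<^esub>"
    by (rule inj_onD[OF inj']) (use map[OF x(1)] map[OF A'.zero_closed] inr x ay a ring_hom_closed[OF phi, of a] in simp_all)
  then have z: "t.inr x = \<zero>\<^bsub>t.T\<^esub>" using ring_hom_zero'[OF t.inr_hom A'.ring_axioms t.T.ring_axioms] by simp
  \<comment> \<open>The map sending \<open>a \<otimes> b\<close> to \<open>\<phi> a b\<close> shows
    that \<open>1 \<otimes> x = 0\<close> forces \<open>x = 0\<close>.\<close>
  have "\<exists>h. (\<forall>x\<in>carrier t.T. h x \<in> carrier A') \<and> (\<forall>x\<in>carrier t.T. \<forall>y\<in>carrier t.T. h (x \<oplus>\<^bsub>t.T\<^esub> y) = h x \<oplus>\<^bsub>A'\<^esub> h y)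
    \<and> (\<forall>a\<in>carrier A. \<forall>b\<in>carrier A'. h (t.inl a \<otimes>\<^bsub>t.T\<^esub> t.inr b) = \<phi> a \<otimes>\<^bsub>A'\<^esub> b)"
    using ring_hom_closed[OF phi]
    by (intro t.bilinear_descends A'.abelian_group_axioms)
      (simp_all add: ring_hom_add[OF phi] ring_hom_mult[OF phi] A'.l_distr A'.r_distr A'.m_ac)
  then obtain h where h0: "\<And>x. x \<in> carrier t.T \<Longrightarrow> h x \<in> carrier A'"
      "\<And>x y. x \<in> carrier t.T \<Longrightarrow> y \<in> carrier t.T \<Longrightarrow> h (x \<oplus>\<^bsub>t.T\<^esub> y) = h x \<oplus>\<^bsub>A'\<^esub> h y"
      and h1: "h (t.inl \<one>\<^bsub>A\<^esub> \<otimes>\<^bsub>t.T\<^esub> t.inr x) = \<phi> \<one>\<^bsub>A\<^esub> \<otimes>\<^bsub>A'\<^esub> x"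
    using x A.one_closed by blast
  have "h \<zero>\<^bsub>t.T\<^esub> = h \<zero>\<^bsub>t.T\<^esub> \<oplus>\<^bsub>A'\<^esub> h \<zero>\<^bsub>t.T\<^esub>" using h0(2)[OF t.T.zero_closed t.T.zero_closed] by simp
  then have h: "h \<zero>\<^bsub>t.T\<^esub> = \<zero>\<^bsub>A'\<^esub>" using A'.add.r_cancel_one'[of "h \<zero>\<^bsub>t.T\<^esub>" "h \<zero>\<^bsub>t.T\<^esub>"] h0(1) by auto
  have "t.inl \<one>\<^bsub>A\<^esub> \<otimes>\<^bsub>t.T\<^esub> t.inr x = t.inr x" using ring_hom_one[OF t.inl_hom] x by simp
  then have "\<phi> \<one>\<^bsub>A\<^esub> \<otimes>\<^bsub>A'\<^esub> x = \<zero>\<^bsub>A'\<^esub>" using h h1 z by simp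
  then show ?thesis using ring_hom_one[OF phi] x by simp
qed

locale regular_extension = padic_extension p K \<iota> + A': cring A'
  for p and K :: "('k, 'm) ring_scheme" and \<iota> and A' :: "('r, 'n) ring_scheme" +
  fixes \<phi> :: "'k \<Rightarrow> 'r"
  assumes phi: "\<phi> \<in> ring_hom (ring_of_integers p K \<iota>) A'"
    and fg: "finitely_generated_module (ring_of_integers p K \<iota>) (algebra_module \<phi> A')"
    and flat: "flat_module (ring_of_integers p K \<iota>) (algebra_module \<phi> A')"
    and regular: "regular_local_ring A'"
begin

lemma phi_torsion_free:
  "a \<in> carrier A \<Longrightarrow> a \<noteq> \<zero>\<^bsub>A\<^esub> \<Longrightarrow> x \<in> carrier A' \<Longrightarrow> \<phi> a \<otimes>\<^bsub>A'\<^esub> x = \<zero>\<^bsub>A'\<^esub> \<Longrightarrow> x = \<zero>\<^bsub>A'\<^esub>"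
  by (rule flat_torsion_free[OF A.domain_axioms A'.is_cring phi flat])

lemma phi_alpha_hom: "\<phi> \<circ> \<alpha> \<in> ring_hom Z A'"
  by (rule ring_hom_trans[OF alpha_hom phi])

text \<open>Generators of \<open>R'\<close> over \<open>R\<close> times a basis of \<open>R\<close>
  span over the p-adic integers; flatness excludes \<open>p\<close>-torsion, so a basis can be
  selected among the products.\<close>

lemma basis_A':
  "\<exists>(I :: ('r \<times> nat) set) e. zspans A' (\<phi> \<circ> \<alpha>) I e \<and>
     zindep A' (\<phi> \<circ> \<alpha>) I e"
proof -
  have modA: "module A (algebra_module \<phi> A')" by (rule module_algebra_module[OF cring_A phi A'.is_cring])
  interpret N: module A "algebra_module \<phi> A'" by (rule modA)
  have algA': "zalg A' (\<phi> \<circ> \<alpha>)" using phi_alpha_hom A'.is_cring by (simp add: zalg_def)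
  interpret D: module Z "algebra_module (\<phi> \<circ> \<alpha>) A'" by (rule zalg_module[OF algA'])
  obtain B where B: "B \<subseteq> carrier A'" "finite B"
      "\<And>x. x \<in> carrier A' \<Longrightarrow> \<exists>c\<in>B \<rightarrow> carrier A. x = (\<Oplus>\<^bsub>A'\<^esub>b\<in>B. \<phi> (c b) \<otimes>\<^bsub>A'\<^esub> b)"
    using fg unfolding finitely_generated_module_def by auto
  have sB: "spans_mod A (algebra_module \<phi> A') {\<zero>\<^bsub>A'\<^esub>} (carrier A') B (\<lambda>b. b)"
    unfolding spans_mod_def
  proof (intro conjI ballI)
    fix d assume d: "d \<in> carrier A'"
    obtain c where c: "c \<in> B \<rightarrow> carrier A" "d = (\<Oplus>\<^bsub>A'\<^esub>b\<in>B. \<phi> (c b) \<otimes>\<^bsub>A'\<^esub> b)" using B(3)[OF d] by blast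
    have mc: "mcong (algebra_module \<phi> A') {\<zero>\<^bsub>A'\<^esub>} d (lincomb A (algebra_module \<phi> A') B c (\<lambda>b. b))"
      using N.mcong_trivial[of d] c(2) d by (simp add: lincomb_def)
    show "\<exists>c\<in>B \<rightarrow> carrier A. mcong (algebra_module \<phi> A') {\<zero>\<^bsub>A'\<^esub>} d (lincomb A (algebra_module \<phi> A') B c (\<lambda>b. b))"
      by (rule bexI[where x = c], rule mc, rule c(1))
  qed (use B in auto)
  obtain I :: "nat set" and e where I: "zspans A \<alpha> I e"
    using basis_A by (elim exE conjE) (rule that)
  have carrA: "submodule (carrier A') A (algebra_module \<phi> A')" using N.carrier_is_submodule by simp
  have req: "restrict_scalars \<alpha> (algebra_module \<phi> A') = algebra_module (\<phi> \<circ> \<alpha>) A'"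
    by (simp add: restrict_scalars_def algebra_module_def comp_def)
  let ?e = "\<lambda>(i, k). e k \<odot>\<^bsub>algebra_module \<phi> A'\<^esub> i"
  have sp: "zspans A' (\<phi> \<circ> \<alpha>) (B \<times> I) ?e"
    using N.spans_mod_Times[OF Z.is_cring alpha_hom carrA sB I] unfolding req .
  have carr: "submodule (carrier A') Z (algebra_module (\<phi> \<circ> \<alpha>) A')" using D.carrier_is_submodule by simp
  have zero: "submodule {\<zero>\<^bsub>A'\<^esub>} Z (algebra_module (\<phi> \<circ> \<alpha>) A')" using D.zero_submodule by simp
  have "\<exists>J\<subseteq>B \<times> I. zspans A' (\<phi> \<circ> \<alpha>) J ?e \<and>
      zindep A' (\<phi> \<circ> \<alpha>) J ?e"
  proof (rule D.torsion_free_basis[OF zero carr pz_closed local separated _ sp])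
    show "d \<in> {\<zero>\<^bsub>A'\<^esub>}" if "d \<in> carrier A'" "pz \<odot>\<^bsub>algebra_module (\<phi> \<circ> \<alpha>) A'\<^esub> d \<in> {\<zero>\<^bsub>A'\<^esub>}" for d
      using phi_torsion_free[of "\<alpha> pz" d] alpha_integral[OF pz_closed] alpha_pz_nonzero that by simp
  qed
  then show ?thesis by (elim exE conjE) (intro exI conjI)
qed

text \<open>Regularity provides as many generators of the maximal ideal as the dimension, which is
  at most one. There is exactly one generator, because \<open>p\<close> is a nonzero element of the
  ideal. Separatedness for \<open>x\<close> is inherited from that for \<open>p\<close>, since some
  power of \<open>x\<close> is divisible by \<open>p\<close>.\<close>

lemma uniformizer_A':
  "\<exists>x c. x \<in> carrier A' \<and> c \<in> carrier A' \<and> c \<otimes>\<^bsub>A'\<^esub> x = \<phi> (\<alpha> pz) \<and>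
     (\<forall>a\<in>carrier A'. a \<in> Units A' \<or> (\<exists>b\<in>carrier A'. a = x \<otimes>\<^bsub>A'\<^esub> b)) \<and> adic_separated A' x"
proof -
  obtain I :: "('r \<times> nat) set" and e where I: "zspans A' (\<phi> \<circ> \<alpha>) I e"
     "zindep A' (\<phi> \<circ> \<alpha>) I e"
    using basis_A' by (elim exE conjE) (rule that)
  interpret O: padic_order p A' "\<phi> \<circ> \<alpha>" I e
    by (intro padic_order.intro padic_order_axioms.intro padic_axioms A'.is_cring phi_alpha_hom I)
  obtain S L where S: "S \<subseteq> carrier A'" "finite S" "enat (card S) = krull_dim A'" "maximalideal (Idl\<^bsub>A'\<^esub> S) A'"
      and uniq: "\<And>J. maximalideal J A' \<Longrightarrow> J = L"
    using regular unfolding regular_local_ring_def by blast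
  have maxS: "J = Idl\<^bsub>A'\<^esub> S" if "maximalideal J A'" for J using uniq[OF that] uniq[OF S(4)] by simp
  interpret S: maximalideal "Idl\<^bsub>A'\<^esub> S" A' by (rule S(4))
  have one: "\<one>\<^bsub>A'\<^esub> \<noteq> \<zero>\<^bsub>A'\<^esub>" using S.one_imp_carrier S.I_notcarr S.zero_closed by metis
  have "krull_dim A' \<le> 1"
    unfolding krull_dim_def
  proof (rule Sup_least)
    fix d assume "d \<in> {enat n |n. \<exists>P. (\<forall>i\<le>n. primeideal (P i) A') \<and> (\<forall>i<n. P i \<subset> P (Suc i))}"
    then obtain n :: nat and J where n: "d = enat n" "\<And>i. i \<le> n \<Longrightarrow> primeideal (J i) A'" "\<And>i. i < n \<Longrightarrow> J i \<subset> J (Suc i)"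
      by blast
    have "n \<le> 1"
    proof (rule ccontr)
      assume "\<not> n \<le> 1"
      then show False using O.no_prime_chain[of "J 0" "J 1" "J 2"] n(2)[of 0] n(2)[of 1] n(2)[of 2] n(3)[of 0] n(3)[of 1]
        by (simp add: numeral_2_eq_2)
    qed
    then show "d \<le> 1" using n(1) by (simp add: one_enat_def)
  qed
  then have "enat (card S) \<le> 1" by (simp only: S(3))
  then have card: "card S \<le> 1" by (simp add: one_enat_def)
  have P: "\<phi> (\<alpha> pz) \<in> Idl\<^bsub>A'\<^esub> S" using O.P_in_maximalideal[OF S(4)] by simp
  have "S \<noteq> {}"
  proof
    assume "S = {}"
    then have "Idl\<^bsub>A'\<^esub> S \<subseteq> {\<zero>\<^bsub>A'\<^esub>}" using A'.genideal_minimal[OF A'.zeroideal] by simp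
    then have "\<phi> (\<alpha> pz) \<otimes>\<^bsub>A'\<^esub> \<one>\<^bsub>A'\<^esub> = \<zero>\<^bsub>A'\<^esub>" using P by auto
    then show False using O.P_cancel[of "\<one>\<^bsub>A'\<^esub>"] one by simp
  qed
  then obtain x where "S = {x}" using card S(2) by (metis One_nat_def card_0_eq card_1_singletonE le_Suc_eq le_zero_eq)
  then have x: "x \<in> carrier A'" and Sx: "Idl\<^bsub>A'\<^esub> S = PIdl\<^bsub>A'\<^esub> x" using S(1) A'.cgenideal_eq_genideal by auto
  have mem: "a \<in> Idl\<^bsub>A'\<^esub> S \<longleftrightarrow> (\<exists>b\<in>carrier A'. a = x \<otimes>\<^bsub>A'\<^esub> b)" for a
    unfolding Sx cgenideal_def using x A'.m_comm by auto
  have loc: "a \<in> Units A' \<or> (\<exists>b\<in>carrier A'. a = x \<otimes>\<^bsub>A'\<^esub> b)" if a: "a \<in> carrier A'" for a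
  proof (cases "\<one>\<^bsub>A'\<^esub> \<in> PIdl\<^bsub>A'\<^esub> a")
    case True
    then show ?thesis unfolding cgenideal_def using A'.Units_of_mult_one[OF a] A'.m_comm a by auto
  next
    case False
    obtain J where "maximalideal J A'" "PIdl\<^bsub>A'\<^esub> a \<subseteq> J"
      using A'.exists_maximalideal_superset[OF A'.cgenideal_ideal[OF a] False] by blast
    then have "a \<in> Idl\<^bsub>A'\<^esub> S" using maxS A'.cgenideal_self[OF a] by blast
    then show ?thesis unfolding mem ..
  qed
  obtain c where c: "c \<in> carrier A'" "\<phi> (\<alpha> pz) = x \<otimes>\<^bsub>A'\<^esub> c" using P unfolding mem by blast
  \<comment> \<open>The collision gives \<open>x^k (1 - x^d) = p t\<close>. The second factor is a
    unit because \<open>x\<close> lies in the only maximal ideal, so \<open>x^k\<close> is a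
    multiple of \<open>p\<close>.\<close>
  obtain k d :: nat where kd: "d > 0" "eqmod A' O.P (x [^]\<^bsub>A'\<^esub> k) (x [^]\<^bsub>A'\<^esub> (k + d))"
    using power_collision[OF O.alg O.sp x] by blast
  then obtain t where t: "t \<in> carrier A'" "x [^]\<^bsub>A'\<^esub> k = x [^]\<^bsub>A'\<^esub> (k + d) \<oplus>\<^bsub>A'\<^esub> O.P \<otimes>\<^bsub>A'\<^esub> t" unfolding eqmod_def by blast
  have xk: "x [^]\<^bsub>A'\<^esub> k \<in> carrier A'" "x [^]\<^bsub>A'\<^esub> d \<in> carrier A'" using x by simp_all
  define v where "v = \<one>\<^bsub>A'\<^esub> \<ominus>\<^bsub>A'\<^esub> x [^]\<^bsub>A'\<^esub> d"
  have v: "v \<in> carrier A'" using xk by (simp add: v_def)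
  have "x [^]\<^bsub>A'\<^esub> k \<otimes>\<^bsub>A'\<^esub> v = x [^]\<^bsub>A'\<^esub> k \<ominus>\<^bsub>A'\<^esub> x [^]\<^bsub>A'\<^esub> (k + d)"
    using xk unfolding v_def A'.nat_pow_mult[OF x, symmetric] by algebra
  also have "\<dots> = O.P \<otimes>\<^bsub>A'\<^esub> t"
  proof -
    have zk: "x [^]\<^bsub>A'\<^esub> (k + d) \<in> carrier A'" using x by simp
    have "(x [^]\<^bsub>A'\<^esub> (k + d) \<oplus>\<^bsub>A'\<^esub> O.P \<otimes>\<^bsub>A'\<^esub> t) \<ominus>\<^bsub>A'\<^esub> x [^]\<^bsub>A'\<^esub> (k + d) = O.P \<otimes>\<^bsub>A'\<^esub> t"
      using zk t(1) O.P_closed by algebra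
    then show ?thesis using t(2) by simp
  qed
  finally have xv: "x [^]\<^bsub>A'\<^esub> k \<otimes>\<^bsub>A'\<^esub> v = O.P \<otimes>\<^bsub>A'\<^esub> t" .
  have "v \<in> Units A'"
  proof (rule ccontr)
    assume "v \<notin> Units A'"
    then have vS: "v \<in> Idl\<^bsub>A'\<^esub> S" using loc[OF v] unfolding mem by blast
    have "x [^]\<^bsub>A'\<^esub> d = x \<otimes>\<^bsub>A'\<^esub> x [^]\<^bsub>A'\<^esub> (d - 1)" using kd(1) x by (cases d) (auto simp: A'.m_comm)
    then have "x [^]\<^bsub>A'\<^esub> d \<in> Idl\<^bsub>A'\<^esub> S" unfolding mem using x by blast
    then have "v \<oplus>\<^bsub>A'\<^esub> x [^]\<^bsub>A'\<^esub> d \<in> Idl\<^bsub>A'\<^esub> S" by (rule S.a_closed[OF vS])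
    moreover have "v \<oplus>\<^bsub>A'\<^esub> x [^]\<^bsub>A'\<^esub> d = \<one>\<^bsub>A'\<^esub>" unfolding v_def using xk A'.one_closed by algebra
    ultimately show False using S.one_imp_carrier S.I_notcarr by simp
  qed
  then obtain v' where v': "v' \<in> carrier A'" "v \<otimes>\<^bsub>A'\<^esub> v' = \<one>\<^bsub>A'\<^esub>" unfolding Units_def by blast
  define q where "q = t \<otimes>\<^bsub>A'\<^esub> v'"
  have q: "q \<in> carrier A'" using t v' by (simp add: q_def)
  have "x [^]\<^bsub>A'\<^esub> k = (x [^]\<^bsub>A'\<^esub> k \<otimes>\<^bsub>A'\<^esub> v) \<otimes>\<^bsub>A'\<^esub> v'" using xk v v' by (simp add: A'.m_assoc)
  then have xP: "x [^]\<^bsub>A'\<^esub> k = O.P \<otimes>\<^bsub>A'\<^esub> q" unfolding xv q_def using t v' O.P_closed by (simp add: A'.m_assoc)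
  have sep: "adic_separated A' x"
    unfolding adic_separated_def
  proof (intro ballI impI)
    fix a assume a: "a \<in> carrier A'" "\<forall>n::nat. \<exists>b\<in>carrier A'. a = x [^]\<^bsub>A'\<^esub> n \<otimes>\<^bsub>A'\<^esub> b"
    show "a = \<zero>\<^bsub>A'\<^esub>"
    proof (rule adic_separatedD[OF O.P_separated a(1)])
      fix n :: nat
      obtain b where b: "b \<in> carrier A'" "a = x [^]\<^bsub>A'\<^esub> (k * n) \<otimes>\<^bsub>A'\<^esub> b" using a(2) by blast
      have Pn: "O.P [^]\<^bsub>A'\<^esub> n \<in> carrier A'" "q [^]\<^bsub>A'\<^esub> n \<in> carrier A'" using O.P_closed q by (auto intro: A'.nat_pow_closed)
      have "x [^]\<^bsub>A'\<^esub> (k * n) = (O.P \<otimes>\<^bsub>A'\<^esub> q) [^]\<^bsub>A'\<^esub> n" unfolding xP[symmetric] using x by (simp add: A'.nat_pow_pow)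
      then have "a = O.P [^]\<^bsub>A'\<^esub> n \<otimes>\<^bsub>A'\<^esub> (q [^]\<^bsub>A'\<^esub> n \<otimes>\<^bsub>A'\<^esub> b)"
        using b Pn A'.nat_pow_distrib[OF O.P_closed q] by (simp add: A'.m_assoc del: comp_apply)
      then show "\<exists>b\<in>carrier A'. a = O.P [^]\<^bsub>A'\<^esub> n \<otimes>\<^bsub>A'\<^esub> b" using Pn b by (intro bexI[of _ "q [^]\<^bsub>A'\<^esub> n \<otimes>\<^bsub>A'\<^esub> b"]) auto
    qed
  qed
  have cx: "c \<otimes>\<^bsub>A'\<^esub> x = \<phi> (\<alpha> pz)" using c x A'.m_comm by simp
  show ?thesis
    by (rule exI[of _ x], rule exI[of _ c], intro conjI x c(1) cx sep ballI loc)
qed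

end

section \<open>The residue field and its roots of unity\<close>

text \<open>\<open>\<theta>\<close> generates the multiplicative group and \<open>m\<close> is its
  order. The exponent \<open>f\<close> comes from the pigeonhole principle for the powers of
  \<open>p\<close> modulo \<open>m\<close>, so the number of elements of the field is not computed;
  any such \<open>f\<close> serves for the Teichmueller lift and for inverting the
  Frobenius.\<close>

lemma (in field) finite_field_generator:
  assumes p: "Factorial_Ring.prime (p::nat)" and fin: "finite (carrier R)" and char: "[p] \<cdot> \<one> = \<zero>"
  shows "\<exists>\<theta> (m::nat) f. \<theta> \<in> carrier R \<and> m > 0 \<and> (\<forall>k::nat. \<theta> [^] k = \<one> \<longleftrightarrow> m dvd k) \<and>
    (\<forall>x\<in>carrier R. x = \<zero> \<or> (\<exists>i<m. x = \<theta> [^] i)) \<and> \<not> p dvd m \<and> f > 0 \<and> m dvd p ^ f - 1 \<and>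
    (\<forall>x\<in>carrier R. x [^] (p ^ f) = x)"
proof -
  let ?G = "Multiplicative_Group.mult_of R"
  interpret G: group ?G by (rule field_mult_group)
  have finG: "finite (carrier ?G)" using fin by simp
  obtain \<theta> where \<theta>: "\<theta> \<in> carrier ?G" "carrier ?G = {\<theta> [^] i |i::nat. i \<in> UNIV}"
    using finite_field_mult_group_has_gen[OF fin] by blast
  have tR: "\<theta> \<in> carrier R" "\<theta> \<noteq> \<zero>" using \<theta>(1) by auto
  define m where "m = G.ord \<theta>"
  have m: "m > 0" using G.ord_ge_1[OF finG \<theta>(1)] by (simp add: m_def)
  have id: "\<theta> [^] k = \<one> \<longleftrightarrow> m dvd k" for k :: nat
    using G.pow_eq_id[OF \<theta>(1), of k] by (simp add: m_def Multiplicative_Group.nat_pow_mult_of)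
  have gen: "\<exists>i<m. x = \<theta> [^] i" if xR: "x \<in> carrier R" "x \<noteq> \<zero>" for x
  proof -
    obtain i :: nat where i: "x = \<theta> [^] i" using \<theta>(2) xR by auto
    have "\<theta> [^] i = \<theta> [^] (m * (i div m) + i mod m)" by simp
    also have "\<dots> = (\<theta> [^] m) [^] (i div m) \<otimes> \<theta> [^] (i mod m)"
      using nat_pow_mult[OF tR(1), of "m * (i div m)" "i mod m"] nat_pow_pow[OF tR(1), of m "i div m"] by (simp only:)
    also have "\<theta> [^] m = \<one>" using id[of m] by simp
    finally show ?thesis using i m tR by (intro exI[of _ "i mod m"]) simp
  qed
  \<comment> \<open>In characteristic \<open>p\<close>, \<open>x^p = 1\<close> means
    \<open>(x - 1)^p = 0\<close>. This triviality of \<open>p\<close>-th roots of \<open>1\<close>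
    makes \<open>m\<close> prime to \<open>p\<close> and lets powers of \<open>p\<close> be
    cancelled in divisibilities by \<open>m\<close>.\<close>
  have frob1: "x = \<one>" if x: "x \<in> carrier R" "x [^] p = \<one>" for x
  proof -
    have "(x \<ominus> \<one>) [^] p \<oplus> \<one> = x [^] p"
      using freshman_char[OF p char, of "x \<ominus> \<one>" \<one>] x by (simp add: a_minus_def a_assoc l_neg)
    then have "(x \<ominus> \<one>) [^] p \<oplus> \<one> = \<zero> \<oplus> \<one>" using x(2) by simp
    then have z: "(x \<ominus> \<one>) [^] p \<otimes> \<one> = \<zero>" using add.r_cancel[of \<one> "(x \<ominus> \<one>) [^] p" \<zero>] x(1) by simp
    have "x \<ominus> \<one> = \<zero>"
    proof (rule ccontr)
      assume "x \<ominus> \<one> \<noteq> \<zero>"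
      then show False using pow_cancel_zero[OF _ _ one_closed z] x(1) by simp
    qed
    then show ?thesis using x(1) by simp
  qed
  have pm: "\<not> p dvd m"
  proof
    assume "p dvd m"
    then have mp: "m = m div p * p" by simp
    have "\<theta> [^] m = \<one>" using id[of m] by simp
    then have "(\<theta> [^] (m div p)) [^] p = \<one>" using tR mp by (simp add: nat_pow_pow)
    then have "m dvd m div p" using frob1[of "\<theta> [^] (m div p)"] tR id by simp
    moreover have "m div p < m" "m div p > 0" using m prime_gt_1_nat[OF p] mp
      by (auto intro: div_less_dividend) (metis gr0I mult_0)
    ultimately show False using dvd_imp_le by fastforce
  qed
  have cancel: "m dvd k" if "m dvd p ^ n * k" for n k
    using that
  proof (induction n)
    case (Suc n)
    have "\<theta> [^] (p ^ n * k * p) = \<one>" using Suc.prems id by (simp add: ac_simps)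
    then have "(\<theta> [^] (p ^ n * k)) [^] p = \<one>" using tR by (simp add: nat_pow_pow)
    then have "m dvd p ^ n * k" using frob1[of "\<theta> [^] (p ^ n * k)"] tR id by simp
    then show ?case by (rule Suc.IH)
  qed simp
  have "\<not> inj (\<lambda>i::nat. p ^ i mod m)"
  proof
    assume "inj (\<lambda>i::nat. p ^ i mod m)"
    moreover have "finite (range (\<lambda>i::nat. p ^ i mod m))" by (rule finite_subset[of _ "{..<m}"]) (use m in auto)
    ultimately show False using finite_imageD infinite_UNIV_nat by blast
  qed
  then obtain i k :: nat where "i < k" "p ^ i mod m = p ^ k mod m"
    unfolding inj_def by (metis linorder_neqE_nat)
  then obtain f where f: "f > 0" "p ^ i mod m = p ^ (i + f) mod m" by (metis less_imp_add_positive)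
  have "m dvd p ^ i * (p ^ f - 1)"
    using f(2) mod_eq_dvd_iff_nat[of "p ^ i" "p ^ (i + f)" m] prime_gt_0_nat[OF p]
    by (simp add: power_add diff_mult_distrib2)
  then have mf: "m dvd p ^ f - 1" by (rule cancel)
  have fixp: "x [^] (p ^ f) = x" if x: "x \<in> carrier R" for x
  proof (cases "x = \<zero>")
    case True
    then show ?thesis using prime_gt_0_nat[OF p] by (simp add: nat_pow_zero)
  next
    case False
    then obtain i :: nat where i: "x = \<theta> [^] i" using gen x by blast
    obtain q where q: "p ^ f - 1 = m * q" using mf by blast
    have "p ^ f = Suc (p ^ f - 1)" using prime_gt_0_nat[OF p] by simp
    then have "\<theta> [^] (p ^ f) = (\<theta> [^] m) [^] q \<otimes> \<theta>" using tR q by (metis nat_pow_Suc nat_pow_pow)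
    then have "\<theta> [^] (p ^ f) = \<theta>" using id[of m] tR by simp
    then show ?thesis unfolding i using tR by (metis mult.commute nat_pow_pow)
  qed
  show ?thesis
    by (rule exI[of _ \<theta>], rule exI[of _ m], rule exI[of _ f]) (use tR m id gen pm f(1) mf fixp in blast)
qed

context padic_extension
begin

lemma residue_field:
  assumes unif: "uniformizer A \<pi>"
  defines "rc \<equiv> \<lambda>a. PIdl\<^bsub>A\<^esub> \<pi> +>\<^bsub>A\<^esub> a"
  shows "field (A Quot PIdl\<^bsub>A\<^esub> \<pi>)"
    and "rc \<in> ring_hom A (A Quot PIdl\<^bsub>A\<^esub> \<pi>)"
    and "\<And>x. x \<in> carrier (A Quot PIdl\<^bsub>A\<^esub> \<pi>) \<Longrightarrow> \<exists>a\<in>carrier A. x = rc a"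
    and "\<And>a b. a \<in> carrier A \<Longrightarrow> b \<in> carrier A \<Longrightarrow> rc a = rc b \<longleftrightarrow> eqmod A \<pi> a b"
proof -
  have pi: "\<pi> \<in> carrier A" using unif by (simp add: uniformizer_def)
  interpret M: maximalideal "PIdl\<^bsub>A\<^esub> \<pi>" A using unif by (simp add: uniformizer_def)
  show "field (A Quot PIdl\<^bsub>A\<^esub> \<pi>)" by (rule M.quotient_is_field[OF cring_A])
  show "rc \<in> ring_hom A (A Quot PIdl\<^bsub>A\<^esub> \<pi>)" unfolding rc_def by (rule M.rcos_ring_hom)
  show "\<And>x. x \<in> carrier (A Quot PIdl\<^bsub>A\<^esub> \<pi>) \<Longrightarrow> \<exists>a\<in>carrier A. x = rc a"
    unfolding rc_def FactRing_def A_RCOSETS_def' by auto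
  fix a b assume ab: "a \<in> carrier A" "b \<in> carrier A"
  have "rc a = rc b \<longleftrightarrow> a \<ominus>\<^bsub>A\<^esub> b \<in> PIdl\<^bsub>A\<^esub> \<pi>"
    unfolding rc_def using A.quotient_eq_iff_same_a_r_cos[OF M.is_ideal ab] by simp
  also have "\<dots> \<longleftrightarrow> eqmod A \<pi> a b"
  proof
    assume "a \<ominus>\<^bsub>A\<^esub> b \<in> PIdl\<^bsub>A\<^esub> \<pi>"
    then obtain t where t: "t \<in> carrier A" "a \<ominus>\<^bsub>A\<^esub> b = t \<otimes>\<^bsub>A\<^esub> \<pi>" unfolding cgenideal_def by auto
    have "a = b \<oplus>\<^bsub>A\<^esub> \<pi> \<otimes>\<^bsub>A\<^esub> t" using A.eq_add_diff[OF ab] A.m_comm[OF t(1) pi] t(2) by simp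
    then show "eqmod A \<pi> a b" using ab t unfolding eqmod_def by blast
  next
    assume "eqmod A \<pi> a b"
    then obtain t where t: "t \<in> carrier A" "a = b \<oplus>\<^bsub>A\<^esub> \<pi> \<otimes>\<^bsub>A\<^esub> t" unfolding eqmod_def by blast
    have "(b \<oplus>\<^bsub>A\<^esub> \<pi> \<otimes>\<^bsub>A\<^esub> t) \<ominus>\<^bsub>A\<^esub> b = t \<otimes>\<^bsub>A\<^esub> \<pi>" using ab(2) pi t(1) by algebra
    then show "a \<ominus>\<^bsub>A\<^esub> b \<in> PIdl\<^bsub>A\<^esub> \<pi>" using t unfolding cgenideal_def by auto
  qed
  finally show "rc a = rc b \<longleftrightarrow> eqmod A \<pi> a b" .
qed

lemma ring_hom_pow':
  assumes "h \<in> ring_hom R S" "a \<in> carrier R" "ring R" "ring S"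
  shows "h (a [^]\<^bsub>R\<^esub> (n::nat)) = h a [^]\<^bsub>S\<^esub> n"
proof -
  interpret R: ring R by fact
  interpret S: ring S by fact
  show ?thesis using assms(2) ring_hom_mult[OF assms(1)] ring_hom_one[OF assms(1)] by (induction n) auto
qed

text \<open>The generator \<open>\<theta>\<close> is lifted to a root of unity in the ring of
  integers; reduction shows that the lift has exact order \<open>m\<close>. Limits are taken for
  \<open>p\<close>, whereas \<open>\<theta>\<close> is known only modulo \<open>\<pi>\<close>, so
  the two moduli have to be compared.\<close>

lemma root_of_unity:
  assumes unif: "uniformizer A \<pi>"
  defines "\<kappa> \<equiv> A Quot PIdl\<^bsub>A\<^esub> \<pi>"
  shows "\<exists>\<theta> \<zeta> (m::nat) f. finite (carrier \<kappa>) \<and> nat_elem \<kappa> p = \<zero>\<^bsub>\<kappa>\<^esub> \<and> \<theta> \<in> carrier \<kappa> \<and> m > 0 \<and> \<theta> [^]\<^bsub>\<kappa>\<^esub> m = \<one>\<^bsub>\<kappa>\<^esub> \<and>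
    (\<forall>x\<in>carrier \<kappa>. x = \<zero>\<^bsub>\<kappa>\<^esub> \<or> (\<exists>i<m. x = \<theta> [^]\<^bsub>\<kappa>\<^esub> i)) \<and> \<not> p dvd m \<and> f > 0 \<and> m dvd p ^ f - 1 \<and>
    (\<forall>x\<in>carrier \<kappa>. x [^]\<^bsub>\<kappa>\<^esub> (p ^ f) = x) \<and>
    \<zeta> \<in> carrier A \<and> \<zeta> [^]\<^bsub>A\<^esub> m = \<one>\<^bsub>A\<^esub> \<and> (\<forall>k::nat. \<zeta> [^]\<^bsub>A\<^esub> k = \<one>\<^bsub>A\<^esub> \<longrightarrow> m dvd k)"
proof -
  define rc where "rc = (\<lambda>a. PIdl\<^bsub>A\<^esub> \<pi> +>\<^bsub>A\<^esub> a)"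
  note rf = residue_field[OF unif, folded rc_def \<kappa>_def]
  have pi: "\<pi> \<in> carrier A" using unif by (simp add: uniformizer_def)
  interpret k: field \<kappa> by (rule rf(1))
  obtain I :: "nat set" and e where I: "zspans A \<alpha> I e"
     "zindep A \<alpha> I e"
    using basis_A by (elim exE conjE) (rule that)
  interpret O: padic_order p A \<alpha> I e
    by (intro padic_order.intro padic_order_axioms.intro padic_axioms cring_A alpha_hom I)
  have "O.P \<in> PIdl\<^bsub>A\<^esub> \<pi>" using O.P_in_maximalideal unif by (simp add: uniformizer_def)
  then obtain c where "c \<in> carrier A" "O.P = c \<otimes>\<^bsub>A\<^esub> \<pi>" unfolding cgenideal_def by blast
  then have c: "c \<in> carrier A" "O.P = \<pi> \<otimes>\<^bsub>A\<^esub> c" using A.m_comm[OF _ pi] by simp_all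
  have rc0: "rc \<zero>\<^bsub>A\<^esub> = \<zero>\<^bsub>\<kappa>\<^esub>" by (rule ring_hom_zero'[OF rf(2) A.ring_axioms k.ring_axioms])
  have rc1: "rc \<one>\<^bsub>A\<^esub> = \<one>\<^bsub>\<kappa>\<^esub>" by (rule ring_hom_one[OF rf(2)])
  have rcpow: "rc (a [^]\<^bsub>A\<^esub> (n::nat)) = rc a [^]\<^bsub>\<kappa>\<^esub> n" if "a \<in> carrier A" for a n
    by (rule ring_hom_pow'[OF rf(2) that A.ring_axioms k.ring_axioms])
  have Pred: "eqmod A \<pi> a b" if "eqmod A O.P a b" for a b
    using A.eqmod_dvd[of \<pi> c a b] that pi c by simp
  have pi0: "rc \<pi> = \<zero>\<^bsub>\<kappa>\<^esub>"
  proof -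
    have "eqmod A \<pi> \<pi> \<zero>\<^bsub>A\<^esub>"
      unfolding eqmod_def by (intro conjI bexI[of _ "\<one>\<^bsub>A\<^esub>"]) (use pi in \<open>simp_all del: A_ops\<close>)
    then show ?thesis using rf(4)[OF pi A.zero_closed] rc0 by simp
  qed
  have fink: "finite (carrier \<kappa>)"
  proof -
    obtain F :: "(nat \<Rightarrow> int) set" and r where F: "finite F" "r \<in> carrier A \<rightarrow> F"
      and r: "\<forall>a\<in>carrier A. \<forall>b\<in>carrier A. r a = r b \<longrightarrow> eqmod A O.P a b"
      using finite_residues[OF O.alg O.sp] by (elim exE conjE) (rule that)
    have "carrier \<kappa> \<subseteq> (\<lambda>y. rc (inv_into (carrier A) r y)) ` (r ` carrier A)"
    proof
      fix x assume "x \<in> carrier \<kappa>"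
      then obtain a where a: "a \<in> carrier A" "x = rc a" using rf(3) by blast
      let ?b = "inv_into (carrier A) r (r a)"
      have b: "?b \<in> carrier A" "r ?b = r a" using a by (auto intro: inv_into_into f_inv_into_f)
      then have "rc ?b = rc a" using rf(4)[OF b(1) a(1)] Pred r[rule_format, OF b(1) a(1) b(2)] by blast
      then show "x \<in> (\<lambda>y. rc (inv_into (carrier A) r y)) ` (r ` carrier A)" using a by auto
    qed
    moreover have "finite (r ` carrier A)" using F finite_subset[of "r ` carrier A" F] by auto
    ultimately show ?thesis using finite_surj by blast
  qed
  have "rc \<circ> \<alpha> \<in> ring_hom Z \<kappa>" by (rule ring_hom_trans[OF alpha_hom rf(2)])
  then have "zalg \<kappa> (rc \<circ> \<alpha>)" using k.is_cring by (simp add: zalg_def)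
  then have "nat_elem \<kappa> p = rc O.P" using hom_nat_elem[of \<kappa> "rc \<circ> \<alpha>" p] by simp
  also have "\<dots> = rc \<zero>\<^bsub>A\<^esub>"
  proof -
    have "eqmod A \<pi> O.P \<zero>\<^bsub>A\<^esub>"
      unfolding eqmod_def by (intro conjI bexI[of _ c]) (use pi c O.P_closed in \<open>simp_all del: A_ops comp_apply\<close>)
    then show ?thesis using rf(4)[OF O.P_closed A.zero_closed] by simp
  qed
  finally have char: "nat_elem \<kappa> p = \<zero>\<^bsub>\<kappa>\<^esub>" using rc0 by simp
  obtain \<theta> m f where t: "\<theta> \<in> carrier \<kappa>" "(m::nat) > 0" "\<forall>k::nat. \<theta> [^]\<^bsub>\<kappa>\<^esub> k = \<one>\<^bsub>\<kappa>\<^esub> \<longleftrightarrow> m dvd k"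
    "\<forall>x\<in>carrier \<kappa>. x = \<zero>\<^bsub>\<kappa>\<^esub> \<or> (\<exists>i<m. x = \<theta> [^]\<^bsub>\<kappa>\<^esub> i)" "\<not> p dvd m" "f > 0" "m dvd p ^ f - 1"
    "\<forall>x\<in>carrier \<kappa>. x [^]\<^bsub>\<kappa>\<^esub> (p ^ f) = x"
    using k.finite_field_generator[OF prime fink char] by (elim exE conjE) (rule that)
  \<comment> \<open>Some power of \<open>\<pi>\<close> is divisible by \<open>p\<close>, as no
    positive power of \<open>\<pi>\<close> is congruent to \<open>1\<close>. This permits passing
    from congruences modulo powers of \<open>\<pi>\<close> to congruences modulo
    \<open>p\<close>.\<close>
  have "\<exists>(N::nat) d. d \<in> carrier A \<and> \<pi> [^]\<^bsub>A\<^esub> N = O.P \<otimes>\<^bsub>A\<^esub> d"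
  proof (rule nilpotent_mod_p[OF O.alg O.sp A.domain_axioms O.P_separated pi])
    fix N :: nat assume N: "N > 0"
    show "\<not> eqmod A O.P (\<pi> [^]\<^bsub>A\<^esub> N) \<one>\<^bsub>A\<^esub>"
    proof
      assume "eqmod A O.P (\<pi> [^]\<^bsub>A\<^esub> N) \<one>\<^bsub>A\<^esub>"
      then have "rc (\<pi> [^]\<^bsub>A\<^esub> N) = rc \<one>\<^bsub>A\<^esub>" using rf(4)[OF A.nat_pow_closed[OF pi] A.one_closed] Pred by blast
      then show False using rcpow[OF pi] pi0 rc1 N k.nat_pow_zero by simp
    qed
  qed
  then obtain N :: nat and d where d: "d \<in> carrier A" "\<pi> [^]\<^bsub>A\<^esub> N = O.P \<otimes>\<^bsub>A\<^esub> d" by (elim exE conjE) (rule that)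
  obtain \<tau> where \<tau>: "\<tau> \<in> carrier A" "\<theta> = rc \<tau>" using rf(3)[OF t(1)] by blast
  \<comment> \<open>The exponent is a power of \<open>p^f\<close>, so the residue is still
    \<open>\<theta>\<close>, and it is large enough to improve a congruence modulo
    \<open>\<pi>\<close> to one modulo \<open>\<pi>^N\<close> and therefore modulo
    \<open>p\<close>.\<close>
  let ?q = "p ^ (f * N)"
  define a where "a = \<tau> [^]\<^bsub>A\<^esub> ?q"
  have a: "a \<in> carrier A" using \<tau> by (simp add: a_def del: A_pow)
  have pe: "nat_elem A p = \<pi> \<otimes>\<^bsub>A\<^esub> c" using hom_nat_elem[OF O.alg, of p] c(2) by simp
  have "eqmod A \<pi> (\<tau> [^]\<^bsub>A\<^esub> m) \<one>\<^bsub>A\<^esub>"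
    using rf(4)[OF A.nat_pow_closed[OF \<tau>(1), of m] A.one_closed] \<tau> rcpow[OF \<tau>(1), of m] t(3) rc1 A.nat_pow_closed[OF \<tau>(1), of m] by simp
  then have "eqmod A (\<pi> [^]\<^bsub>A\<^esub> Suc (f * N)) ((\<tau> [^]\<^bsub>A\<^esub> m) [^]\<^bsub>A\<^esub> ?q) (\<one>\<^bsub>A\<^esub> [^]\<^bsub>A\<^esub> ?q)"
    by (rule A.eqmod_pow_prime_pow[OF pi c(1) pe p_pos(1)])
  moreover have "(\<tau> [^]\<^bsub>A\<^esub> m) [^]\<^bsub>A\<^esub> ?q = a [^]\<^bsub>A\<^esub> m"
    unfolding a_def A.nat_pow_pow[OF \<tau>(1)] by (simp only: mult.commute)
  moreover have "N \<le> Suc (f * N)" using t(6) by (cases f) auto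
  ultimately have "eqmod A (\<pi> [^]\<^bsub>A\<^esub> N) (a [^]\<^bsub>A\<^esub> m) \<one>\<^bsub>A\<^esub>"
    using A.eqmod_pow_le[of \<pi> "Suc (f * N)" "a [^]\<^bsub>A\<^esub> m" "\<one>\<^bsub>A\<^esub>" N] pi A.nat_pow_one[of ?q] by simp
  then have am: "eqmod A O.P (a [^]\<^bsub>A\<^esub> m) \<one>\<^bsub>A\<^esub>"
    unfolding d(2) using O.P_closed d(1) by (rule A.eqmod_dvd)
  have pe': "nat_elem A p = O.P \<otimes>\<^bsub>A\<^esub> \<one>\<^bsub>A\<^esub>" using hom_nat_elem[OF O.alg, of p] A.r_one[OF O.P_closed] by simp
  obtain \<zeta> where z: "\<zeta> \<in> carrier A" "\<zeta> [^]\<^bsub>A\<^esub> m = \<one>\<^bsub>A\<^esub>" "eqmod A O.P \<zeta> a"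
    using A.teichmueller_root[OF O.P_closed O.P_complete O.P_separated A.one_closed pe' p_pos(1) am a t(7,6)] by blast
  have iter: "x [^]\<^bsub>\<kappa>\<^esub> (p ^ (f * n)) = x" if x: "x \<in> carrier \<kappa>" for x n
  proof (induction n)
    case (Suc n)
    have "p ^ (f * Suc n) = p ^ (f * n) * p ^ f" by (simp add: power_add)
    then show ?case using Suc t(8) x k.nat_pow_pow[OF x, of "p ^ (f * n)" "p ^ f"] by simp
  qed (use x in simp)
  have "rc \<zeta> = rc a" using rf(4)[OF z(1) a] Pred[OF z(3)] by simp
  also have "\<dots> = \<theta>" unfolding a_def rcpow[OF \<tau>(1)] \<tau>(2)[symmetric] by (rule iter[OF t(1)])
  finally have rcz: "rc \<zeta> = \<theta>" .
  have zk: "m dvd k" if k: "\<zeta> [^]\<^bsub>A\<^esub> k = \<one>\<^bsub>A\<^esub>" for k :: nat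
  proof -
    have "\<theta> [^]\<^bsub>\<kappa>\<^esub> k = rc (\<zeta> [^]\<^bsub>A\<^esub> k)" using rcpow[OF z(1), of k] rcz by simp
    then show ?thesis using t(3) k rc1 by simp
  qed
  have tm: "\<theta> [^]\<^bsub>\<kappa>\<^esub> m = \<one>\<^bsub>\<kappa>\<^esub>" using t(3) by simp
  show ?thesis
    by (rule exI[of _ \<theta>], rule exI[of _ \<zeta>], rule exI[of _ m], rule exI[of _ f], intro conjI fink char t(1,2) tm t(4-8) z(1,2) allI impI zk)
qed

end

locale witt_finite = witt p \<kappa> + k: field \<kappa> for p and \<kappa> :: "('k, 'm) ring_scheme" (structure) +
  fixes j :: "(nat \<Rightarrow> int) \<Rightarrow> (nat \<Rightarrow> 'k)" and \<theta> and m f :: nat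
  assumes hom: "j \<in> ring_hom (padic_int p) (witt_ring p \<kappa>)" and fink: "finite (carrier \<kappa>)"
    and char: "nat_elem \<kappa> p = \<zero>" and theta: "\<theta> \<in> carrier \<kappa>" and m: "m > 0" and theta_m: "\<theta> [^] m = \<one>"
    and gen: "\<And>x. x \<in> carrier \<kappa> \<Longrightarrow> x = \<zero> \<or> (\<exists>i<m. x = \<theta> [^] i)"
    and f: "f > 0" "m dvd p ^ f - 1" and frob: "\<And>x. x \<in> carrier \<kappa> \<Longrightarrow> x [^] (p ^ f) = x"
begin

lemma alg: "zalg W j" using hom cring_witt by (simp add: zalg_def)

sublocale D: module "padic_int p" "algebra_module j (witt_ring p \<kappa>)" by (rule zalg_module[OF alg])

abbreviation "P \<equiv> j pz"

lemma P_closed [simp]: "P \<in> carrier W" using ring_hom_closed[OF hom] by simp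

text \<open>Multiplication by the image of \<open>p\<close> is an explicit shift of
  \<open>p\<close>-th powers. Cancellation, divisibility and separatedness in the Witt ring are all
  read off from this.\<close>

lemma P_mult: assumes "w \<in> carrier W" shows "P \<otimes>\<^bsub>W\<^esub> w = (\<lambda>n. case n of 0 \<Rightarrow> \<zero> | Suc n \<Rightarrow> w n [^] p)"
  using nat_mult_witt[OF char assms] W.nat_elem_mult[OF assms, of p] hom_nat_elem[OF alg, of p] by simp

lemma P_cancel: assumes w: "w \<in> carrier W" "P \<otimes>\<^bsub>W\<^esub> w = \<zero>\<^bsub>W\<^esub>" shows "w = \<zero>\<^bsub>W\<^esub>"
proof -
  have "w n = \<zero>" for n
  proof (rule ccontr)
    assume n: "w n \<noteq> \<zero>"
    have wn: "w n \<in> carrier \<kappa>" using w(1) by (simp add: witt_carrier)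
    have "w n [^] p = \<zero>" using fun_cong[OF w(2)[unfolded P_mult[OF w(1)]], of "Suc n"] by (simp add: witt_ring_def)
    then have "w n [^] p \<otimes> \<one> = \<zero>" by simp
    then show False using k.pow_cancel_zero[OF wn n one_closed, of p] by simp
  qed
  then show ?thesis by (simp add: witt_ring_def fun_eq_iff)
qed

lemma P_dvd: assumes w: "w \<in> carrier W" "w 0 = \<zero>" shows "\<exists>v\<in>carrier W. w = P \<otimes>\<^bsub>W\<^esub> v"
proof -
  \<comment> \<open>The power with exponent \<open>p^(f-1)\<close> inverts the \<open>p\<close>-th
    power map on the residue field.\<close>
  define v where "v n = w (Suc n) [^] (p ^ (f - 1))" for n
  have wc: "w n \<in> carrier \<kappa>" for n using w(1) by (simp add: witt_carrier)
  have v: "v \<in> carrier W" unfolding witt_carrier v_def using wc by simp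
  have "v n [^] p = w (Suc n)" for n
  proof -
    have "p ^ (f - 1) * p = p ^ f" using f(1) by (cases f) auto
    then show ?thesis unfolding v_def nat_pow_pow[OF wc] using frob[OF wc] by simp
  qed
  then have "P \<otimes>\<^bsub>W\<^esub> v = w" unfolding P_mult[OF v] using w(2) by (auto simp: fun_eq_iff split: nat.split)
  with v show ?thesis by blast
qed

lemma separated_W: "adic_separated W P"
  unfolding adic_separated_def
proof (intro ballI impI)
  fix w assume w: "w \<in> carrier W" "\<forall>n::nat. \<exists>b\<in>carrier W. w = P [^]\<^bsub>W\<^esub> n \<otimes>\<^bsub>W\<^esub> b"
  have z: "(P [^]\<^bsub>W\<^esub> n \<otimes>\<^bsub>W\<^esub> b) i = \<zero>" if "i < n" "b \<in> carrier W" for n i :: nat and b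
    using that
  proof (induction n arbitrary: i)
    case (Suc n)
    have Pb: "P [^]\<^bsub>W\<^esub> n \<otimes>\<^bsub>W\<^esub> b \<in> carrier W" using Suc.prems by (intro W.m_closed W.nat_pow_closed P_closed)
    have "P [^]\<^bsub>W\<^esub> Suc n \<otimes>\<^bsub>W\<^esub> b = P \<otimes>\<^bsub>W\<^esub> (P [^]\<^bsub>W\<^esub> n \<otimes>\<^bsub>W\<^esub> b)"
      using W.nat_pow_Suc2[OF P_closed, of n] W.m_assoc[OF P_closed W.nat_pow_closed[OF P_closed, of n] Suc.prems(2)] by simp
    then have "(P [^]\<^bsub>W\<^esub> Suc n \<otimes>\<^bsub>W\<^esub> b) i = (case i of 0 \<Rightarrow> \<zero> | Suc i \<Rightarrow> (P [^]\<^bsub>W\<^esub> n \<otimes>\<^bsub>W\<^esub> b) i [^] p)"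
      by (simp only: P_mult[OF Pb])
    also have "\<dots> = \<zero>"
    proof (cases i)
      case (Suc i')
      then have "(P [^]\<^bsub>W\<^esub> n \<otimes>\<^bsub>W\<^esub> b) i' = \<zero>" using Suc.IH[of i'] Suc.prems by simp
      then show ?thesis using Suc p_pos(1) nat_pow_zero[of p] by simp
    qed simp
    finally show ?case .
  qed simp
  have "w n = \<zero>" for n
  proof -
    obtain b where "b \<in> carrier W" "w = P [^]\<^bsub>W\<^esub> Suc n \<otimes>\<^bsub>W\<^esub> b" using w(2) by blast
    then show ?thesis using z[of n "Suc n" b] by simp
  qed
  then show "w = \<zero>\<^bsub>W\<^esub>" by (simp add: witt_ring_def fun_eq_iff)
qed

text \<open>Vectors representing the nonzero residues generate modulo \<open>p\<close>, since a Witt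
  vector with first component zero is divisible by \<open>p\<close>; \<open>span_lift\<close> does
  the rest. Residue zero is represented by the zero combination.\<close>

lemma span_of_residues:
  assumes I: "finite I" and e: "\<And>i. i \<in> I \<Longrightarrow> e i \<in> carrier W"
    and res: "\<And>x. x \<in> carrier \<kappa> \<Longrightarrow> x \<noteq> \<zero> \<Longrightarrow> \<exists>i\<in>I. e i 0 = x"
  shows "zspans W j I e"
proof -
  have carr: "submodule (carrier W) Z (algebra_module j W)" using D.carrier_is_submodule by simp
  have e': "e \<in> I \<rightarrow> carrier W" using e by auto
  have "spans_mod Z (algebra_module j W) {\<zero>\<^bsub>algebra_module j W\<^esub>} (carrier W) I e"
  proof (rule D.span_lift[OF pz_closed complete carr _ I e'])
    fix d assume d: "d \<in> carrier W"
    show "d = \<zero>\<^bsub>algebra_module j W\<^esub>" if "\<And>n::nat. \<exists>d'\<in>carrier W. d = (pz [^]\<^bsub>Z\<^esub> n) \<odot>\<^bsub>algebra_module j W\<^esub> d'"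
      using adic_separatedD[OF separated_W d] that hom_pow[OF alg pz_closed] by simp
    have hom0: "(\<lambda>w. w 0) \<in> ring_hom W \<kappa>" by (rule witt_first_hom)
    have "\<exists>c\<in>I \<rightarrow> carrier Z. lincomb Z (algebra_module j W) I c e 0 = d 0"
    proof (cases "d 0 = \<zero>")
      case True
      have "lincomb Z (algebra_module j W) I (\<lambda>_. \<zero>\<^bsub>Z\<^esub>) e = \<zero>\<^bsub>algebra_module j W\<^esub>"
        by (rule D.lincomb_zero) (use e' in auto)
      then show ?thesis using True by (intro bexI[where x = "\<lambda>_. \<zero>\<^bsub>Z\<^esub>"]) (auto simp: witt_ring_def)
    next
      case False
      then obtain i where i: "i \<in> I" "e i 0 = d 0" using res d by (auto simp: witt_carrier)
      have "lincomb Z (algebra_module j W) I (\<lambda>k. if k = i then \<one>\<^bsub>Z\<^esub> else \<zero>\<^bsub>Z\<^esub>) e = \<one>\<^bsub>Z\<^esub> \<odot>\<^bsub>algebra_module j W\<^esub> e i"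
        by (rule D.lincomb_single) (use I i e' in auto)
      also have "\<dots> = e i" using ring_hom_one[OF hom] e[OF i(1)] by simp
      finally show ?thesis using i(2) by (intro bexI[where x = "\<lambda>k. if k = i then \<one>\<^bsub>Z\<^esub> else \<zero>\<^bsub>Z\<^esub>"]) auto
    qed
    then obtain c where c: "c \<in> I \<rightarrow> carrier Z" "lincomb Z (algebra_module j W) I c e 0 = d 0" by (elim bexE) (rule that)
    let ?l = "lincomb Z (algebra_module j W) I c e"
    have l: "?l \<in> carrier W" using D.lincomb_closed[OF c(1), of e] e' by simp
    have "d = (d \<ominus>\<^bsub>W\<^esub> ?l) \<oplus>\<^bsub>W\<^esub> ?l" using d l W.eq_add_diff[of d ?l] W.a_comm[of ?l "d \<ominus>\<^bsub>W\<^esub> ?l"] by simp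
    then have "d 0 = (d \<ominus>\<^bsub>W\<^esub> ?l) 0 \<oplus> d 0"
      using ring_hom_add[OF hom0, of "d \<ominus>\<^bsub>W\<^esub> ?l" ?l] d l c(2) by simp
    moreover have "(d \<ominus>\<^bsub>W\<^esub> ?l) 0 \<in> carrier \<kappa>" "d 0 \<in> carrier \<kappa>" using ring_hom_closed[OF hom0] d l W.minus_closed[OF d l] by blast+
    ultimately have "(d \<ominus>\<^bsub>W\<^esub> ?l) 0 = \<zero>" using add.l_cancel_one'[of "d 0" "(d \<ominus>\<^bsub>W\<^esub> ?l) 0"] by simp
    then obtain v where v: "v \<in> carrier W" "d \<ominus>\<^bsub>W\<^esub> ?l = P \<otimes>\<^bsub>W\<^esub> v" using P_dvd[OF W.minus_closed[OF d l]] by blast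
    have dv: "d = ?l \<oplus>\<^bsub>algebra_module j W\<^esub> pz \<odot>\<^bsub>algebra_module j W\<^esub> v" using W.eq_add_diff[OF d l] v by simp
    show "\<exists>c\<in>I \<rightarrow> carrier Z. \<exists>d'\<in>carrier W. d = lincomb Z (algebra_module j W) I c e \<oplus>\<^bsub>algebra_module j W\<^esub> pz \<odot>\<^bsub>algebra_module j W\<^esub> d'"
      by (rule bexI[where x = c], rule bexI[where x = v], rule dv, rule v(1), rule c(1))
  qed
  then show ?thesis by simp
qed

text \<open>The vectors \<open>(x, 0, 0, ...)\<close> form a finite generating family because the
  residue field is finite, and finitely generated algebras over the p-adic integers are
  complete.\<close>

lemma complete_W: "adic_complete W P"
proof -
  let ?e = "\<lambda>x. (\<lambda>n::nat. if n = 0 then x else \<zero>)"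
  have "zspans W j (carrier \<kappa>) ?e"
    by (rule span_of_residues[OF fink]) (auto simp: witt_carrier)
  then show ?thesis by (rule adic_complete_of_span[OF alg])
qed

text \<open>A root of unity with first component \<open>\<theta>\<close>. Its powers reach every
  nonzero residue, so they generate the Witt ring over the p-adic integers.\<close>

lemma witt_root_of_unity:
  "\<exists>\<Theta>\<in>carrier W. \<Theta> [^]\<^bsub>W\<^esub> m = \<one>\<^bsub>W\<^esub> \<and> zspans W j {..<m} (\<lambda>k. \<Theta> [^]\<^bsub>W\<^esub> k)"
proof -
  define a where "a = (\<lambda>n::nat. if n = 0 then \<theta> else \<zero>)"
  have a: "a \<in> carrier W" "a 0 = \<theta>" using theta by (auto simp: a_def witt_carrier)
  have hom0: "(\<lambda>w. w 0) \<in> ring_hom W \<kappa>" by (rule witt_first_hom)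
  have pow0: "(w [^]\<^bsub>W\<^esub> (n::nat)) 0 = w 0 [^] n" if "w \<in> carrier W" for w n
    using that ring_hom_mult[OF hom0] ring_hom_one[OF hom0] W.nat_pow_closed[OF that] by (induction n) auto
  let ?d = "a [^]\<^bsub>W\<^esub> m \<ominus>\<^bsub>W\<^esub> \<one>\<^bsub>W\<^esub>"
  have am: "a [^]\<^bsub>W\<^esub> m \<in> carrier W" using a by simp
  have ad: "a [^]\<^bsub>W\<^esub> m = \<one>\<^bsub>W\<^esub> \<oplus>\<^bsub>W\<^esub> ?d" using W.eq_add_diff[OF am W.one_closed] .
  have "(a [^]\<^bsub>W\<^esub> m) 0 = \<one>" using pow0[OF a(1)] a(2) theta_m by simp
  moreover have "(\<one>\<^bsub>W\<^esub> \<oplus>\<^bsub>W\<^esub> ?d) 0 = \<one> \<oplus> ?d 0"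
    using ring_hom_add[OF hom0 W.one_closed W.minus_closed[OF am W.one_closed]] ring_hom_one[OF hom0] by simp
  ultimately have "\<one> = \<one> \<oplus> ?d 0" using ad by simp
  moreover have "?d 0 \<in> carrier \<kappa>" using ring_hom_closed[OF hom0 W.minus_closed[OF am W.one_closed]] .
  ultimately have "?d 0 = \<zero>" using add.r_cancel_one'[of "\<one>" "?d 0"] by simp
  then obtain v where "v \<in> carrier W" "?d = P \<otimes>\<^bsub>W\<^esub> v" using P_dvd[OF W.minus_closed[OF am W.one_closed]] by blast
  then have "eqmod W P (a [^]\<^bsub>W\<^esub> m) \<one>\<^bsub>W\<^esub>" using ad am W.one_closed unfolding eqmod_def by auto
  moreover have "nat_elem W p = P \<otimes>\<^bsub>W\<^esub> \<one>\<^bsub>W\<^esub>" using hom_nat_elem[OF alg, of p] by simp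
  ultimately obtain \<Theta> where T: "\<Theta> \<in> carrier W" "\<Theta> [^]\<^bsub>W\<^esub> m = \<one>\<^bsub>W\<^esub>" "eqmod W P \<Theta> a"
    using W.teichmueller_root[OF P_closed complete_W separated_W W.one_closed _ p_pos(1) _ a(1) f(2,1)] by blast
  obtain t where t: "t \<in> carrier W" "\<Theta> = a \<oplus>\<^bsub>W\<^esub> P \<otimes>\<^bsub>W\<^esub> t" using T(3) unfolding eqmod_def by blast
  have "(P \<otimes>\<^bsub>W\<^esub> t) 0 = \<zero>" using P_mult[OF t(1)] by simp
  then have T0: "\<Theta> 0 = \<theta>"
    using ring_hom_add[OF hom0 a(1) W.m_closed[OF P_closed t(1)]] t(2) a(2) theta by simp
  have "zspans W j {..<m} (\<lambda>k. \<Theta> [^]\<^bsub>W\<^esub> k)"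
  proof (rule span_of_residues)
    fix x assume "x \<in> carrier \<kappa>" "x \<noteq> \<zero>"
    then obtain i where "i < m" "x = \<theta> [^] i" using gen by blast
    then show "\<exists>i\<in>{..<m}. (\<Theta> [^]\<^bsub>W\<^esub> i) 0 = x" using pow0[OF T(1), of i] T0 by auto
  qed (use T in auto)
  with T show ?thesis by blast
qed

end

section \<open>Eigenspace idempotents\<close>

lemma (in abelian_monoid) finsum_swap:
  assumes "finite I" "finite K" "\<And>i k. i \<in> I \<Longrightarrow> k \<in> K \<Longrightarrow> u i k \<in> carrier G"
  shows "(\<Oplus>i\<in>I. \<Oplus>k\<in>K. u i k) = (\<Oplus>k\<in>K. \<Oplus>i\<in>I. u i k)"
  using assms(1,3)
proof (induction I)
  case (insert i I)
  have r: "(\<Oplus>k\<in>K. u i' k) \<in> carrier G" if "i' \<in> insert i I" for i' using that insert.prems by (intro finsum_closed) auto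
  have c: "(\<Oplus>i\<in>I. u i k) \<in> carrier G" if "k \<in> K" for k using that insert.prems by (intro finsum_closed) auto
  have "(\<Oplus>i\<in>insert i I. \<Oplus>k\<in>K. u i k) = (\<Oplus>k\<in>K. u i k) \<oplus> (\<Oplus>i\<in>I. \<Oplus>k\<in>K. u i k)"
    using insert.hyps r by (intro finsum_insert) auto
  also have "(\<Oplus>i\<in>I. \<Oplus>k\<in>K. u i k) = (\<Oplus>k\<in>K. \<Oplus>i\<in>I. u i k)" using insert by auto
  also have "(\<Oplus>k\<in>K. u i k) \<oplus> (\<Oplus>k\<in>K. \<Oplus>i\<in>I. u i k) = (\<Oplus>k\<in>K. u i k \<oplus> (\<Oplus>i\<in>I. u i k))"
    using insert.prems c by (intro finsum_addf[symmetric]) auto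
  also have "\<dots> = (\<Oplus>k\<in>K. \<Oplus>i\<in>insert i I. u i k)"
    using insert.prems insert.hyps c by (intro finsum_cong') (auto intro!: finsum_insert[symmetric] finsum_closed)
  finally show ?case .
qed simp

lemma ring_hom_finsum:
  assumes h: "h \<in> ring_hom R S" and R: "ring R" and S: "ring S" and u: "u \<in> I \<rightarrow> carrier R"
  shows "h (\<Oplus>\<^bsub>R\<^esub>i\<in>I. u i) = (\<Oplus>\<^bsub>S\<^esub>i\<in>I. h (u i))"
proof -
  interpret ring_hom_ring R S h by (intro ring_hom_ringI2 R S h)
  show ?thesis using hom_finsum[of u I] u by (simp add: comp_def)
qed

context tensor
begin

text \<open>As \<open>A\<close> is free over \<open>S\<close>, an element of
  \<open>A \<otimes> B\<close> is determined by coordinates in \<open>B\<close>, and multiplication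
  by an element of \<open>S\<close> acts on each coordinate separately.\<close>

lemma tensor_torsion_free:
  assumes sp: "spans_mod S (algebra_module f A) {\<zero>\<^bsub>A\<^esub>} (carrier A) I e"
    and ind: "indep_mod S (algebra_module f A) {\<zero>\<^bsub>A\<^esub>} I e"
    and s: "s \<in> carrier S" and tf: "\<And>b. b \<in> carrier B \<Longrightarrow> g s \<otimes>\<^bsub>B\<^esub> b = \<zero>\<^bsub>B\<^esub> \<Longrightarrow> b = \<zero>\<^bsub>B\<^esub>"
    and t: "t \<in> carrier T" "inl (f s) \<otimes>\<^bsub>T\<^esub> t = \<zero>\<^bsub>T\<^esub>"
  shows "t = \<zero>\<^bsub>T\<^esub>"
proof -
  interpret N: module S "algebra_module f A" by (rule module_algebra_module[OF S.is_cring f A.is_cring])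
  have fin: "finite I" and e: "e \<in> I \<rightarrow> carrier (algebra_module f A)" using sp by (auto simp: spans_mod_def)
  let ?lc = "\<lambda>c. lincomb S (algebra_module f A) I c e"
  have "\<exists>c. c \<in> I \<rightarrow> carrier S \<and> a = ?lc c" if "a \<in> carrier A" for a
    using N.spans_modD[OF sp that] N.mcong_trivial by (metis algebra_module_simps(2))
  then obtain crd where crd: "\<And>a. a \<in> carrier A \<Longrightarrow> crd a \<in> I \<rightarrow> carrier S" and lc: "\<And>a. a \<in> carrier A \<Longrightarrow> a = ?lc (crd a)"
    by metis
  have crdS: "crd a i \<in> carrier S" if "a \<in> carrier A" "i \<in> I" for a i using crd[OF that(1)] that(2) by auto
  have uniq: "c i = d i" if "c \<in> I \<rightarrow> carrier S" "d \<in> I \<rightarrow> carrier S" "?lc c = ?lc d" "i \<in> I" for c d i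
  proof -
    have cd: "(\<lambda>i. c i \<ominus>\<^bsub>S\<^esub> d i) \<in> I \<rightarrow> carrier S" using that by auto
    have "?lc d \<in> carrier A" using N.lincomb_closed[OF that(2) e] by simp
    then have "?lc (\<lambda>i. c i \<ominus>\<^bsub>S\<^esub> d i) = \<zero>\<^bsub>A\<^esub>"
      using N.lincomb_diff[OF that(1,2) e] that(3) A.r_right_minus_eq[of "?lc d" "?lc d"] by simp
    then have "c i \<ominus>\<^bsub>S\<^esub> d i = \<zero>\<^bsub>S\<^esub>" using ind cd that(4) unfolding indep_mod_def by simp
    moreover have "c i \<in> carrier S" "d i \<in> carrier S" using that by auto
    ultimately show ?thesis by simp
  qed
  have crd_add: "crd (a \<oplus>\<^bsub>A\<^esub> b) i = crd a i \<oplus>\<^bsub>S\<^esub> crd b i" if "a \<in> carrier A" "b \<in> carrier A" "i \<in> I" for a b i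
  proof (rule uniq[OF _ _ _ that(3)])
    show "?lc (crd (a \<oplus>\<^bsub>A\<^esub> b)) = ?lc (\<lambda>i. crd a i \<oplus>\<^bsub>S\<^esub> crd b i)"
      using N.lincomb_add[OF crd[OF that(1)] crd[OF that(2)] e] lc[OF that(1)] lc[OF that(2)] lc[OF A.a_closed[OF that(1,2)]] by simp
  qed (use that crd crdS in auto)
  have crd_smult: "crd (f r \<otimes>\<^bsub>A\<^esub> a) i = r \<otimes>\<^bsub>S\<^esub> crd a i" if "r \<in> carrier S" "a \<in> carrier A" "i \<in> I" for r a i
  proof (rule uniq[OF _ _ _ that(3)])
    show "?lc (crd (f r \<otimes>\<^bsub>A\<^esub> a)) = ?lc (\<lambda>i. r \<otimes>\<^bsub>S\<^esub> crd a i)"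
      using N.lincomb_smult[OF that(1) crd[OF that(2)] e] lc[OF that(2)] lc[of "f r \<otimes>\<^bsub>A\<^esub> a"] that by simp
  qed (use that crd crdS in auto)
  \<comment> \<open>\<open>good i h\<close> says that \<open>h\<close> is the \<open>i\<close>-th
    coordinate map, an additive map with values in \<open>B\<close>; it exists by the universal
    property.\<close>
  define good where "good i h \<longleftrightarrow> (\<forall>x\<in>carrier T. h x \<in> carrier B) \<and> (\<forall>x\<in>carrier T. \<forall>y\<in>carrier T. h (x \<oplus>\<^bsub>T\<^esub> y) = h x \<oplus>\<^bsub>B\<^esub> h y)
      \<and> (\<forall>a\<in>carrier A. \<forall>b\<in>carrier B. h (inl a \<otimes>\<^bsub>T\<^esub> inr b) = g (crd a i) \<otimes>\<^bsub>B\<^esub> b)" for i h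
  have "\<exists>h. good i h" if "i \<in> I" for i
    unfolding good_def using that crdS
    by (intro bilinear_descends B.abelian_group_axioms)
      (simp_all add: crd_add crd_smult ring_hom_add[OF g] ring_hom_mult[OF g] B.l_distr B.r_distr B.m_ac)
  then obtain h where h: "\<And>i. i \<in> I \<Longrightarrow> good i (h i)" by metis
  have hc: "h i x \<in> carrier B" if "i \<in> I" "x \<in> carrier T" for i x using h[OF that(1)] that(2) unfolding good_def by blast
  have ha: "h i (x \<oplus>\<^bsub>T\<^esub> y) = h i x \<oplus>\<^bsub>B\<^esub> h i y" if "i \<in> I" "x \<in> carrier T" "y \<in> carrier T" for i x y
    using h[OF that(1)] that(2,3) unfolding good_def by blast
  have ht: "h i (inl a \<otimes>\<^bsub>T\<^esub> inr b) = g (crd a i) \<otimes>\<^bsub>B\<^esub> b" if "i \<in> I" "a \<in> carrier A" "b \<in> carrier B" for i a b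
    using h[OF that(1)] that(2,3) unfolding good_def by blast
  have h0: "h i \<zero>\<^bsub>T\<^esub> = \<zero>\<^bsub>B\<^esub>" if "i \<in> I" for i
    using ha[OF that T.zero_closed T.zero_closed] hc[OF that T.zero_closed] by simp
  have hd: "h i (x \<ominus>\<^bsub>T\<^esub> y) = h i x \<ominus>\<^bsub>B\<^esub> h i y" if "i \<in> I" "x \<in> carrier T" "y \<in> carrier T" for i x y
  proof -
    have xy: "x \<ominus>\<^bsub>T\<^esub> y \<in> carrier T" using that by simp
    have "(x \<ominus>\<^bsub>T\<^esub> y) \<oplus>\<^bsub>T\<^esub> y = x" using that by algebra
    then have "h i (x \<ominus>\<^bsub>T\<^esub> y) \<oplus>\<^bsub>B\<^esub> h i y = h i x" using ha[OF that(1) xy that(3)] by simp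
    moreover have "(h i (x \<ominus>\<^bsub>T\<^esub> y) \<oplus>\<^bsub>B\<^esub> h i y) \<ominus>\<^bsub>B\<^esub> h i y = h i (x \<ominus>\<^bsub>T\<^esub> y)"
      using hc[OF that(1) xy] hc[OF that(1) that(3)] by algebra
    ultimately show ?thesis by simp
  qed
  have eA: "e i \<in> carrier A" if "i \<in> I" for i using e that by auto
  let ?r = "\<lambda>x. \<Oplus>\<^bsub>T\<^esub>i\<in>I. inl (e i) \<otimes>\<^bsub>T\<^esub> inr (h i x)"
  \<comment> \<open>Every tensor is recovered from its coordinates, so it vanishes once they all
    do.\<close>
  have rep: "x = ?r x" if "x \<in> carrier T" for x
    using that
  proof (induction x rule: T_induct)
    case zero
    have "?r \<zero>\<^bsub>T\<^esub> = (\<Oplus>\<^bsub>T\<^esub>i\<in>I. \<zero>\<^bsub>T\<^esub>)"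
      using h0 ring_hom_zero'[OF inr_hom B.ring_axioms T.ring_axioms] eA by (intro T.finsum_cong') auto
    then show ?case by simp
  next
    case (tensor a b)
    have "inl a = inl (\<Oplus>\<^bsub>A\<^esub>i\<in>I. f (crd a i) \<otimes>\<^bsub>A\<^esub> e i)" using lc[OF tensor(1)] by (simp add: lincomb_def)
    also have "\<dots> = (\<Oplus>\<^bsub>T\<^esub>i\<in>I. inl (f (crd a i) \<otimes>\<^bsub>A\<^esub> e i))"
      using crdS[OF tensor(1)] eA by (intro ring_hom_finsum[OF inl_hom A.ring_axioms T.ring_axioms]) auto
    finally have "inl a \<otimes>\<^bsub>T\<^esub> inr b = (\<Oplus>\<^bsub>T\<^esub>i\<in>I. inl (f (crd a i) \<otimes>\<^bsub>A\<^esub> e i) \<otimes>\<^bsub>T\<^esub> inr b)"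
      using crdS[OF tensor(1)] eA tensor T.finsum_ldistr[of I "inr b" "\<lambda>i. inl (f (crd a i) \<otimes>\<^bsub>A\<^esub> e i)"] fin by (auto simp: Pi_iff)
    also have "\<dots> = ?r (inl a \<otimes>\<^bsub>T\<^esub> inr b)"
    proof (intro T.finsum_cong')
      fix i assume i: "i \<in> I"
      have "inl (f (crd a i) \<otimes>\<^bsub>A\<^esub> e i) = inl (e i) \<otimes>\<^bsub>T\<^esub> inr (g (crd a i))"
        using ring_hom_mult[OF inl_hom, of "f (crd a i)" "e i"] crdS[OF tensor(1) i] eA[OF i] inl_f[of "crd a i"]
        by (simp add: T.m_comm)
      then show "inl (f (crd a i) \<otimes>\<^bsub>A\<^esub> e i) \<otimes>\<^bsub>T\<^esub> inr b = inl (e i) \<otimes>\<^bsub>T\<^esub> inr (h i (inl a \<otimes>\<^bsub>T\<^esub> inr b))"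
        using ht[OF i tensor] ring_hom_mult[OF inr_hom, of "g (crd a i)" b] crdS[OF tensor(1) i] eA[OF i] tensor
        by (simp add: T.m_assoc)
    qed (use hc eA tensor in auto)
    finally show ?case .
  next
    case (diff x y)
    have s: "(\<lambda>i. inl (e i) \<otimes>\<^bsub>T\<^esub> inr (h i z)) \<in> I \<rightarrow> carrier T" if "z \<in> carrier T" for z using hc eA that by auto
    have "?r (x \<ominus>\<^bsub>T\<^esub> y) \<oplus>\<^bsub>T\<^esub> ?r y
      = (\<Oplus>\<^bsub>T\<^esub>i\<in>I. inl (e i) \<otimes>\<^bsub>T\<^esub> inr (h i (x \<ominus>\<^bsub>T\<^esub> y)) \<oplus>\<^bsub>T\<^esub> inl (e i) \<otimes>\<^bsub>T\<^esub> inr (h i y))"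
      using s[of "x \<ominus>\<^bsub>T\<^esub> y"] s[of y] diff by (intro T.finsum_addf[symmetric]) auto
    also have "\<dots> = ?r x"
    proof (intro T.finsum_cong')
      fix i assume i: "i \<in> I"
      note c = hc[OF i diff(1)] hc[OF i diff(2)] eA[OF i]
      have "h i (x \<ominus>\<^bsub>T\<^esub> y) \<oplus>\<^bsub>B\<^esub> h i y = h i x" unfolding hd[OF i diff(1,2)] using c(1,2) by algebra
      then show "inl (e i) \<otimes>\<^bsub>T\<^esub> inr (h i (x \<ominus>\<^bsub>T\<^esub> y)) \<oplus>\<^bsub>T\<^esub> inl (e i) \<otimes>\<^bsub>T\<^esub> inr (h i y) = inl (e i) \<otimes>\<^bsub>T\<^esub> inr (h i x)"
        using ring_hom_add[OF inr_hom, of "h i (x \<ominus>\<^bsub>T\<^esub> y)" "h i y"] hc[OF i, of "x \<ominus>\<^bsub>T\<^esub> y"] c diff(1,2)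
        by (simp flip: T.r_distr)
    qed (use s[OF diff(1)] in auto)
    finally have E: "?r (x \<ominus>\<^bsub>T\<^esub> y) \<oplus>\<^bsub>T\<^esub> y = x" using diff.IH by simp
    have "?r (x \<ominus>\<^bsub>T\<^esub> y) \<in> carrier T" using s[of "x \<ominus>\<^bsub>T\<^esub> y"] diff by (intro T.finsum_closed) auto
    moreover have "(u \<oplus>\<^bsub>T\<^esub> y) \<ominus>\<^bsub>T\<^esub> y = u" if "u \<in> carrier T" for u using that diff(2) by algebra
    ultimately have "(?r (x \<ominus>\<^bsub>T\<^esub> y) \<oplus>\<^bsub>T\<^esub> y) \<ominus>\<^bsub>T\<^esub> y
      = ?r (x \<ominus>\<^bsub>T\<^esub> y)" by blast
    then show ?case unfolding E .
  qed
  have hs: "h i (inl (f s) \<otimes>\<^bsub>T\<^esub> x) = g s \<otimes>\<^bsub>B\<^esub> h i x" if i: "i \<in> I" and x: "x \<in> carrier T" for i x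
    using x
  proof (induction x rule: T_induct)
    case zero
    then show ?case using h0[OF i] s by simp
  next
    case (tensor a b)
    have "inl (f s) \<otimes>\<^bsub>T\<^esub> (inl a \<otimes>\<^bsub>T\<^esub> inr b) = inl (f s \<otimes>\<^bsub>A\<^esub> a) \<otimes>\<^bsub>T\<^esub> inr b"
      using tensor s ring_hom_mult[OF inl_hom, of "f s" a] by (simp add: T.m_assoc)
    then show ?case using ht[OF i, of "f s \<otimes>\<^bsub>A\<^esub> a" b] ht[OF i tensor] tensor s i crdS[OF tensor(1) i]
      by (simp add: crd_smult ring_hom_mult[OF g] B.m_assoc)
  next
    case (diff x y)
    have fs: "inl (f s) \<in> carrier T" "g s \<in> carrier B" using s by simp_all
    have "inl (f s) \<otimes>\<^bsub>T\<^esub> (x \<ominus>\<^bsub>T\<^esub> y) = inl (f s) \<otimes>\<^bsub>T\<^esub> x \<ominus>\<^bsub>T\<^esub> inl (f s) \<otimes>\<^bsub>T\<^esub> y" using diff(1,2) fs by algebra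
    then have "h i (inl (f s) \<otimes>\<^bsub>T\<^esub> (x \<ominus>\<^bsub>T\<^esub> y)) = g s \<otimes>\<^bsub>B\<^esub> h i x \<ominus>\<^bsub>B\<^esub> g s \<otimes>\<^bsub>B\<^esub> h i y"
      using hd[OF i, of "inl (f s) \<otimes>\<^bsub>T\<^esub> x" "inl (f s) \<otimes>\<^bsub>T\<^esub> y"] diff fs by simp
    also have "\<dots> = g s \<otimes>\<^bsub>B\<^esub> (h i x \<ominus>\<^bsub>B\<^esub> h i y)" using fs hc[OF i diff(1)] hc[OF i diff(2)] by algebra
    finally show ?case unfolding hd[OF i diff(1,2)] .
  qed
  have "h i t = \<zero>\<^bsub>B\<^esub>" if "i \<in> I" for i
    using tf[OF hc[OF that t(1)]] hs[OF that t(1)] t(2) h0[OF that] by simp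
  then have "?r t = (\<Oplus>\<^bsub>T\<^esub>i\<in>I. \<zero>\<^bsub>T\<^esub>)"
    using ring_hom_zero'[OF inr_hom B.ring_axioms T.ring_axioms] eA by (intro T.finsum_cong') auto
  then show ?thesis using rep[OF t(1)] by simp
qed

text \<open>On an eigenvector \<open>E\<close> the element \<open>1 \<otimes> \<Theta>\<close> acts
  as \<open>z \<otimes> 1\<close>. Since the powers of \<open>\<Theta>\<close> generate
  \<open>B\<close>, the whole tensor product acts on \<open>E\<close> through
  \<open>A\<close>.\<close>

lemma tensor_eigen:
  assumes sp: "spans_mod S (algebra_module g B) {\<zero>\<^bsub>B\<^esub>} (carrier B) {..<m::nat} (\<lambda>k. \<Theta> [^]\<^bsub>B\<^esub> k)"
    and \<Theta>: "\<Theta> \<in> carrier B" and E: "E \<in> carrier T" and z: "z \<in> carrier A" "inr \<Theta> \<otimes>\<^bsub>T\<^esub> E = inl z \<otimes>\<^bsub>T\<^esub> E"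
    and t: "t \<in> carrier T"
  shows "\<exists>a\<in>carrier A. E \<otimes>\<^bsub>T\<^esub> t = inl a \<otimes>\<^bsub>T\<^esub> E"
proof -
  interpret N: module S "algebra_module g B" by (rule module_algebra_module[OF S.is_cring g B.is_cring])
  have pow: "inr (\<Theta> [^]\<^bsub>B\<^esub> k) \<otimes>\<^bsub>T\<^esub> E = inl (z [^]\<^bsub>A\<^esub> k) \<otimes>\<^bsub>T\<^esub> E" for k :: nat
  proof (induction k)
    case 0
    then show ?case using ring_hom_one[OF inr_hom] ring_hom_one[OF inl_hom] by simp
  next
    case (Suc k)
    have "inr (\<Theta> [^]\<^bsub>B\<^esub> Suc k) \<otimes>\<^bsub>T\<^esub> E = inr (\<Theta> [^]\<^bsub>B\<^esub> k) \<otimes>\<^bsub>T\<^esub> (inr \<Theta> \<otimes>\<^bsub>T\<^esub> E)"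
      using \<Theta> E ring_hom_mult[OF inr_hom, of "\<Theta> [^]\<^bsub>B\<^esub> k" \<Theta>] by (simp add: T.m_assoc)
    also have "\<dots> = inl z \<otimes>\<^bsub>T\<^esub> (inr (\<Theta> [^]\<^bsub>B\<^esub> k) \<otimes>\<^bsub>T\<^esub> E)" unfolding z(2) using \<Theta> E z(1) by (simp add: T.m_lcomm)
    also have "\<dots> = inl (z [^]\<^bsub>A\<^esub> Suc k) \<otimes>\<^bsub>T\<^esub> E"
      unfolding Suc using E z(1) ring_hom_mult[OF inl_hom, of "z [^]\<^bsub>A\<^esub> k" z] by (simp add: T.m_ac)
    finally show ?case .
  qed
  have inrE: "\<exists>a\<in>carrier A. inr b \<otimes>\<^bsub>T\<^esub> E = inl a \<otimes>\<^bsub>T\<^esub> E" if b: "b \<in> carrier B" for b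
  proof -
    obtain c where c: "c \<in> {..<m} \<rightarrow> carrier S" "mcong (algebra_module g B) {\<zero>\<^bsub>B\<^esub>} b (lincomb S (algebra_module g B) {..<m} c (\<lambda>k. \<Theta> [^]\<^bsub>B\<^esub> k))"
      using N.spans_modD[OF sp b] .
    then have bc: "b = (\<Oplus>\<^bsub>B\<^esub>k\<in>{..<m}. g (c k) \<otimes>\<^bsub>B\<^esub> \<Theta> [^]\<^bsub>B\<^esub> k)" using N.mcong_trivial by (simp add: lincomb_def)
    have ck: "c k \<in> carrier S" if "k < m" for k using c(1) that by auto
    let ?a = "\<Oplus>\<^bsub>A\<^esub>k\<in>{..<m}. f (c k) \<otimes>\<^bsub>A\<^esub> z [^]\<^bsub>A\<^esub> k"
    have "inr b \<otimes>\<^bsub>T\<^esub> E = (\<Oplus>\<^bsub>T\<^esub>k\<in>{..<m}. inr (g (c k) \<otimes>\<^bsub>B\<^esub> \<Theta> [^]\<^bsub>B\<^esub> k)) \<otimes>\<^bsub>T\<^esub> E"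
      unfolding bc using ck \<Theta> by (subst ring_hom_finsum[OF inr_hom B.ring_axioms T.ring_axioms]) auto
    also have "\<dots> = (\<Oplus>\<^bsub>T\<^esub>k\<in>{..<m}. inr (g (c k) \<otimes>\<^bsub>B\<^esub> \<Theta> [^]\<^bsub>B\<^esub> k) \<otimes>\<^bsub>T\<^esub> E)"
      using ck \<Theta> E by (intro T.finsum_ldistr) auto
    also have "\<dots> = (\<Oplus>\<^bsub>T\<^esub>k\<in>{..<m}. inl (f (c k) \<otimes>\<^bsub>A\<^esub> z [^]\<^bsub>A\<^esub> k) \<otimes>\<^bsub>T\<^esub> E)"
    proof (intro T.finsum_cong')
      fix k assume "k \<in> {..<m}"
      then have k: "c k \<in> carrier S" using ck by simp
      have "inr (g (c k) \<otimes>\<^bsub>B\<^esub> \<Theta> [^]\<^bsub>B\<^esub> k) \<otimes>\<^bsub>T\<^esub> E = inr (g (c k)) \<otimes>\<^bsub>T\<^esub> (inr (\<Theta> [^]\<^bsub>B\<^esub> k) \<otimes>\<^bsub>T\<^esub> E)"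
        using k \<Theta> E ring_hom_mult[OF inr_hom, of "g (c k)" "\<Theta> [^]\<^bsub>B\<^esub> k"] by (simp add: T.m_assoc)
      also have "\<dots> = inl (f (c k) \<otimes>\<^bsub>A\<^esub> z [^]\<^bsub>A\<^esub> k) \<otimes>\<^bsub>T\<^esub> E"
        unfolding pow inl_f[OF k, symmetric] using k z(1) E ring_hom_mult[OF inl_hom, of "f (c k)" "z [^]\<^bsub>A\<^esub> k"] by (simp add: T.m_assoc)
      finally show "inr (g (c k) \<otimes>\<^bsub>B\<^esub> \<Theta> [^]\<^bsub>B\<^esub> k) \<otimes>\<^bsub>T\<^esub> E = inl (f (c k) \<otimes>\<^bsub>A\<^esub> z [^]\<^bsub>A\<^esub> k) \<otimes>\<^bsub>T\<^esub> E" .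
    qed (use ck z(1) E in auto)
    also have "\<dots> = (\<Oplus>\<^bsub>T\<^esub>k\<in>{..<m}. inl (f (c k) \<otimes>\<^bsub>A\<^esub> z [^]\<^bsub>A\<^esub> k)) \<otimes>\<^bsub>T\<^esub> E"
      using ck z(1) E by (intro T.finsum_ldistr[symmetric]) auto
    also have "\<dots> = inl ?a \<otimes>\<^bsub>T\<^esub> E"
      using ck z(1) by (subst ring_hom_finsum[OF inl_hom A.ring_axioms T.ring_axioms]) auto
    finally have r: "inr b \<otimes>\<^bsub>T\<^esub> E = inl ?a \<otimes>\<^bsub>T\<^esub> E" .
    have "?a \<in> carrier A" using ck z(1) by (intro A.finsum_closed) auto
    with r show ?thesis by (rule bexI)
  qed
  show ?thesis using t
  proof (induction t rule: T_induct)
    case zero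
    then show ?case using E ring_hom_zero'[OF inl_hom A.ring_axioms T.ring_axioms] by (intro bexI[of _ "\<zero>\<^bsub>A\<^esub>"]) auto
  next
    case (tensor a b)
    obtain a' where a': "a' \<in> carrier A" "inr b \<otimes>\<^bsub>T\<^esub> E = inl a' \<otimes>\<^bsub>T\<^esub> E" using inrE[OF tensor(2)] by blast
    have "E \<otimes>\<^bsub>T\<^esub> (inl a \<otimes>\<^bsub>T\<^esub> inr b) = inl a \<otimes>\<^bsub>T\<^esub> (inr b \<otimes>\<^bsub>T\<^esub> E)" using tensor E by (simp add: T.m_ac)
    also have "\<dots> = inl (a \<otimes>\<^bsub>A\<^esub> a') \<otimes>\<^bsub>T\<^esub> E" unfolding a'(2) using tensor a' E ring_hom_mult[OF inl_hom, of a a'] by (simp add: T.m_assoc)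
    finally show ?case using tensor a' by (intro bexI[of _ "a \<otimes>\<^bsub>A\<^esub> a'"]) auto
  next
    case (diff x y)
    obtain a b where ab: "a \<in> carrier A" "E \<otimes>\<^bsub>T\<^esub> x = inl a \<otimes>\<^bsub>T\<^esub> E" "b \<in> carrier A" "E \<otimes>\<^bsub>T\<^esub> y = inl b \<otimes>\<^bsub>T\<^esub> E" using diff.IH by blast
    have l: "inl a \<in> carrier T" "inl b \<in> carrier T" using ab by simp_all
    have d: "inl (a \<ominus>\<^bsub>A\<^esub> b) \<oplus>\<^bsub>T\<^esub> inl b = inl a"
      using ring_hom_add[OF inl_hom, of "a \<ominus>\<^bsub>A\<^esub> b" b] ab by (simp add: A.a_ac A.eq_add_diff[symmetric])
    have "E \<otimes>\<^bsub>T\<^esub> (x \<ominus>\<^bsub>T\<^esub> y) = E \<otimes>\<^bsub>T\<^esub> x \<ominus>\<^bsub>T\<^esub> E \<otimes>\<^bsub>T\<^esub> y" using E diff(1,2) by algebra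
    also have "\<dots> = ((inl (a \<ominus>\<^bsub>A\<^esub> b) \<oplus>\<^bsub>T\<^esub> inl b) \<ominus>\<^bsub>T\<^esub> inl b) \<otimes>\<^bsub>T\<^esub> E" unfolding ab d using E l by algebra
    also have "\<dots> = inl (a \<ominus>\<^bsub>A\<^esub> b) \<otimes>\<^bsub>T\<^esub> E" using E l inl_closed[OF A.minus_closed[OF ab(1,3)]] by algebra
    finally show ?case using ab by (intro bexI[of _ "a \<ominus>\<^bsub>A\<^esub> b"]) auto
  qed
qed

end

text \<open>Here \<open>\<mu> = 1/m\<close>, and \<open>\<epsilon> i = 1/m \<Sum>\<^sub>k (\<zeta>\<^sup>-\<^sup>i \<otimes> \<Theta>)\<^sup>k\<close> is the projection onto the eigenspace of
  \<open>\<Theta>\<close> for the eigenvalue \<open>\<zeta>\<^sup>i\<close>.\<close>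

locale eigen_idempotents = tensor S A B f g + A: domain A
  for S :: "('s, 'k) ring_scheme" and A :: "('a, 'm) ring_scheme" and B :: "('b, 'n) ring_scheme" and f g +
  fixes m :: nat and \<mu> \<zeta> :: 'a and \<Theta> :: 'b
  assumes m: "m > 0" and mu: "\<mu> \<in> carrier A" "\<mu> \<otimes>\<^bsub>A\<^esub> nat_elem A m = \<one>\<^bsub>A\<^esub>"
    and zeta: "\<zeta> \<in> carrier A" "\<zeta> [^]\<^bsub>A\<^esub> m = \<one>\<^bsub>A\<^esub>" and prim: "\<And>k::nat. \<zeta> [^]\<^bsub>A\<^esub> k = \<one>\<^bsub>A\<^esub> \<Longrightarrow> m dvd k"
    and Theta: "\<Theta> \<in> carrier B" "\<Theta> [^]\<^bsub>B\<^esub> m = \<one>\<^bsub>B\<^esub>"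
    and tf: "\<And>a t. a \<in> carrier A \<Longrightarrow> a \<noteq> \<zero>\<^bsub>A\<^esub> \<Longrightarrow> t \<in> carrier (tensor_ring S f A g B) \<Longrightarrow>
      tensor.inl S A B f g a \<otimes>\<^bsub>tensor_ring S f A g B\<^esub> t = \<zero>\<^bsub>tensor_ring S f A g B\<^esub> \<Longrightarrow> t = \<zero>\<^bsub>tensor_ring S f A g B\<^esub>"
begin

text \<open>The inverse of \<open>\<zeta>\<close>, expressed as a power because the
  \<open>m\<close>-th power of \<open>\<zeta>\<close> is \<open>1\<close>.\<close>

definition "\<eta> = \<zeta> [^]\<^bsub>A\<^esub> (m - 1)"
definition "gen i = inl (\<eta> [^]\<^bsub>A\<^esub> i) \<otimes>\<^bsub>T\<^esub> inr \<Theta>" for i :: nat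
definition "\<epsilon> i = inl \<mu> \<otimes>\<^bsub>T\<^esub> (\<Oplus>\<^bsub>T\<^esub>k\<in>{..<m}. gen i [^]\<^bsub>T\<^esub> k)" for i :: nat

lemma eta: "\<eta> \<in> carrier A" "\<zeta> \<otimes>\<^bsub>A\<^esub> \<eta> = \<one>\<^bsub>A\<^esub>"
proof -
  show "\<eta> \<in> carrier A" using zeta by (simp add: \<eta>_def)
  have "\<zeta> \<otimes>\<^bsub>A\<^esub> \<eta> = \<zeta> [^]\<^bsub>A\<^esub> Suc (m - 1)" unfolding \<eta>_def A.nat_pow_Suc using zeta by (simp add: A.m_comm)
  also have "Suc (m - 1) = m" using m by simp
  finally show "\<zeta> \<otimes>\<^bsub>A\<^esub> \<eta> = \<one>\<^bsub>A\<^esub>" using zeta by simp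
qed

lemma zeta_eta_pow: "\<zeta> [^]\<^bsub>A\<^esub> (i::nat) \<otimes>\<^bsub>A\<^esub> \<eta> [^]\<^bsub>A\<^esub> i = \<one>\<^bsub>A\<^esub>"
  using A.nat_pow_distrib[OF zeta(1) eta(1), of i] eta(2) by simp

lemma eta_m: "\<eta> [^]\<^bsub>A\<^esub> m = \<one>\<^bsub>A\<^esub>"
  using zeta_eta_pow[of m] zeta eta by simp

lemma eta_prim: "\<eta> [^]\<^bsub>A\<^esub> (k::nat) = \<one>\<^bsub>A\<^esub> \<Longrightarrow> m dvd k"
  using zeta_eta_pow[of k] zeta prim[of k] by simp

lemma inl_pow: "a \<in> carrier A \<Longrightarrow> inl (a [^]\<^bsub>A\<^esub> (k::nat)) = inl a [^]\<^bsub>T\<^esub> k"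
  and inr_pow: "b \<in> carrier B \<Longrightarrow> inr (b [^]\<^bsub>B\<^esub> (k::nat)) = inr b [^]\<^bsub>T\<^esub> k"
  using ring_hom_mult[OF inl_hom] ring_hom_one[OF inl_hom] ring_hom_mult[OF inr_hom] ring_hom_one[OF inr_hom]
  by (induction k) auto

lemma gen_closed [simp]: "gen i \<in> carrier T" using eta Theta by (simp add: gen_def)

lemma gen_pow: "gen i [^]\<^bsub>T\<^esub> (k::nat) = inl (\<eta> [^]\<^bsub>A\<^esub> (k * i)) \<otimes>\<^bsub>T\<^esub> inr (\<Theta> [^]\<^bsub>B\<^esub> k)"
  using T.nat_pow_distrib[of "inl (\<eta> [^]\<^bsub>A\<^esub> i)" "inr \<Theta>" k] eta Theta
    inl_pow[of "\<eta> [^]\<^bsub>A\<^esub> i" k] inr_pow[of \<Theta> k] by (simp add: gen_def A.nat_pow_pow mult.commute)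

lemma gen_m: "gen i [^]\<^bsub>T\<^esub> m = \<one>\<^bsub>T\<^esub>"
  using eta eta_m A.nat_pow_pow[OF eta(1), of m i] ring_hom_one[OF inl_hom] ring_hom_one[OF inr_hom]
  by (simp add: gen_pow Theta)

lemma eps_closed [simp]: "\<epsilon> i \<in> carrier T"
  using mu by (auto simp: \<epsilon>_def intro!: T.finsum_closed)

text \<open>The sum of the powers of \<open>gen i\<close> is fixed by \<open>gen i\<close>, which is
  \<open>\<zeta>^(-i) \<otimes> \<Theta>\<close>.\<close>

lemma Theta_eps: "inr \<Theta> \<otimes>\<^bsub>T\<^esub> \<epsilon> i = inl (\<zeta> [^]\<^bsub>A\<^esub> i) \<otimes>\<^bsub>T\<^esub> \<epsilon> i"
proof -
  define s where "s = (\<Oplus>\<^bsub>T\<^esub>k\<in>{..<m}. gen i [^]\<^bsub>T\<^esub> k)"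
  have s: "s \<in> carrier T" by (auto simp: s_def intro!: T.finsum_closed)
  have l: "inl \<mu> \<in> carrier T" "inl (\<zeta> [^]\<^bsub>A\<^esub> i) \<in> carrier T" "inl (\<eta> [^]\<^bsub>A\<^esub> i) \<in> carrier T" "inr \<Theta> \<in> carrier T"
    using mu zeta eta Theta by simp_all
  have "gen i \<otimes>\<^bsub>T\<^esub> s = s" unfolding s_def by (rule T.geometric_fixed[OF gen_closed gen_m])
  then have g: "inl (\<eta> [^]\<^bsub>A\<^esub> i) \<otimes>\<^bsub>T\<^esub> inr \<Theta> \<otimes>\<^bsub>T\<^esub> s = s" by (simp add: gen_def)
  have one: "inl (\<zeta> [^]\<^bsub>A\<^esub> i) \<otimes>\<^bsub>T\<^esub> inl (\<eta> [^]\<^bsub>A\<^esub> i) = \<one>\<^bsub>T\<^esub>"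
    using ring_hom_mult[OF inl_hom, of "\<zeta> [^]\<^bsub>A\<^esub> i" "\<eta> [^]\<^bsub>A\<^esub> i"] zeta_eta_pow[of i] zeta eta ring_hom_one[OF inl_hom] by simp
  have "inl (\<zeta> [^]\<^bsub>A\<^esub> i) \<otimes>\<^bsub>T\<^esub> (inl \<mu> \<otimes>\<^bsub>T\<^esub> (inl (\<eta> [^]\<^bsub>A\<^esub> i) \<otimes>\<^bsub>T\<^esub> inr \<Theta> \<otimes>\<^bsub>T\<^esub> s))
      = (inl (\<zeta> [^]\<^bsub>A\<^esub> i) \<otimes>\<^bsub>T\<^esub> inl (\<eta> [^]\<^bsub>A\<^esub> i)) \<otimes>\<^bsub>T\<^esub> (inr \<Theta> \<otimes>\<^bsub>T\<^esub> (inl \<mu> \<otimes>\<^bsub>T\<^esub> s))"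
    using l s by algebra
  then show ?thesis unfolding g one \<epsilon>_def s_def[symmetric] using l s by simp
qed

text \<open>Orthogonality of characters: the sum is fixed under multiplication by the
  \<open>k\<close>-th power of \<open>\<eta>\<close>, which differs from \<open>1\<close>, so it
  vanishes in a domain.\<close>

lemma eta_sum: assumes "0 < k" "k < m" shows "(\<Oplus>\<^bsub>A\<^esub>i\<in>{..<m}. \<eta> [^]\<^bsub>A\<^esub> (k * i)) = \<zero>\<^bsub>A\<^esub>"
proof -
  let ?w = "\<eta> [^]\<^bsub>A\<^esub> k"
  define s where "s = (\<Oplus>\<^bsub>A\<^esub>i\<in>{..<m}. (\<eta> [^]\<^bsub>A\<^esub> k) [^]\<^bsub>A\<^esub> i)"
  have w: "?w \<in> carrier A" using eta by simp
  have s: "s \<in> carrier A" using w by (auto simp: s_def intro!: A.finsum_closed)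
  have "?w [^]\<^bsub>A\<^esub> m = \<one>\<^bsub>A\<^esub>" using eta_m eta A.nat_pow_pow[of \<eta> m k] by (simp add: A.nat_pow_pow mult.commute)
  then have "?w \<otimes>\<^bsub>A\<^esub> s = s" unfolding s_def by (rule A.geometric_fixed[OF w])
  then have "(?w \<ominus>\<^bsub>A\<^esub> \<one>\<^bsub>A\<^esub>) \<otimes>\<^bsub>A\<^esub> s = s \<ominus>\<^bsub>A\<^esub> s" using w s A.one_closed by algebra
  then have "(?w \<ominus>\<^bsub>A\<^esub> \<one>\<^bsub>A\<^esub>) \<otimes>\<^bsub>A\<^esub> s = \<zero>\<^bsub>A\<^esub>" using A.r_right_minus_eq[OF s s] by simp
  then have "?w \<ominus>\<^bsub>A\<^esub> \<one>\<^bsub>A\<^esub> = \<zero>\<^bsub>A\<^esub> \<or> s = \<zero>\<^bsub>A\<^esub>" using A.integral[OF _ A.minus_closed[OF w A.one_closed] s] by blast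
  moreover have "?w \<noteq> \<one>\<^bsub>A\<^esub>" using eta_prim[of k] assms dvd_imp_le[of m k] by auto
  ultimately have "s = \<zero>\<^bsub>A\<^esub>" using A.r_right_minus_eq[OF w A.one_closed] by blast
  then show ?thesis unfolding s_def A.nat_pow_pow[OF eta(1)] .
qed

text \<open>After interchanging the two summations only \<open>k = 0\<close> survives and
  contributes \<open>m\<close>, which is cancelled by \<open>\<mu>\<close>.\<close>

lemma eps_sum: "(\<Oplus>\<^bsub>T\<^esub>i\<in>{..<m}. \<epsilon> i) = \<one>\<^bsub>T\<^esub>"
proof -
  have "(\<Oplus>\<^bsub>T\<^esub>i\<in>{..<m}. \<epsilon> i) = inl \<mu> \<otimes>\<^bsub>T\<^esub> (\<Oplus>\<^bsub>T\<^esub>i\<in>{..<m}. \<Oplus>\<^bsub>T\<^esub>k\<in>{..<m}. gen i [^]\<^bsub>T\<^esub> k)"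
    unfolding \<epsilon>_def using mu by (intro T.finsum_rdistr[symmetric]) (auto intro!: T.finsum_closed)
  also have "(\<Oplus>\<^bsub>T\<^esub>i\<in>{..<m}. \<Oplus>\<^bsub>T\<^esub>k\<in>{..<m}. gen i [^]\<^bsub>T\<^esub> k) = (\<Oplus>\<^bsub>T\<^esub>k\<in>{..<m}. \<Oplus>\<^bsub>T\<^esub>i\<in>{..<m}. gen i [^]\<^bsub>T\<^esub> k)"
    by (rule T.finsum_swap) auto
  also have "\<dots> = (\<Oplus>\<^bsub>T\<^esub>k\<in>{..<m}. if k = 0 then inl (nat_elem A m) else \<zero>\<^bsub>T\<^esub>)"
  proof (intro T.finsum_cong')
    fix k assume k: "k \<in> {..<m}"
    have "(\<Oplus>\<^bsub>T\<^esub>i\<in>{..<m}. gen i [^]\<^bsub>T\<^esub> k) = (\<Oplus>\<^bsub>T\<^esub>i\<in>{..<m}. inl (\<eta> [^]\<^bsub>A\<^esub> (k * i)) \<otimes>\<^bsub>T\<^esub> inr (\<Theta> [^]\<^bsub>B\<^esub> k))"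
      by (simp only: gen_pow)
    also have "\<dots> = (\<Oplus>\<^bsub>T\<^esub>i\<in>{..<m}. inl (\<eta> [^]\<^bsub>A\<^esub> (k * i))) \<otimes>\<^bsub>T\<^esub> inr (\<Theta> [^]\<^bsub>B\<^esub> k)"
      using eta Theta by (intro T.finsum_ldistr[symmetric]) auto
    also have "(\<Oplus>\<^bsub>T\<^esub>i\<in>{..<m}. inl (\<eta> [^]\<^bsub>A\<^esub> (k * i))) = inl (\<Oplus>\<^bsub>A\<^esub>i\<in>{..<m}. \<eta> [^]\<^bsub>A\<^esub> (k * i))"
      using eta by (intro ring_hom_finsum[OF inl_hom A.ring_axioms T.ring_axioms, symmetric]) auto
    finally have e: "(\<Oplus>\<^bsub>T\<^esub>i\<in>{..<m}. gen i [^]\<^bsub>T\<^esub> k) = inl (\<Oplus>\<^bsub>A\<^esub>i\<in>{..<m}. \<eta> [^]\<^bsub>A\<^esub> (k * i)) \<otimes>\<^bsub>T\<^esub> inr (\<Theta> [^]\<^bsub>B\<^esub> k)" .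
    show "(\<Oplus>\<^bsub>T\<^esub>i\<in>{..<m}. gen i [^]\<^bsub>T\<^esub> k) = (if k = 0 then inl (nat_elem A m) else \<zero>\<^bsub>T\<^esub>)"
    proof (cases "k = 0")
      case True
      have "(\<Oplus>\<^bsub>A\<^esub>i\<in>{..<m}. \<one>\<^bsub>A\<^esub>) = nat_elem A m" using A.add.finprod_const[OF A.one_closed, of "{..<m}"] by simp
      then show ?thesis unfolding e using True ring_hom_one[OF inr_hom] by simp
    next
      case False
      then have "(\<Oplus>\<^bsub>A\<^esub>i\<in>{..<m}. \<eta> [^]\<^bsub>A\<^esub> (k * i)) = \<zero>\<^bsub>A\<^esub>" using k by (intro eta_sum) auto
      then show ?thesis unfolding e using False Theta ring_hom_zero'[OF inl_hom A.ring_axioms T.ring_axioms] by simp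
    qed
  qed auto
  also have "\<dots> = inl (nat_elem A m)"
    using T.finsum_singleton[of 0 "{..<m}" "\<lambda>_. inl (nat_elem A m)"] m by (auto simp: eq_commute)
  also have "inl \<mu> \<otimes>\<^bsub>T\<^esub> inl (nat_elem A m) = \<one>\<^bsub>T\<^esub>"
    using ring_hom_mult[OF inl_hom mu(1), of "nat_elem A m"] mu(2) ring_hom_one[OF inl_hom] by simp
  finally show ?thesis .
qed

lemma zeta_pow_neq: assumes "i < k" "k < m" shows "\<zeta> [^]\<^bsub>A\<^esub> i \<noteq> \<zeta> [^]\<^bsub>A\<^esub> k"
proof
  assume e: "\<zeta> [^]\<^bsub>A\<^esub> i = \<zeta> [^]\<^bsub>A\<^esub> k"
  have "\<zeta> [^]\<^bsub>A\<^esub> (k - i) = (\<zeta> [^]\<^bsub>A\<^esub> i \<otimes>\<^bsub>A\<^esub> \<eta> [^]\<^bsub>A\<^esub> i) \<otimes>\<^bsub>A\<^esub> \<zeta> [^]\<^bsub>A\<^esub> (k - i)" using zeta_eta_pow[of i] zeta by simp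
  also have "\<dots> = (\<zeta> [^]\<^bsub>A\<^esub> i \<otimes>\<^bsub>A\<^esub> \<zeta> [^]\<^bsub>A\<^esub> (k - i)) \<otimes>\<^bsub>A\<^esub> \<eta> [^]\<^bsub>A\<^esub> i" using zeta eta by (simp add: A.m_ac)
  also have "\<zeta> [^]\<^bsub>A\<^esub> i \<otimes>\<^bsub>A\<^esub> \<zeta> [^]\<^bsub>A\<^esub> (k - i) = \<zeta> [^]\<^bsub>A\<^esub> i" using A.nat_pow_mult[OF zeta(1), of i "k - i"] assms e by simp
  finally have "m dvd k - i" using zeta_eta_pow[of i] prim by simp
  then show False using assms dvd_imp_le[of m "k - i"] by simp
qed

text \<open>The product is an eigenvector for both eigenvalues, so it is killed by their difference,
  a nonzero element of \<open>A\<close>. Torsion-freeness replaces the usual assumption that this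
  difference is a unit.\<close>

lemma eps_orth: assumes "i < m" "k < m" "i \<noteq> k" shows "\<epsilon> i \<otimes>\<^bsub>T\<^esub> \<epsilon> k = \<zero>\<^bsub>T\<^esub>"
proof (rule tf)
  let ?a = "\<zeta> [^]\<^bsub>A\<^esub> i" and ?b = "\<zeta> [^]\<^bsub>A\<^esub> k"
  have ab: "?a \<in> carrier A" "?b \<in> carrier A" using zeta by simp_all
  then show "?a \<ominus>\<^bsub>A\<^esub> ?b \<in> carrier A" by simp
  have "?a \<noteq> ?b" using zeta_pow_neq[of i k] zeta_pow_neq[of k i] assms by (metis linorder_neqE_nat)
  then show "?a \<ominus>\<^bsub>A\<^esub> ?b \<noteq> \<zero>\<^bsub>A\<^esub>" using ab by simp
  show "\<epsilon> i \<otimes>\<^bsub>T\<^esub> \<epsilon> k \<in> carrier T" by simp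
  have l: "inl ?a \<in> carrier T" "inl ?b \<in> carrier T" "inl (?a \<ominus>\<^bsub>A\<^esub> ?b) \<in> carrier T" "inr \<Theta> \<in> carrier T" "\<epsilon> i \<in> carrier T" "\<epsilon> k \<in> carrier T"
    using ab Theta by simp_all
  have d: "inl ?a = inl (?a \<ominus>\<^bsub>A\<^esub> ?b) \<oplus>\<^bsub>T\<^esub> inl ?b"
    using ring_hom_add[OF inl_hom, of "?a \<ominus>\<^bsub>A\<^esub> ?b" ?b] ab by (simp add: A.a_ac A.eq_add_diff[symmetric])
  have "inl (?a \<ominus>\<^bsub>A\<^esub> ?b) \<otimes>\<^bsub>T\<^esub> (\<epsilon> i \<otimes>\<^bsub>T\<^esub> \<epsilon> k)
      = (inl (?a \<ominus>\<^bsub>A\<^esub> ?b) \<oplus>\<^bsub>T\<^esub> inl ?b) \<otimes>\<^bsub>T\<^esub> \<epsilon> i \<otimes>\<^bsub>T\<^esub> \<epsilon> k \<ominus>\<^bsub>T\<^esub> \<epsilon> i \<otimes>\<^bsub>T\<^esub> (inl ?b \<otimes>\<^bsub>T\<^esub> \<epsilon> k)"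
    using l by algebra
  also have "\<dots> = inr \<Theta> \<otimes>\<^bsub>T\<^esub> \<epsilon> i \<otimes>\<^bsub>T\<^esub> \<epsilon> k \<ominus>\<^bsub>T\<^esub> \<epsilon> i \<otimes>\<^bsub>T\<^esub> (inr \<Theta> \<otimes>\<^bsub>T\<^esub> \<epsilon> k)"
    unfolding d[symmetric] by (simp only: Theta_eps)
  also have "\<dots> = \<zero>\<^bsub>T\<^esub>" using l by algebra
  finally show "inl (?a \<ominus>\<^bsub>A\<^esub> ?b) \<otimes>\<^bsub>T\<^esub> (\<epsilon> i \<otimes>\<^bsub>T\<^esub> \<epsilon> k) = \<zero>\<^bsub>T\<^esub>" .
qed

end

lemma (in witt_finite) P_pow_cancel:
  "w \<in> carrier W \<Longrightarrow> P [^]\<^bsub>W\<^esub> (n::nat) \<otimes>\<^bsub>W\<^esub> w = \<zero>\<^bsub>W\<^esub> \<Longrightarrow> w = \<zero>\<^bsub>W\<^esub>"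
proof (induction n arbitrary: w)
  case (Suc n)
  have "P [^]\<^bsub>W\<^esub> n \<otimes>\<^bsub>W\<^esub> (P \<otimes>\<^bsub>W\<^esub> w) = \<zero>\<^bsub>W\<^esub>" using Suc.prems by (simp add: W.m_assoc)
  moreover have "P \<otimes>\<^bsub>W\<^esub> w \<in> carrier W" using Suc.prems(1) by simp
  ultimately have "P \<otimes>\<^bsub>W\<^esub> w = \<zero>\<^bsub>W\<^esub>" by (rule Suc.IH[rotated])
  with Suc.prems(1) show ?case by (rule P_cancel)
qed simp

section \<open>The descent applied to the ring of integers and its regular extension\<close>

context regular_extension
begin

lemma one_not_zero_A': "\<one>\<^bsub>A'\<^esub> \<noteq> \<zero>\<^bsub>A'\<^esub>"
proof -
  obtain L where "maximalideal L A'" using regular unfolding regular_local_ring_def by blast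
  then interpret L: maximalideal L A' .
  show ?thesis using L.one_imp_carrier L.I_notcarr L.zero_closed by metis
qed

theorem finite_free_over_extension:
  fixes \<pi> :: 'k and j :: "(nat \<Rightarrow> int) \<Rightarrow> (nat \<Rightarrow> 'k set)"
    and M :: "(nat \<Rightarrow> ('r \<times> (nat \<Rightarrow> 'k set) \<Rightarrow>\<^sub>0 int) set, 'x, 'o) module_scheme"
  assumes unif: "uniformizer A \<pi>"
  defines "W \<equiv> witt_ring p (A Quot PIdl\<^bsub>A\<^esub> \<pi>)"
  assumes j: "j \<in> ring_hom Z W"
    and M: "module (power_series_ring (tensor_ring Z (\<phi> \<circ> \<alpha>) A' j W)) M"
    and free: "finite_free_module (power_series_ring (tensor_ring Z \<alpha> A j W))
      (restrict_scalars (power_series_map (tensor_map Z (algebra_module (\<phi> \<circ> \<alpha>) A') (algebra_module j W) \<phi> (\<lambda>w. w))) M)"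
  shows "finite_free_module (power_series_ring (tensor_ring Z (\<phi> \<circ> \<alpha>) A' j W)) M"
proof -
  let ?k = "A Quot PIdl\<^bsub>A\<^esub> \<pi>"
  obtain \<theta> \<zeta> and m f :: nat where r: "finite (carrier ?k)" "nat_elem ?k p = \<zero>\<^bsub>?k\<^esub>" "\<theta> \<in> carrier ?k" "m > 0" "\<theta> [^]\<^bsub>?k\<^esub> m = \<one>\<^bsub>?k\<^esub>"
    "\<forall>x\<in>carrier ?k. x = \<zero>\<^bsub>?k\<^esub> \<or> (\<exists>i<m. x = \<theta> [^]\<^bsub>?k\<^esub> i)" "\<not> p dvd m" "f > 0" "m dvd p ^ f - 1"
    "\<forall>x\<in>carrier ?k. x [^]\<^bsub>?k\<^esub> (p ^ f) = x"
    "\<zeta> \<in> carrier A" "\<zeta> [^]\<^bsub>A\<^esub> m = \<one>\<^bsub>A\<^esub>" "\<forall>k::nat. \<zeta> [^]\<^bsub>A\<^esub> k = \<one>\<^bsub>A\<^esub> \<longrightarrow> m dvd k"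
    using root_of_unity[OF unif] by (elim exE conjE) (rule that)
  interpret k: field ?k by (rule residue_field(1)[OF unif])
  interpret Wf: witt_finite p ?k j \<theta> m f
    by (intro witt_finite.intro witt.intro witt_finite_axioms.intro padic_axioms k.is_cring k.field_axioms
      j[unfolded W_def] r(1-5,8,9) r(6)[rule_format] r(10)[rule_format])
  obtain \<Theta> where Th: "\<Theta> \<in> carrier W" "\<Theta> [^]\<^bsub>W\<^esub> m = \<one>\<^bsub>W\<^esub>"
      "zspans W j {..<m} (\<lambda>k. \<Theta> [^]\<^bsub>W\<^esub> k)"
    using Wf.witt_root_of_unity[folded W_def] by (elim bexE conjE) (rule that)
  obtain I :: "nat set" and e where I: "zspans A \<alpha> I e"
     "zindep A \<alpha> I e"
    using basis_A by (elim exE conjE) (rule that)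
  obtain I' :: "('r \<times> nat) set" and e' where I': "zspans A' (\<phi> \<circ> \<alpha>) I' e'"
     "zindep A' (\<phi> \<circ> \<alpha>) I' e'"
    using basis_A' by (elim exE conjE) (rule that)
  obtain x c where x: "x \<in> carrier A'" "c \<in> carrier A'" "c \<otimes>\<^bsub>A'\<^esub> x = \<phi> (\<alpha> pz)"
      "\<forall>a\<in>carrier A'. a \<in> Units A' \<or> (\<exists>b\<in>carrier A'. a = x \<otimes>\<^bsub>A'\<^esub> b)" "adic_separated A' x"
    using uniformizer_A' by (elim exE conjE) (rule that)
  have cringW: "cring W" unfolding W_def by (rule Wf.cring_witt)
  interpret t: tensor_mor Z A W \<alpha> j A' \<phi>
    by (intro tensor_mor.intro tensor.intro tensor_axioms.intro tensor_mor_axioms.intro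
      Z.is_cring cring_A cringW A'.is_cring alpha_hom j phi_alpha_hom phi)
  have tf_pow: "t = \<zero>\<^bsub>t.D.T\<^esub>" if "t \<in> carrier t.D.T" "t.D.inl (\<alpha> (pz [^]\<^bsub>Z\<^esub> (n::nat))) \<otimes>\<^bsub>t.D.T\<^esub> t = \<zero>\<^bsub>t.D.T\<^esub>" for n t
  proof (rule t.D.tensor_torsion_free[OF I _ _ that])
    show "b = \<zero>\<^bsub>W\<^esub>" if "b \<in> carrier W" "j (pz [^]\<^bsub>Z\<^esub> n) \<otimes>\<^bsub>W\<^esub> b = \<zero>\<^bsub>W\<^esub>" for b
      using Wf.P_pow_cancel[of b n] hom_pow[OF Wf.alg pz_closed, of n] that unfolding W_def by simp
  qed simp
  \<comment> \<open>A nonzero \<open>a\<close> divides a power of \<open>p\<close>, so its torsion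
    reduces to \<open>p\<close>-torsion, which is excluded by freeness of the ring of integers and
    cancellation in the Witt ring.\<close>
  have tfA: "t = \<zero>\<^bsub>t.D.T\<^esub>" if a: "a \<in> carrier A" "a \<noteq> \<zero>\<^bsub>A\<^esub>" and t: "t \<in> carrier t.D.T" "t.D.inl a \<otimes>\<^bsub>t.D.T\<^esub> t = \<zero>\<^bsub>t.D.T\<^esub>" for a t
  proof -
    obtain n :: nat and w where w: "w \<in> carrier A" "a \<otimes>\<^bsub>A\<^esub> w = \<alpha> pz [^]\<^bsub>A\<^esub> n"
      using multiple_A[OF a] by (elim exE conjE) (rule that)
    have "\<alpha> (pz [^]\<^bsub>Z\<^esub> n) = w \<otimes>\<^bsub>A\<^esub> a" using hom_pow[OF alg_A pz_closed, of n] w A.m_comm[OF a(1) w(1)] by simp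
    then have "t.D.inl (\<alpha> (pz [^]\<^bsub>Z\<^esub> n)) \<otimes>\<^bsub>t.D.T\<^esub> t = t.D.inl w \<otimes>\<^bsub>t.D.T\<^esub> (t.D.inl a \<otimes>\<^bsub>t.D.T\<^esub> t)"
      using ring_hom_mult[OF t.D.inl_hom w(1) a(1)] t.D.inl_closed[OF w(1)] t.D.inl_closed[OF a(1)] t(1)
      by (simp add: t.D.T.m_assoc del: comp_apply)
    also have "\<dots> = \<zero>\<^bsub>t.D.T\<^esub>" unfolding t(2) using t.D.inl_closed[OF w(1)] by simp
    finally show ?thesis by (rule tf_pow[OF t(1)])
  qed
  \<comment> \<open>\<open>m\<close> is prime to \<open>p\<close> and hence already invertible among
    the p-adic integers.\<close>
  define \<mu> where "\<mu> = \<alpha> (inv\<^bsub>Z\<^esub> (nat_elem Z m))"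
  have u: "nat_elem Z m \<in> Units Z" by (rule nat_elem_unit[OF r(7)])
  have mu: "\<mu> \<in> carrier A" unfolding \<mu>_def by (rule alpha_integral) (use u in simp)
  have "\<mu> \<otimes>\<^bsub>A\<^esub> nat_elem A m = \<alpha> (inv\<^bsub>Z\<^esub> (nat_elem Z m) \<otimes>\<^bsub>Z\<^esub> nat_elem Z m)"
    unfolding ring_hom_mult[OF alpha_hom Z.Units_closed[OF Z.Units_inv_Units[OF u]] Z.Units_closed[OF u]]
    by (simp only: \<mu>_def hom_nat_elem[OF alg_A])
  also have "\<dots> = \<one>\<^bsub>A\<^esub>" using u ring_hom_one[OF alpha_hom] by (simp add: Z.Units_l_inv del: comp_apply)
  finally have mu1: "\<mu> \<otimes>\<^bsub>A\<^esub> nat_elem A m = \<one>\<^bsub>A\<^esub>" .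
  interpret E: eigen_idempotents Z A W \<alpha> j m \<mu> \<zeta> \<Theta>
    by (intro eigen_idempotents.intro t.D.tensor_axioms A.domain_axioms eigen_idempotents_axioms.intro)
      (rule r(4) mu mu1 r(11) r(12) Th(1) Th(2) | erule r(13)[rule_format] | erule (3) tfA)+
  \<comment> \<open>The induced map carries the idempotents to the tensor product over
    \<open>R'\<close>; their images have the images of the old eigenvalues.\<close>
  have eigen': "t.C.inr \<Theta> \<otimes>\<^bsub>t.C.T\<^esub> t.tmap (E.\<epsilon> i) = t.C.inl (\<phi> (\<zeta> [^]\<^bsub>A\<^esub> i)) \<otimes>\<^bsub>t.C.T\<^esub> t.tmap (E.\<epsilon> i)" for i
  proof -
    have z: "\<zeta> [^]\<^bsub>A\<^esub> i \<in> carrier A" by (rule A.nat_pow_closed[OF r(11)])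
    have "t.tmap (t.D.inr \<Theta> \<otimes>\<^bsub>t.D.T\<^esub> E.\<epsilon> i) = t.tmap (t.D.inl (\<zeta> [^]\<^bsub>A\<^esub> i) \<otimes>\<^bsub>t.D.T\<^esub> E.\<epsilon> i)" by (simp only: E.Theta_eps)
    then show ?thesis
      unfolding ring_hom_mult[OF t.tmap_hom t.D.inr_closed[OF Th(1)] E.eps_closed]
        ring_hom_mult[OF t.tmap_hom t.D.inl_closed[OF z] E.eps_closed] t.tmap_inl[OF z] t.tmap_inr[OF Th(1)] .
  qed
  \<comment> \<open>Being a commutative ring is part of \<open>module\<close>, so this is contained
    in the two module hypotheses.\<close>
  have cringP: "cring (power_series_ring t.D.T)" using free unfolding finite_free_module_def module_def by blast
  have cringP': "cring (power_series_ring t.C.T)" using M unfolding module_def by blast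
  interpret d: descent Z A A' t.D.T t.C.T M \<alpha> \<phi> t.D.inl t.C.inl t.tmap "{..<m}" E.\<epsilon> x c pz
  proof (intro descent.intro descent_axioms.intro power_series.intro Z.domain_axioms cring_A A'.is_cring t.D.T.is_cring
      t.C.T.is_cring cringP cringP' M alpha_hom phi t.D.inl_hom t.C.inl_hom t.tmap_hom t.tmap_inl x(1,2,3,5) pz_closed
      E.eps_closed E.eps_sum x(4)[rule_format] free finite_lessThan)
    show "E.\<epsilon> i \<otimes>\<^bsub>t.D.T\<^esub> E.\<epsilon> k = \<zero>\<^bsub>t.D.T\<^esub>" if "i \<in> {..<m}" "k \<in> {..<m}" "i \<noteq> k" for i k
      using E.eps_orth that by simp
    show "\<exists>a\<in>carrier A. E.\<epsilon> i \<otimes>\<^bsub>t.D.T\<^esub> s = t.D.inl a \<otimes>\<^bsub>t.D.T\<^esub> E.\<epsilon> i" if "s \<in> carrier t.D.T" for i s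
      by (rule t.D.tensor_eigen[OF Th(3,1) E.eps_closed A.nat_pow_closed[OF r(11)] E.Theta_eps that])
    show "\<exists>a\<in>carrier A'. t.tmap (E.\<epsilon> i) \<otimes>\<^bsub>t.C.T\<^esub> s = t.C.inl a \<otimes>\<^bsub>t.C.T\<^esub> t.tmap (E.\<epsilon> i)" if "s \<in> carrier t.C.T" for i s
      by (rule t.C.tensor_eigen[OF Th(3,1) ring_hom_closed[OF t.tmap_hom E.eps_closed]
          ring_hom_closed[OF phi A.nat_pow_closed[OF r(11)]] eigen' that])
    show "a = \<zero>\<^bsub>A\<^esub>" if "a \<in> carrier A" "E.\<epsilon> i \<noteq> \<zero>\<^bsub>t.D.T\<^esub>" "t.D.inl a \<otimes>\<^bsub>t.D.T\<^esub> E.\<epsilon> i = \<zero>\<^bsub>t.D.T\<^esub>" for i a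
      using tfA[OF that(1) _ E.eps_closed that(3)] that(2) by blast
    show "s = \<zero>\<^bsub>t.D.T\<^esub>" if "s \<in> carrier t.D.T" "t.D.inl (\<alpha> pz) \<otimes>\<^bsub>t.D.T\<^esub> s = \<zero>\<^bsub>t.D.T\<^esub>" for s
      using tf_pow[of s 1] that Z.nat_pow_eone[OF pz_closed] by simp
  qed
  \<comment> \<open>Positivity of the rank of \<open>R'\<close>, by which the common rank is
    divided; an empty basis would make \<open>1\<close> zero.\<close>
  have "I' \<noteq> {}"
  proof
    assume e: "I' = {}"
    interpret O: padic_order p A' "\<phi> \<circ> \<alpha>" I' e'
      by (intro padic_order.intro padic_order_axioms.intro padic_axioms A'.is_cring phi_alpha_hom I')
    obtain c where "\<one>\<^bsub>A'\<^esub> = O.lc c" by (rule O.coords[OF A'.one_closed])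
    then show False using one_not_zero_A' e O.D.lincomb_empty by simp
  qed
  then show ?thesis by (rule d.finite_free[OF I I'])
qed

end

theorem theorem2p4:
  fixes p :: nat
    and K :: "('k, 'm) ring_scheme"
    and \<iota> :: "((nat \<Rightarrow> int) \<times> (nat \<Rightarrow> int)) set \<Rightarrow> 'k"
    and R :: "('k, 'm) ring_scheme"
    and \<alpha> :: "(nat \<Rightarrow> int) \<Rightarrow> 'k"
    and \<pi> :: 'k
    and \<kappa> :: "'k set ring"
    and W :: "(nat \<Rightarrow> 'k set) ring"
    and j :: "(nat \<Rightarrow> int) \<Rightarrow> (nat \<Rightarrow> 'k set)"
    and R' :: "('r, 'n) ring_scheme"
    and \<phi> :: "'k \<Rightarrow> 'r"
    and P :: "(nat \<Rightarrow> ('k \<times> (nat \<Rightarrow> 'k set) \<Rightarrow>\<^sub>0 int) set) ring"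
    and P' :: "(nat \<Rightarrow> ('r \<times> (nat \<Rightarrow> 'k set) \<Rightarrow>\<^sub>0 int) set) ring"
    and \<Phi> :: "(nat \<Rightarrow> ('k \<times> (nat \<Rightarrow> 'k set) \<Rightarrow>\<^sub>0 int) set)
               \<Rightarrow> (nat \<Rightarrow> ('r \<times> (nat \<Rightarrow> 'k set) \<Rightarrow>\<^sub>0 int) set)"
    and M :: "(nat \<Rightarrow> ('r \<times> (nat \<Rightarrow> 'k set) \<Rightarrow>\<^sub>0 int) set, 'x, 'o) module_scheme"
  assumes "Factorial_Ring.prime p"
    and "finite_padic_extension p K \<iota>"
    and "R = ring_of_integers p K \<iota>"
    and "\<alpha> = \<iota> \<circ> padic_of_int p"
    and "uniformizer R \<pi>"
    and "\<kappa> = R Quot (PIdl\<^bsub>R\<^esub> \<pi>)"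
    and "W = witt_ring p \<kappa>"
    and "j \<in> ring_hom (padic_int p) W"
    and "regular_local_ring R'"
    and "\<phi> \<in> ring_hom R R'"
    and "finitely_generated_module R (algebra_module \<phi> R')"
    and "flat_module R (algebra_module \<phi> R')"
    and "P = power_series_ring (tensor_ring (padic_int p) \<alpha> R j W)"
    and "P' = power_series_ring (tensor_ring (padic_int p) (\<phi> \<circ> \<alpha>) R' j W)"
    and "\<Phi> = power_series_map (tensor_map (padic_int p)
               (algebra_module (\<phi> \<circ> \<alpha>) R') (algebra_module j W) \<phi> (\<lambda>w. w))"
    and "module P' M"
    and "finite_free_module P (restrict_scalars \<Phi> M)"
  shows "finite_free_module P' M"
proof -
  \<comment> \<open>This hypothesis is the source of the fact that the integral elements form a
    commutative ring.\<close>
  have "module R (algebra_module \<phi> R')" using assms(11) by (simp add: finitely_generated_module_def)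
  then have cringR: "cring (ring_of_integers p K \<iota>)" unfolding assms(3) module_def by blast
  have "cring R'" using assms(9) by (simp add: regular_local_ring_def)
  then interpret regular_extension p K \<iota> R' \<phi>
    using assms(1,2,9-12) cringR unfolding assms(3)
    by (intro regular_extension.intro padic_extension.intro padic.intro padic_extension_axioms.intro
      regular_extension_axioms.intro) (simp_all add: finite_padic_extension_def)
  show ?thesis
    using assms(5,8,16,17) finite_free_over_extension[of \<pi> j M]
    unfolding assms(14) unfolding assms(13,15) unfolding assms(7) unfolding assms(6) unfolding assms(3,4)
    by simp
qed

end
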